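(* Let $q$ be an odd prime power. (1) For every even integer $n\ge2$, \[ \frac{0.1}{q^{n/2}} \le \|P_O-\Lambda_{O,z-1,n}\|_{TV} \le \frac{1.3}{q^{n/2}}. \] (2) For every odd integer $n\ge1$, \[ \frac{0.1}{q^{(n+1)/2}} \le \|P_O-\Lambda_{O,z-1,n}\|_{TV} \le \frac{2}{q^{(n+1)/2}}. \]
   Context: For a partition $\lambda$, $m_i(\lambda)$ is the multiplicity of $i$, $\lambda'_i=m_i(\lambda)+m_{i+1}(\lambda)+\cdots$, $n(\lambda)=\sum_i\binom{\lambda'_i}{2}$, and $o(\lambda)$ is the number of odd parts. For $q$ odd set $|Aut_O(\lambda)| = q^{n(\lambda)+|\lambda|/2-o(\lambda)/2}\prod_i\prod_{k=1}^{\lfloor m_i(\lambda)/2\rfloor}(1-q^{-2k})$. $P_O$ is the probability measure on the set of partitions of non-negative integers in which every even part has even multiplicity, given by $P_O(\lambda)=\frac{\prod_{i\ge1}(1-q^{-(2i-1)})}{2|Aut_O(\lambda)|}$. Let $O^+(n,q)$ and $O^-(n,q)$ be the orthogonal groups (subgroups of $GL(n,q)$) of the two isometry classes of nondegenerate quadratic forms on $\mathbb{F}_q^n$. Choose $g$ with probability $1/2$ uniformly from $O^+(n,q)$ and with probability $1/2$ uniformly from $O^-(n,q)$. Regard $\mathbb{F}_q^n$ as an $\mathbb{F}_q[z]$-module with $z$ acting as $g$; its $(z-1)$-primary component is $\bigoplus_i\mathbb{F}_q[z]/((z-1)^{\lambda_i})$ for a unique partition $\lambda_{z-1}(g)$.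 $\Lambda_{O,z-1,n}$ is the distribution of $\lambda_{z-1}(g)$. $\|P-Q\|_{TV}=\frac12\sum_x|P(x)-Q(x)|$. *)

theory Defs
  imports
    "HOL-Analysis.Infinite_Products"
    "HOL-Analysis.Infinite_Sum"
    "HOL-Probability.Probability_Mass_Function"
    "HOL-Computational_Algebra.Polynomial"
    "HOL-Library.Multiset"
    "Jordan_Normal_Form.Matrix"
begin

unbundle no vec_syntax

hide_type (open) Finite_Cartesian_Product.vec
hide_const (open) Finite_Cartesian_Product.vec


section \<open>Partitions\<close>

text \<open>A partition is the multiset of its (positive) parts, so \<open>m\<^sub>i(\<mu>) = count \<mu> i\<close>
  and \<open>|\<mu>| = \<Sum>\<^sub># \<mu>\<close>.\<close>

definition is_partition :: "nat multiset \<Rightarrow> bool" where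
  "is_partition \<mu> \<longleftrightarrow> 0 \<notin># \<mu>"

definition conj_part :: "nat multiset \<Rightarrow> nat \<Rightarrow> nat" where
  "conj_part \<mu> i = size {#j \<in># \<mu>. i \<le> j#}"

text \<open>Every part is at most \<open>|\<mu>|\<close>, so all terms with \<open>i > |\<mu>|\<close> vanish.\<close>

definition n_stat :: "nat multiset \<Rightarrow> nat" where
  "n_stat \<mu> = (\<Sum>i = 1..\<Sum>\<^sub># \<mu>. conj_part \<mu> i choose 2)"

definition odd_parts :: "nat multiset \<Rightarrow> nat" where
  "odd_parts \<mu> = size {#j \<in># \<mu>. odd j#}"

definition Aut_O :: "nat \<Rightarrow> nat multiset \<Rightarrow> real" where
  "Aut_O q \<mu> =
     real q powr (real (n_stat \<mu>) + real (\<Sum>\<^sub># \<mu>) / 2 - real (odd_parts \<mu>) / 2)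
     * (\<Prod>i\<in>set_mset \<mu>. \<Prod>k = 1..count \<mu> i div 2. 1 - 1 / real q ^ (2 * k))"

text \<open>The point masses of \<open>P\<^sub>O\<close>, extended by zero outside its set of definition. The infinite
  product is reindexed to start at \<open>i = 0\<close>.\<close>

definition P_O :: "nat \<Rightarrow> nat multiset \<Rightarrow> real" where
  "P_O q \<mu> =
     (if is_partition \<mu> \<and> (\<forall>i. even i \<longrightarrow> even (count \<mu> i))
      then (\<Prod>i. 1 - 1 / real q ^ (2 * i + 1)) / (2 * Aut_O q \<mu>)
      else 0)"


section \<open>Orthogonal groups\<close>

definition polar :: "('a::ring vec \<Rightarrow> 'a) \<Rightarrow> 'a vec \<Rightarrow> 'a vec \<Rightarrow> 'a" where
  "polar Q u v = Q (u + v) - Q u - Q v"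

text \<open>The polar form is symmetric, so linearity in the first argument is bilinearity.\<close>

definition quadratic_form :: "nat \<Rightarrow> ('a::field vec \<Rightarrow> 'a) \<Rightarrow> bool" where
  "quadratic_form n Q \<longleftrightarrow>
     (\<forall>c. \<forall>v\<in>carrier_vec n. Q (c \<cdot>\<^sub>v v) = c^2 * Q v) \<and>
     (\<forall>u\<in>carrier_vec n. \<forall>v\<in>carrier_vec n. \<forall>w\<in>carrier_vec n.
        polar Q (u + v) w = polar Q u w + polar Q v w) \<and>
     (\<forall>c. \<forall>u\<in>carrier_vec n. \<forall>w\<in>carrier_vec n. polar Q (c \<cdot>\<^sub>v u) w = c * polar Q u w)"

definition nondegenerate :: "nat \<Rightarrow> ('a::field vec \<Rightarrow> 'a) \<Rightarrow> bool" where
  "nondegenerate n Q \<longleftrightarrow>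
     (\<forall>v\<in>carrier_vec n. (\<forall>w\<in>carrier_vec n. polar Q v w = 0) \<longrightarrow> v = 0\<^sub>v n)"

definition GL :: "nat \<Rightarrow> 'a::field mat set" where
  "GL n = {g \<in> carrier_mat n n. invertible_mat g}"

definition isometric :: "nat \<Rightarrow> ('a::field vec \<Rightarrow> 'a) \<Rightarrow> ('a vec \<Rightarrow> 'a) \<Rightarrow> bool" where
  "isometric n Q Q' \<longleftrightarrow> (\<exists>g\<in>GL n. \<forall>v\<in>carrier_vec n. Q' (g *\<^sub>v v) = Q v)"

definition orthogonal_group :: "nat \<Rightarrow> ('a::field vec \<Rightarrow> 'a) \<Rightarrow> 'a mat set" where
  "orthogonal_group n Q = {g \<in> GL n. \<forall>v\<in>carrier_vec n. Q (g *\<^sub>v v) = Q v}"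


section \<open>The partition of a primary component\<close>

text \<open>The action of \<open>r \<in> F[z]\<close> on \<open>F\<^sup>n\<close> with \<open>z\<close> acting as \<open>g\<close>, i.e.
  \<open>r \<cdot> v = \<Sum>\<^sub>i r\<^sub>i g\<^sup>i v\<close>.\<close>

definition poly_act :: "'a::field mat \<Rightarrow> 'a poly \<Rightarrow> 'a vec \<Rightarrow> 'a vec" where
  "poly_act g r v =
     vec (dim_row g) (\<lambda>j. \<Sum>i\<le>degree r. coeff r i * ((g ^\<^sub>m i) *\<^sub>v v) $ j)"

definition primary_component :: "'a::field poly \<Rightarrow> 'a mat \<Rightarrow> 'a vec set" where
  "primary_component \<phi> g =
     {v \<in> carrier_vec (dim_row g). \<exists>k. poly_act g (\<phi> ^ k) v = 0\<^sub>v (dim_row g)}"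

text \<open>The \<open>F[z]\<close>-module \<open>\<Oplus>\<^sub>i F[z]/(\<phi>\<^bsup>d\<^sub>i\<^esup>)\<close> for a list \<open>ds\<close> of exponents. A residue class is
  represented by its reduced remainder, an element of the sum by the list of its components.\<close>

definition cyclic_sum :: "'a::field poly \<Rightarrow> nat list \<Rightarrow> 'a poly list set" where
  "cyclic_sum \<phi> ds = {ps. list_all2 (\<lambda>p d. p mod \<phi> ^ d = p) ps ds}"

definition cyclic_sum_add :: "'a::field poly list \<Rightarrow> 'a poly list \<Rightarrow> 'a poly list" where
  "cyclic_sum_add ps ps' = map2 (+) ps ps'"

definition cyclic_sum_act ::
    "'a::field poly \<Rightarrow> nat list \<Rightarrow> 'a poly \<Rightarrow> 'a poly list \<Rightarrow> 'a poly list" where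
  "cyclic_sum_act \<phi> ds r ps = map2 (\<lambda>p d. (r * p) mod \<phi> ^ d) ps ds"

definition primary_iso ::
    "'a::field poly \<Rightarrow> 'a mat \<Rightarrow> nat list \<Rightarrow> ('a poly list \<Rightarrow> 'a vec) \<Rightarrow> bool" where
  "primary_iso \<phi> g ds h \<longleftrightarrow>
     bij_betw h (cyclic_sum \<phi> ds) (primary_component \<phi> g) \<and>
     (\<forall>ps\<in>cyclic_sum \<phi> ds. \<forall>ps'\<in>cyclic_sum \<phi> ds.
        h (cyclic_sum_add ps ps') = h ps + h ps') \<and>
     (\<forall>r. \<forall>ps\<in>cyclic_sum \<phi> ds. h (cyclic_sum_act \<phi> ds r ps) = poly_act g r (h ps))"

text \<open>For \<open>\<phi>\<close> irreducible, the partition \<open>\<lambda>\<^sub>\<phi>(g)\<close>.\<close>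

definition primary_partition :: "'a::field poly \<Rightarrow> 'a mat \<Rightarrow> nat multiset" where
  "primary_partition \<phi> g =
     (THE \<mu>. is_partition \<mu> \<and> (\<exists>ds h. mset ds = \<mu> \<and> primary_iso \<phi> g ds h))"


section \<open>The random partition and total variation distance\<close>

text \<open>Here \<open>Q\<close> and \<open>Q'\<close> represent the two isometry classes of nondegenerate quadratic forms.
  The mixture is symmetric in them and depends on each only up to isometry, so it does
  not matter which of the two is labelled \<open>+\<close>.\<close>

definition random_orthogonal ::
    "nat \<Rightarrow> ('a::{field,finite} vec \<Rightarrow> 'a) \<Rightarrow> ('a vec \<Rightarrow> 'a) \<Rightarrow> 'a mat pmf" where
  "random_orthogonal n Q Q' =
     bind_pmf (bernoulli_pmf (1/2))
       (\<lambda>b. pmf_of_set (if b then orthogonal_group n Q else orthogonal_group n Q'))"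

text \<open>\<open>[:-1, 1:]\<close> is the polynomial \<open>z - 1\<close>.\<close>

definition Lambda_O ::
    "nat \<Rightarrow> ('a::{field,finite} vec \<Rightarrow> 'a) \<Rightarrow> ('a vec \<Rightarrow> 'a) \<Rightarrow> nat multiset pmf" where
  "Lambda_O n Q Q' = map_pmf (primary_partition [:-1, 1:]) (random_orthogonal n Q Q')"

definition tv_dist :: "('b \<Rightarrow> real) \<Rightarrow> ('b \<Rightarrow> real) \<Rightarrow> real" where
  "tv_dist P P' = 1/2 * (\<Sum>\<^sub>\<infinity>x. \<bar>P x - P' x\<bar>)"

end

theory Submission
  imports Defs
begin

text \<open>Every dimension has exactly two congruence classes of nondegenerate symmetric forms. Hence counting
  pairs \<open>(B, g)\<close> of a form and an isometry modulo \<open>GL\<close> gives the average over the two orthogonal groups.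
  Fitting's lemma splits \<open>g - 1\<close> into a nilpotent and an invertible block, so type \<open>\<mu>\<close> has probability
  \<open>w(\<mu>) d(n - |\<mu>|) / 2\<close>, where \<open>w(\<mu>)\<close> is the weight of the pairs with \<open>g - 1\<close> nilpotent of type \<open>\<mu>\<close>. The
  Cayley transform \<open>X = (g - 1) / (g + 1)\<close> reduces \<open>w(\<mu>)\<close> to skew nilpotent \<open>X\<close>, and passing to the image
  of \<open>X\<close> removes the first column of \<open>\<mu>\<close>, which yields \<open>w(\<mu>) = 1 / |Aut(\<mu>)|\<close>. Comparing the total weights
  of all pairs, first for skew maps and then for isometries, determines \<open>\<Sum> w(\<mu>)\<close> over \<open>|\<mu>| = m\<close> and then
  \<open>d\<close>. The number \<open>d(k)\<close> is a partial sum of Euler's alternating series for the product in \<open>P\<^sub>O\<close>, so the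
  distance is governed by the tails of this series.\<close>

section \<open>Finitely supported matrices\<close>

text \<open>With one fixed form, the unipotent classes of each orthogonal group and their
  centralizers would be required. With a varying form only linear algebra is left. The weight of a
  family of pairs is its number divided by the order of \<open>GL\<close>; it is multiplicative over
  the two Fitting components, which are orthogonal, so totals become convolutions in the dimension.
  A skew pair \<open>(B, X)\<close> corresponds to \<open>(B, B X)\<close> with \<open>B X\<close>
  alternating. Hence the total and the invertible part are explicit for skew pairs, and the
  nilpotent totals come out by division. For isometries the total is 2 in every positive dimension,
  one for each orbit of forms, and this determines \<open>d\<close>. On the image of a skew
  \<open>X\<close> the form \<open>b(X u, X v) = B(u, X v)\<close> has the symmetry opposite to that
  of \<open>B\<close>; therefore symmetric and alternating forms are treated together through a sign
  \<open>ep\<close>. The estimates compare tails with geometric series of ratio 1/9 and 1/3, which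
  rests on \<open>q \<ge> 3\<close>. The lower bound comes from the partitions of
  \<open>n + 1\<close> alone, which \<open>P_O\<close> charges and no matrix of size
  \<open>n\<close> can have.\<close>

text \<open>One ring contains the matrices of all sizes: an \<open>I \<times> J\<close> matrix is an element supported on
  \<open>I \<times> J\<close>, a block matrix is a sum, and \<open>idm I\<close> is a projection.\<close>

typedef (overloaded) 'a fmat =
  "{f :: nat => nat => 'a::zero. \<exists>n. \<forall>i j. n \<le> i \<or> n \<le> j --> f i j = 0}"
  morphisms ent Abs_fmat
  by (intro exI[of _ "\<lambda>_ _. 0"]) auto

setup_lifting type_definition_fmat

lemma fmat_eqI: "(\<And>i j. ent M i j = ent N i j) ==> M = N"
  by (simp add: ent_inject[symmetric] fun_eq_iff)

lemma finite_row_support: "finite {k. ent M i k ~= 0}"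
proof -
  obtain n where n: "\<And>i j. n \<le> i \<or> n \<le> j ==> ent M i j = 0" using ent[of M] by auto
  have "{k. ent M i k ~= 0} \<subseteq> {..<n}"
  proof
    fix k assume "k \<in> {k. ent M i k ~= 0}"
    then show "k \<in> {..<n}" using n[of i k] by (cases "k < n") auto
  qed
  then show ?thesis using finite_subset by blast
qed

text \<open>The class is \<open>ring\<close> without a unit, since an identity matrix of infinite
  size has infinite support. The matrices \<open>idm I\<close> act as local units, and taking a
  block means multiplying by them on both sides.\<close>

instantiation fmat :: (comm_ring_1) ring
begin

lift_definition zero_fmat :: "'a fmat" is "\<lambda>_ _. 0" by auto

lift_definition plus_fmat :: "'a fmat => 'a fmat => 'a fmat" is "\<lambda>f g i j. f i j + g i j"
proof -
  fix f g :: "nat => nat => 'a"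
  assume "\<exists>n. \<forall>i j. n \<le> i \<or> n \<le> j --> f i j = 0" "\<exists>n. \<forall>i j. n \<le> i \<or> n \<le> j --> g i j = 0"
  then obtain n m where "\<forall>i j. n \<le> i \<or> n \<le> j --> f i j = 0" "\<forall>i j. m \<le> i \<or> m \<le> j --> g i j = 0" by blast
  then show "\<exists>n. \<forall>i j. n \<le> i \<or> n \<le> j --> f i j + g i j = 0" by (intro exI[of _ "max n m"]) auto
qed

lift_definition uminus_fmat :: "'a fmat => 'a fmat" is "\<lambda>f i j. - f i j" by auto

definition minus_fmat :: "'a fmat => 'a fmat => 'a fmat" where "minus_fmat M N = M + - N"

text \<open>Summation over the support of a row of the left factor is finite without any choice of a
  size. \<open>ent_mult\<close> exchanges this index set for a convenient one.\<close>

lift_definition times_fmat :: "'a fmat => 'a fmat => 'a fmat" is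
  "\<lambda>f g i j. \<Sum>k | f i k ~= 0. f i k * g k j"
proof -
  fix f g :: "nat => nat => 'a"
  assume "\<exists>n. \<forall>i j. n \<le> i \<or> n \<le> j --> f i j = 0" "\<exists>n. \<forall>i j. n \<le> i \<or> n \<le> j --> g i j = 0"
  then obtain n m where "\<forall>i j. n \<le> i \<or> n \<le> j --> f i j = 0" "\<forall>i j. m \<le> i \<or> m \<le> j --> g i j = 0" by blast
  then show "\<exists>n. \<forall>i j. n \<le> i \<or> n \<le> j --> (\<Sum>k | f i k ~= 0. f i k * g k j) = 0"
    by (intro exI[of _ "max n m"]) auto
qed

lemma ent_mult:
  assumes "finite K" "\<And>k. k \<notin> K ==> ent M i k = 0 \<or> ent N k j = 0"
  shows "ent (M * N) i j = (\<Sum>k\<in>K. ent M i k * ent N k j)"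
proof -
  have "ent (M * N) i j = (\<Sum>k | ent M i k ~= 0. ent M i k * ent N k j)" by transfer simp
  also have "... = (\<Sum>k\<in>K. ent M i k * ent N k j)"
  proof (rule sum.mono_neutral_cong[OF assms(1) finite_row_support])
    show "ent M i k * ent N k j = 0" if "k \<in> {k. ent M i k ~= 0} - K" for k
      using assms(2)[of k] that by auto
  qed auto
  finally show ?thesis .
qed

instance
proof
  fix a b c :: "'a fmat"
  show "a + b + c = a + (b + c)" by transfer (simp add: add.assoc)
  show "a + b = b + a" by transfer (simp add: add.commute)
  show "0 + a = a" by transfer simp
  show "- a + a = 0" by transfer simp
  show "a - b = a + - b" by (simp add: minus_fmat_def)
  have fin: "finite {k. ent (x :: 'a fmat) i k ~= 0}" for x i by (rule finite_row_support)
  show "a * b * c = a * (b * c)"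
  proof (rule fmat_eqI)
    fix i j
    let ?K = "{k. ent a i k ~= 0}"
    let ?L = "\<Union>k\<in>?K. {l. ent b k l ~= 0}"
    have L: "finite ?L" using fin by auto
    have ab: "ent (a * b) i l = (\<Sum>k\<in>?K. ent a i k * ent b k l)" for l
      by (rule ent_mult[OF fin]) simp
    have "ent (a * b * c) i j = (\<Sum>l\<in>?L. ent (a * b) i l * ent c l j)"
    proof (rule ent_mult[OF L])
      fix l assume "l \<notin> ?L"
      then have "ent (a * b) i l = 0" unfolding ab by (intro sum.neutral) auto
      then show "ent (a * b) i l = 0 \<or> ent c l j = 0" ..
    qed
    also have "... = (\<Sum>k\<in>?K. ent a i k * (\<Sum>l\<in>?L. ent b k l * ent c l j))"
      unfolding ab sum_distrib_left sum_distrib_right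
      by (subst sum.swap) (simp add: mult.assoc)
    also have "... = (\<Sum>k\<in>?K. ent a i k * ent (b * c) k j)"
    proof (rule sum.cong[OF refl])
      fix k assume k: "k \<in> ?K"
      have "ent (b * c) k j = (\<Sum>l\<in>?L. ent b k l * ent c l j)"
        by (rule ent_mult[OF L]) (use k in blast)
      then show "ent a i k * (\<Sum>l\<in>?L. ent b k l * ent c l j) = ent a i k * ent (b * c) k j" by simp
    qed
    also have "... = ent (a * (b * c)) i j"
      by (rule ent_mult[OF fin, symmetric]) simp
    finally show "ent (a * b * c) i j = ent (a * (b * c)) i j" .
  qed
  have pl: "ent (x + y) i j = ent x i j + ent y i j" for x y :: "'a fmat" and i j by transfer simp
  show "(a + b) * c = a * c + b * c"
  proof (rule fmat_eqI)
    fix i j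
    let ?K = "{k. ent a i k ~= 0} \<union> {k. ent b i k ~= 0}"
    have K: "finite ?K" using fin by (rule finite_UnI[OF _ fin])
    have *: "ent (x * c) i j = (\<Sum>k\<in>?K. ent x i k * ent c k j)"
      if "\<And>k. k \<notin> ?K ==> ent x i k = 0" for x
      by (rule ent_mult[OF K]) (use that in blast)
    show "ent ((a + b) * c) i j = ent (a * c + b * c) i j"
      using *[of "a + b"] *[of a] *[of b] by (simp add: pl sum.distrib distrib_right)
  qed
  show "a * (b + c) = a * b + a * c"
  proof (rule fmat_eqI)
    fix i j
    have *: "ent (a * x) i j = (\<Sum>k | ent a i k ~= 0. ent a i k * ent x k j)" for x
      by (rule ent_mult[OF fin]) simp
    show "ent (a * (b + c)) i j = ent (a * b + a * c) i j"
      by (simp add: * pl sum.distrib distrib_left)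
  qed
qed

end

lemma ent_zero [simp]: "ent 0 i j = 0" by (simp add: zero_fmat.rep_eq)
lemma ent_add [simp]: "ent (M + N) i j = ent M i j + ent N i j" by (simp add: plus_fmat.rep_eq)
lemma ent_uminus [simp]: "ent (- M) i j = - ent M i j" by (simp add: uminus_fmat.rep_eq)
lemma ent_diff [simp]: "ent (M - N) i j = ent M i j - ent (N :: 'a::comm_ring_1 fmat) i j"
  by (simp only: diff_conv_add_uminus ent_add ent_uminus)

lemma ent_sum: "ent (sum f A) i j = (\<Sum>x\<in>A. ent (f x) i j)"
proof (cases "finite A")
  case True
  then show ?thesis by induction (simp_all only: sum.insert ent_add sum.empty ent_zero not_False_eq_True)
next
  case False
  then show ?thesis by (simp only: sum.infinite ent_zero not_False_eq_True)
qed

lift_definition smult_fmat :: "'a::comm_ring_1 => 'a fmat => 'a fmat" (infixr "\<cdot>" 75) is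
  "\<lambda>c f i j. c * f i j"
proof -
  fix c :: 'a and f :: "nat => nat => 'a"
  assume "\<exists>n. \<forall>i j. n \<le> i \<or> n \<le> j --> f i j = 0"
  then obtain n where "\<forall>i j. n \<le> i \<or> n \<le> j --> f i j = 0" by blast
  then show "\<exists>n. \<forall>i j. n \<le> i \<or> n \<le> j --> c * f i j = 0" by (intro exI[of _ n]) auto
qed

lift_definition tr :: "'a::comm_ring_1 fmat => 'a fmat" is "\<lambda>f i j. f j i"
proof -
  fix f :: "nat => nat => 'a"
  assume "\<exists>n. \<forall>i j. n \<le> i \<or> n \<le> j --> f i j = 0"
  then obtain n where "\<forall>i j. n \<le> i \<or> n \<le> j --> f i j = 0" by blast
  then show "\<exists>n. \<forall>i j. n \<le> i \<or> n \<le> j --> f j i = 0" by (intro exI[of _ n]) simp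
qed

lift_definition idm :: "nat set => 'a::comm_ring_1 fmat" is
  "\<lambda>I i j. if finite I & i \<in> I & i = j then 1 else 0"
proof -
  fix I :: "nat set"
  show "\<exists>n. \<forall>i j. n \<le> i \<or> n \<le> j --> (if finite I & i \<in> I & i = j then 1 else (0 :: 'a)) = 0"
  proof (cases "finite I")
    case True
    then obtain n where "\<forall>i\<in>I. i < n" using finite_nat_set_iff_bounded by blast
    then show ?thesis by (intro exI[of _ n]) auto
  qed auto
qed

lemma ent_smult [simp]: "ent (c \<cdot> M) i j = c * ent M i j" by (simp add: smult_fmat.rep_eq)
lemma ent_tr [simp]: "ent (tr M) i j = ent M j i" by (simp add: tr.rep_eq)
lemma ent_idm: "ent (idm I) i j = (if finite I & i \<in> I & i = j then 1 else 0)" by (simp add: idm.rep_eq)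

lemma smult_add [simp]: "c \<cdot> (M + N) = c \<cdot> M + c \<cdot> N"
  by (rule fmat_eqI) (simp add: distrib_left)
lemma smult_diff [simp]: "c \<cdot> (M - N) = c \<cdot> M - c \<cdot> N"
  by (rule fmat_eqI) (simp add: right_diff_distrib)
lemma smult_minus [simp]: "c \<cdot> (- M) = - (c \<cdot> M)" by (rule fmat_eqI) simp
lemma minus_smult [simp]: "(- c) \<cdot> M = - (c \<cdot> M)" by (rule fmat_eqI) simp
lemma add_smult: "(c + d) \<cdot> M = c \<cdot> M + d \<cdot> M" by (rule fmat_eqI) (simp add: distrib_right)
lemma smult_smult [simp]: "c \<cdot> d \<cdot> M = (c * d) \<cdot> M" by (rule fmat_eqI) (simp add: mult.assoc)
lemma smult_one [simp]: "1 \<cdot> M = M" by (rule fmat_eqI) simp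
lemma smult_zero_right [simp]: "c \<cdot> 0 = 0" by (rule fmat_eqI) simp
lemma smult_zero_left [simp]: "0 \<cdot> M = 0" by (rule fmat_eqI) simp

lemma ent_mult_row:
  "ent (M * N) i j = (\<Sum>k | ent M i k ~= 0. ent M i k * ent N k j)"
  by (rule ent_mult[OF finite_row_support]) simp

lemma smult_mult_right [simp]: "M * (c \<cdot> N) = c \<cdot> (M * N)"
  by (rule fmat_eqI) (simp add: ent_mult_row sum_distrib_left mult.left_commute)

lemma smult_mult_left [simp]: "(c \<cdot> M) * N = c \<cdot> (M * N)"
proof (rule fmat_eqI)
  fix i j
  have "ent ((c \<cdot> M) * N) i j = (\<Sum>k | ent M i k ~= 0. ent (c \<cdot> M) i k * ent N k j)"
    by (rule ent_mult[OF finite_row_support]) simp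
  then show "ent ((c \<cdot> M) * N) i j = ent (c \<cdot> (M * N)) i j"
    by (simp add: ent_mult_row sum_distrib_left mult.assoc)
qed

lemma tr_tr [simp]: "tr (tr M) = M" by (rule fmat_eqI) simp
lemma tr_add [simp]: "tr (M + N) = tr M + tr N" by (rule fmat_eqI) simp
lemma tr_diff [simp]: "tr (M - N) = tr M - tr N" by (rule fmat_eqI) simp
lemma tr_uminus [simp]: "tr (- M) = - tr M" by (rule fmat_eqI) simp
lemma tr_smult [simp]: "tr (c \<cdot> M) = c \<cdot> tr M" by (rule fmat_eqI) simp
lemma tr_zero [simp]: "tr 0 = 0" by (rule fmat_eqI) simp
lemma tr_idm [simp]: "tr (idm I) = idm I" by (rule fmat_eqI) (auto simp: ent_idm)
lemma tr_eq_iff [simp]: "tr M = tr N \<longleftrightarrow> M = N" by (metis tr_tr)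

lemma tr_mult [simp]: "tr (M * N) = tr N * tr M"
proof (rule fmat_eqI)
  fix i j
  have "ent (tr N * tr M) i j = (\<Sum>k | ent M j k ~= 0. ent (tr N) i k * ent (tr M) k j)"
    by (rule ent_mult[OF finite_row_support]) simp
  then show "ent (tr (M * N)) i j = ent (tr N * tr M) i j" by (simp add: ent_mult_row mult.commute)
qed

definition Mats :: "nat set => nat set => 'a::comm_ring_1 fmat set" where
  "Mats I J = {M. \<forall>i j. ent M i j ~= 0 --> i \<in> I & j \<in> J}"

lemma MatsI: "(\<And>i j. ent M i j ~= 0 ==> i \<in> I & j \<in> J) ==> M \<in> Mats I J"
  by (auto simp: Mats_def)

lemma MatsD: "M \<in> Mats I J ==> i \<notin> I \<or> j \<notin> J ==> ent M i j = 0"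
  by (auto simp: Mats_def)

lemma Mats_mono: "M \<in> Mats I J ==> I \<subseteq> I' ==> J \<subseteq> J' ==> M \<in> Mats I' J'"
  by (auto simp: Mats_def)

lemma Mats_zero [simp, intro]: "0 \<in> Mats I J" by (auto simp: Mats_def)
lemma Mats_add [intro]: "M \<in> Mats I J ==> N \<in> Mats I J ==> M + N \<in> Mats I J"
  by (simp add: Mats_def) (metis add.left_neutral)
lemma Mats_diff [intro]: "M \<in> Mats I J ==> N \<in> Mats I J ==> M - N \<in> Mats I J"
  by (simp add: Mats_def) (metis diff_self)
lemma Mats_uminus [simp]: "- M \<in> Mats I J \<longleftrightarrow> M \<in> Mats I J" by (auto simp: Mats_def)
lemma Mats_smult [intro]: "M \<in> Mats I J ==> c \<cdot> M \<in> Mats I J"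
  by (simp add: Mats_def) (metis mult_zero_right)
lemma Mats_sum [intro]: "(\<And>x. x \<in> A ==> f x \<in> Mats I J) ==> sum f A \<in> Mats I J"
  by (induction A rule: infinite_finite_induct) auto
lemma Mats_tr [simp]: "tr M \<in> Mats I J \<longleftrightarrow> M \<in> Mats J I" by (auto simp: Mats_def)
lemma Mats_idm [intro]: "I \<subseteq> J ==> I \<subseteq> K ==> idm I \<in> Mats J K"
  by (auto simp: Mats_def ent_idm split: if_splits)
lemma Mats_mult [intro]: assumes "M \<in> Mats I J" "N \<in> Mats K L" shows "M * N \<in> Mats I L"
proof (rule MatsI)
  fix i j assume ne: "ent (M * N) i j ~= 0"
  have "ent (M * N) i j = (\<Sum>k | ent M i k ~= 0. ent M i k * ent N k j)"
    by (rule ent_mult_row)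
  then obtain k where "ent M i k ~= 0" "ent M i k * ent N k j ~= 0"
    using ne by (metis (mono_tags, lifting) mem_Collect_eq sum.neutral)
  then show "i \<in> I & j \<in> L" using MatsD[OF assms(1), of i k] MatsD[OF assms(2), of k j] by (metis mult_zero_right)
qed

text \<open>Nearly all block computations consist of this rule together with \<open>idm_mult\<close>
  and \<open>mult_idm\<close>; the products that vanish by it are usually collected in facts named
  \<open>z\<close>.\<close>

lemma mult_disjoint: assumes "M \<in> Mats I J" "N \<in> Mats K L" "J \<inter> K = {}" shows "M * N = 0"
proof (rule fmat_eqI)
  fix i j
  have "ent (M * N) i j = (\<Sum>k\<in>{}. ent M i k * ent N k j)"
  proof (rule ent_mult)
    fix k show "ent M i k = 0 \<or> ent N k j = 0"
      using MatsD[OF assms(1), of i k] MatsD[OF assms(2), of k j] assms(3) by (cases "k \<in> J") auto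
  qed simp
  then show "ent (M * N) i j = ent 0 i j" by simp
qed

lemma ent_idm_mult: "finite K ==> ent (idm K * M) i j = (if i \<in> K then ent M i j else 0)"
  by (subst ent_mult[where K = "{i}"]) (auto simp: ent_idm)

lemma ent_mult_idm: "finite K ==> ent (M * idm K) i j = (if j \<in> K then ent M i j else 0)"
  by (subst ent_mult[where K = "{j}"]) (auto simp: ent_idm)

lemma idm_mult: "M \<in> Mats I J ==> finite K ==> I \<subseteq> K ==> idm K * M = M"
  by (rule fmat_eqI) (auto simp: ent_idm_mult Mats_def)

lemma mult_idm: "M \<in> Mats I J ==> finite K ==> J \<subseteq> K ==> M * idm K = M"
  by (rule fmat_eqI) (auto simp: ent_mult_idm Mats_def)

lemma idm_mult_idm: "finite I ==> finite J ==> idm I * idm J = idm (I \<inter> J)"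
  by (rule fmat_eqI) (auto simp: ent_idm_mult ent_idm)

lemma idm_Un: "finite I ==> finite J ==> I \<inter> J = {} ==> idm (I \<union> J) = idm I + idm J"
  by (rule fmat_eqI) (auto simp: ent_idm)

lemma idm_mult_Mats: "M \<in> Mats I J ==> finite K ==> idm K * M \<in> Mats K J"
  by (rule MatsI) (auto simp: ent_idm_mult Mats_def split: if_splits)

lemma mult_idm_Mats: "M \<in> Mats I J ==> finite K ==> M * idm K \<in> Mats I K"
  by (rule MatsI) (auto simp: ent_mult_idm Mats_def split: if_splits)

text \<open>Products are normalized to the right, so a known product \<open>A * B\<close> mostly
  occurs in front of a further factor. This form makes it rewrite there.\<close>

lemma mult_eq_assoc: "A * B = C ==> A * (B * X) = C * (X :: 'a::comm_ring_1 fmat)"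
  by (simp add: mult.assoc[symmetric])

lemma Mats_split_rows:
  assumes "M \<in> Mats (I \<union> J) K" "finite I" "finite J" "I \<inter> J = {}"
  shows "M = idm I * M + idm J * M"
  using idm_mult[OF assms(1), of "I \<union> J"] assms by (simp add: idm_Un distrib_right)

lemma Mats_split_cols:
  assumes "M \<in> Mats K (I \<union> J)" "finite I" "finite J" "I \<inter> J = {}"
  shows "M = M * idm I + M * idm J"
  using mult_idm[OF assms(1), of "I \<union> J"] assms by (simp add: idm_Un distrib_left)

lemma bij_betw_Mats_fun:
  assumes "finite I" "finite J"
  shows "bij_betw (\<lambda>M. \<lambda>p\<in>I \<times> J. ent M (fst p) (snd p)) (Mats I J) (PiE (I \<times> J) (\<lambda>_. UNIV))"
proof (rule bij_betwI')
  fix M N :: "'a fmat" assume M: "M \<in> Mats I J" and N: "N \<in> Mats I J"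
  show "((\<lambda>p\<in>I \<times> J. ent M (fst p) (snd p)) = (\<lambda>p\<in>I \<times> J. ent N (fst p) (snd p))) = (M = N)"
  proof
    assume eq: "(\<lambda>p\<in>I \<times> J. ent M (fst p) (snd p)) = (\<lambda>p\<in>I \<times> J. ent N (fst p) (snd p))"
    show "M = N"
    proof (rule fmat_eqI)
      fix i j show "ent M i j = ent N i j"
      proof (cases "i \<in> I & j \<in> J")
        case True
        then show ?thesis using fun_cong[OF eq, of "(i, j)"] by simp
      next
        case False
        then show ?thesis using MatsD[OF M, of i j] MatsD[OF N, of i j] by metis
      qed
    qed
  qed simp
next
  fix M :: "'a fmat" assume "M \<in> Mats I J"
  show "(\<lambda>p\<in>I \<times> J. ent M (fst p) (snd p)) \<in> I \<times> J \<rightarrow>\<^sub>E UNIV" by (simp add: restrict_PiE_iff)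
next
  fix f :: "nat \<times> nat => 'a" assume f: "f \<in> I \<times> J \<rightarrow>\<^sub>E UNIV"
  define g where "g = (\<lambda>i j. if (i, j) \<in> I \<times> J then f (i, j) else 0)"
  obtain n where "\<forall>i\<in>I \<union> J. i < n" using assms finite_nat_set_iff_bounded by (metis finite_Un)
  then have n: "i \<in> I ==> \<not> n \<le> i" "i \<in> J ==> \<not> n \<le> i" for i by (auto simp: not_le)
  have "g \<in> {f. \<exists>n. \<forall>i j. n \<le> i \<or> n \<le> j --> f i j = 0}"
    by (auto simp: g_def intro!: exI[of _ n] dest: n)
  then have e: "ent (Abs_fmat g) = g" by (rule Abs_fmat_inverse)
  have "Abs_fmat g \<in> Mats I J" by (rule MatsI, unfold e) (auto simp: g_def split: if_splits)
  moreover have "f = (\<lambda>p\<in>I \<times> J. ent (Abs_fmat g) (fst p) (snd p))"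
  proof
    fix p show "f p = (\<lambda>p\<in>I \<times> J. ent (Abs_fmat g) (fst p) (snd p)) p"
      unfolding e using PiE_arb[OF f, of p] by (cases "p \<in> I \<times> J") (auto simp: g_def)
  qed
  ultimately show "\<exists>M\<in>Mats I J. f = (\<lambda>p\<in>I \<times> J. ent M (fst p) (snd p))" by blast
qed

lemma finite_Mats [simp]:
  assumes "finite I" "finite J" shows "finite (Mats I J :: 'a::{comm_ring_1,finite} fmat set)"
  using bij_betw_finite[OF bij_betw_Mats_fun[OF assms]] assms by (auto intro!: finite_PiE)

lemma card_Mats:
  assumes "finite I" "finite J"
  shows "card (Mats I J :: 'a::{comm_ring_1,finite} fmat set) = CARD('a) ^ (card I * card J)"
  using bij_betw_same_card[OF bij_betw_Mats_fun[OF assms]] assms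
  by (simp add: card_PiE card_cartesian_product)

section \<open>Invertible matrices, full row rank and rank factorization\<close>

definition GLs :: "nat set => 'a::comm_ring_1 fmat set" where
  "GLs I = {P \<in> Mats I I. \<exists>P'\<in>Mats I I. P * P' = idm I & P' * P = idm I}"

text \<open>Matrices of full row rank, expressed by a right inverse. Ranks are handled as the number
  of rows of such a matrix or through the cardinality of a kernel.\<close>

definition Epi :: "nat set => nat set => 'a::comm_ring_1 fmat set" where
  "Epi I J = {R \<in> Mats I J. \<exists>S\<in>Mats J I. R * S = idm I}"

definition finv :: "nat set => 'a::comm_ring_1 fmat => 'a fmat" where
  "finv I P = (SOME P'. P' \<in> Mats I I & P * P' = idm I & P' * P = idm I)"

lemma GLsI: "P \<in> Mats I I ==> P' \<in> Mats I I ==> P * P' = idm I ==> P' * P = idm I ==> P \<in> GLs I"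
  by (auto simp: GLs_def)

lemma GLs_Mats: "P \<in> GLs I ==> P \<in> Mats I I" by (simp add: GLs_def)
lemma Epi_Mats: "P \<in> Epi I J ==> P \<in> Mats I J" by (simp add: Epi_def)
lemma EpiI: "R \<in> Mats I J ==> S \<in> Mats J I ==> R * S = idm I ==> R \<in> Epi I J"
  by (auto simp: Epi_def)
lemma EpiE: assumes "R \<in> Epi I J" obtains S where "S \<in> Mats J I" "R * S = idm I"
  using assms by (auto simp: Epi_def)

lemma finv_props:
  assumes "P \<in> GLs I"
  shows "finv I P \<in> Mats I I" "P * finv I P = idm I" "finv I P * P = idm I"
proof -
  have "\<exists>P'. P' \<in> Mats I I & P * P' = idm I & P' * P = idm I" using assms by (auto simp: GLs_def)
  from someI_ex[OF this] show "finv I P \<in> Mats I I" "P * finv I P = idm I" "finv I P * P = idm I"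
    unfolding finv_def by blast+
qed

lemma finv_GLs: "P \<in> GLs I ==> finv I P \<in> GLs I"
  using finv_props[of P I] by (auto intro: GLsI GLs_Mats)

lemma finv_cancel:
  assumes "P \<in> GLs I" "finite I" "X \<in> Mats I J"
  shows "P * (finv I P * X) = X" "finv I P * (P * X) = X"
  using finv_props[OF assms(1)] assms by (simp_all add: mult.assoc[symmetric] idm_mult)

lemma finv_cancel_right:
  assumes "P \<in> GLs I" "finite I" "X \<in> Mats J I"
  shows "X * P * finv I P = X" "X * finv I P * P = X"
  using finv_props[OF assms(1)] assms by (simp_all add: mult.assoc mult_idm)

lemma idm_GLs: "finite I ==> idm I \<in> GLs I"
  by (rule GLsI[of _ _ "idm I"]) (auto simp: idm_mult_idm)

lemma idm_Mats [simp]: "idm I \<in> Mats I I" by auto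

lemma finv_unique:
  assumes "P \<in> GLs I" "finite I" "X \<in> Mats I I" "P * X = idm I" shows "X = finv I P"
  using finv_cancel(2)[OF assms(1-3)] finv_props[OF assms(1)] assms
  by (simp add: mult_idm[where J = I])

lemma finv_finv: "P \<in> GLs I ==> finite I ==> finv I (finv I P) = P"
  using finv_unique[OF finv_GLs, of P I P] finv_props[of P I] GLs_Mats[of P I] by simp

lemma GLs_mult:
  assumes "finite I" "P \<in> GLs I" "R \<in> GLs I" shows "P * R \<in> GLs I"
proof (rule GLsI[of _ _ "finv I R * finv I P"])
  note f = finv_props[OF assms(2)] finv_props[OF assms(3)] GLs_Mats[OF assms(2)] GLs_Mats[OF assms(3)]
  show "P * R \<in> Mats I I" "finv I R * finv I P \<in> Mats I I" using f by auto
  show "P * R * (finv I R * finv I P) = idm I"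
    using f assms by (simp add: mult.assoc finv_cancel[where J = I])
  show "finv I R * finv I P * (P * R) = idm I"
    using f assms by (simp add: mult.assoc finv_cancel[where J = I])
qed

lemma GLs_tr [simp]: "tr P \<in> GLs I \<longleftrightarrow> P \<in> GLs I"
proof -
  have *: "tr P \<in> GLs I" if "P \<in> GLs I" for P :: "'a fmat"
    using finv_props[OF that] GLs_Mats[OF that]
    by (intro GLsI[of _ _ "tr (finv I P)"]) (simp_all flip: tr_mult)
  show ?thesis using *[of P] *[of "tr P"] by auto
qed

lemma GLs_smult:
  assumes "P \<in> GLs I" "(c :: 'a::field) ~= 0" shows "c \<cdot> P \<in> GLs I"
  using finv_props[OF assms(1)] GLs_Mats[OF assms(1)] assms(2)
  by (intro GLsI[of _ _ "(1 / c) \<cdot> finv I P"]) auto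

lemma GLs_uminus [simp]: "- P \<in> GLs I \<longleftrightarrow> P \<in> GLs (I)"
proof -
  have *: "- P \<in> GLs I" if "P \<in> GLs I" for P :: "'a fmat"
    using finv_props[OF that] GLs_Mats[OF that]
    by (intro GLsI[of _ _ "- finv I P"]) simp_all
  show ?thesis using *[of P] *[of "- P"] by auto
qed

lemma finite_GLs [simp]: "finite I ==> finite (GLs I :: 'a::{comm_ring_1,finite} fmat set)"
  by (rule finite_subset[of _ "Mats I I"]) (auto simp: GLs_def)

lemma finite_Epi [simp]: "finite I ==> finite J ==> finite (Epi I J :: 'a::{comm_ring_1,finite} fmat set)"
  by (rule finite_subset[of _ "Mats I J"]) (auto simp: Epi_def)

lemma card_GLs_pos: "finite I ==> card (GLs I :: 'a::{comm_ring_1,finite} fmat set) > 0"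
  using idm_GLs[of I, where 'a = 'a] by (auto simp: card_gt_0_iff)

text \<open>Left multiplication by \<open>B\<close> is injective on \<open>Mats I I\<close>, because
  \<open>A\<close> undoes it, hence surjective on this finite set. Finiteness of the coefficient
  ring replaces determinants.\<close>

lemma left_inverse_right_inverse:
  fixes A B :: "'a::{comm_ring_1,finite} fmat"
  assumes I: "finite I" and A: "A \<in> Mats I I" and B: "B \<in> Mats I I" and AB: "A * B = idm I"
  shows "B * A = idm I"
proof -
  have "inj_on ((*) B) (Mats I I)"
  proof (rule inj_onI)
    fix X Y :: "'a fmat" assume X: "X \<in> Mats I I" and Y: "Y \<in> Mats I I" and eq: "B * X = B * Y"
    have "A * (B * X) = A * (B * Y)" using eq by simp
    then show "X = Y" using X Y I by (simp add: mult_eq_assoc[OF AB] idm_mult)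
  qed
  moreover have "(*) B ` Mats I I \<subseteq> Mats I I" using B by auto
  ultimately have "(*) B ` Mats I I = Mats I I" using I by (simp add: endo_inj_surj)
  then obtain X where X: "X \<in> Mats I I" "B * X = idm I" by (metis idm_Mats imageE)
  have "A * (B * X) = X" using X(1) I by (simp only: mult_eq_assoc[OF AB] idm_mult order_refl)
  then have "X = A" using X(2) A I by (simp add: mult_idm[where J = I])
  then show ?thesis using X by simp
qed

lemma GLsI_right:
  fixes A :: "'a::{comm_ring_1,finite} fmat"
  shows "finite I ==> A \<in> Mats I I ==> B \<in> Mats I I ==> A * B = idm I ==> A \<in> GLs I"
  using left_inverse_right_inverse GLsI by blast

lemma GLsI_left:
  fixes A :: "'a::{comm_ring_1,finite} fmat"
  shows "finite I ==> A \<in> Mats I I ==> B \<in> Mats I I ==> B * A = idm I ==> A \<in> GLs I"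
  using left_inverse_right_inverse GLsI by blast

lemma Epi_square: "finite I ==> Epi I I = (GLs I :: 'a::{comm_ring_1,finite} fmat set)"
  by (auto simp: Epi_def intro: GLsI_right finv_props dest: GLs_Mats)

lift_definition eunit :: "nat => nat => 'a::comm_ring_1 => 'a fmat" is
  "\<lambda>i j c a b. if a = i & b = j then c else 0"
proof -
  fix i j :: nat and c :: 'a
  show "\<exists>n. \<forall>a b. n \<le> a \<or> n \<le> b --> (if a = i & b = j then c else 0) = 0"
    by (intro exI[of _ "Suc (max i j)"]) auto
qed

lemma ent_eunit: "ent (eunit i j c) a b = (if a = i & b = j then c else 0)" by transfer simp

lemma eunit_Mats: "i \<in> I ==> j \<in> J ==> eunit i j c \<in> Mats I J"
  by (auto simp: Mats_def ent_eunit split: if_splits)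

lemma ent_mult_eunit: "ent (M * eunit i j c) a b = (if b = j then ent M a i * c else 0)"
  by (subst ent_mult[where K = "{i}"]) (auto simp: ent_eunit)

text \<open>A matrix unit on the right moves any column of \<open>X\<close> to position
  \<open>k\<close>, so injectivity on single columns is enough.\<close>

lemma mult_col_zeroI:
  assumes "\<And>v. v \<in> Mats J {k} ==> A * v = 0 ==> v = 0" and X: "X \<in> Mats J L" "A * X = 0"
  shows "X = 0"
proof (rule fmat_eqI)
  fix i j
  have "X * eunit j k 1 \<in> Mats J {k}" using X(1) by (intro Mats_mult[of X J L _ UNIV] eunit_Mats) auto
  moreover have "A * (X * eunit j k 1) = 0" by (simp add: mult_eq_assoc[OF X(2)])
  ultimately have "X * eunit j k 1 = 0" by (rule assms(1))
  then have "ent (X * eunit j k 1) i k = 0" by simp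
  then show "ent X i j = ent 0 i j" by (simp add: ent_mult_eunit)
qed

lemma GLsI_inj:
  fixes A :: "'a::{comm_ring_1,finite} fmat"
  assumes I: "finite I" and A: "A \<in> Mats I I"
    and inj: "\<And>v. v \<in> Mats I {0} ==> A * v = 0 ==> v = 0"
  shows "A \<in> GLs I"
proof -
  have "inj_on ((*) A) (Mats I I)"
  proof (rule inj_onI)
    fix X Y :: "'a fmat" assume X: "X \<in> Mats I I" and Y: "Y \<in> Mats I I" and eq: "A * X = A * Y"
    have "A * (X - Y) = 0" using eq by (simp add: algebra_simps)
    moreover have "X - Y \<in> Mats I I" using X Y by auto
    ultimately show "X = Y" using mult_col_zeroI[OF inj] by fastforce
  qed
  moreover have "(*) A ` Mats I I \<subseteq> Mats I I" using A by auto
  ultimately have "(*) A ` Mats I I = Mats I I" using I by (simp add: endo_inj_surj)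
  then obtain X where "X \<in> Mats I I" "A * X = idm I" by (metis idm_Mats imageE)
  then show ?thesis using I A by (blast intro: GLsI_right)
qed

lemma GLs_cancel: "P \<in> GLs I ==> finite I ==> X \<in> Mats I J ==> P * X = 0 ==> X = 0"
  using finv_cancel(2)[of P I X J] by simp

lemma GLs_mult_iff:
  fixes A :: "'a::{comm_ring_1,finite} fmat"
  assumes "finite I" "P \<in> GLs I" "A \<in> Mats I I"
  shows "P * A \<in> GLs I \<longleftrightarrow> A \<in> GLs I" "A * P \<in> GLs I \<longleftrightarrow> A \<in> GLs I"
proof -
  note f = finv_GLs[OF assms(2)]
  show "P * A \<in> GLs I \<longleftrightarrow> A \<in> GLs I"
    using GLs_mult[OF assms(1) f, of "P * A"] GLs_mult[OF assms(1,2)] finv_cancel(2)[OF assms(2,1,3)] by metis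
  show "A * P \<in> GLs I \<longleftrightarrow> A \<in> GLs I"
    using GLs_mult[OF assms(1) _ f, of "A * P"] GLs_mult[OF assms(1) _ assms(2)]
      finv_cancel_right(1)[OF assms(2,1,3)] by metis
qed

text \<open>The inverse of a block upper triangular matrix is written down; the block
  \<open>C\<close> enters it as \<open>- finv I A * C * finv J B\<close>.\<close>

lemma GLs_add_block:
  assumes "finite I" "finite J" "I \<inter> J = {}" "A \<in> GLs I" "B \<in> GLs J" "C \<in> Mats I J"
  shows "A + B + C \<in> GLs (I \<union> J)"
    and "finv I A + finv J B - finv I A * C * finv J B \<in> Mats (I \<union> J) (I \<union> J)"
    and "(A + B + C) * (finv I A + finv J B - finv I A * C * finv J B) = idm (I \<union> J)"
    and "(finv I A + finv J B - finv I A * C * finv J B) * (A + B + C) = idm (I \<union> J)"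
proof -
  let ?A = "finv I A" and ?B = "finv J B"
  have J: "J \<inter> I = {}" using assms(3) by auto
  note m = GLs_Mats[OF assms(4)] GLs_Mats[OF assms(5)] finv_props[OF assms(4)] finv_props[OF assms(5)] assms(6)
  have z: "A * ?B = 0" "B * ?A = 0" "C * ?A = 0" "?A * B = 0" "?B * A = 0" "?B * C = 0" "C * A = 0" "B * C = 0"
      "?A * ?B = 0" "?B * ?A = 0" "A * B = 0" "B * A = 0"
    using m assms(3) J by (auto intro: mult_disjoint)
  have mm: "?A + ?B - ?A * C * ?B \<in> Mats (I \<union> J) (I \<union> J)"
    by (intro Mats_diff Mats_add; rule Mats_mono[where I = I and J = I] Mats_mono[where I = J and J = J]
      Mats_mono[where I = I and J = J]) (use m in auto)
  then show "?A + ?B - ?A * C * ?B \<in> Mats (I \<union> J) (I \<union> J)" .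
  have m': "A + B + C \<in> Mats (I \<union> J) (I \<union> J)"
    by (intro Mats_diff Mats_add; rule Mats_mono[where I = I and J = I] Mats_mono[where I = J and J = J]
      Mats_mono[where I = I and J = J]) (use m in auto)
  have e1: "A * (?A * X) = X" "?A * (A * X) = X" if "X \<in> Mats I K" for X K
    using finv_cancel[OF assms(4,1) that] by auto
  have CB: "C * ?B \<in> Mats I J" using m by auto
  show *: "(A + B + C) * (?A + ?B - ?A * C * ?B) = idm (I \<union> J)"
    by (simp add: algebra_simps z z[THEN mult_eq_assoc] m e1[OF CB] idm_Un assms(1-3))
  show **: "(?A + ?B - ?A * C * ?B) * (A + B + C) = idm (I \<union> J)"
    using mult_idm[OF m(9), of J] assms(2) by (simp add: algebra_simps z z[THEN mult_eq_assoc] m idm_Un assms(1-3))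
  show "A + B + C \<in> GLs (I \<union> J)" by (rule GLsI[OF m' mm * **])
qed

lemma GLs_block_iff:
  fixes A :: "'a::{comm_ring_1,finite} fmat"
  assumes "finite I" "finite J" "I \<inter> J = {}" "A \<in> Mats I I" "B \<in> Mats J J" "C \<in> Mats I J"
  shows "A + B + C \<in> GLs (I \<union> J) \<longleftrightarrow> A \<in> GLs I & B \<in> GLs J"
proof
  assume G: "A + B + C \<in> GLs (I \<union> J)"
  let ?M = "finv (I \<union> J) (A + B + C)"
  note p = finv_props[OF G]
  have J: "J \<inter> I = {}" using assms(3) by auto
  have z: "idm J * A = 0" "idm J * C = 0" "B * idm I = 0" "C * idm I = 0"
    using assms(3-) J by (auto intro: mult_disjoint)
  have s: "idm J * B = B" "A * idm I = A" using assms by (auto intro: idm_mult mult_idm)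
  have "idm J * ((A + B + C) * ?M) * idm J = B * (idm J * ?M * idm J)"
    using mult_idm[OF assms(5), of J] assms(2)
    by (simp add: algebra_simps z z[THEN mult_eq_assoc] s s[THEN mult_eq_assoc])
       (simp add: mult.assoc[symmetric])
  then have "B * (idm J * ?M * idm J) = idm J" using assms p by (simp add: idm_mult_idm Int_absorb1)
  then have B: "B \<in> GLs J" using assms p by (intro GLsI_right[of J B "idm J * ?M * idm J"]) auto
  have "idm I * (?M * (A + B + C)) * idm I = idm I * ?M * idm I * A"
    using idm_mult[OF assms(4), of I] assms(1)
    by (simp add: algebra_simps z z[THEN mult_eq_assoc] s s[THEN mult_eq_assoc])
  then have "(idm I * ?M * idm I) * A = idm I" using assms p by (simp add: idm_mult_idm Int_absorb1 Int_absorb2)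
  then have "A \<in> GLs I" using assms p by (intro GLsI_left[of I A "idm I * ?M * idm I"]) auto
  with B show "A \<in> GLs I & B \<in> GLs J" by simp
qed (use assms GLs_add_block in blast)

text \<open>\<open>S * R\<close> projects rows onto the row space of \<open>R\<close>, so the
  condition on the right means that the new row lies outside this space.\<close>

lemma Epi_insert_iff:
  fixes R :: "'a::field fmat"
  assumes fin: "finite I" "finite J" and i: "i \<notin> I" and R: "R \<in> Mats I J" and S: "S \<in> Mats J I" and RS: "R * S = idm I"
    and \<rho>: "\<rho> \<in> Mats {i} J"
  shows "R + \<rho> \<in> Epi (insert i I) J \<longleftrightarrow> \<rho> ~= \<rho> * S * R"
proof -
  let ?r = "\<rho> - \<rho> * S * R"
  have d: "{i} \<inter> I = {}" "I \<inter> {i} = {}" using i by auto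
  have r: "?r \<in> Mats {i} J" using \<rho> S R by auto
  have e: "S * (R * S) = S" using RS S fin by (simp add: mult_idm[where J = I])
  show ?thesis
  proof
    assume "R + \<rho> \<in> Epi (insert i I) J"
    then obtain T where T: "T \<in> Mats J (insert i I)" "(R + \<rho>) * T = idm (insert i I)" by (rule EpiE)
    show "\<rho> ~= \<rho> * S * R"
    proof
      assume eq: "\<rho> = \<rho> * S * R"
      have 1: "idm {i} * R = 0" "idm I * \<rho> = 0" using R \<rho> d by (auto intro: mult_disjoint)
      have 2: "idm {i} * \<rho> = \<rho>" "idm I * R = R" using R \<rho> fin by (auto intro: idm_mult)
      have "idm {i} * ((R + \<rho>) * T) = \<rho> * T" by (simp add: algebra_simps 1[THEN mult_eq_assoc] 2[THEN mult_eq_assoc])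
      then have a: "\<rho> * T = idm {i}" using T fin by (simp add: idm_mult_idm)
      have "idm I * ((R + \<rho>) * T) = R * T" by (simp add: algebra_simps 1[THEN mult_eq_assoc] 2[THEN mult_eq_assoc])
      then have "R * T = idm I" using T fin by (simp add: idm_mult_idm Int_absorb2 subset_insertI)
      then have "\<rho> * S * (R * T) = \<rho> * S" using \<rho> S fin by (simp add: mult_idm[where J = I] mult.assoc)
      moreover have "\<rho> * S * (R * T) = \<rho> * T" using arg_cong[OF eq, of "\<lambda>x. x * T"] by (simp add: mult.assoc)
      ultimately have "idm {i} = \<rho> * S" using a by simp
      moreover have "\<rho> * S \<in> Mats {i} I" using \<rho> S by auto
      ultimately have "ent (idm {i} :: 'a fmat) i i = 0" using i by (simp add: MatsD)
      then show False by (simp add: ent_idm)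
    qed
  next
    assume "\<rho> ~= \<rho> * S * R"
    then have "?r ~= 0" by simp
    then obtain a j where "ent ?r a j ~= 0" by (metis fmat_eqI ent_zero)
    then have x: "ent ?r i j ~= 0" and j: "j \<in> J" using MatsD[OF r, of a j] by auto
    let ?T = "eunit j i (1 / ent ?r i j)"
    have T: "?T \<in> Mats J {i}" using j by (auto intro: eunit_Mats)
    have rT: "?r * ?T = idm {i}"
    proof (rule fmat_eqI)
      fix a b show "ent (?r * ?T) a b = ent (idm {i}) a b"
        unfolding ent_mult_eunit ent_idm using x MatsD[OF r, of a j] by auto
    qed
    \<comment> \<open>\<open>U\<close> is a column in the kernel of \<open>R\<close> on which the
      new row takes the value 1. It supplies the additional column of the right inverse.\<close>
    define U where "U = ?T - S * R * ?T"
    have U: "U \<in> Mats J {i}" unfolding U_def using S R T by auto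
    have RU: "R * U = 0"
      using idm_mult[OF Mats_mult[OF R T], of I] fin
      unfolding U_def right_diff_distrib mult.assoc mult_eq_assoc[OF RS] by simp
    have \<rho>U: "\<rho> * U = idm {i}" using rT by (simp add: U_def algebra_simps)
    let ?S = "S + U - U * \<rho> * S"
    have rs: "idm {i} * (\<rho> * S) = \<rho> * S" by (rule idm_mult[of _ "{i}" I]) (use \<rho> S in auto)
    have "(R + \<rho>) * ?S = idm (insert i I)"
      using idm_Un[of "{i}" I, where 'a = 'a] d fin
      by (simp add: algebra_simps RS RU \<rho>U mult_eq_assoc[OF RU] mult_eq_assoc[OF \<rho>U] rs)
    moreover have "?S \<in> Mats J (insert i I)"
      by (intro Mats_diff Mats_add; rule Mats_mono[where I = J and J = I] Mats_mono[where I = J and J = "{i}"])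
         (use S U R \<rho> in auto)
    moreover have "R + \<rho> \<in> Mats (insert i I) J"
      by (intro Mats_add; rule Mats_mono[where I = I and J = J] Mats_mono[where I = "{i}" and J = J]) (use R \<rho> in auto)
    ultimately show "R + \<rho> \<in> Epi (insert i I) J" by (blast intro: EpiI)
  qed
qed

text \<open>Gaussian elimination, one row at a time, in the form of a full rank factorization. The
  size of \<open>I1\<close> is the rank of \<open>A\<close>.\<close>

lemma row_compress:
  fixes A :: "'a::{field,finite} fmat"
  assumes "finite I" "finite J" "A \<in> Mats I J"
  obtains P I1 R where "P \<in> GLs I" "I1 \<subseteq> I" "R \<in> Epi I1 J" "A = P * R"
proof -
  have "\<exists>P\<in>GLs I. \<exists>I1\<subseteq>I. \<exists>R\<in>Epi I1 J. A = P * R"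
    using assms(1,3)
  proof (induction I arbitrary: A rule: finite_induct)
    case empty
    then have "A = 0" by (auto simp: Mats_def intro: fmat_eqI)
    moreover have "idm {} = (0 :: 'a fmat)" by (rule fmat_eqI) (simp add: ent_idm)
    ultimately show ?case
      by (intro bexI[of _ "idm {}"] exI[of _ "{}"] conjI bexI[of _ 0] idm_GLs EpiI[of _ _ _ 0]) auto
  next
    case (insert i I)
    define \<rho> where "\<rho> = idm {i} * A"
    have d: "{i} \<inter> I = {}" "I \<inter> {i} = {}" using insert by auto
    have \<rho>: "\<rho> \<in> Mats {i} J" unfolding \<rho>_def using insert by (auto intro: idm_mult_Mats)
    have "idm I * A \<in> Mats I J" using insert by (auto intro: idm_mult_Mats)
    from insert.IH[OF this] obtain P I1 R where P: "P \<in> GLs I" and I1: "I1 \<subseteq> I"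
      and R: "R \<in> Epi I1 J" and PR: "idm I * A = P * R" by blast
    obtain S where S: "S \<in> Mats J I1" "R * S = idm I1" using R by (rule EpiE)
    have fin: "finite I1" using I1 insert finite_subset by blast
    have A: "A = \<rho> + P * R"
      using Mats_split_rows[of A "{i}" I J] insert d PR by (auto simp: \<rho>_def)
    have i1: "{i} \<inter> I1 = {}" "I1 \<inter> {i} = {}" using I1 insert by auto
    note m = GLs_Mats[OF P] Epi_Mats[OF R] S(1) \<rho>
    \<comment> \<open>\<open>P1\<close> puts back the part \<open>\<rho> * S * R\<close> of the new
      row that depends on the earlier rows.\<close>
    define P1 where "P1 = P + idm {i} + \<rho> * S"
    have \<rho>S: "\<rho> * S \<in> Mats {i} I" using m I1 by (auto intro: Mats_mono)
    have "idm {i} + P + \<rho> * S \<in> GLs ({i} \<union> I)"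
      using insert d P \<rho>S by (intro GLs_add_block idm_GLs) auto
    then have P1: "P1 \<in> GLs (insert i I)" by (simp add: P1_def add.commute)
    have z: "idm {i} * R = 0" "P * \<rho> = 0" "S * \<rho> = 0" if True
      using m i1 d by (auto intro: mult_disjoint)
    have z2: "\<rho> * (S * \<rho>) = 0"
      by (subst mult.assoc[symmetric], rule mult_disjoint[of _ "{i}" I1 _ "{i}" J]) (use m i1 in auto)
    show ?case
    proof (cases "\<rho> = \<rho> * S * R")
      case True
      then have "A = P1 * R" unfolding A P1_def using z by (simp add: distrib_right mult.assoc)
      then show ?thesis using P1 I1 R by blast
    next
      case False
      define \<rho>' where "\<rho>' = \<rho> - \<rho> * S * R"
      have \<rho>': "\<rho>' \<in> Mats {i} J" unfolding \<rho>'_def using m by auto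
      have "\<rho>' * S = 0"
        unfolding \<rho>'_def using S fin by (simp add: left_diff_distrib mult.assoc mult_idm[where J = I1])
      then have E: "\<rho>' + R \<in> Epi (insert i I1) J"
        using Epi_insert_iff[OF fin \<open>finite J\<close> _ m(2) S \<rho>'] i1 False by (auto simp: \<rho>'_def add.commute)
      have "A = P1 * (\<rho>' + R)"
      proof -
        have "P * \<rho>' = 0" "\<rho> * S * \<rho>' = 0" "idm {i} * R = 0"
          using mult_disjoint[OF m(1) \<rho>'] mult_disjoint[OF \<rho>S \<rho>'] mult_disjoint[OF idm_Mats m(2)] d i1 by auto
        moreover have "idm {i} * \<rho>' = \<rho>'" using \<rho>' by (intro idm_mult) auto
        ultimately show ?thesis unfolding A P1_def by (simp add: distrib_right distrib_left mult.assoc \<rho>'_def)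
      qed
      moreover have "insert i I1 \<subseteq> insert i I" using I1 by blast
      ultimately show ?thesis using P1 E by blast
    qed
  qed
  then show ?thesis using that by blast
qed

lemma permutation_fmat:
  assumes "finite I" "finite J" "card I = card J"
  obtains W :: "'a::comm_ring_1 fmat" where "W \<in> Mats I J" "W * tr W = idm I" "tr W * W = idm J"
proof -
  obtain \<sigma> where \<sigma>: "bij_betw \<sigma> I J" using assms finite_same_card_bij by blast
  define W :: "'a fmat" where "W = (\<Sum>i\<in>I. eunit i (\<sigma> i) 1)"
  have eW: "ent W i j = (if i \<in> I & j = \<sigma> i then 1 else 0)" for i j
  proof -
    have "ent W i j = (\<Sum>x\<in>I. if x = i then (if j = \<sigma> i then 1 else 0) else 0)"
      unfolding W_def ent_sum ent_eunit by (rule sum.cong) auto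
    then show ?thesis using assms(1) by simp
  qed
  have W: "W \<in> Mats I J" using \<sigma> by (auto simp: Mats_def eW bij_betw_def split: if_splits)
  have "W * tr W = idm I"
  proof (rule fmat_eqI)
    fix a b
    have "ent (W * tr W) a b = (\<Sum>k\<in>{\<sigma> a}. ent W a k * ent (tr W) k b)"
      by (rule ent_mult) (auto simp: eW)
    then show "ent (W * tr W) a b = ent (idm I) a b"
      using \<sigma> assms(1) by (auto simp: eW ent_idm bij_betw_def inj_on_def)
  qed
  moreover have "tr W * W = idm J"
  proof (rule fmat_eqI)
    fix a b
    have "ent (tr W * W) a b = (\<Sum>k\<in>{inv_into I \<sigma> a}. ent (tr W) a k * ent W k b)"
    proof (rule ent_mult)
      fix k assume "k \<notin> {inv_into I \<sigma> a}"
      then have "\<not> (k \<in> I & a = \<sigma> k)" using \<sigma> by (auto simp: bij_betw_def)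
      then show "ent (tr W) a k = 0 \<or> ent W k b = 0" by (auto simp: eW)
    qed simp
    moreover have "\<sigma> (inv_into I \<sigma> a) = a & inv_into I \<sigma> a \<in> I" if "a \<in> J"
      using \<sigma> that by (auto simp: bij_betw_def f_inv_into_f inv_into_into)
    moreover have "a \<in> J" if "inv_into I \<sigma> a \<in> I" "a = \<sigma> (inv_into I \<sigma> a)"
      using \<sigma> that by (metis bij_betwE)
    ultimately show "ent (tr W * W) a b = ent (idm J) a b"
      using assms(2) by (auto simp: eW ent_idm)
  qed
  ultimately show ?thesis using W that by blast
qed

text \<open>The full rank factor may be moved to any row set of the right size by a permutation
  matrix. This places the image of a map on prescribed coordinates.\<close>

lemma Epi_reindex:
  fixes R :: "'a::{comm_ring_1,finite} fmat"
  assumes fin: "finite I" and P: "P \<in> GLs I" and I1: "I1 \<subseteq> I" and R: "R \<in> Epi I1 J"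
    and I2: "I2 \<subseteq> I" "card I2 = card I1"
  obtains P' R' where "P' \<in> GLs I" "R' \<in> Epi I2 J" "P * R = P' * R'"
proof -
  have f: "finite I1" "finite I2" using I1 I2 fin finite_subset by blast+
  obtain U :: "'a fmat" where U: "U \<in> Mats I2 I1" "U * tr U = idm I2" "tr U * U = idm I1"
    using permutation_fmat f I2 by metis
  have "card (I - I2) = card (I - I1)" using I1 I2 f by (simp add: card_Diff_subset)
  then obtain V :: "'a fmat" where V: "V \<in> Mats (I - I2) (I - I1)" "V * tr V = idm (I - I2)" "tr V * V = idm (I - I1)"
    using permutation_fmat[of "I - I2" "I - I1"] fin by auto
  have z: "U * tr V = 0" "V * tr U = 0" "tr U * V = 0" "tr V * U = 0" "V * R = 0"
    using U(1) V(1) Epi_Mats[OF R] by (auto intro!: mult_disjoint)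
  have un: "I2 \<union> (I - I2) = I" "I1 \<union> (I - I1) = I" using I1 I2 by auto
  have WW: "(U + V) * tr (U + V) = idm I" "tr (U + V) * (U + V) = idm I"
    using idm_Un[of I2 "I - I2", where 'a = 'a] idm_Un[of I1 "I - I1", where 'a = 'a] fin f un
    by (auto simp: distrib_left distrib_right U V z)
  have W: "U + V \<in> Mats I I" using U(1) V(1) I1 I2 by (intro Mats_add) (auto intro: Mats_mono)
  obtain S where S: "S \<in> Mats J I1" "R * S = idm I1" using R by (rule EpiE)
  have "P * tr (U + V) \<in> GLs I" by (intro GLs_mult fin P GLsI[of _ _ "U + V"] WW W) (simp only: Mats_tr W)
  moreover have "U * R \<in> Epi I2 J"
  proof (rule EpiI)
    show "U * R * (S * tr U) = idm I2"
      using U(1) f by (simp add: mult.assoc mult_eq_assoc[OF S(2)] idm_mult[of "tr U" I1 I2] U(2))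
  qed (use U S Epi_Mats[OF R] in auto)
  moreover have "P * tr (U + V) * (U * R) = P * R"
    using Epi_Mats[OF R] f by (simp add: distrib_left distrib_right mult.assoc mult_eq_assoc[OF U(3)] mult_eq_assoc[OF z(4)] idm_mult)
  ultimately show ?thesis using that by metis
qed

text \<open>\<open>S\<close> splits the surjection \<open>R\<close>: every column is the sum of a
  kernel element and an element of the image of \<open>S\<close>.\<close>

lemma bij_betw_Epi_solutions:
  assumes "R \<in> Epi I J" "finite I" "S \<in> Mats J I" "R * S = idm I"
  shows "bij_betw (\<lambda>(v, w). v + S * w) ({v \<in> Mats J K. R * v = 0} \<times> Mats I K) (Mats J K)"
proof (rule bij_betw_byWitness[where f' = "\<lambda>v. (v - S * (R * v), R * v)"])
  note m = Epi_Mats[OF assms(1)] assms(3)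
  have e: "R * (S * w) = w" if "w \<in> Mats I L" for w L
    using that assms(2) by (simp add: mult_eq_assoc[OF assms(4)] idm_mult)
  have e': "R * (S * (R * v)) = R * v" if "v \<in> Mats J L" for v L
    using e[OF Mats_mult[OF m(1) that]] .
  show "\<forall>a\<in>{v \<in> Mats J K. R * v = 0} \<times> Mats I K.
     (\<lambda>v. (v - S * (R * v), R * v)) ((\<lambda>(v, w). v + S * w) a) = a"
    using e by (auto simp: distrib_left)
  show "\<forall>a'\<in>Mats J K. (\<lambda>(v, w). v + S * w) (a' - S * (R * a'), R * a') = a'" by simp
  show "(\<lambda>(v, w). v + S * w) ` ({v \<in> Mats J K. R * v = 0} \<times> Mats I K) \<subseteq> Mats J K" using m by auto
  show "(\<lambda>v. (v - S * (R * v), R * v)) ` Mats J K \<subseteq> {v \<in> Mats J K. R * v = 0} \<times> Mats I K"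
    using m e' by (auto simp: right_diff_distrib)
qed

definition kerf :: "nat set => 'a::comm_ring_1 fmat => 'a fmat set" where
  "kerf J X = {v \<in> Mats J {0}. X * v = 0}"

lemma card_Epi_solutions:
  fixes R :: "'a::{comm_ring_1,finite} fmat"
  assumes "R \<in> Epi I J" "finite I" "finite J" "finite K"
  shows "card {v \<in> Mats J K. R * v = 0} * CARD('a) ^ (card I * card K) = CARD('a) ^ (card J * card K)"
proof -
  obtain S where "S \<in> Mats J I" "R * S = idm I" using assms(1) by (rule EpiE)
  from bij_betw_same_card[OF bij_betw_Epi_solutions[OF assms(1,2) this, of K]]
  show ?thesis using assms by (simp add: card_cartesian_product card_Mats)
qed

lemma card_kerf_Epi:
  fixes R :: "'a::{comm_ring_1,finite} fmat"
  assumes "R \<in> Epi I J" "finite I" "finite J"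
  shows "card (kerf J R) * CARD('a) ^ card I = CARD('a) ^ card J"
  using card_Epi_solutions[OF assms, of "{0}"] by (simp add: kerf_def)

lemma kerf_GLs_mult: "P \<in> GLs I ==> finite I ==> R \<in> Mats I J ==> kerf J (P * R) = kerf J R"
  using GLs_cancel[of P I "R * _" "{0}"] by (auto simp: kerf_def mult.assoc)

section \<open>Counting symmetric and alternating matrices\<close>

text \<open>Row by row: a new row must avoid the row space of the rows already chosen, and this
  space has \<open>CARD('a) ^ card I\<close> elements.\<close>

lemma real_card_Epi:
  fixes TYPEA :: "'a::{field,finite} itself"
  assumes "finite I" "finite J"
  shows "real (card (Epi I J :: 'a fmat set)) = (\<Prod>i<card I. real CARD('a) ^ card J - real CARD('a) ^ i)"
  using assms(1)
proof (induction I rule: finite_induct)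
  case empty
  have "Mats {} J = {0 :: 'a fmat}" by (auto simp: Mats_def intro: fmat_eqI)
  moreover have "idm {} = (0 :: 'a fmat)" by (rule fmat_eqI) (simp add: ent_idm)
  ultimately have "Epi {} J = {0 :: 'a fmat}" by (auto simp: Epi_def intro!: bexI[of _ 0])
  then show ?case by simp
next
  case (insert i I)
  let ?q = "CARD('a)"
  define B where "B R = Mats {i} J - (\<lambda>x. x * R) ` Mats {i} I" for R :: "'a fmat"
  have d: "{i} \<inter> I = {}" "I \<inter> {i} = {}" using insert by auto
  have B: "R + \<rho> \<in> Epi (insert i I) J \<longleftrightarrow> \<rho> \<in> B R" if R: "R \<in> Epi I J" and \<rho>: "\<rho> \<in> Mats {i} J" for R \<rho>
  proof -
    obtain S where S: "S \<in> Mats J I" "R * S = idm I" using R by (rule EpiE)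
    have "\<rho> = \<rho> * S * R \<longleftrightarrow> \<rho> \<in> (\<lambda>x. x * R) ` Mats {i} I"
    proof
      assume "\<rho> = \<rho> * S * R" then show "\<rho> \<in> (\<lambda>x. x * R) ` Mats {i} I" using S \<rho> by blast
    next
      assume "\<rho> \<in> (\<lambda>x. x * R) ` Mats {i} I"
      then obtain x where "x \<in> Mats {i} I" "\<rho> = x * R" by blast
      then show "\<rho> = \<rho> * S * R"
        using insert(1) S(2) by (simp add: mult.assoc mult_eq_assoc[OF S(2)] idm_mult[OF Epi_Mats[OF R]])
    qed
    then show ?thesis
      using Epi_insert_iff[OF insert(1) assms(2) insert(2) Epi_Mats[OF R] S \<rho>] \<rho> by (auto simp: B_def)
  qed
  have cB: "real (card (B R)) = real ?q ^ card J - real ?q ^ card I" if R: "R \<in> Epi I J" for R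
  proof -
    obtain S where S: "S \<in> Mats J I" "R * S = idm I" using R by (rule EpiE)
    have "inj_on (\<lambda>x. x * R) (Mats {i} I)"
    proof (rule inj_onI)
      fix x y assume xy: "x \<in> Mats {i} I" "y \<in> Mats {i} I" "x * R = y * R"
      then have "x * (R * S) = y * (R * S)" by (simp add: mult.assoc[symmetric])
      then show "x = y" using insert(1) by (simp add: S(2) mult_idm[OF xy(1)] mult_idm[OF xy(2)])
    qed
    then have "card ((\<lambda>x. x * R) ` Mats {i} I) = ?q ^ card I"
      using insert(1) by (simp add: card_image card_Mats)
    moreover have sub: "(\<lambda>x. x * R) ` Mats {i} I \<subseteq> Mats {i} J" using Epi_Mats[OF R] by auto
    moreover have fin: "finite (Mats {i} J :: 'a fmat set)" "card (Mats {i} J :: 'a fmat set) = ?q ^ card J"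
      using assms by (simp_all add: card_Mats)
    moreover have "finite ((\<lambda>x. x * R) ` Mats {i} I)" using finite_subset[OF sub fin(1)] .
    ultimately have "card (B R) = ?q ^ card J - ?q ^ card I" "?q ^ card I \<le> ?q ^ card J"
      using card_mono[OF fin(1) sub] unfolding B_def by (simp_all add: card_Diff_subset)
    then show ?thesis by simp
  qed
  have "bij_betw (\<lambda>(R, \<rho>). R + \<rho>) (Sigma (Epi I J) B) (Epi (insert i I) J)"
  proof (rule bij_betwI[where g = "\<lambda>M. (idm I * M, idm {i} * M)"])
    show "(\<lambda>M. (idm I * M, idm {i} * M)) ((\<lambda>(R, \<rho>). R + \<rho>) a) = a" if a: "a \<in> Sigma (Epi I J) B" for a
    proof -
      obtain R \<rho> where [simp]: "a = (R, \<rho>)" and R: "R \<in> Epi I J" and \<rho>: "\<rho> \<in> Mats {i} J"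
        using a by (auto simp: B_def)
      have "idm I * \<rho> = 0" "idm {i} * R = 0" using \<rho> Epi_Mats[OF R] d by (auto intro: mult_disjoint)
      moreover have "idm I * R = R" "idm {i} * \<rho> = \<rho>" using \<rho> Epi_Mats[OF R] insert(1) by (auto intro: idm_mult)
      ultimately show ?thesis by (simp add: distrib_left)
    qed
    have split: "idm I * M + idm {i} * M = M" if "M \<in> Mats (insert i I) J" for M :: "'a fmat"
      using Mats_split_rows[of M I "{i}" J] that insert(1) d by auto
    show "(\<lambda>(R, \<rho>). R + \<rho>) (idm I * a', idm {i} * a') = a'" if "a' \<in> Epi (insert i I) J" for a' :: "'a fmat"
      using split Epi_Mats[OF that] by auto
    show "(\<lambda>(R, \<rho>). R + \<rho>) \<in> Sigma (Epi I J) B \<rightarrow> Epi (insert i I) J"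
      using B by (auto simp: B_def)
    show "(\<lambda>M. (idm I * M, idm {i} * M)) \<in> Epi (insert i I) J \<rightarrow> Sigma (Epi I J) B"
    proof
      fix M :: "'a fmat" assume M: "M \<in> Epi (insert i I) J"
      then obtain T where T: "T \<in> Mats J (insert i I)" "M * T = idm (insert i I)" by (rule EpiE)
      have m: "idm I * M \<in> Mats I J" "idm {i} * M \<in> Mats {i} J"
        using Epi_Mats[OF M] insert(1) by (auto intro: idm_mult_Mats)
      have "idm I * M * (T * idm I) = idm I"
        using insert(1) by (simp add: mult.assoc mult_eq_assoc[OF T(2)] idm_mult_idm Int_absorb1 Int_absorb2 subset_insertI)
      then have R: "idm I * M \<in> Epi I J"
        using T insert(1) by (intro EpiI[OF m(1), of "T * idm I"]) (auto intro: mult_idm_Mats)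
      then show "(idm I * M, idm {i} * M) \<in> Sigma (Epi I J) B"
        using B[OF R m(2)] M split[OF Epi_Mats[OF M]] by simp
    qed
  qed
  then have "card (Epi (insert i I) J :: 'a fmat set) = card (Sigma (Epi I J) B)"
    by (simp add: bij_betw_same_card)
  also have "... = (\<Sum>R\<in>Epi I J. card (B R))"
    using assms insert(1) by (simp add: card_SigmaI B_def)
  finally have "real (card (Epi (insert i I) J :: 'a fmat set)) = (\<Sum>R\<in>Epi I J. real (card (B R)))" by simp
  also have "... = real (card (Epi I J :: 'a fmat set)) * (real ?q ^ card J - real ?q ^ card I)"
    using cB by simp
  finally show ?case using insert by simp
qed

lemma real_card_GLs:
  assumes "finite I"
  shows "real (card (GLs I :: 'a::{field,finite} fmat set)) = (\<Prod>i<card I. real CARD('a) ^ card I - real CARD('a) ^ i)"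
  using real_card_Epi[OF assms assms, where 'a = 'a] assms by (simp add: Epi_square)

text \<open>The sign \<open>ep\<close> is 1 or -1; with 2 invertible, the value -1 gives the
  alternating matrices.\<close>

definition Sym :: "'a::comm_ring_1 => nat set => 'a fmat set" where
  "Sym ep I = {M \<in> Mats I I. tr M = ep \<cdot> M}"

definition SN :: "'a::comm_ring_1 => nat set => 'a fmat set" where
  "SN ep I = {M \<in> GLs I. tr M = ep \<cdot> M}"

lemma SymI: "M \<in> Mats I I ==> tr M = ep \<cdot> M ==> M \<in> Sym ep I" by (simp add: Sym_def)
lemma SymD: "M \<in> Sym ep I ==> M \<in> Mats I I" "M \<in> Sym ep I ==> tr M = ep \<cdot> M" by (simp_all add: Sym_def)
lemma SND: "M \<in> SN ep I ==> M \<in> GLs I" "M \<in> SN ep I ==> tr M = ep \<cdot> M" by (simp_all add: SN_def)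
lemma SN_Mats: "M \<in> SN ep I ==> M \<in> Mats I I" by (rule GLs_Mats[OF SND(1)])

lemma SN_Sym: "SN ep I = Sym ep I \<inter> GLs I" by (auto simp: SN_def Sym_def GLs_Mats)

lemma finite_Sym [simp]: "finite I ==> finite (Sym ep I :: 'a::{comm_ring_1,finite} fmat set)"
  by (rule finite_subset[of _ "Mats I I"]) (auto simp: Sym_def)
lemma finite_SN [simp]: "finite I ==> finite (SN ep I :: 'a::{comm_ring_1,finite} fmat set)"
  by (simp add: SN_Sym)

lemma bij_betw_Sym_Un:
  fixes ep :: "'a::comm_ring_1"
  assumes "finite I" "finite J" "I \<inter> J = {}" and ep: "ep * ep = 1"
  shows "bij_betw (\<lambda>(A, C, B). A + C + ep \<cdot> tr C + B) (Sym ep I \<times> Mats I J \<times> Sym ep J) (Sym ep (I \<union> J))"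
proof (rule bij_betwI[where g = "\<lambda>M. (idm I * M * idm I, idm I * M * idm J, idm J * M * idm J)"])
  have J: "J \<inter> I = {}" using assms by auto
  show "(\<lambda>M. (idm I * M * idm I, idm I * M * idm J, idm J * M * idm J))
      ((\<lambda>(A, C, B). A + C + ep \<cdot> tr C + B) a) = a" if a: "a \<in> Sym ep I \<times> Mats I J \<times> Sym ep J" for a
  proof -
    obtain A C B where [simp]: "a = (A, C, B)" and A: "A \<in> Sym ep I" and C: "C \<in> Mats I J" and B: "B \<in> Sym ep J"
      using a by auto
    have "idm I * B = 0" "idm J * A = 0" "A * idm J = 0" "B * idm I = 0" "idm J * C = 0" "C * idm I = 0"
      "idm I * tr C = 0" "tr C * idm J = 0"
      using SymD(1)[OF A] SymD(1)[OF B] C assms(3) J by (auto intro!: mult_disjoint)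
    moreover have "idm I * A = A" "A * idm I = A" "idm J * B = B" "B * idm J = B" "idm I * C = C" "C * idm J = C"
      "idm J * tr C = tr C" "tr C * idm I = tr C"
      using SymD(1)[OF A] SymD(1)[OF B] C assms by (auto intro: idm_mult mult_idm)
    ultimately show ?thesis by (simp add: distrib_left distrib_right mult.assoc)
  qed
  show "(\<lambda>(A, C, B). A + C + ep \<cdot> tr C + B) (idm I * M * idm I, idm I * M * idm J, idm J * M * idm J) = M"
    if M: "M \<in> Sym ep (I \<union> J)" for M :: "'a fmat"
  proof -
    have e: "idm (I \<union> J) * M = M" "M * idm (I \<union> J) = M" using SymD(1)[OF M] assms by (auto intro: idm_mult mult_idm)
    have "M = idm (I \<union> J) * M * idm (I \<union> J)" using e by simp
    also have "... = idm I * M * idm I + idm I * M * idm J + idm J * M * idm I + idm J * M * idm J"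
      using assms by (simp add: idm_Un distrib_left distrib_right)
    finally show ?thesis using SymD(2)[OF M] ep by (simp add: mult.assoc)
  qed
  show "(\<lambda>(A, C, B). A + C + ep \<cdot> tr C + B) \<in> Sym ep I \<times> Mats I J \<times> Sym ep J \<rightarrow> Sym ep (I \<union> J)"
  proof
    fix a :: "'a fmat \<times> 'a fmat \<times> 'a fmat" assume a: "a \<in> Sym ep I \<times> Mats I J \<times> Sym ep J"
    obtain A C B where [simp]: "a = (A, C, B)" and A: "A \<in> Sym ep I" and C: "C \<in> Mats I J" and B: "B \<in> Sym ep J"
      using a by auto
    note m = SymD(1)[OF A] C SymD(1)[OF B]
    have "A \<in> Mats (I \<union> J) (I \<union> J)" "B \<in> Mats (I \<union> J) (I \<union> J)" "C \<in> Mats (I \<union> J) (I \<union> J)" "tr C \<in> Mats (I \<union> J) (I \<union> J)"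
      using m by (auto intro: Mats_mono)
    then have "A + C + ep \<cdot> tr C + B \<in> Sym ep (I \<union> J)"
      by (intro SymI Mats_add Mats_smult) (auto simp: SymD(2)[OF A] SymD(2)[OF B] ep)
    then show "(\<lambda>(A, C, B). A + C + ep \<cdot> tr C + B) a \<in> Sym ep (I \<union> J)" by simp
  qed
  show "(\<lambda>M. (idm I * M * idm I, idm I * M * idm J, idm J * M * idm J)) \<in> Sym ep (I \<union> J)
      \<rightarrow> Sym ep I \<times> Mats I J \<times> Sym ep J"
    by (auto simp: Sym_def mult.assoc)
qed

lemma card_Sym_Un:
  fixes ep :: "'a::{comm_ring_1,finite}"
  assumes "finite I" "finite J" "I \<inter> J = {}" and ep: "ep * ep = 1"
  shows "card (Sym ep (I \<union> J)) = card (Sym ep I) * CARD('a) ^ (card I * card J) * card (Sym ep J)"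
  using bij_betw_same_card[OF bij_betw_Sym_Un[OF assms]] assms
  by (simp add: card_cartesian_product card_Mats)

text \<open>Number of entries on and above the diagonal, or strictly above it, in a matrix of size
  \<open>k\<close>.\<close>

definition sexp :: "'a::field => nat => nat" where
  "sexp ep k = (if ep = 1 then Suc k choose 2 else k choose 2)"

lemma sexp_0 [simp]: "sexp ep 0 = 0" by (simp add: sexp_def)
lemma sexp_Suc: "sexp ep (Suc k) = sexp ep k + k + (if ep = 1 then 1 else 0)"
  by (simp add: sexp_def numeral_2_eq_2)

lemma Mats_singleton_tr: "M \<in> Mats {i} {i} ==> tr M = M"
proof (rule fmat_eqI)
  fix a b assume "M \<in> Mats {i} {i}"
  then show "ent (tr M) a b = ent M a b" using MatsD[of M "{i}" "{i}" a b] MatsD[of M "{i}" "{i}" b a]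
    by (cases "a = b") auto
qed

lemma Sym_empty: "Sym ep {} = {0}"
  by (auto simp: Sym_def Mats_def intro: fmat_eqI)

lemma card_Sym_singleton:
  fixes ep :: "'a::{field,finite}"
  assumes "(2 :: 'a) ~= 0" "ep = 1 \<or> ep = -1"
  shows "card (Sym ep {i}) = CARD('a) ^ (if ep = 1 then 1 else 0)"
proof (cases "ep = 1")
  case True
  then have "Sym ep {i} = Mats {i} {i}" by (auto simp: Sym_def Mats_singleton_tr)
  then show ?thesis using True card_Mats[of "{i}" "{i}", where 'a = 'a] by simp
next
  case False
  then have e: "ep = - 1" using assms by auto
  have "M = 0" if "M \<in> Sym ep {i}" for M
  proof (rule fmat_eqI)
    fix a b
    have "M = - M" using SymD[OF that] Mats_singleton_tr[of M i] e by simp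
    then have "ent M a b = - ent M a b" by (metis ent_uminus)
    then have "2 * ent M a b = 0" by (metis add.left_inverse mult_2 add.commute ab_left_minus)
    then show "ent M a b = ent 0 a b" using assms(1) by simp
  qed
  then have "Sym ep {i} = {0}" by (auto intro: SymI)
  then show ?thesis using False by simp
qed

lemma card_Sym:
  fixes ep :: "'a::{field,finite}"
  assumes "(2 :: 'a) ~= 0" "ep = 1 \<or> ep = -1" "finite I"
  shows "card (Sym ep I) = CARD('a) ^ sexp ep (card I)"
  using assms(3)
proof (induction I rule: finite_induct)
  case empty
  then show ?case by (simp add: Sym_empty)
next
  case (insert i I)
  have "ep * ep = 1" using assms(2) by auto
  then have "card (Sym ep ({i} \<union> I)) = card (Sym ep {i}) * CARD('a) ^ (card {i} * card I) * card (Sym ep I)"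
    using insert by (intro card_Sym_Un) auto
  then show ?case using insert card_Sym_singleton[OF assms(1,2), of i] by (simp add: sexp_Suc power_add)
qed

lemma GLs_congruence_iff:
  fixes A :: "'a::{comm_ring_1,finite} fmat"
  assumes "finite I" "P \<in> GLs I" "A \<in> Mats I I"
  shows "P * A * tr P \<in> GLs I \<longleftrightarrow> A \<in> GLs I"
proof -
  have "P * A \<in> Mats I I" using GLs_Mats[OF assms(2)] assms(3) by auto
  then show ?thesis using assms by (simp add: GLs_mult_iff)
qed

text \<open>In \<open>completion\<close> the unknown block undergoes exactly such a change:
  subtraction of a Schur complement term, then a congruence.\<close>

lemma bij_betw_Sym_affine:
  assumes I: "finite I" and H: "H \<in> GLs I" and S0: "S0 \<in> Sym ep I"
  shows "bij_betw (\<lambda>S. H * (S - S0) * tr H) (Sym ep I) (Sym ep I)"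
proof (rule bij_betw_byWitness[where f' = "\<lambda>S. finv I H * S * tr (finv I H) + S0"])
  note f = finv_props[OF H] GLs_Mats[OF H] SymD(1)[OF S0] SymD(2)[OF S0]
  have t: "tr H * tr (finv I H) = idm I" "tr (finv I H) * tr H = idm I" using f by (simp_all flip: tr_mult)
  show "\<forall>S\<in>Sym ep I. finv I H * (H * (S - S0) * tr H) * tr (finv I H) + S0 = S"
  proof
    fix S assume S: "S \<in> Sym ep I"
    have d: "S - S0 \<in> Mats I I" using SymD(1)[OF S] f by auto
    have "finv I H * (H * (S - S0) * tr H) * tr (finv I H) = finv I H * (H * ((S - S0) * (tr H * tr (finv I H))))"
      by (simp only: mult.assoc)
    also have "... = S - S0" using d I by (simp add: t mult_idm[OF d] finv_cancel[OF H I d] del: tr_mult)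
    finally show "finv I H * (H * (S - S0) * tr H) * tr (finv I H) + S0 = S" by simp
  qed
  show "\<forall>S\<in>Sym ep I. H * (finv I H * S * tr (finv I H) + S0 - S0) * tr H = S"
  proof
    fix S assume S: "S \<in> Sym ep I"
    have "H * (finv I H * S * tr (finv I H) + S0 - S0) * tr H = H * (finv I H * (S * (tr (finv I H) * tr H)))"
      by (simp only: mult.assoc add_diff_cancel_right')
    also have "... = S" using SymD(1)[OF S] I by (simp add: t mult_idm[of S I I] finv_cancel[OF H I] del: tr_mult)
    finally show "H * (finv I H * S * tr (finv I H) + S0 - S0) * tr H = S" .
  qed
  show "(\<lambda>S. H * (S - S0) * tr H) ` Sym ep I \<subseteq> Sym ep I"
    using f by (auto simp: Sym_def mult.assoc left_diff_distrib right_diff_distrib intro!: Mats_mult[of _ I I _ I I] Mats_diff)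
  show "(\<lambda>S. finv I H * S * tr (finv I H) + S0) ` Sym ep I \<subseteq> Sym ep I"
    using f by (auto simp: Sym_def mult.assoc intro!: Mats_mult[of _ I I _ I I] Mats_add)
qed

lemma one_less_card_field: "1 < CARD('a::{field,finite})"
proof -
  have "card {0, 1 :: 'a} \<le> CARD('a)" by (rule card_mono) auto
  then show ?thesis by simp
qed

section \<open>Completions of a partially given symmetric or alternating matrix\<close>

lemma Sym_UnE:
  fixes ep :: "'a::comm_ring_1"
  assumes "S \<in> Sym ep (I \<union> J)" "finite I" "finite J" "I \<inter> J = {}" "ep * ep = 1"
  obtains A C B where "A \<in> Sym ep I" "C \<in> Mats I J" "B \<in> Sym ep J" "S = A + C + ep \<cdot> tr C + B"
proof -
  have "S \<in> (\<lambda>(A, C, B). A + C + ep \<cdot> tr C + B) ` (Sym ep I \<times> Mats I J \<times> Sym ep J)"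
    using bij_betw_Sym_Un[OF assms(2-5)] assms(1) unfolding bij_betw_def by blast
  then show ?thesis using that by auto
qed

text \<open>Normal form of the completion problem: \<open>A\<close> is invertible on
  \<open>J\<close>, and \<open>D\<close> pairs \<open>L\<close> perfectly with \<open>L'\<close>.
  The rows and columns through \<open>D\<close> clear everything of \<open>S\<close> that meets
  \<open>L'\<close>, so only the corner on \<open>I3\<close> decides.\<close>

lemma completion_core:
  fixes ep :: "'a::{field,finite}"
  assumes fin: "finite J" "finite L" "finite L'" "finite I3"
    and dis: "J \<inter> L = {}" "J \<inter> L' = {}" "J \<inter> I3 = {}" "L \<inter> L' = {}" "L \<inter> I3 = {}" "L' \<inter> I3 = {}"
    and A: "A \<in> GLs J" and D: "D \<in> Mats L L'" and E: "E \<in> Mats L' L" and DE: "D * E = idm L" "E * D = idm L'"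
    and S: "S \<in> Sym ep (L' \<union> I3)" and ep: "ep * ep = 1"
  shows "A + D + ep \<cdot> tr D + S \<in> GLs (J \<union> (L \<union> (L' \<union> I3))) \<longleftrightarrow> idm I3 * S * idm I3 \<in> GLs I3"
proof -
  have dis': "L \<inter> J = {}" "L' \<inter> J = {}" "I3 \<inter> J = {}" "L' \<inter> L = {}" "I3 \<inter> L = {}" "I3 \<inter> L' = {}"
    using dis by auto
  obtain S1 C S3 where S1: "S1 \<in> Sym ep L'" and C: "C \<in> Mats L' I3" and S3: "S3 \<in> Sym ep I3"
    and S_eq: "S = S1 + C + ep \<cdot> tr C + S3"
    using Sym_UnE[OF S fin(3,4) dis(6) ep] .
  note m = SymD(1)[OF S1] SymD(1)[OF S3] C D E GLs_Mats[OF A]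
  let ?N = "D + ep \<cdot> tr D + S"
  let ?K = "L \<union> (L' \<union> I3)"
  have up: "D \<in> Mats ?K ?K" "E \<in> Mats ?K ?K" "S \<in> Mats ?K ?K" "tr D \<in> Mats ?K ?K" "tr E \<in> Mats ?K ?K" "idm I3 \<in> Mats ?K ?K"
    unfolding Mats_tr by (rule Mats_mono[OF D] Mats_mono[OF E] Mats_mono[OF SymD(1)[OF S]] Mats_idm; blast)+
  have N: "?N \<in> Mats (L \<union> (L' \<union> I3)) (L \<union> (L' \<union> I3))"
    by (intro Mats_add Mats_diff Mats_smult up)+
  have 1: "A + D + ep \<cdot> tr D + S \<in> GLs (J \<union> (L \<union> (L' \<union> I3))) \<longleftrightarrow> ?N \<in> GLs (L \<union> (L' \<union> I3))"
    using GLs_block_iff[of J "L \<union> (L' \<union> I3)" A ?N 0] A m N fin dis by (auto simp: add.assoc)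
  have tDE: "tr D * tr E = idm L'" "tr E * tr D = idm L" using DE by (simp_all flip: tr_mult)
  \<comment> \<open>Multiplication by \<open>?W\<close> exchanges \<open>L\<close> with
    \<open>L'\<close>. Then \<open>?N * ?W\<close> is block triangular with diagonal blocks
    \<open>idm L'\<close>, \<open>S3\<close> and \<open>idm L\<close>.\<close>
  let ?W = "E + ep \<cdot> tr E + idm I3" and ?W' = "D + ep \<cdot> tr D + idm I3"
  have mW: "?W \<in> Mats (L \<union> (L' \<union> I3)) (L \<union> (L' \<union> I3))" "?W' \<in> Mats (L \<union> (L' \<union> I3)) (L \<union> (L' \<union> I3))"
    by (intro Mats_add Mats_diff Mats_smult up)+
  have z: "D * D = 0" "E * E = 0" "E * tr D = 0" "tr E * D = 0" "D * tr E = 0" "tr D * E = 0" "D * idm I3 = 0" "tr D * idm I3 = 0"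
      "idm I3 * E = 0" "idm I3 * tr E = 0" "E * idm I3 = 0" "tr E * idm I3 = 0" "tr E * tr E = 0" "tr D * tr D = 0"
      "idm I3 * D = 0" "idm I3 * tr D = 0"
    using m dis dis' by (auto intro!: mult_disjoint)
  have "?W * ?W' = idm (L \<union> (L' \<union> I3))"
    using fin dis by (simp add: distrib_left distrib_right z DE tDE ep idm_mult_idm idm_Un Int_Un_distrib)
  then have W: "?W \<in> GLs (L \<union> (L' \<union> I3))" using mW fin by (intro GLsI_right[of _ ?W ?W']) auto
  have zS: "S1 * tr E = 0" "S1 * idm I3 = 0" "C * E = 0" "C * tr E = 0" "tr C * tr E = 0" "tr C * idm I3 = 0"
      "S3 * E = 0" "S3 * tr E = 0"
    using m dis dis' by (auto intro!: mult_disjoint)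
  have iS: "C * idm I3 = C" "S3 * idm I3 = S3" using m fin by (auto intro: mult_idm)
  have NW: "?N * ?W = idm L' + (idm L + S3 + ep \<cdot> (tr C * E)) + (C + S1 * E)"
    unfolding S_eq by (simp add: distrib_left distrib_right z zS iS DE tDE ep algebra_simps)
  have SE: "tr C * E \<in> Mats I3 L" "S1 * E \<in> Mats L' L" using m by auto
  have "?N \<in> GLs (L \<union> (L' \<union> I3)) \<longleftrightarrow> ?N * ?W \<in> GLs (L \<union> (L' \<union> I3))"
    using fin by (subst GLs_mult_iff(2)[OF _ W N]) auto
  also have eqU: "L \<union> (L' \<union> I3) = L' \<union> (I3 \<union> L)" by auto
  also have "?N * ?W \<in> GLs (L' \<union> (I3 \<union> L)) \<longleftrightarrow> idm L + S3 + ep \<cdot> (tr C * E) \<in> GLs (I3 \<union> L)"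
    unfolding NW
  proof (subst GLs_block_iff)
    show "idm L + S3 + ep \<cdot> (tr C * E) \<in> Mats (I3 \<union> L) (I3 \<union> L)"
      by (intro Mats_add Mats_smult Mats_idm Mats_mono[OF SE(1)] Mats_mono[OF m(2)]) auto
    show "C + S1 * E \<in> Mats L' (I3 \<union> L)"
      by (intro Mats_add Mats_mono[OF SE(2)] Mats_mono[OF m(3)]) auto
  qed (use fin dis dis' idm_GLs in auto)
  also have "... \<longleftrightarrow> S3 \<in> GLs I3"
    using GLs_block_iff[of I3 L S3 "idm L" "ep \<cdot> (tr C * E)"] fin dis dis' m SE idm_GLs[of L, where 'a = 'a]
    by (auto simp: add.commute)
  also have "S3 = idm I3 * S * idm I3"
  proof -
    have "idm I3 * S1 = 0" "idm I3 * C = 0" "idm I3 * S3 = S3" "tr C * idm I3 = 0"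
      using m fin dis dis' by (auto intro: mult_disjoint idm_mult)
    then show ?thesis unfolding S_eq by (simp add: distrib_left distrib_right mult.assoc iS)
  qed
  finally show ?thesis using 1 eqU by simp
qed

text \<open>The corner on \<open>J\<close> of a uniformly chosen matrix is uniform in
  \<open>Sym ep J\<close>; the proportion is stated without division.\<close>

lemma card_Sym_corner:
  fixes ep :: "'a::{field,finite}"
  assumes "finite I" "finite J" "I \<inter> J = {}" and ep: "ep * ep = 1"
  shows "card {S \<in> Sym ep (I \<union> J). idm J * S * idm J \<in> GLs J} * card (Sym ep J) = card (Sym ep (I \<union> J)) * card (SN ep J)"
proof -
  note b = bij_betw_Sym_Un[OF assms]
  have J: "J \<inter> I = {}" using assms by auto
  have corner: "idm J * (A + C + ep \<cdot> tr C + B) * idm J = B"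
    if "A \<in> Sym ep I" "C \<in> Mats I J" "B \<in> Sym ep J" for A C B
  proof -
    have "idm J * A = 0" "idm J * C = 0" "tr C * idm J = 0" "idm J * B = B" "B * idm J = B"
      using that SymD(1) assms J by (auto intro: mult_disjoint idm_mult mult_idm)
    then show ?thesis by (simp add: distrib_left distrib_right mult.assoc)
  qed
  have "{S \<in> Sym ep (I \<union> J). idm J * S * idm J \<in> GLs J} =
      (\<lambda>(A, C, B). A + C + ep \<cdot> tr C + B) ` (Sym ep I \<times> Mats I J \<times> SN ep J)" (is "?L = ?f ` _")
  proof
    show "?L \<subseteq> ?f ` (Sym ep I \<times> Mats I J \<times> SN ep J)"
    proof
      fix S assume S: "S \<in> ?L"
      then have "S \<in> Sym ep (I \<union> J)" by simp
      from Sym_UnE[OF this assms] obtain A C B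
        where *: "A \<in> Sym ep I" "C \<in> Mats I J" "B \<in> Sym ep J" "S = A + C + ep \<cdot> tr C + B" .
      then have "B \<in> SN ep J" using S corner[OF *(1-3)] by (simp add: SN_Sym)
      then show "S \<in> ?f ` (Sym ep I \<times> Mats I J \<times> SN ep J)" using * by force
    qed
    show "?f ` (Sym ep I \<times> Mats I J \<times> SN ep J) \<subseteq> ?L"
    proof
      fix S assume "S \<in> ?f ` (Sym ep I \<times> Mats I J \<times> SN ep J)"
      then obtain A C B where *: "A \<in> Sym ep I" "C \<in> Mats I J" "B \<in> SN ep J" "S = A + C + ep \<cdot> tr C + B" by auto
      then have B: "B \<in> Sym ep J" "B \<in> GLs J" by (auto simp: SN_Sym)
      have "?f (A, C, B) \<in> Sym ep (I \<union> J)" using b *(1,2) B(1) unfolding bij_betw_def by blast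
      then show "S \<in> ?L" using corner[OF *(1,2) B(1)] B * by auto
    qed
  qed
  moreover have "inj_on ?f (Sym ep I \<times> Mats I J \<times> SN ep J)"
    by (rule inj_on_subset[OF bij_betw_imp_inj_on[OF b]]) (auto simp: SN_Sym)
  ultimately have "card ?L = card (Sym ep I) * (CARD('a) ^ (card I * card J) * card (SN ep J))"
    using assms by (simp add: card_image card_cartesian_product card_Mats)
  then show ?thesis using card_Sym_Un[OF assms] by simp
qed

text \<open>The right inverse of \<open>tr D\<close> transposes to a left inverse of
  \<open>D\<close>, and the two one-sided inverses agree. Both index sets then have the same size
  because the kernels are trivial.\<close>

lemma Epi_two_sided:
  fixes D :: "'a::{field,finite} fmat"
  assumes "finite I" "finite J" "D \<in> Epi I J" "tr D \<in> Epi J I"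
  obtains E where "E \<in> Mats J I" "D * E = idm I" "E * D = idm J" "card I = card J"
proof -
  obtain X where X: "X \<in> Mats J I" "D * X = idm I" using assms(3) by (rule EpiE)
  obtain Y where Y: "Y \<in> Mats I J" "tr D * Y = idm J" using assms(4) by (rule EpiE)
  have Y': "tr Y * D = idm J" using arg_cong[OF Y(2), of tr] by simp
  have "tr Y = tr Y * (D * X)" using X Y assms(1) by (simp add: mult_idm[of "tr Y" J I])
  also have "... = X" unfolding mult_eq_assoc[OF Y'] using X assms(2) by (simp add: idm_mult)
  finally have E: "X * D = idm J" using Y' by simp
  have "1 < CARD('a)" by (rule one_less_card_field)
  moreover have "kerf J D = {0}" "kerf I (tr D) = {0}"
  proof -
    have "v = 0" if "v \<in> Mats J {0}" "D * v = 0" for v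
      using that assms(2) mult_eq_assoc[OF E, of v] by (simp add: idm_mult)
    then show "kerf J D = {0}" by (auto simp: kerf_def)
    have "tr X * tr D = idm I" using arg_cong[OF X(2), of tr] arg_cong[OF X(2), of tr] X by (simp flip: tr_mult)
    then have "v = 0" if "v \<in> Mats I {0}" "tr D * v = 0" for v
      using that assms(1) mult_eq_assoc[of "tr X" "tr D" "idm I" v] by (simp add: idm_mult)
    then show "kerf I (tr D) = {0}" by (auto simp: kerf_def)
  qed
  ultimately have "card I = card J"
    using card_kerf_Epi[OF assms(3,1,2)] by simp
  then show ?thesis using that X E by blast
qed

text \<open>Given a block row \<open>A + C0\<close> of full rank whose part \<open>A\<close> has
  corank \<open>c\<close>, the proportion of blocks \<open>S\<close> that complete it to an
  invertible matrix is the proportion of invertible matrices in \<open>Sym ep\<close> of size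
  \<open>card I2 - c\<close>. The \<open>c\<close> rows in which \<open>A\<close> can be made zero
  are paired with \<open>c\<close> columns of \<open>C0\<close>; the rest is a Schur
  complement.\<close>

lemma completion:
  fixes ep :: "'a::{field,finite}"
  assumes fin: "finite I1" "finite I2" and dis: "I1 \<inter> I2 = {}" and ep: "ep * ep = 1"
    and A: "A \<in> Sym ep I1" and C0: "C0 \<in> Mats I1 I2" and R: "A + C0 \<in> Epi I1 (I1 \<union> I2)"
    and c: "card (kerf I1 A) = CARD('a) ^ c"
  shows "\<exists>I3\<subseteq>I2. card I3 + c = card I2 &
    card {S \<in> Sym ep I2. A + C0 + ep \<cdot> tr C0 + S \<in> GLs (I1 \<union> I2)} * card (Sym ep I3) = card (Sym ep I2) * card (SN ep I3)"
proof -
  have q1: "1 < CARD('a)" by (rule one_less_card_field)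
  have I: "finite (I1 \<union> I2)" using fin by simp
  have dis2: "I2 \<inter> I1 = {}" using dis by auto
  obtain P J R1 where P: "P \<in> GLs I1" and J: "J \<subseteq> I1" and R1: "R1 \<in> Epi J I1" and APR: "A = P * R1"
    using row_compress[OF fin(1) fin(1) SymD(1)[OF A]] .
  define P' where "P' = finv I1 P"
  note p = finv_props[OF P, folded P'_def] GLs_Mats[OF P]
  have P'G: "P' \<in> GLs I1" unfolding P'_def by (rule finv_GLs[OF P])
  have tP: "tr P * tr P' = idm I1" "tr P' * tr P = idm I1" using p by (simp_all flip: tr_mult)
  define L where "L = I1 - J"
  have finJ: "finite J" "finite L" and JL: "I1 = J \<union> L" "J \<inter> L = {}" "L \<inter> J = {}"
    using J fin finite_subset by (auto simp: L_def)
  have P'A: "P' * A = R1" unfolding APR using finv_cancel(2)[OF P fin(1) Mats_mono[OF Epi_Mats[OF R1] J subset_refl]] by (simp add: P'_def)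
  \<comment> \<open>After a congruence by \<open>P'\<close> the form lives on \<open>J\<close>
    alone: its rows do, and it is symmetric up to sign.\<close>
  define A' where "A' = R1 * tr P'"
  have A'eq: "A' = P' * A * tr P'" by (simp add: A'_def P'A)
  have "A' \<in> Mats J I1" unfolding A'_def using p Epi_Mats[OF R1] by auto
  moreover have tA': "tr A' = ep \<cdot> A'" unfolding A'eq using SymD(2)[OF A] by (simp add: mult.assoc)
  ultimately have A'J: "A' \<in> Mats J J"
  proof -
    have "tr A' \<in> Mats J I1" unfolding tA' using \<open>A' \<in> Mats J I1\<close> by auto
    then have "A' \<in> Mats I1 J" by simp
    with \<open>A' \<in> Mats J I1\<close> show ?thesis by (auto simp: Mats_def)
  qed
  have A'G: "A' \<in> GLs J"
  proof -
    obtain S1 where S1: "S1 \<in> Mats I1 J" "R1 * S1 = idm J" using R1 by (rule EpiE)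
    have "A' * (idm J * (tr P * S1)) = R1 * (tr P' * (tr P * S1))"
      using mult_idm[OF A'J finJ(1)] by (simp add: mult.assoc[symmetric] A'_def)
    also have "... = idm J" using S1 fin by (simp add: mult_eq_assoc[OF tP(2)] idm_mult del: tr_mult)
    finally show ?thesis using p S1 finJ by (intro GLsI_right[OF finJ(1) A'J]) (auto intro!: idm_mult_Mats Mats_mult[of "tr P" I1 I1 S1 I1 J])
  qed
  have cL: "card L = c"
  proof -
    have "kerf I1 A = kerf I1 R1"
      unfolding APR by (rule kerf_GLs_mult[OF P fin(1) Mats_mono[OF Epi_Mats[OF R1] J subset_refl]])
    then have "CARD('a) ^ (c + card J) = CARD('a) ^ card I1"
      using card_kerf_Epi[OF R1 finJ(1) fin(1)] c by (simp add: power_add)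
    then have "c + card J = card I1" using q1 by simp
    then show ?thesis using J finJ by (simp add: L_def card_Diff_subset)
  qed
  define C where "C = idm J * (P' * C0)"
  define D where "D = idm L * (P' * C0)"
  have PC: "P' * C0 \<in> Mats I1 I2" using p C0 by auto
  have CD: "P' * C0 = C + D" unfolding C_def D_def using Mats_split_rows[of "P' * C0" J L I2] PC JL finJ by simp
  have Cm: "C \<in> Mats J I2" "D \<in> Mats L I2" unfolding C_def D_def using PC finJ by (auto intro: idm_mult_Mats)
  \<comment> \<open>The rows of the reduced \<open>A\<close> in \<open>L\<close> are zero, so the
    full rank of \<open>A + C0\<close> forces the rows of \<open>C0\<close> in \<open>L\<close> to
    be independent.\<close>
  have D: "D \<in> Epi L I2"
  proof -
    obtain T where T: "T \<in> Mats (I1 \<union> I2) I1" "(A + C0) * T = idm I1" using R by (rule EpiE)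
    have z: "idm L * R1 = 0" using Epi_Mats[OF R1] JL by (auto intro: mult_disjoint)
    have D': "D = idm L * (P' * (A + C0))" by (simp add: distrib_left P'A D_def z)
    have "D * (idm I2 * (T * (P * idm L))) = D * (T * (P * idm L))"
      using mult_idm[OF Cm(2) fin(2)] by (simp add: mult.assoc[symmetric])
    also have "... = idm L * (P' * (P * idm L))"
      unfolding D' using idm_mult[OF p(4) fin(1)] by (simp add: mult.assoc mult_eq_assoc[OF T(2)] mult_eq_assoc[of "idm I1" P P])
    also have "... = idm L"
    proof -
      have "idm L \<in> Mats I1 L" using JL(1) by (intro Mats_idm) auto
      then have "P' * (P * idm L) = idm L" using finv_cancel(2)[OF P fin(1)] by (simp add: P'_def)
      then show ?thesis using finJ by (simp add: idm_mult_idm)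
    qed
    finally show ?thesis
      by (rule EpiI[OF Cm(2), rotated]) (use T p fin finJ in \<open>auto intro: idm_mult_Mats\<close>)
  qed
  obtain H L' K where H: "H \<in> GLs I2" and L': "L' \<subseteq> I2" and K: "K \<in> Epi L' L" and tD: "tr D = H * K"
    using row_compress[OF fin(2) finJ(2), of "tr D"] Cm by auto
  have finL': "finite L'" using L' fin finite_subset by blast
  have DK: "D = tr K * tr H" using arg_cong[OF tD, of tr] by simp
  define I3 where "I3 = I2 - L'"
  have I3: "finite I3" "I2 = L' \<union> I3" "L' \<inter> I3 = {}" "I3 \<inter> L' = {}" using L' fin by (auto simp: I3_def)
  have "tr K \<in> Epi L L'"
  proof -
    obtain T where T: "T \<in> Mats I2 L" "D * T = idm L" using D by (rule EpiE)
    have "tr K * (idm L' * (tr H * T)) = tr K * idm L' * (tr H * T)" by (simp only: mult.assoc)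
    also have "... = D * T" using mult_idm[of "tr K" L L' L'] Epi_Mats[OF K] finL' by (simp add: DK mult.assoc)
    finally have "tr K * (idm L' * (tr H * T)) = idm L" by (simp add: T(2))
    then show ?thesis
      using Epi_Mats[OF K] T GLs_Mats[OF H] finL' by (intro EpiI[of "tr K" L L' "idm L' * (tr H * T)"]) (auto intro!: idm_mult_Mats)
  qed
  then obtain E where E: "E \<in> Mats L' L" "tr K * E = idm L" "E * tr K = idm L'" and cLL: "card L = card L'"
    using Epi_two_sided[of L L' "tr K"] K finJ finL' by auto
  define H' where "H' = finv I2 H"
  have H'G: "H' \<in> GLs I2" unfolding H'_def by (rule finv_GLs[OF H])
  note h = finv_props[OF H, folded H'_def] GLs_Mats[OF H]
  have DH: "D * tr H' = tr K"
  proof -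
    have tH: "tr H * tr H' = idm I2" using h by (simp flip: tr_mult)
    show ?thesis unfolding DK using mult_idm[of "tr K" L L' I2] Epi_Mats[OF K] L' fin by (simp add: mult.assoc tH del: tr_mult)
  qed
  let ?I = "I1 \<union> I2"
  define Ai where "Ai = finv J A'"
  note ai = finv_props[OF A'G, folded Ai_def]
  have tAi: "tr Ai = ep \<cdot> Ai"
  proof -
    have "tr A' * tr Ai = idm J" using ai by (simp flip: tr_mult)
    then have "A' * (ep \<cdot> tr Ai) = idm J" using tA' by simp
    then have "ep \<cdot> tr Ai = Ai" unfolding Ai_def using ai(1) by (intro finv_unique[OF A'G finJ(1)]) (auto simp: Ai_def)
    then have "ep \<cdot> ep \<cdot> tr Ai = ep \<cdot> Ai" by simp
    then show ?thesis using ep by simp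
  qed
  \<comment> \<open>The Schur complement term that arises when \<open>A'\<close> is used to clear
    \<open>C\<close>.\<close>
  define S0 where "S0 = ep \<cdot> (tr C * Ai * C)"
  have S0: "S0 \<in> Sym ep I2"
    unfolding S0_def using Cm ai by (intro SymI) (auto simp: tAi mult.assoc intro!: Mats_smult)
  have key: "A + C0 + ep \<cdot> tr C0 + S \<in> GLs ?I \<longleftrightarrow> idm I3 * (H' * (S - S0) * tr H') * idm I3 \<in> GLs I3"
    if S: "S \<in> Sym ep I2" for S
  proof -
    let ?M = "A + C0 + ep \<cdot> tr C0 + S"
    note s = SymD(1)[OF S] SymD(1)[OF A] C0
    have SS: "S - S0 \<in> Mats I2 I2" using s SymD(1)[OF S0] by auto
    have upI: "S \<in> Mats ?I ?I" "S0 \<in> Mats ?I ?I" "A \<in> Mats ?I ?I" "C0 \<in> Mats ?I ?I" "tr C0 \<in> Mats ?I ?I" "A' \<in> Mats ?I ?I" "P' * C0 \<in> Mats ?I ?I"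
        "tr (P' * C0) \<in> Mats ?I ?I" "C \<in> Mats ?I ?I" "D \<in> Mats ?I ?I" "tr D \<in> Mats ?I ?I" "S - S0 \<in> Mats ?I ?I"
      unfolding Mats_tr
      by (rule Mats_mono[OF s(1)] Mats_mono[OF SymD(1)[OF S0]] Mats_mono[OF s(2)] Mats_mono[OF C0] Mats_mono[OF A'J] Mats_mono[OF PC]
          Mats_mono[OF Cm(1)] Mats_mono[OF Cm(2)] Mats_mono[OF SS]; use J JL in blast)+
    have M: "?M \<in> Mats ?I ?I"
      by (intro Mats_add Mats_diff Mats_smult upI)
    have G1: "P' + idm I2 \<in> GLs ?I" using GLs_add_block(1)[OF fin dis P'G idm_GLs[OF fin(2)], of 0] by simp
    have z1: "P' * tr C0 = 0" "P' * S = 0" "idm I2 * A = 0" "idm I2 * C0 = 0" "S * tr P' = 0" "C0 * tr P' = 0"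
        "A * idm I2 = 0" "tr C0 * idm I2 = 0"
      using s p dis dis2 by (auto intro!: mult_disjoint)
    have i1: "idm I2 * S = S" "S * idm I2 = S" "C0 * idm I2 = C0" "idm I2 * tr C0 = tr C0"
      using s fin by (auto intro: idm_mult mult_idm)
    let ?M1 = "A' + P' * C0 + ep \<cdot> tr (P' * C0) + S"
    have "(P' + idm I2) * ?M * tr (P' + idm I2) = ?M1"
      by (simp add: distrib_left distrib_right mult.assoc z1 z1[THEN mult_eq_assoc] i1 A'eq)
    then have 1: "?M \<in> GLs ?I \<longleftrightarrow> ?M1 \<in> GLs ?I" using GLs_congruence_iff[OF I G1 M] by simp
    have M1: "?M1 \<in> Mats ?I ?I"
      by (intro Mats_add Mats_diff Mats_smult upI)
    \<comment> \<open>The elimination of \<open>C\<close>. The matrix \<open>idm ?I - ?U\<close> is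
      unipotent because \<open>?U\<close> maps \<open>J\<close> to \<open>I2\<close> and so squares
      to zero.\<close>
    let ?U = "ep \<cdot> (tr C * Ai)"
    have U: "?U \<in> Mats I2 J" by (intro Mats_smult Mats_mult[of "tr C" I2 J Ai J J]) (use Cm ai in simp_all)
    have G2: "idm ?I - ?U \<in> GLs ?I"
    proof (rule GLsI[of _ _ "idm ?I + ?U"])
      have UU: "?U * ?U = 0" using U J dis by (intro mult_disjoint[OF U U]) auto
      have "idm ?I * ?U = ?U" "?U * idm ?I = ?U" using J I by (blast intro: idm_mult[OF U] mult_idm[OF U])+
      then show "(idm ?I - ?U) * (idm ?I + ?U) = idm ?I" "(idm ?I + ?U) * (idm ?I - ?U) = idm ?I"
        using UU I by (simp_all add: left_diff_distrib right_diff_distrib distrib_left distrib_right idm_mult_idm)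
      show "idm ?I - ?U \<in> Mats ?I ?I" "idm ?I + ?U \<in> Mats ?I ?I"
        using J by (auto intro!: Mats_mono[OF U] Mats_diff Mats_add)
    qed
    let ?M2 = "A' + D + ep \<cdot> tr D + (S - S0)"
    have trU: "tr ?U = Ai * C" using ep by (simp add: tAi)
    have "(idm ?I - ?U) * ?M1 * tr (idm ?I - ?U) = ?M2"
    proof -
      have zU: "?U * D = 0" "?U * tr C = 0" "?U * tr D = 0" "?U * S = 0" "D * tr ?U = 0" "C * tr ?U = 0" "S * tr ?U = 0" "tr D * tr ?U = 0"
        using mult_disjoint[OF U Cm(2)] mult_disjoint[OF U, of "tr C" I2 J] mult_disjoint[OF U, of "tr D" I2 L] mult_disjoint[OF U s(1)]
          mult_disjoint[OF Cm(2), of "tr ?U" J I2] mult_disjoint[OF Cm(1), of "tr ?U" J I2] mult_disjoint[OF s(1), of "tr ?U" J I2]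
          mult_disjoint[of "tr D" I2 L "tr ?U" J I2] U Cm J dis dis2 JL
        by (auto simp del: tr_smult tr_mult)
      have UA: "?U * A' = ep \<cdot> tr C" using Cm finJ ai mult_idm[of "tr C" I2 J J] by (simp add: mult.assoc)
      have UC: "?U * C = S0" by (simp add: S0_def)
      have M1e: "?M1 = A' + C + D + ep \<cdot> tr C + ep \<cdot> tr D + S" unfolding CD by (simp add: algebra_simps)
      have id1: "idm ?I * ?M1 = ?M1" using M1 I by (intro idm_mult) auto
      have left: "(idm ?I - ?U) * ?M1 = A' + C + D + ep \<cdot> tr D + S - S0"
        unfolding left_diff_distrib id1 unfolding M1e using zU UA UC by (simp add: distrib_left)
      have "A' + C + D + ep \<cdot> tr D + S - S0 \<in> Mats ?I ?I"
        by (intro Mats_add Mats_diff Mats_smult upI)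
      then have id2: "(A' + C + D + ep \<cdot> tr D + S - S0) * idm ?I = A' + C + D + ep \<cdot> tr D + S - S0"
        using I by (intro mult_idm) auto
      have "S0 * tr ?U = 0" using mult_disjoint[OF SymD(1)[OF S0], of "tr ?U" J I2] U J dis2 by (auto simp del: tr_smult tr_mult)
      moreover have "A' * tr ?U = C" unfolding trU using ai Cm finJ by (simp add: mult.assoc[symmetric] idm_mult)
      ultimately show ?thesis
        unfolding left tr_diff tr_idm right_diff_distrib id2 using zU by (simp add: distrib_right left_diff_distrib)
    qed
    then have 2: "?M1 \<in> GLs ?I \<longleftrightarrow> ?M2 \<in> GLs ?I" using GLs_congruence_iff[OF I G2 M1] by simp
    have M2: "?M2 \<in> Mats ?I ?I"
      by (intro Mats_add Mats_diff Mats_smult upI)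
    \<comment> \<open>\<open>H'\<close> normalizes the columns of \<open>D\<close>: it becomes
      \<open>tr K\<close>, supported on \<open>L\<close> and \<open>L'\<close>. This is the
      situation of \<open>completion_core\<close>.\<close>
    have G3: "idm I1 + H' \<in> GLs ?I" using GLs_add_block(1)[OF fin dis idm_GLs[OF fin(1)] H'G, of 0] by simp
    let ?S = "H' * (S - S0) * tr H'"
    have "(idm I1 + H') * ?M2 * tr (idm I1 + H') = A' + tr K + ep \<cdot> tr (tr K) + ?S"
    proof -
      have dJ: "I2 \<inter> J = {}" "J \<inter> I2 = {}" "I2 \<inter> L = {}" "L \<inter> I2 = {}" using J JL dis by auto
      have tm: "tr D \<in> Mats I2 L" "tr H' \<in> Mats I2 I2" using Cm h by auto
      note md = mult_disjoint
      have z3: "idm I1 * tr D = 0" "idm I1 * (S - S0) = 0" "H' * A' = 0" "H' * D = 0"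
          "A' * tr H' = 0" "D * idm I1 = 0" "(S - S0) * idm I1 = 0" "tr D * tr H' = 0"
        using md[OF idm_Mats tm(1) dis] md[OF idm_Mats SS dis] md[OF h(1) A'J dJ(1)] md[OF h(1) Cm(2) dJ(3)]
          md[OF A'J tm(2) dJ(2)] md[OF Cm(2) idm_Mats dis2] md[OF SS idm_Mats dis2] md[OF tm dJ(4)] by simp_all
      have i3: "idm I1 * A' = A'" "A' * idm I1 = A'" "idm I1 * D = D" "tr D * idm I1 = tr D"
        using A'J Cm J JL fin by (auto intro!: idm_mult[OF A'J] mult_idm[OF A'J] idm_mult[OF Cm(2)] mult_idm[of "tr D" I2 L])
      have tDH: "H' * tr D = K" using arg_cong[OF DH, of tr] by simp
      have Ki: "K * idm I1 = K" "K * tr H' = 0"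
        using Epi_Mats[OF K] h JL dis fin by (auto intro!: mult_idm[of K L' L] mult_disjoint[of K L' L "tr H'" I2 I2])
      show ?thesis
        using z3 z3[THEN mult_eq_assoc] i3 DH tDH Ki
        by (simp add: distrib_left distrib_right mult.assoc del: right_diff_distrib left_diff_distrib)
    qed
    then have 3: "?M2 \<in> GLs ?I \<longleftrightarrow> A' + tr K + ep \<cdot> tr (tr K) + ?S \<in> GLs ?I" using GLs_congruence_iff[OF I G3 M2] by simp
    have "?S \<in> Sym ep (L' \<union> I3)"
      using bij_betwE[OF bij_betw_Sym_affine[OF fin(2) H'G S0]] S I3(2) by auto
    moreover have "J \<inter> L' = {}" "J \<inter> I3 = {}" "L \<inter> L' = {}" "L \<inter> I3 = {}" using dis JL I3 by auto
    moreover have "?I = J \<union> (L \<union> (L' \<union> I3))" using JL I3 by auto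
    ultimately have 4: "A' + tr K + ep \<cdot> tr (tr K) + ?S \<in> GLs ?I \<longleftrightarrow> idm I3 * ?S * idm I3 \<in> GLs I3"
      using completion_core[OF finJ finL' I3(1) JL(2) _ _ _ _ I3(3) A'G _ E(1,2,3) _ ep, of ?S] Epi_Mats[OF K] by simp
    show ?thesis using 1 2 3 4 by simp
  qed
  have "bij_betw (\<lambda>S. H' * (S - S0) * tr H')
     {S \<in> Sym ep I2. A + C0 + ep \<cdot> tr C0 + S \<in> GLs ?I} {S \<in> Sym ep I2. idm I3 * S * idm I3 \<in> GLs I3}"
    (is "bij_betw ?f ?X ?Y")
  proof -
    note b = bij_betw_Sym_affine[OF fin(2) H'G S0]
    have "?f ` ?X = ?Y"
    proof
      show "?f ` ?X \<subseteq> ?Y" using key bij_betwE[OF b] by auto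
      show "?Y \<subseteq> ?f ` ?X"
      proof
        fix T assume T: "T \<in> ?Y"
        then obtain S where "S \<in> Sym ep I2" "T = ?f S" using b by (auto simp: bij_betw_def image_iff)
        then show "T \<in> ?f ` ?X" using T key by auto
      qed
    qed
    moreover have "inj_on ?f ?X" by (rule inj_on_subset[OF bij_betw_imp_inj_on[OF b]]) auto
    ultimately show ?thesis by (simp add: bij_betw_def)
  qed
  then have "card {S \<in> Sym ep I2. A + C0 + ep \<cdot> tr C0 + S \<in> GLs ?I} = card {S \<in> Sym ep I2. idm I3 * S * idm I3 \<in> GLs I3}"
    by (rule bij_betw_same_card)
  then have "card {S \<in> Sym ep I2. A + C0 + ep \<cdot> tr C0 + S \<in> GLs ?I} * card (Sym ep I3) = card (Sym ep I2) * card (SN ep I3)"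
    using card_Sym_corner[OF finL' I3(1,3) ep] I3(2) by simp
  moreover have "card I3 + c = card I2"
    using cL cLL L' finL' fin(2) card_mono[OF fin(2) L'] by (simp add: I3_def card_Diff_subset)
  ultimately show ?thesis using I3(2) by blast
qed

section \<open>Closed formula for the number of nondegenerate forms\<close>

definition podd :: "real => nat => real" where
  "podd q k = (\<Prod>i<k. 1 - 1 / q ^ (2 * i + 1))"

text \<open>The value claimed for the number of invertible matrices in \<open>Sym ep\<close> of size
  \<open>n\<close>. The last case reflects that there are no nondegenerate alternating forms in odd
  dimension.\<close>

definition snf :: "'a::{field,finite} => nat => real" where
  "snf ep n = real CARD('a) ^ sexp ep n *
     (if ep = 1 then podd (real CARD('a)) (Suc n div 2)
      else if even n then podd (real CARD('a)) (n div 2) else 0)"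

lemma podd_Suc: "podd q (Suc k) = podd q k * (1 - 1 / q ^ (2 * k + 1))" by (simp add: podd_def)
lemma podd_0 [simp]: "podd q 0 = 1" by (simp add: podd_def)

text \<open>The true numbers satisfy the same recursion by \<open>real_card_SN_step\<close>. The two
  summands correspond to a nonzero and a zero first diagonal entry.\<close>

lemma snf_recursion:
  fixes ep :: "'a::{field,finite}"
  defines "q \<equiv> real CARD('a)"
  shows "snf ep (Suc (Suc m)) = (if ep = 1 then (q - 1) * q ^ Suc m * snf ep (Suc m) else 0)
    + (q ^ Suc m - 1) * q ^ (m + (if ep = 1 then 1 else 0)) * snf ep m"
proof -
  have q0: "q > 0" unfolding q_def using one_less_card_field[where 'a = 'a] by simp
  define Q where "Q = q ^ m"
  define E where "E = q ^ sexp ep m"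
  have Q0: "Q > 0" using q0 by (simp add: Q_def)
  have QS: "q ^ Suc m = q * Q" "q ^ (m + 2) = q * q * Q" "q ^ (m + 1) = q * Q" by (simp_all add: Q_def)
  show ?thesis
  proof (cases "ep = 1")
    case True
    have E1: "q ^ sexp ep (Suc m) = E * Q * q" "q ^ sexp ep (Suc (Suc m)) = E * Q * Q * q * q * q"
      using True by (simp_all add: sexp_Suc power_add E_def Q_def)
    show ?thesis
    proof (cases "even m")
      case ev: True
      then obtain k where k: "m = 2 * k" by blast
      have d: "Suc (Suc (Suc m)) div 2 = Suc k" "Suc (Suc m) div 2 = Suc k" "Suc m div 2 = k" "2 * k + 1 = m + 1" using k by auto
      define P where "P = podd q k"
      have "snf ep (Suc (Suc m)) = E * Q * Q * q * q * q * (P * (1 - 1 / (q * Q)))" "snf ep (Suc m) = E * Q * q * (P * (1 - 1 / (q * Q)))" "snf ep m = E * P"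
        unfolding snf_def q_def[symmetric] d podd_Suc E1 P_def QS using True by (simp_all add: E_def)
      then show ?thesis unfolding QS using True q0 Q0 by (simp add: Q_def[symmetric]) (simp add: field_simps)
    next
      case False
      then obtain k where k: "m = 2 * k + 1" using oddE by blast
      have d: "Suc (Suc (Suc m)) div 2 = Suc (Suc k)" "Suc (Suc m) div 2 = Suc k" "Suc m div 2 = Suc k" using k by auto
      have m2: "2 * Suc k + 1 = m + 2" using k by simp
      define P where "P = podd q (Suc k)"
      have "snf ep (Suc (Suc m)) = E * Q * Q * q * q * q * (P * (1 - 1 / (q * q * Q)))"
        unfolding snf_def q_def[symmetric] d podd_Suc[of q "Suc k"] m2 E1 P_def QS using True by simp
      moreover have "snf ep (Suc m) = E * Q * q * P" "snf ep m = E * P"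
        unfolding snf_def q_def[symmetric] d E1 P_def using True by (simp_all add: E_def)
      ultimately show ?thesis unfolding QS using True q0 Q0 by (simp add: Q_def[symmetric]) (simp add: field_simps)
    qed
  next
    case False
    have E1: "q ^ sexp ep (Suc (Suc m)) = E * Q * Q * q"
      using False by (simp add: sexp_Suc power_add E_def Q_def)
    show ?thesis
    proof (cases "even m")
      case ev: True
      then obtain k where k: "m = 2 * k" by blast
      have d: "Suc (Suc m) div 2 = Suc k" "m div 2 = k" "2 * k + 1 = m + 1" using k by auto
      define P where "P = podd q k"
      have "snf ep (Suc (Suc m)) = E * Q * Q * q * (P * (1 - 1 / (q * Q)))" "snf ep m = E * P"
        unfolding snf_def q_def[symmetric] d podd_Suc E1 P_def QS using False ev by (simp_all add: E_def)
      then show ?thesis unfolding QS using False q0 Q0 by (simp add: Q_def[symmetric]) (simp add: field_simps)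
    qed (use False in \<open>simp add: snf_def\<close>)
  qed
qed

lemma Epi_row: "finite J ==> \<rho> \<in> Mats {i} J ==> \<rho> ~= 0 ==> (\<rho> :: 'a::field fmat) \<in> Epi {i} J"
proof -
  assume J: "finite J" and \<rho>: "\<rho> \<in> Mats {i} J" "\<rho> ~= 0"
  have e: "idm {} = (0 :: 'a fmat)" by (rule fmat_eqI) (simp add: ent_idm)
  show ?thesis using Epi_insert_iff[of "{}" J i 0 0 \<rho>] J \<rho> e by simp
qed

text \<open>The index \<open>i\<close> is split off. A nonzero diagonal entry \<open>A\<close> has
  corank 0 in \<open>completion\<close>. For \<open>A = 0\<close> the corank is 1, and the rest
  \<open>C\<close> of the row must be nonzero. In the alternating case only \<open>A = 0\<close>
  occurs.\<close>

lemma real_card_SN_step: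
  fixes ep :: "'a::{field,finite}"
  defines "q \<equiv> real CARD('a)"
  assumes two: "(2 :: 'a) ~= 0" and eps: "ep = 1 \<or> ep = -1" and I: "finite I" "i \<notin> I"
    and IH: "\<And>I'. I' \<subseteq> I ==> real (card (SN ep I')) = snf ep (card I')"
  shows "real (card (SN ep (insert i I))) = (if ep = 1 then (q - 1) * q ^ card I * snf ep (card I) else 0)
    + (q ^ card I - 1) * q ^ (card I - 1 + (if ep = 1 then 1 else 0)) * snf ep (card I - 1)"
proof -
  have q1: "q > 1" unfolding q_def using one_less_card_field[where 'a = 'a] by simp
  have ep: "ep * ep = 1" using eps by auto
  have dis: "{i} \<inter> I = {}" using I by auto
  let ?g = "\<lambda>A C. {B \<in> Sym ep I. A + C + ep \<cdot> tr C + B \<in> GLs ({i} \<union> I)}"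
  let ?f = "\<lambda>(A, C, B). A + C + ep \<cdot> tr C + B"
  let ?D = "Sigma (Sym ep {i}) (\<lambda>A. Sigma (Mats {i} I) (?g A))"
  note b = bij_betw_Sym_Un[OF _ I(1) dis ep, simplified]
  have "bij_betw ?f ?D (SN ep ({i} \<union> I))"
  proof -
    have "?f ` ?D = SN ep ({i} \<union> I)"
    proof
      show "?f ` ?D \<subseteq> SN ep ({i} \<union> I)"
      proof
        fix M assume "M \<in> ?f ` ?D"
        then obtain A C B where *: "A \<in> Sym ep {i}" "C \<in> Mats {i} I" "B \<in> Sym ep I" "M = ?f (A, C, B)" "M \<in> GLs ({i} \<union> I)"
          by auto
        then have "M \<in> Sym ep ({i} \<union> I)" using bij_betwE[OF b, rule_format, of "(A, C, B)"] by auto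
        then show "M \<in> SN ep ({i} \<union> I)" using * by (simp add: SN_Sym)
      qed
      show "SN ep ({i} \<union> I) \<subseteq> ?f ` ?D"
      proof
        fix M assume M: "M \<in> SN ep ({i} \<union> I)"
        then have "M \<in> Sym ep ({i} \<union> I)" by (simp add: SN_Sym)
        from Sym_UnE[OF this _ I(1) dis ep] obtain A C B
          where "A \<in> Sym ep {i}" "C \<in> Mats {i} I" "B \<in> Sym ep I" "M = A + C + ep \<cdot> tr C + B" by auto
        then show "M \<in> ?f ` ?D" using SND(1)[OF M] by (intro image_eqI[of _ _ "(A, C, B)"]) auto
      qed
    qed
    moreover have "inj_on ?f ?D" by (rule inj_on_subset[OF bij_betw_imp_inj_on[OF b]]) auto
    ultimately show ?thesis by (simp add: bij_betw_def)
  qed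
  then have "card (SN ep ({i} \<union> I)) = card ?D" by (simp add: bij_betw_same_card)
  also have "... = (\<Sum>A\<in>Sym ep {i}. \<Sum>C\<in>Mats {i} I. card (?g A C))"
    using I by (subst card_SigmaI; simp)+
  finally have "real (card (SN ep ({i} \<union> I))) = (\<Sum>A\<in>Sym ep {i}. \<Sum>C\<in>Mats {i} I. real (card (?g A C)))" by simp
  also have "... = (\<Sum>A\<in>Sym ep {i}. if A = 0 then (q ^ card I - 1) * q ^ (card I - 1 + (if ep = 1 then 1 else 0)) * snf ep (card I - 1)
      else q ^ card I * snf ep (card I))"
  proof (rule sum.cong[OF refl])
    fix A assume A: "A \<in> Sym ep {i}"
    note Am = SymD(1)[OF A]
    have Epi: "A + C \<in> Epi {i} ({i} \<union> I)" if "C \<in> Mats {i} I" "A ~= 0 \<or> C ~= 0" for C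
    proof -
      have m: "A + C \<in> Mats {i} ({i} \<union> I)" using Mats_mono[OF Am, of "{i}" "{i} \<union> I"] Mats_mono[OF that(1), of "{i}" "{i} \<union> I"] by auto
      have ne: "A + C ~= 0"
      proof
        assume z: "A + C = 0"
        have dis': "I \<inter> {i} = {}" using dis by auto
        have "A * idm I = 0" "C * idm {i} = 0" "A * idm {i} = A" "C * idm I = C"
          using mult_disjoint[OF Am idm_Mats dis] mult_disjoint[OF that(1) idm_Mats dis']
            mult_idm[OF Am, of "{i}"] mult_idm[OF that(1) I(1)] by simp_all
        then have "(A + C) * idm I = C" "(A + C) * idm {i} = A" by (simp_all add: distrib_right)
        then have "C = 0" "A = 0" unfolding z by simp_all
        then show False using that(2) by simp
      qed
      show ?thesis by (rule Epi_row[OF _ m ne]) (use I in simp)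
    qed
    show "(\<Sum>C\<in>Mats {i} I. real (card (?g A C))) = (if A = 0 then (q ^ card I - 1) * q ^ (card I - 1 + (if ep = 1 then 1 else 0)) * snf ep (card I - 1)
      else q ^ card I * snf ep (card I))"
    proof (cases "A = 0")
      case False
      have "kerf {i} A = {0}"
      proof -
        obtain T where T: "T \<in> Mats {i} {i}" "A * T = idm {i}" using Epi_row[OF _ Am False] by (auto elim: EpiE)
        have "T * A = idm {i}" using left_inverse_right_inverse[OF _ Am T] by simp
        have "v = 0" if "v \<in> Mats {i} {0}" "A * v = 0" for v
          using idm_mult[OF that(1), of "{i}"] mult_eq_assoc[OF \<open>T * A = idm {i}\<close>, of v] that(2) by simp
        then show ?thesis by (auto simp: kerf_def)
      qed
      then have k: "card (kerf {i} A) = CARD('a) ^ 0" by simp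
      have "real (card (?g A C)) = snf ep (card I)" if C: "C \<in> Mats {i} I" for C
      proof -
        obtain I3 where I3: "I3 \<subseteq> I" "card I3 + 0 = card I" "card (?g A C) * card (Sym ep I3) = card (Sym ep I) * card (SN ep I3)"
          using completion[OF _ I(1) dis ep A C Epi[OF C disjI1[OF False]] k] by blast
        then have "I3 = I" using card_subset_eq[OF I(1) I3(1)] by simp
        then show ?thesis using I3(3) IH[of I] card_Sym[OF two eps I(1)] by simp
      qed
      then show ?thesis using False I by (simp add: card_Mats q_def)
    next
      case True
      have k: "card (kerf {i} A) = CARD('a) ^ 1" using True card_Mats[of "{i}" "{0}", where 'a = 'a] by (simp add: kerf_def)
      \<comment> \<open>With \<open>A = 0\<close> and \<open>C = 0\<close> the row \<open>i\<close>
        vanishes, and no completion is invertible.\<close>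
      have c0: "real (card (?g A 0)) = 0"
      proof -
        have g0: "?g A 0 = {}"
        proof -
          have False if B: "B \<in> Sym ep I" "B \<in> GLs (insert i I)" for B
          proof -
            have "idm {i} * B = 0" using mult_disjoint[OF idm_Mats SymD(1)[OF B(1)] dis] .
            then have "idm {i} * (B * finv (insert i I) B) = 0" by (simp add: mult.assoc[symmetric])
            then have "idm {i} = (0 :: 'a fmat)" using finv_props[OF B(2)] I by (simp add: idm_mult_idm)
            then have "ent (idm {i} :: 'a fmat) i i = 0" by simp
            then show False by (simp add: ent_idm)
          qed
          then show ?thesis using True by auto
        qed
        show ?thesis unfolding g0 by simp
      qed
      have cC: "real (card (?g A C)) = q ^ (card I - 1 + (if ep = 1 then 1 else 0)) * snf ep (card I - 1)"
        if C: "C \<in> Mats {i} I" "C ~= 0" for C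
      proof -
        obtain I3 where I3: "I3 \<subseteq> I" "card I3 + 1 = card I" "card (?g A C) * card (Sym ep I3) = card (Sym ep I) * card (SN ep I3)"
          using completion[OF _ I(1) dis ep A C(1) Epi[OF C(1) disjI2[OF C(2)]] k] by blast
        have fin3: "finite I3" using I3(1) I(1) finite_subset by blast
        have cI: "card I = Suc (card I3)" using I3(2) by simp
        have "real (card (?g A C)) * q ^ sexp ep (card I3) = q ^ sexp ep (card I) * snf ep (card I3)"
          using arg_cong[OF I3(3), of real] IH[OF I3(1)] card_Sym[OF two eps I(1)] card_Sym[OF two eps fin3]
          by (simp add: q_def)
        then show ?thesis using q1 unfolding cI by (simp add: sexp_Suc power_add)
      qed
      have "(\<Sum>C\<in>Mats {i} I. real (card (?g A C))) = (\<Sum>C\<in>Mats {i} I - {0}. real (card (?g A C)))"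
        using c0 I by (intro sum.mono_neutral_right) auto
      also have "... = (\<Sum>C\<in>(Mats {i} I - {0} :: 'a fmat set). q ^ (card I - 1 + (if ep = 1 then 1 else 0)) * snf ep (card I - 1))"
        by (rule sum.cong[OF refl]) (use cC in auto)
      also have "... = (q ^ card I - 1) * (q ^ (card I - 1 + (if ep = 1 then 1 else 0)) * snf ep (card I - 1))"
        using I q1 by (simp add: card_Diff_singleton card_Mats q_def of_nat_diff)
      finally show ?thesis using True by simp
    qed
  qed
  also have "... = (\<Sum>A\<in>Sym ep {i} - {0}. q ^ card I * snf ep (card I))
      + (q ^ card I - 1) * q ^ (card I - 1 + (if ep = 1 then 1 else 0)) * snf ep (card I - 1)"
  proof -
    have "0 \<in> Sym ep {i}" by (auto intro: SymI)
    then show ?thesis by (subst sum.remove[of _ 0]) (auto intro!: sum.cong simp: add.commute)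
  qed
  also have "(\<Sum>A\<in>Sym ep {i} - {0}. q ^ card I * snf ep (card I)) = (if ep = 1 then (q - 1) * q ^ card I * snf ep (card I) else 0)"
  proof -
    have z: "0 \<in> Sym ep {i}" by (auto intro: SymI)
    have "real (card (Sym ep {i} - {0})) = (if ep = 1 then q - 1 else 0)"
      using card_Sym_singleton[OF two eps, of i] z q1 by (simp add: card_Diff_singleton q_def of_nat_diff)
    then show ?thesis by simp
  qed
  finally show ?thesis by simp
qed

theorem real_card_SN:
  fixes ep :: "'a::{field,finite}"
  assumes two: "(2 :: 'a) ~= 0" and eps: "ep = 1 \<or> ep = -1" and I: "finite I"
  shows "real (card (SN ep I)) = snf ep (card I)"
  using I
proof (induction "card I" arbitrary: I rule: less_induct)
  case less
  show ?case
  proof (cases "I = {}")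
    case True
    have e: "idm {} = (0 :: 'a fmat)" by (rule fmat_eqI) (simp add: ent_idm)
    have "(0 :: 'a fmat) \<in> GLs {}" by (rule GLsI[of 0 "{}" 0]) (simp_all add: e)
    then have "SN ep {} = {0}" using Sym_empty[of ep] by (simp add: SN_Sym)
    then show ?thesis using True by (simp add: snf_def)
  next
    case False
    then obtain i where "i \<in> I" by blast
    define I' where "I' = I - {i}"
    have I': "I = insert i I'" "i \<notin> I'" using \<open>i \<in> I\<close> by (auto simp: I'_def)
    have f: "finite I'" using less.prems I' by simp
    have "real (card (SN ep J)) = snf ep (card J)" if "J \<subseteq> I'" for J
    proof (rule less.hyps)
      show "card J < card I" using I' f card_mono[OF f that] by simp
      show "finite J" using f that finite_subset by blast
    qed
    from real_card_SN_step[OF two eps f I'(2) this]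
    have step: "real (card (SN ep I)) = (if ep = 1 then (real CARD('a) - 1) * real CARD('a) ^ card I' * snf ep (card I') else 0)
      + (real CARD('a) ^ card I' - 1) * real CARD('a) ^ (card I' - 1 + (if ep = 1 then 1 else 0)) * snf ep (card I' - 1)"
      unfolding I'(1) .
    have cI: "card I = Suc (card I')" using I' f by simp
    show ?thesis
    proof (cases "card I'")
      case 0
      have "sexp ep (Suc 0) = (if ep = 1 then 1 else 0)" by (simp add: sexp_Suc)
      then have "snf ep (Suc 0) = (if ep = 1 then real CARD('a) - 1 else 0)"
        using one_less_card_field[where 'a = 'a] by (simp add: snf_def podd_def right_diff_distrib)
      moreover have "snf ep 0 = 1" by (simp add: snf_def)
      ultimately show ?thesis unfolding cI 0 step by (cases "ep = 1") simp_all
    next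
      case (Suc m)
      show ?thesis unfolding cI Suc step snf_recursion[of ep m] by simp
    qed
  qed
qed

section \<open>Congruence classes of pairs\<close>

text \<open>Counting incidences with base changes by this lemma serves in place of group actions and
  orbits.\<close>

lemma double_count:
  assumes "finite A" "finite G"
    and "\<And>x. x \<in> A ==> card {g \<in> G. R x g} = K" and "\<And>g. g \<in> G ==> card {x \<in> A. R x g} = L"
  shows "card A * K = card G * L"
proof -
  have "card A * K = (\<Sum>x\<in>A. card {g \<in> G. R x g})" using assms(3) by simp
  also have "... = (\<Sum>x\<in>A. \<Sum>g\<in>G. if R x g then 1 else 0)"
    using assms(2) by (simp add: sum.If_cases Int_def conj_commute)
  also have "... = (\<Sum>g\<in>G. \<Sum>x\<in>A. if R x g then 1 else 0)" by (rule sum.swap)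
  also have "... = (\<Sum>g\<in>G. card {x \<in> A. R x g})"
    using assms(1) by (simp add: sum.If_cases Int_def conj_commute)
  also have "... = card G * L" using assms(4) by simp
  finally show ?thesis .
qed

definition kpow :: "nat set => 'a::comm_ring_1 fmat => nat => 'a fmat set" where
  "kpow I X i = {v \<in> Mats I {0}. ((*) X ^^ i) v = 0}"

lemma funpow_mult_Mats: "X \<in> Mats I I ==> v \<in> Mats I J ==> ((*) X ^^ i) v \<in> Mats I J"
  by (induction i) auto

lemma funpow_mult_zero [simp]: "((*) X ^^ i) (0 :: 'a::comm_ring_1 fmat) = 0"
  by (induction i) auto

text \<open>Dimension of the kernel of the \<open>i\<close>-th power of a nilpotent map whose Jordan
  blocks have the sizes in \<open>\<mu>\<close>.\<close>

definition kdim :: "nat multiset => nat => nat" where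
  "kdim \<mu> i = (\<Sum>j\<in>#\<mu>. min j i)"

text \<open>The type is encoded by the sizes of the kernels of all powers, with no Jordan basis. The
  map \<open>X\<close> may have an invertible Fitting component, to which these kernels are blind;
  \<open>X\<close> is nilpotent when \<open>card I = sum_mset \<mu>\<close>.\<close>

definition has_type :: "nat set => nat multiset => 'a::{field,finite} fmat => bool" where
  "has_type I \<mu> X \<longleftrightarrow> X \<in> Mats I I & (\<forall>i. card (kpow I X i) = CARD('a) ^ kdim \<mu> i)"

text \<open>For \<open>th = 1\<close> the condition says that \<open>1 + T\<close> is an isometry of \<open>B\<close>, for \<open>th = 0\<close> that \<open>T\<close> is skew.\<close>

definition Prs :: "'a::comm_ring_1 => 'a => nat set => ('a fmat \<times> 'a fmat) set" where
  "Prs th ep I = {(B, T). B \<in> SN ep I & T \<in> Mats I I & tr T * B + B * T + th \<cdot> (tr T * B * T) = 0}"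

definition Prt :: "'a::{field,finite} => 'a => nat set => nat multiset => ('a fmat \<times> 'a fmat) set" where
  "Prt th ep I \<mu> = {(B, T) \<in> Prs th ep I. has_type I \<mu> T}"

lemma finite_Prs [simp]: "finite I ==> finite (Prs th ep I :: ('a::{comm_ring_1,finite} fmat \<times> 'a fmat) set)"
  by (rule finite_subset[of _ "SN ep I \<times> Mats I I"]) (auto simp: Prs_def)

lemma finite_Prt [simp]: "finite I ==> finite (Prt th ep I \<mu>)"
  by (rule finite_subset[of _ "Prs th ep I"]) (auto simp: Prt_def)

definition cong_pair :: "nat set => 'a::comm_ring_1 fmat => 'a fmat \<times> 'a fmat => 'a fmat \<times> 'a fmat" where
  "cong_pair I P = (\<lambda>(B, T). (tr P * B * P, finv I P * T * P))"

lemma tr_finv: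
  assumes "P \<in> GLs I" shows "tr P * tr (finv I P) = idm I" "tr (finv I P) * tr P = idm I"
  using finv_props[OF assms] by (simp_all flip: tr_mult)

lemma SN_congruence:
  fixes B :: "'a::{comm_ring_1,finite} fmat"
  assumes I: "finite I" and P: "P \<in> GLs I" and B: "B \<in> SN ep I"
  shows "tr P * B * P \<in> SN ep I"
proof -
  have "tr P * B * P \<in> GLs I" using I P SND(1)[OF B] by (intro GLs_mult) simp_all
  moreover have "tr (tr P * B * P) = ep \<cdot> (tr P * B * P)" using SND(2)[OF B] by (simp add: mult.assoc)
  ultimately show ?thesis by (simp add: SN_def)
qed

lemma cong_pair_Prs:
  fixes P :: "'a::{comm_ring_1,finite} fmat"
  assumes I: "finite I" and P: "P \<in> GLs I" and x: "x \<in> Prs th ep I"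
  shows "cong_pair I P x \<in> Prs th ep I"
proof -
  obtain B T where [simp]: "x = (B, T)" and B: "B \<in> SN ep I" and T: "T \<in> Mats I I"
    and e: "tr T * B + B * T + th \<cdot> (tr T * B * T) = 0" using x by (auto simp: Prs_def)
  let ?P = "finv I P"
  note m = finv_props[OF P] GLs_Mats[OF P] SN_Mats[OF B]
  have c: "P * (?P * X) = X" "tr ?P * (tr P * X) = X" if "X \<in> Mats I I" for X
    using finv_cancel(1)[OF P I that] mult_eq_assoc[OF tr_finv(2)[OF P], of X] idm_mult[OF that I] by simp_all
  have c1: "P * (?P * (T * P)) = T * P" using c(1) T m by blast
  have c2: "tr ?P * (tr P * (B * X)) = B * X" if "X \<in> Mats I I" for X
    using c(2) Mats_mult[OF m(5) that] by blast
  let ?T = "?P * T * P" and ?B = "tr P * B * P"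
  have mT: "?T \<in> Mats I I" using Mats_mult[OF Mats_mult[OF m(1) T] m(4)] .
  have "tr ?T * ?B + ?B * ?T + th \<cdot> (tr ?T * ?B * ?T) = tr P * (tr T * B + B * T + th \<cdot> (tr T * B * T)) * P"
  proof -
    have "tr ?T * ?B = tr P * (tr T * B) * P" by (simp add: mult.assoc c2[OF m(4)])
    moreover have "?B * ?T = tr P * (B * T) * P" by (simp add: mult.assoc c1)
    moreover have "tr ?T * ?B * ?T = tr P * (tr T * B * T) * P"
    proof -
      have "B * (P * (?P * (T * P))) = B * (T * P)" by (simp only: c1)
      then show ?thesis using c2[of "T * P"] T m(4) by (simp add: mult.assoc c1 Mats_mult[OF T m(4)])
    qed
    ultimately show ?thesis by (simp add: distrib_left distrib_right)
  qed
  then have "tr ?T * ?B + ?B * ?T + th \<cdot> (tr ?T * ?B * ?T) = 0" using e by simp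
  then show ?thesis using SN_congruence[OF I P B] mT by (simp add: Prs_def cong_pair_def)
qed

lemma conj_inverse:
  assumes I: "finite I" and P: "P \<in> GLs I" and T: "T \<in> Mats I I"
  shows "P * (finv I P * T * P) * finv I P = T" "finv I P * (P * T * finv I P) * P = T"
proof -
  note m = finv_props[OF P] GLs_Mats[OF P]
  show "P * (finv I P * T * P) * finv I P = T" "finv I P * (P * T * finv I P) * P = T"
    using finv_cancel[OF P I T] mult_idm[OF T I] m by (simp_all add: mult.assoc)
qed

lemma cong_pair_inverse:
  assumes I: "finite I" and P: "P \<in> GLs I" and "B \<in> Mats I I" "T \<in> Mats I I"
  shows "cong_pair I (finv I P) (cong_pair I P (B, T)) = (B, T)"
proof -
  note m = finv_props[OF P] GLs_Mats[OF P]
  have "tr (finv I P) * (tr P * B * P) * finv I P = tr (finv I P) * (tr P * (B * (P * finv I P)))" by (simp only: mult.assoc)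
  also have "... = B" unfolding m(2) mult_idm[OF assms(3) I subset_refl]
    using mult_eq_assoc[OF tr_finv(2)[OF P], of B] idm_mult[OF assms(3) I] by simp
  finally show ?thesis using conj_inverse(1)[OF I P assms(4)] by (simp add: cong_pair_def finv_finv[OF P I])
qed

lemma funpow_conj:
  assumes I: "finite I" and P: "P \<in> GLs I" and T: "T \<in> Mats I I" and v: "v \<in> Mats I J"
  shows "((*) (finv I P * T * P) ^^ i) v = finv I P * ((*) T ^^ i) (P * v)"
proof (induction i)
  case 0
  then show ?case using finv_cancel(2)[OF P I v] by simp
next
  case (Suc i)
  have "((*) T ^^ i) (P * v) \<in> Mats I J" using funpow_mult_Mats[OF T Mats_mult[OF GLs_Mats[OF P] v]] .
  then show ?case using Suc finv_cancel(1)[OF P I] by (simp add: mult.assoc)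
qed

lemma card_kpow_conj:
  assumes I: "finite I" and P: "P \<in> GLs I" and T: "T \<in> Mats I I"
  shows "card (kpow I (finv I P * T * P) i) = card (kpow I T i)"
proof (rule bij_betw_same_card[where f = "(*) P"], rule bij_betwI[where g = "(*) (finv I P)"])
  note m = finv_props[OF P] GLs_Mats[OF P]
  have z: "finv I P * w = 0 \<longleftrightarrow> w = 0" if "w \<in> Mats I {0}" for w
    using finv_cancel(1)[OF P I that] by auto
  show "(*) P \<in> kpow I (finv I P * T * P) i \<rightarrow> kpow I T i"
  proof
    fix v assume "v \<in> kpow I (finv I P * T * P) i"
    then have v: "v \<in> Mats I {0}" "finv I P * ((*) T ^^ i) (P * v) = 0" using funpow_conj[OF I P T] by (auto simp: kpow_def)
    have Pv: "P * v \<in> Mats I {0}" using m v by auto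
    then show "P * v \<in> kpow I T i" using z[OF funpow_mult_Mats[OF T Pv]] v by (simp add: kpow_def)
  qed
  show "(*) (finv I P) \<in> kpow I T i \<rightarrow> kpow I (finv I P * T * P) i"
  proof
    fix v assume "v \<in> kpow I T i"
    then have v: "v \<in> Mats I {0}" "((*) T ^^ i) v = 0" by (auto simp: kpow_def)
    have "finv I P * v \<in> Mats I {0}" using m v by auto
    then show "finv I P * v \<in> kpow I (finv I P * T * P) i"
      using v finv_cancel(1)[OF P I v(1)] by (simp add: kpow_def funpow_conj[OF I P T])
  qed
  show "finv I P * (P * v) = v" if "v \<in> kpow I (finv I P * T * P) i" for v
    using finv_cancel(2)[OF P I] that by (auto simp: kpow_def)
  show "P * (finv I P * v) = v" if "v \<in> kpow I T i" for v
    using finv_cancel(1)[OF P I] that by (auto simp: kpow_def)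
qed

lemma has_type_conj:
  assumes I: "finite I" and P: "P \<in> GLs I" and T: "T \<in> Mats I I"
  shows "has_type I \<mu> (finv I P * T * P) \<longleftrightarrow> has_type I \<mu> T"
proof -
  note m = finv_props[OF P] GLs_Mats[OF P]
  have "finv I P * T * P \<in> Mats I I" using Mats_mult[OF Mats_mult[OF m(1) T] m(4)] .
  then show ?thesis using T card_kpow_conj[OF I P T] by (simp add: has_type_def)
qed

lemma bij_betw_cong_pair:
  fixes P :: "'a::{comm_ring_1,finite} fmat"
  assumes I: "finite I" and P: "P \<in> GLs I"
  shows "bij_betw (cong_pair I P) {x \<in> Prs th ep I. \<Phi> (cong_pair I P x)} {x \<in> Prs th ep I. \<Phi> x}"
proof (rule bij_betwI[where g = "cong_pair I (finv I P)"])
  have i: "cong_pair I (finv I P) (cong_pair I P x) = x" if "x \<in> Prs th ep I" for x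
    using that cong_pair_inverse[OF I P] by (auto simp: Prs_def SN_def GLs_Mats)
  have i': "cong_pair I P (cong_pair I (finv I P) x) = x" if "x \<in> Prs th ep I" for x
    using that cong_pair_inverse[OF I finv_GLs[OF P]] by (auto simp: Prs_def SN_def GLs_Mats finv_finv[OF P I])
  show "cong_pair I P \<in> {x \<in> Prs th ep I. \<Phi> (cong_pair I P x)} \<rightarrow> {x \<in> Prs th ep I. \<Phi> x}"
    using cong_pair_Prs[OF I P] by auto
  show "cong_pair I (finv I P) \<in> {x \<in> Prs th ep I. \<Phi> x} \<rightarrow> {x \<in> Prs th ep I. \<Phi> (cong_pair I P x)}"
    using cong_pair_Prs[OF I finv_GLs[OF P]] i' by auto
  show "cong_pair I (finv I P) (cong_pair I P x) = x" if "x \<in> {x \<in> Prs th ep I. \<Phi> (cong_pair I P x)}" for x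
    using that i by simp
  show "cong_pair I P (cong_pair I (finv I P) x) = x" if "x \<in> {x \<in> Prs th ep I. \<Phi> x}" for x
    using that i' by simp
qed

lemma GLs_blocksE:
  fixes g :: "'a::{comm_ring_1,finite} fmat"
  assumes fin: "finite I1" "finite I2" and dis: "I1 \<inter> I2 = {}" and g: "g \<in> GLs (I1 \<union> I2)" and z: "idm I2 * g * idm I1 = 0"
  obtains A B C where "A \<in> GLs I1" "B \<in> GLs I2" "C \<in> Mats I1 I2" "g = A + B + C"
proof -
  let ?A = "idm I1 * g * idm I1" and ?B = "idm I2 * g * idm I2" and ?C = "idm I1 * g * idm I2"
  have m: "?A \<in> Mats I1 I1" "?B \<in> Mats I2 I2" "?C \<in> Mats I1 I2"
    by (rule Mats_mult[OF Mats_mult[OF idm_Mats GLs_Mats[OF g]] idm_Mats])+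
  have gI: "idm (I1 \<union> I2) * g = g" "g * idm (I1 \<union> I2) = g"
    using idm_mult[OF GLs_Mats[OF g]] mult_idm[OF GLs_Mats[OF g]] fin by simp_all
  have "g = idm (I1 \<union> I2) * g * idm (I1 \<union> I2)" using gI by simp
  also have "... = ?A + ?B + ?C" using z fin dis by (simp add: idm_Un distrib_left distrib_right)
  finally have eq: "g = ?A + ?B + ?C" .
  have "?A + ?B + ?C \<in> GLs (I1 \<union> I2)" unfolding eq[symmetric] by (rule g)
  then have "?A \<in> GLs I1" "?B \<in> GLs I2" using GLs_block_iff[OF fin dis m] by blast+
  then show ?thesis by (rule that[OF _ _ m(3) eq])
qed

text \<open>The order of the parabolic subgroup that stabilizes the coordinate subspace of
  \<open>I1\<close>.\<close>

lemma card_block_triangular: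
  fixes I1 I2 :: "nat set"
  assumes fin: "finite I1" "finite I2" and dis: "I1 \<inter> I2 = {}"
  shows "card {g \<in> GLs (I1 \<union> I2) :: 'a::{comm_ring_1,finite} fmat set. idm I2 * g * idm I1 = 0} =
    card (GLs I1 :: 'a fmat set) * card (GLs I2 :: 'a fmat set) * CARD('a) ^ (card I1 * card I2)"
proof -
  let ?f = "\<lambda>(A, B, C). A + B + C :: 'a fmat"
  have z: "idm I2 * (A + B + C) * idm I1 = 0 & idm I1 * (A + B + C) * idm I1 = A & idm I2 * (A + B + C) * idm I2 = B
      & idm I1 * (A + B + C) * idm I2 = C"
    if "A \<in> Mats I1 I1" "B \<in> Mats I2 I2" "C \<in> Mats I1 I2" for A B C :: "'a fmat"
  proof -
    have dis': "I2 \<inter> I1 = {}" using dis by auto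
    show ?thesis
      using mult_disjoint[OF idm_Mats that(1) dis'] mult_disjoint[OF idm_Mats that(3) dis'] mult_disjoint[OF idm_Mats that(2) dis]
        mult_disjoint[OF that(1) idm_Mats dis] mult_disjoint[OF that(2) idm_Mats dis'] mult_disjoint[OF that(3) idm_Mats dis']
        idm_mult[OF that(1) fin(1)] mult_idm[OF that(1) fin(1)] idm_mult[OF that(2) fin(2)] mult_idm[OF that(2) fin(2)]
        idm_mult[OF that(3) fin(1)] mult_idm[OF that(3) fin(2)]
      by (simp add: distrib_left distrib_right mult.assoc)
  qed
  let ?G = "{g \<in> GLs (I1 \<union> I2). idm I2 * g * idm I1 = (0 :: 'a fmat)}"
  have "bij_betw ?f (GLs I1 \<times> GLs I2 \<times> Mats I1 I2) ?G"
  proof (rule bij_betwI[where g = "\<lambda>g. (idm I1 * g * idm I1, idm I2 * g * idm I2, idm I1 * g * idm I2)"])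
    show "?f \<in> GLs I1 \<times> GLs I2 \<times> Mats I1 I2 \<rightarrow> ?G"
    proof
      fix x :: "'a fmat \<times> 'a fmat \<times> 'a fmat" assume "x \<in> GLs I1 \<times> GLs I2 \<times> Mats I1 I2"
      then obtain A B C where x: "x = (A, B, C)" "A \<in> GLs I1" "B \<in> GLs I2" "C \<in> Mats I1 I2" by auto
      then show "?f x \<in> ?G" using GLs_add_block(1)[OF fin dis x(2-4)] z[OF GLs_Mats[OF x(2)] GLs_Mats[OF x(3)] x(4)] by simp
    qed
    show "(\<lambda>g. (idm I1 * g * idm I1, idm I2 * g * idm I2, idm I1 * g * idm I2)) \<in> ?G
       \<rightarrow> GLs I1 \<times> GLs I2 \<times> Mats I1 I2"
    proof
      fix g :: "'a fmat" assume "g \<in> ?G"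
      then have g: "g \<in> GLs (I1 \<union> I2)" "idm I2 * g * idm I1 = 0" by blast+
      obtain A B C where *: "A \<in> GLs I1" "B \<in> GLs I2" "C \<in> Mats I1 I2" "g = A + B + C"
        using GLs_blocksE[OF fin dis g] .
      then show "(idm I1 * g * idm I1, idm I2 * g * idm I2, idm I1 * g * idm I2) \<in> GLs I1 \<times> GLs I2 \<times> Mats I1 I2"
        using z[OF GLs_Mats GLs_Mats, of A B C] by simp
    qed
    show "(\<lambda>g. (idm I1 * g * idm I1, idm I2 * g * idm I2, idm I1 * g * idm I2)) (?f x) = x"
      if "x \<in> GLs I1 \<times> GLs I2 \<times> Mats I1 I2" for x :: "'a fmat \<times> 'a fmat \<times> 'a fmat"
    proof -
      from that obtain A B C where x: "x = (A, B, C)" "A \<in> GLs I1" "B \<in> GLs I2" "C \<in> Mats I1 I2" by auto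
      then show ?thesis using z[OF GLs_Mats[OF x(2)] GLs_Mats[OF x(3)] x(4)] by simp
    qed
    show "?f (idm I1 * g * idm I1, idm I2 * g * idm I2, idm I1 * g * idm I2) = g"
      if "g \<in> ?G" for g
    proof -
      have g: "g \<in> GLs (I1 \<union> I2)" "idm I2 * g * idm I1 = 0" using that by blast+
      obtain A B C where *: "A \<in> GLs I1" "B \<in> GLs I2" "C \<in> Mats I1 I2" "g = A + B + C"
        using GLs_blocksE[OF fin dis g] .
      then show ?thesis using z[OF GLs_Mats GLs_Mats, of A B C] by simp
    qed
  qed
  then show ?thesis using fin by (simp add: bij_betw_same_card[symmetric] card_cartesian_product card_Mats)
qed

text \<open>A kernel of the smallest possible size forces the rank factorization to use all
  rows.\<close>

lemma Epi_of_kernel: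
  fixes X :: "'a::{field,finite} fmat"
  assumes fin: "finite I1" "finite I" and X: "X \<in> Mats I1 I"
    and k: "card (kerf I X) * CARD('a) ^ card I1 = CARD('a) ^ card I"
  shows "X \<in> Epi I1 I"
proof -
  obtain P J R where P: "P \<in> GLs I1" and J: "J \<subseteq> I1" and R: "R \<in> Epi J I" and X': "X = P * R"
    using row_compress[OF fin X] .
  have finJ: "finite J" using J fin finite_subset by blast
  have "kerf I X = kerf I R" unfolding X' by (rule kerf_GLs_mult[OF P fin(1) Mats_mono[OF Epi_Mats[OF R] J subset_refl]])
  then have "CARD('a) ^ card J * card (kerf I R) = CARD('a) ^ card I1 * card (kerf I R)"
    using card_kerf_Epi[OF R finJ fin(2)] k by (simp add: mult.commute)
  moreover have "card (kerf I R) ~= 0" using card_kerf_Epi[OF R finJ fin(2)] one_less_card_field[where 'a = 'a] by (intro notI) simp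
  ultimately have "card J = card I1" using one_less_card_field[where 'a = 'a] by simp
  then have "J = I1" using card_subset_eq[OF fin(1) J] by simp
  then obtain S where S: "S \<in> Mats I I1" "R * S = idm I1" using R by (auto elim: EpiE)
  have "X * (S * finv I1 P) = idm I1"
    unfolding X' using idm_mult[OF finv_props(1)[OF P] fin(1)] finv_props(2)[OF P] by (simp add: mult.assoc mult_eq_assoc[OF S(2)])
  then show ?thesis using EpiI[OF X Mats_mult[OF S(1) finv_props(1)[OF P]]] by simp
qed

text \<open>The rows of \<open>finv P * X\<close> lie in \<open>I1\<close> exactly if the columns of
  \<open>P\<close> in \<open>I1\<close> span the image of \<open>X\<close>. Such \<open>P\<close>
  form one coset \<open>P0 * g\<close>, with \<open>g\<close> in the parabolic subgroup.\<close>

lemma card_adapted: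
  fixes X :: "'a::{field,finite} fmat"
  assumes fin: "finite I1" "finite I2" and dis: "I1 \<inter> I2 = {}" and X: "X \<in> Mats (I1 \<union> I2) (I1 \<union> I2)"
    and k: "card (kerf (I1 \<union> I2) X) = CARD('a) ^ card I2"
  shows "card {P \<in> GLs (I1 \<union> I2). finv (I1 \<union> I2) P * X \<in> Mats I1 (I1 \<union> I2)} =
    card (GLs I1 :: 'a fmat set) * card (GLs I2 :: 'a fmat set) * CARD('a) ^ (card I1 * card I2)"
proof -
  let ?I = "I1 \<union> I2"
  have I: "finite ?I" using fin by simp
  have cI: "card ?I = card I1 + card I2" using fin dis by (simp add: card_Un_disjoint)
  obtain P J R where P: "P \<in> GLs ?I" and J: "J \<subseteq> ?I" and R: "R \<in> Epi J ?I" and X': "X = P * R"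
    using row_compress[OF I I X] .
  have finJ: "finite J" using J I finite_subset by blast
  have "kerf ?I X = kerf ?I R" unfolding X' by (rule kerf_GLs_mult[OF P I Mats_mono[OF Epi_Mats[OF R] J subset_refl]])
  then have "CARD('a) ^ (card I2 + card J) = CARD('a) ^ card ?I"
    using card_kerf_Epi[OF R finJ I] k by (simp add: power_add)
  then have "card J = card I1" using one_less_card_field[where 'a = 'a] cI by simp
  then obtain P0 R0 where P0: "P0 \<in> GLs ?I" and R0: "R0 \<in> Epi I1 ?I" and X0: "X = P0 * R0"
    using Epi_reindex[OF I P J R, of I1] X' by auto
  obtain S0 where S0: "S0 \<in> Mats ?I I1" "R0 * S0 = idm I1" using R0 by (rule EpiE)
  have R0m: "R0 \<in> Mats ?I ?I" using Mats_mono[OF Epi_Mats[OF R0]] by blast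
  have dis': "I2 \<inter> I1 = {}" using dis by auto
  have ii: "idm I1 * idm I1 = (idm I1 :: 'a fmat)" "idm I2 * idm I1 = (0 :: 'a fmat)"
    using idm_mult_idm[OF fin(1) fin(1), where 'a = 'a] mult_disjoint[OF idm_Mats idm_Mats dis', where 'a = 'a] by simp_all
  have key: "finv ?I (P0 * g) * X \<in> Mats I1 ?I \<longleftrightarrow> idm I2 * g * idm I1 = 0" if g: "g \<in> GLs ?I" for g
  proof -
    have Pg: "P0 * g \<in> GLs ?I" using GLs_mult[OF I P0 g] .
    let ?R = "finv ?I (P0 * g) * X"
    have Rm: "?R \<in> Mats ?I ?I" using finv_props(1)[OF Pg] X by auto
    have "P0 * g * ?R = P0 * R0" using finv_cancel(1)[OF Pg I X] X0 by simp
    then have "finv ?I P0 * (P0 * (g * ?R)) = finv ?I P0 * (P0 * R0)" by (simp add: mult.assoc)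
    then have gR: "g * ?R = R0" using finv_cancel(2)[OF P0 I Mats_mult[OF GLs_Mats[OF g] Rm]] finv_cancel(2)[OF P0 I R0m] by simp
    show ?thesis
    proof
      assume R1: "?R \<in> Mats I1 ?I"
      define a where "a = ?R * S0"
      have a: "a \<in> Mats I1 I1" unfolding a_def using Mats_mult[OF R1 S0(1)] .
      have ga: "g * a = idm I1" unfolding a_def using gR S0(2) by (simp add: mult.assoc[symmetric])
      have "(idm I1 * g * idm I1) * a = idm I1"
        using ga idm_mult[OF a fin(1)] ii by (simp add: mult.assoc)
      then have G: "a \<in> GLs I1"
        by (rule GLsI_left[OF fin(1) a Mats_mult[OF Mats_mult[OF idm_Mats GLs_Mats[OF g]] idm_Mats]])
      have "idm I2 * (g * a) * finv I1 a = idm I2 * g * idm I1"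
        using finv_props(2)[OF G] by (simp add: mult.assoc)
      then show "idm I2 * g * idm I1 = 0" unfolding ga ii by simp
    next
      assume z: "idm I2 * g * idm I1 = 0"
      obtain A B C where A: "A \<in> GLs I1" "B \<in> GLs I2" "C \<in> Mats I1 I2" "g = A + B + C"
        using GLs_blocksE[OF fin dis g z] .
      let ?X = "finv I1 A * R0"
      have X1: "?X \<in> Mats I1 ?I" using finv_props(1)[OF A(1)] Epi_Mats[OF R0] by auto
      have "g * ?X = R0"
        unfolding A(4) using finv_cancel(1)[OF A(1) fin(1) Epi_Mats[OF R0]] mult_disjoint[OF GLs_Mats[OF A(2)] X1 dis'] mult_disjoint[OF A(3) X1 dis']
        by (simp add: distrib_right)
      then have "g * (?R - ?X) = 0" using gR by (simp add: right_diff_distrib)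
      moreover have "?R - ?X \<in> Mats ?I ?I" using Rm Mats_mono[OF X1, of ?I ?I] by auto
      ultimately have "?R - ?X = 0" using GLs_cancel[OF g I] by blast
      then show "?R \<in> Mats I1 ?I" using X1 by simp
    qed
  qed
  have "bij_betw ((*) P0) {g \<in> GLs ?I. idm I2 * g * idm I1 = 0} {P \<in> GLs ?I. finv ?I P * X \<in> Mats I1 ?I}"
  proof (rule bij_betwI[where g = "(*) (finv ?I P0)"])
    show "(*) P0 \<in> {g \<in> GLs ?I. idm I2 * g * idm I1 = 0} \<rightarrow> {P \<in> GLs ?I. finv ?I P * X \<in> Mats I1 ?I}"
      using key GLs_mult[OF I P0] by auto
    show "(*) (finv ?I P0) \<in> {P \<in> GLs ?I. finv ?I P * X \<in> Mats I1 ?I} \<rightarrow> {g \<in> GLs ?I. idm I2 * g * idm I1 = 0}"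
    proof
      fix P assume P: "P \<in> {P \<in> GLs ?I. finv ?I P * X \<in> Mats I1 ?I}"
      have g: "finv ?I P0 * P \<in> GLs ?I" using GLs_mult[OF I finv_GLs[OF P0]] P by blast
      show "finv ?I P0 * P \<in> {g \<in> GLs ?I. idm I2 * g * idm I1 = 0}"
        using key[OF g] g P finv_cancel(1)[OF P0 I GLs_Mats] by auto
    qed
    show "finv ?I P0 * (P0 * x) = x" if "x \<in> {g \<in> GLs ?I. idm I2 * g * idm I1 = 0}" for x
      using finv_cancel(2)[OF P0 I GLs_Mats] that by simp
    show "P0 * (finv ?I P0 * x) = x" if "x \<in> {P \<in> GLs ?I. finv ?I P * X \<in> Mats I1 ?I}" for x
      using finv_cancel(1)[OF P0 I GLs_Mats] that by simp
  qed
  then show ?thesis using card_block_triangular[OF fin dis, where 'a = 'a] by (simp add: bij_betw_same_card)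
qed

section \<open>Counting nilpotent pairs of a given type\<close>

text \<open>Removal of the first column of the diagram. For a nilpotent map this is the passage to
  the restriction to its image.\<close>

definition shift :: "nat multiset => nat multiset" where
  "shift \<mu> = {#j - 1. j \<in># filter_mset (\<lambda>j. 1 < j) \<mu>#}"

lemma shift_partition [simp]: "0 \<notin># shift \<mu>" by (auto simp: shift_def)

lemma kdim_Suc: "0 \<notin># \<mu> ==> kdim \<mu> (Suc i) = size \<mu> + kdim (shift \<mu>) i"
proof (induction \<mu>)
  case (add x \<mu>)
  then have IH: "kdim \<mu> (Suc i) = size \<mu> + kdim (shift \<mu>) i" and "x ~= 0" by simp_all
  then consider "x = 1" | "1 < x" by linarith
  then show ?case
  proof cases
    case 2
    then have "min x (Suc i) = Suc (min (x - 1) i)" by simp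
    then show ?thesis using IH 2 by (simp add: kdim_def shift_def)
  qed (use IH in \<open>simp add: kdim_def shift_def\<close>)
qed (simp add: kdim_def shift_def)

lemma kdim_0 [simp]: "kdim \<mu> 0 = 0" by (simp add: kdim_def)

lemma kdim_1: "0 \<notin># \<mu> ==> kdim \<mu> (Suc 0) = size \<mu>" by (simp add: kdim_Suc)

lemma sum_mset_shift: "0 \<notin># \<mu> ==> sum_mset \<mu> = size \<mu> + sum_mset (shift \<mu>)"
proof (induction \<mu>)
  case (add x \<mu>)
  have p: "0 \<notin># \<mu>" "x ~= 0" using add.prems by simp_all
  note IH = add.IH[OF p(1)]
  consider "x = 1" | "1 < x" using p(2) by linarith
  then show ?case
  proof cases
    case 1
    have "shift (add_mset x \<mu>) = shift \<mu>" using 1 by (simp add: shift_def)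
    then show ?thesis using IH 1 by simp
  next
    case 2
    have "sum_mset (shift (add_mset x \<mu>)) = x - 1 + sum_mset (shift \<mu>)" using 2 by (simp add: shift_def)
    then show ?thesis using 2 IH by simp
  qed
qed (simp add: shift_def)

lemma size_le_sum_mset: "0 \<notin># \<mu> ==> size \<mu> \<le> sum_mset \<mu>"
  using sum_mset_shift[of \<mu>] by simp

lemma kerf_kpow: "kerf I X = kpow I X (Suc 0)" by (simp add: kerf_def kpow_def)

text \<open>\<open>X\<close> maps onto the coordinates \<open>I1\<close>, and
  \<open>X * idm I1\<close> is its restriction to this image. A vector is killed by the power
  \<open>Suc i\<close> iff its image is killed by the \<open>i\<close>-th power of the restriction,
  and the fibres of \<open>X\<close> are cosets of its kernel.\<close>

lemma card_kpow_Epi: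
  fixes X :: "'a::{field,finite} fmat"
  assumes fin: "finite I1" "finite I2" and dis: "I1 \<inter> I2 = {}" and X: "X \<in> Epi I1 (I1 \<union> I2)"
  shows "card (kpow (I1 \<union> I2) X (Suc i)) = CARD('a) ^ card I2 * card (kpow I1 (X * idm I1) i)"
proof -
  let ?I = "I1 \<union> I2" and ?Y = "X * idm I1"
  have I: "finite ?I" using fin by simp
  note Xm = Epi_Mats[OF X]
  have Ym: "?Y \<in> Mats I1 I1" using mult_idm_Mats[OF Xm fin(1)] .
  have XY: "X * w = ?Y * w" if "w \<in> Mats I1 {0}" for w using idm_mult[OF that fin(1)] by (simp add: mult.assoc)
  have it: "((*) X ^^ k) w = ((*) ?Y ^^ k) w" if "w \<in> Mats I1 {0}" for w k
  proof (induction k)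
    case (Suc k)
    then show ?case using XY[OF funpow_mult_Mats[OF Ym that, of k]] by (simp del: mult.assoc)
  qed simp
  obtain S where S: "S \<in> Mats ?I I1" "X * S = idm I1" using X by (rule EpiE)
  note b = bij_betw_Epi_solutions[OF X fin(1) S, of "{0}"]
  have XS: "X * (v + S * w) = w" if "X * v = 0" "w \<in> Mats I1 {0}" for v w
    using that idm_mult[OF that(2) fin(1)] by (simp add: distrib_left mult_eq_assoc[OF S(2)])
  have eq: "kpow ?I X (Suc i) = (\<lambda>(v, w). v + S * w) ` (kerf ?I X \<times> kpow I1 ?Y i)"
  proof
    show "(\<lambda>(v, w). v + S * w) ` (kerf ?I X \<times> kpow I1 ?Y i) \<subseteq> kpow ?I X (Suc i)"
    proof
      fix u assume "u \<in> (\<lambda>(v, w). v + S * w) ` (kerf ?I X \<times> kpow I1 ?Y i)"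
      then obtain v w where *: "v \<in> Mats ?I {0}" "X * v = 0" "w \<in> Mats I1 {0}" "((*) ?Y ^^ i) w = 0" "u = v + S * w"
        by (auto simp: kerf_def kpow_def)
      have "u \<in> Mats ?I {0}" unfolding *(5) using Mats_add[OF *(1) Mats_mult[OF S(1) *(3)]] .
      moreover have "((*) X ^^ Suc i) u = 0"
        unfolding funpow_Suc_right o_def *(5) XS[OF *(2,3)] it[OF *(3)] *(4) ..
      ultimately show "u \<in> kpow ?I X (Suc i)" by (simp add: kpow_def)
    qed
    show "kpow ?I X (Suc i) \<subseteq> (\<lambda>(v, w). v + S * w) ` (kerf ?I X \<times> kpow I1 ?Y i)"
    proof
      fix u assume "u \<in> kpow ?I X (Suc i)"
      then have u: "u \<in> Mats ?I {0}" "((*) X ^^ Suc i) u = 0" by (simp_all add: kpow_def)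
      have "u \<in> (\<lambda>(v, w). v + S * w) ` ({v \<in> Mats ?I {0}. X * v = 0} \<times> Mats I1 {0})"
        using b u(1) unfolding bij_betw_def by blast
      then obtain v w where *: "v \<in> Mats ?I {0}" "X * v = 0" "w \<in> Mats I1 {0}" "u = v + S * w" by auto
      have "((*) ?Y ^^ i) w = 0"
        using u(2) unfolding funpow_Suc_right o_def *(4) XS[OF *(2,3)] it[OF *(3)] .
      then show "u \<in> (\<lambda>(v, w). v + S * w) ` (kerf ?I X \<times> kpow I1 ?Y i)"
        using * by (intro image_eqI[of _ _ "(v, w)"]) (simp_all add: kerf_def kpow_def)
    qed
  qed
  have "inj_on (\<lambda>(v, w). v + S * w) (kerf ?I X \<times> kpow I1 ?Y i)"
    by (rule inj_on_subset[OF bij_betw_imp_inj_on[OF b]]) (auto simp: kerf_def kpow_def)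
  then have "card (kpow ?I X (Suc i)) = card (kerf ?I X) * card (kpow I1 ?Y i)"
    unfolding eq by (simp add: card_image card_cartesian_product)
  moreover have "card (kerf ?I X) = CARD('a) ^ card I2"
    using card_kerf_Epi[OF X fin(1) I] fin dis one_less_card_field[where 'a = 'a] by (simp add: card_Un_disjoint power_add)
  ultimately show ?thesis by simp
qed

lemma kpow_0: "kpow I X 0 = {0}" by (auto simp: kpow_def)

lemma has_type_Epi:
  fixes X :: "'a::{field,finite} fmat"
  assumes fin: "finite I1" "finite I2" and dis: "I1 \<inter> I2 = {}" and X: "X \<in> Epi I1 (I1 \<union> I2)"
    and \<mu>: "0 \<notin># \<mu>" and c: "card I2 = size \<mu>"
  shows "has_type (I1 \<union> I2) \<mu> X \<longleftrightarrow> has_type I1 (shift \<mu>) (X * idm I1)"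
proof -
  have "X \<in> Mats (I1 \<union> I2) (I1 \<union> I2)" using Mats_mono[OF Epi_Mats[OF X]] by blast
  moreover have "X * idm I1 \<in> Mats I1 I1" using mult_idm_Mats[OF Epi_Mats[OF X] fin(1)] .
  moreover have "(\<forall>i. card (kpow (I1 \<union> I2) X i) = CARD('a) ^ kdim \<mu> i) \<longleftrightarrow>
      (\<forall>i. card (kpow I1 (X * idm I1) i) = CARD('a) ^ kdim (shift \<mu>) i)"
  proof -
    have "(\<forall>i. card (kpow (I1 \<union> I2) X i) = CARD('a) ^ kdim \<mu> i) \<longleftrightarrow>
      (\<forall>i. card (kpow (I1 \<union> I2) X (Suc i)) = CARD('a) ^ kdim \<mu> (Suc i))"
      by (rule iffI, blast, rule allI, rename_tac i, case_tac i) (simp_all add: kpow_0)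
    also have "... \<longleftrightarrow> (\<forall>i. card (kpow I1 (X * idm I1) i) = CARD('a) ^ kdim (shift \<mu>) i)"
      unfolding card_kpow_Epi[OF fin dis X] kdim_Suc[OF \<mu>] c by (simp add: power_add)
    finally show ?thesis .
  qed
  ultimately show ?thesis by (simp add: has_type_def)
qed

text \<open>After row reduction by \<open>P\<close>, the matrix \<open>Y\<close> has
  \<open>c\<close> zero rows. Only in these rows must the reduced \<open>Z\<close> have full rank;
  its other rows are free.\<close>

lemma card_Epi_completions:
  fixes Y :: "'a::{field,finite} fmat"
  assumes fin: "finite I1" "finite I2" and dis: "I1 \<inter> I2 = {}" and Y: "Y \<in> Mats I1 I1"
    and k: "card (kerf I1 Y) = CARD('a) ^ c"
  shows "real (card {Z \<in> Mats I1 I2. Y + Z \<in> Epi I1 (I1 \<union> I2)}) =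
    real CARD('a) ^ ((card I1 - c) * card I2) * (\<Prod>i<c. real CARD('a) ^ card I2 - real CARD('a) ^ i)"
proof -
  obtain P J R where P: "P \<in> GLs I1" and J: "J \<subseteq> I1" and R: "R \<in> Epi J I1" and YR: "Y = P * R"
    using row_compress[OF fin(1) fin(1) Y] .
  define L where "L = I1 - J"
  have finJ: "finite J" "finite L" using J fin(1) finite_subset by (auto simp: L_def)
  have JL: "I1 = J \<union> L" "J \<inter> L = {}" "L \<inter> J = {}" using J by (auto simp: L_def)
  have d: "J \<inter> I2 = {}" "L \<inter> I2 = {}" "I2 \<inter> I1 = {}" using dis JL by auto
  have cL: "card L = c" and cJ: "card J = card I1 - c"
  proof -
    have "kerf I1 Y = kerf I1 R" unfolding YR by (rule kerf_GLs_mult[OF P fin(1) Mats_mono[OF Epi_Mats[OF R] J subset_refl]])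
    then have "CARD('a) ^ (c + card J) = CARD('a) ^ card I1"
      using card_kerf_Epi[OF R finJ(1) fin(1)] k by (simp add: power_add)
    then have "c + card J = card I1" using one_less_card_field[where 'a = 'a] by simp
    then show "card L = c" "card J = card I1 - c" using J finJ by (auto simp: L_def card_Diff_subset)
  qed
  obtain S1 where S1: "S1 \<in> Mats I1 J" "R * S1 = idm J" using R by (rule EpiE)
  let ?P = "finv I1 P"
  note p = finv_props[OF P] GLs_Mats[OF P]
  have Rm: "R \<in> Mats I1 I1" using Mats_mono[OF Epi_Mats[OF R] J] by blast
  have key: "Y + P * (C + D) \<in> Epi I1 (I1 \<union> I2) \<longleftrightarrow> D \<in> Epi L I2" if C: "C \<in> Mats J I2" and D: "D \<in> Mats L I2" for C D
  proof
    have LI: "L \<subseteq> I1" using JL(1) by auto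
    have CD: "C + D \<in> Mats I1 I2" by (rule Mats_add[OF Mats_mono[OF C J subset_refl] Mats_mono[OF D LI subset_refl]])
    have Ye: "Y + P * (C + D) = P * (R + C + D)" unfolding YR by (simp add: distrib_left add.assoc)
    {
      assume "D \<in> Epi L I2"
      then obtain S2 where S2: "S2 \<in> Mats I2 L" "D * S2 = idm L" by (rule EpiE)
      \<comment> \<open>The right inverse of the block triangular \<open>R + C + D\<close>, built
        from right inverses of \<open>R\<close> and \<open>D\<close>.\<close>
      let ?S = "S1 + S2 - S1 * C * S2"
      have z: "R * S2 = 0" "C * S1 = 0" "D * S1 = 0"
        using mult_disjoint[OF Epi_Mats[OF R] S2(1) dis] mult_disjoint[OF C S1(1) d(3)] mult_disjoint[OF D S1(1) d(3)] by simp_all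
      have CS: "idm J * (C * S2) = C * S2" using idm_mult[OF Mats_mult[OF C S2(1)] finJ(1) subset_refl] .
      have inv: "(R + C + D) * ?S = idm I1"
        unfolding JL(1) idm_Un[OF finJ JL(2)]
        by (simp add: distrib_right distrib_left right_diff_distrib left_diff_distrib mult.assoc z z[THEN mult_eq_assoc] S1(2) S2(2) mult_eq_assoc[OF S1(2)] CS)
      have sub: "J \<subseteq> I1" "L \<subseteq> I1" "I1 \<subseteq> I1 \<union> I2" "I2 \<subseteq> I1 \<union> I2" using JL(1) by auto
      note m = Mats_mono[OF S1(1) sub(3,1)] Mats_mono[OF S2(1) sub(4,2)] Mats_mono[OF Mats_mult[OF Mats_mult[OF S1(1) C] S2(1)] sub(3,2)]
      have mS: "?S \<in> Mats (I1 \<union> I2) I1" by (intro Mats_add Mats_diff m)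
      have "(Y + P * (C + D)) * (?S * ?P) = P * ((R + C + D) * ?S) * ?P" unfolding Ye by (simp only: mult.assoc)
      also have "... = idm I1" unfolding inv using mult_idm[OF p(4) fin(1) subset_refl] p(2) by simp
      finally have e: "(Y + P * (C + D)) * (?S * ?P) = idm I1" .
      have "Y + P * (C + D) \<in> Mats I1 (I1 \<union> I2)"
        by (rule Mats_add[OF Mats_mono[OF Y subset_refl sub(3)] Mats_mono[OF Mats_mult[OF p(4) CD] subset_refl sub(4)]])
      then show "Y + P * (C + D) \<in> Epi I1 (I1 \<union> I2)" using Mats_mult[OF mS p(1)] e by (rule EpiI)
    next
      assume "Y + P * (C + D) \<in> Epi I1 (I1 \<union> I2)"
      then obtain T where T: "T \<in> Mats (I1 \<union> I2) I1" "(Y + P * (C + D)) * T = idm I1" by (rule EpiE)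
      have RCD: "R + C + D \<in> Mats I1 (I1 \<union> I2)"
        using Mats_add[OF Mats_mono[OF Rm, of I1 "I1 \<union> I2"] Mats_mono[OF CD, of I1 "I1 \<union> I2"]] by (simp add: add.assoc)
      have zz: "idm L * R = 0" "idm L * C = 0" using mult_disjoint[OF idm_Mats Epi_Mats[OF R] JL(3)] mult_disjoint[OF idm_Mats C JL(3)] by simp_all
      have LD: "idm L * (R + C + D) = D" using zz idm_mult[OF D finJ(2)] by (simp add: distrib_left)
      have "P * ((R + C + D) * T) = idm I1" using T(2) unfolding Ye by (simp add: mult.assoc)
      then have "(R + C + D) * T = ?P" using finv_unique[OF P fin(1) Mats_mult[OF RCD T(1)]] by blast
      then have "idm L * ((R + C + D) * T) = idm L * ?P" by simp
      then have "D * T = idm L * ?P" unfolding mult_eq_assoc[OF LD] .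
      then have DT: "D * (T * X) = idm L * (?P * X)" for X by (simp add: mult.assoc[symmetric])
      have iL: "idm L \<in> Mats I1 L" by (rule Mats_idm[OF LI subset_refl])
      have "D * (T * (P * idm L)) = idm L"
        unfolding DT finv_cancel(2)[OF P fin(1) iL] using finJ by (simp add: idm_mult_idm)
      then have "D * idm I2 * (T * (P * idm L)) = idm L" using mult_idm[OF D fin(2) subset_refl] by simp
      then have *: "D * (idm I2 * (T * (P * idm L))) = idm L" by (simp only: mult.assoc)
      have "idm I2 * (T * (P * idm L)) \<in> Mats I2 L"
        by (rule idm_mult_Mats[OF Mats_mult[OF T(1) Mats_mult[OF p(4) idm_Mats]] fin(2)])
      then show "D \<in> Epi L I2" using * by (rule EpiI[OF D])
    }
  qed
  have "bij_betw (\<lambda>(C, D). P * (C + D)) (Mats J I2 \<times> Epi L I2) {Z \<in> Mats I1 I2. Y + Z \<in> Epi I1 (I1 \<union> I2)}"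
  proof (rule bij_betwI[where g = "\<lambda>Z. (idm J * (?P * Z), idm L * (?P * Z))"])
    have sp: "idm J * (?P * Z) + idm L * (?P * Z) = ?P * Z" if "Z \<in> Mats I1 I2" for Z
      using Mats_split_rows[of "?P * Z" J L I2] Mats_mult[OF p(1) that] JL finJ by simp
    have rec: "P * (idm J * (?P * Z) + idm L * (?P * Z)) = Z" if "Z \<in> Mats I1 I2" for Z
      unfolding sp[OF that] by (rule finv_cancel(1)[OF P fin(1) that])
    have CDm: "C + D \<in> Mats I1 I2" if "C \<in> Mats J I2" "D \<in> Mats L I2" for C D
      by (rule Mats_add[OF Mats_mono[OF that(1) J subset_refl] Mats_mono[OF that(2) _ subset_refl]]) (use JL(1) in auto)
    show "(\<lambda>(C, D). P * (C + D)) \<in> Mats J I2 \<times> Epi L I2 \<rightarrow> {Z \<in> Mats I1 I2. Y + Z \<in> Epi I1 (I1 \<union> I2)}"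
    proof
      fix x :: "'a fmat \<times> 'a fmat" assume "x \<in> Mats J I2 \<times> Epi L I2"
      then obtain C D where x: "x = (C, D)" "C \<in> Mats J I2" "D \<in> Epi L I2" by auto
      then show "(\<lambda>(C, D). P * (C + D)) x \<in> {Z \<in> Mats I1 I2. Y + Z \<in> Epi I1 (I1 \<union> I2)}"
        using key[OF x(2) Epi_Mats[OF x(3)]] Mats_mult[OF p(4) CDm[OF x(2) Epi_Mats[OF x(3)]]] by simp
    qed
    show "(\<lambda>Z. (idm J * (?P * Z), idm L * (?P * Z))) \<in> {Z \<in> Mats I1 I2. Y + Z \<in> Epi I1 (I1 \<union> I2)} \<rightarrow> Mats J I2 \<times> Epi L I2"
    proof
      fix Z assume Z: "Z \<in> {Z \<in> Mats I1 I2. Y + Z \<in> Epi I1 (I1 \<union> I2)}"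
      then have Zm: "Z \<in> Mats I1 I2" and ZE: "Y + Z \<in> Epi I1 (I1 \<union> I2)" by blast+
      have m: "idm J * (?P * Z) \<in> Mats J I2" "idm L * (?P * Z) \<in> Mats L I2"
        using idm_mult_Mats[OF Mats_mult[OF p(1) Zm]] finJ by blast+
      then show "(idm J * (?P * Z), idm L * (?P * Z)) \<in> Mats J I2 \<times> Epi L I2"
        using key[OF m] ZE unfolding rec[OF Zm] by blast
    qed
    show "(\<lambda>Z. (idm J * (?P * Z), idm L * (?P * Z))) ((\<lambda>(C, D). P * (C + D)) x) = x" if "x \<in> Mats J I2 \<times> Epi L I2" for x :: "'a fmat \<times> 'a fmat"
    proof -
      from that obtain C D where x: "x = (C, D)" "C \<in> Mats J I2" "D \<in> Mats L I2" by (auto dest: Epi_Mats)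
      have "?P * (P * (C + D)) = C + D" using finv_cancel(2)[OF P fin(1) CDm[OF x(2,3)]] .
      moreover have "idm J * (C + D) = C" "idm L * (C + D) = D"
        using mult_disjoint[OF idm_Mats x(2) JL(3)] mult_disjoint[OF idm_Mats x(3) JL(2)] idm_mult[OF x(2) finJ(1)] idm_mult[OF x(3) finJ(2)]
        by (simp_all add: distrib_left)
      ultimately show ?thesis using x(1) by simp
    qed
    show "(\<lambda>(C, D). P * (C + D)) (idm J * (?P * Z), idm L * (?P * Z)) = Z" if "Z \<in> {Z \<in> Mats I1 I2. Y + Z \<in> Epi I1 (I1 \<union> I2)}" for Z
      using rec that by simp
  qed
  then have "card {Z \<in> Mats I1 I2. Y + Z \<in> Epi I1 (I1 \<union> I2)} = CARD('a) ^ (card J * card I2) * card (Epi L I2 :: 'a fmat set)"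
    using finJ fin by (simp add: bij_betw_same_card[symmetric] card_cartesian_product card_Mats)
  then show ?thesis using real_card_Epi[OF finJ(2) fin(2), where 'a = 'a] cL cJ by simp
qed

lemma Sym_split:
  fixes ep :: "'a::comm_ring_1"
  assumes "finite I" "finite J" "I \<inter> J = {}" and ep: "ep * ep = 1" and M: "M \<in> Sym ep (I \<union> J)"
  shows "idm I * M * idm I + idm I * M * idm J + ep \<cdot> tr (idm I * M * idm J) + idm J * M * idm J = M"
proof -
  have e: "idm (I \<union> J) * M = M" "M * idm (I \<union> J) = M"
    using idm_mult[OF SymD(1)[OF M]] mult_idm[OF SymD(1)[OF M]] assms(1,2) by simp_all
  have "M = idm (I \<union> J) * M * idm (I \<union> J)" using e by simp
  also have "... = idm I * M * idm I + idm I * M * idm J + idm J * M * idm I + idm J * M * idm J"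
    using assms by (simp add: idm_Un distrib_left distrib_right)
  finally show ?thesis using SymD(2)[OF M] ep by (simp add: mult.assoc)
qed

section \<open>A skew pair rebuilt from the pair induced on the image\<close>

context
  fixes I1 I2 :: "nat set" and ep :: "'a::{field,finite}" and \<mu> :: "nat multiset"
  assumes fin: "finite I1" "finite I2" and dis: "I1 \<inter> I2 = {}" and ep: "ep * ep = 1"
    and \<mu>: "0 \<notin># \<mu>" and c: "card I2 = size \<mu>"
begin

text \<open>With \<open>X = Y + Z\<close> mapping onto \<open>I1\<close>, the form on the image is
  determined by \<open>b(X u, w) = B(u, w)\<close> for \<open>w\<close> in the image. Skewness
  forces the rows of \<open>B\<close> in \<open>I1\<close> to be \<open>- (b * X)\<close>, and
  symmetry then gives its columns in \<open>I1\<close>. Only a block on \<open>I2\<close> remains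
  free.\<close>

definition ext_form :: "'a fmat => 'a fmat => 'a fmat => 'a fmat" where
  "ext_form b Y Z = - (b * Y) + - (b * Z) + ep \<cdot> tr (- (b * Z))"

text \<open>The two conditions say that \<open>X = Y + Z\<close> maps onto \<open>I1\<close> and
  that the rebuilt form is nondegenerate.\<close>

definition ext_set :: "'a fmat \<times> 'a fmat => ('a fmat \<times> 'a fmat) set" where
  "ext_set = (\<lambda>(b, Y). Sigma {Z \<in> Mats I1 I2. Y + Z \<in> Epi I1 (I1 \<union> I2)}
     (\<lambda>Z. {S \<in> Sym ep I2. ext_form b Y Z + S \<in> GLs (I1 \<union> I2)}))"

definition ext_map :: "('a fmat \<times> 'a fmat) \<times> ('a fmat \<times> 'a fmat) => 'a fmat \<times> 'a fmat" where
  "ext_map = (\<lambda>((b, Y), (Z, S)). (ext_form b Y Z + S, Y + Z))"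

lemma ext_facts:
  assumes b: "(b, Y) \<in> Prs 0 (- ep) I1" and Z: "Z \<in> Mats I1 I2"
  shows "b \<in> GLs I1" "Y \<in> Mats I1 I1" "tr b = - (ep \<cdot> b)" "tr Y * b = - (b * Y)" "- (b * Y) \<in> Sym ep I1" "- (b * Z) \<in> Mats I1 I2"
    "ep \<cdot> tr (- (b * Z)) = tr Z * b" "Y + Z \<in> Mats I1 (I1 \<union> I2)"
proof -
  show bG: "b \<in> GLs I1" and Y: "Y \<in> Mats I1 I1" and tb: "tr b = - (ep \<cdot> b)" using b by (auto simp: Prs_def SN_def)
  have "tr Y * b + b * Y = 0" using b by (simp add: Prs_def)
  then show e: "tr Y * b = - (b * Y)" by (simp add: eq_neg_iff_add_eq_0)
  note bm = GLs_Mats[OF bG]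
  show "- (b * Y) \<in> Sym ep I1" using Mats_mult[OF bm Y] by (intro SymI) (simp_all add: tb e)
  show "- (b * Z) \<in> Mats I1 I2" using Mats_mult[OF bm Z] by simp
  show "ep \<cdot> tr (- (b * Z)) = tr Z * b" using ep by (simp add: tb)
  show "Y + Z \<in> Mats I1 (I1 \<union> I2)" by (intro Mats_add Mats_mono[OF Y] Mats_mono[OF Z]) auto
qed

lemma ext_form_cols:
  assumes b: "(b, Y) \<in> Prs 0 (- ep) I1" and Z: "Z \<in> Mats I1 I2" and S: "S \<in> Sym ep I2"
  shows "(ext_form b Y Z + S) * idm I1 = tr (Y + Z) * b"
proof -
  note f = ext_facts[OF b Z]
  have dis': "I2 \<inter> I1 = {}" using dis by auto
  have z: "b * Z * idm I1 = 0" "S * idm I1 = 0"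
    using mult_disjoint[OF Mats_mult[OF GLs_Mats[OF f(1)] Z] idm_Mats dis'] mult_disjoint[OF SymD(1)[OF S] idm_Mats dis'] by simp_all
  have i: "Y * idm I1 = Y" "b * idm I1 = b" using mult_idm[OF f(2) fin(1)] mult_idm[OF GLs_Mats[OF f(1)] fin(1)] by simp_all
  show ?thesis unfolding ext_form_def f(7) using z by (simp add: distrib_right left_diff_distrib mult.assoc i f(4))
qed

lemma ext_form_Sym:
  assumes b: "(b, Y) \<in> Prs 0 (- ep) I1" and Z: "Z \<in> Mats I1 I2" and S: "S \<in> Sym ep I2"
  shows "ext_form b Y Z + S \<in> Sym ep (I1 \<union> I2)"
proof -
  note f = ext_facts[OF b Z]
  have "(\<lambda>(A, C, B). A + C + ep \<cdot> tr C + B) (- (b * Y), - (b * Z), S) \<in> Sym ep (I1 \<union> I2)"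
    using bij_betwE[OF bij_betw_Sym_Un[OF fin dis ep]] f(5,6) S by blast
  then show ?thesis by (simp only: ext_form_def prod.case)
qed

lemma ext_map_in:
  assumes b: "(b, Y) \<in> Prt 0 (- ep) I1 (shift \<mu>)" and ZS: "(Z, S) \<in> ext_set (b, Y)"
  shows "ext_map ((b, Y), (Z, S)) \<in> {(B, X) \<in> Prt 0 ep (I1 \<union> I2) \<mu>. X \<in> Mats I1 (I1 \<union> I2)}"
proof -
  have b': "(b, Y) \<in> Prs 0 (- ep) I1" and ty: "has_type I1 (shift \<mu>) Y" using b by (auto simp: Prt_def)
  have Z: "Z \<in> Mats I1 I2" and E: "Y + Z \<in> Epi I1 (I1 \<union> I2)" and S: "S \<in> Sym ep I2" and G: "ext_form b Y Z + S \<in> GLs (I1 \<union> I2)"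
    using ZS by (auto simp: ext_set_def)
  note f = ext_facts[OF b' Z]
  let ?B = "ext_form b Y Z + S" and ?X = "Y + Z"
  have B: "?B \<in> SN ep (I1 \<union> I2)" using ext_form_Sym[OF b' Z S] G by (simp add: SN_Sym)
  have iX: "idm I1 * ?X = ?X" using idm_mult[OF f(8) fin(1)] by simp
  have "?B * ?X = ?B * idm I1 * ?X" using iX by (simp only: mult.assoc)
  then have BX: "?B * ?X = tr ?X * b * ?X" unfolding ext_form_cols[OF b' Z S] .
  have "tr ?X * ?B = ep \<cdot> (ep \<cdot> (tr ?X * ?B))" using ep by simp
  also have "... = ep \<cdot> tr (?B * ?X)" unfolding tr_mult SND(2)[OF B] by (simp only: smult_mult_right)
  also have "... = - (tr ?X * b * ?X)" unfolding BX using ep by (simp add: f(3) mult.assoc)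
  finally have "tr ?X * ?B + ?B * ?X = 0" unfolding BX by simp
  moreover have Xm: "?X \<in> Mats (I1 \<union> I2) (I1 \<union> I2)" using Mats_mono[OF f(8)] by blast
  ultimately have "(?B, ?X) \<in> Prs 0 ep (I1 \<union> I2)" using B by (simp add: Prs_def)
  moreover have "has_type (I1 \<union> I2) \<mu> ?X"
  proof -
    have dis': "I2 \<inter> I1 = {}" using dis by auto
    have "?X * idm I1 = Y" using mult_disjoint[OF Z idm_Mats dis'] mult_idm[OF f(2) fin(1)] by (simp add: distrib_right)
    then show ?thesis using has_type_Epi[OF fin dis E \<mu> c] ty by simp
  qed
  ultimately show ?thesis using f(8) by (simp add: ext_map_def Prt_def)
qed

lemma inj_on_ext_map: "inj_on ext_map (Sigma (Prt 0 (- ep) I1 (shift \<mu>)) ext_set)"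
proof (rule inj_onI)
  fix x x' assume x: "x \<in> Sigma (Prt 0 (- ep) I1 (shift \<mu>)) ext_set" and x': "x' \<in> Sigma (Prt 0 (- ep) I1 (shift \<mu>)) ext_set"
    and eq: "ext_map x = ext_map x'"
  obtain b Y Z S where xe: "x = ((b, Y), (Z, S))" by (metis surj_pair)
  obtain b' Y' Z' S' where xe': "x' = ((b', Y'), (Z', S'))" by (metis surj_pair)
  have b: "(b, Y) \<in> Prs 0 (- ep) I1" "(b', Y') \<in> Prs 0 (- ep) I1" using x x' by (auto simp: xe xe' Prt_def)
  have Z: "Z \<in> Mats I1 I2" "S \<in> Sym ep I2" "Z' \<in> Mats I1 I2" "S' \<in> Sym ep I2" "Y + Z \<in> Epi I1 (I1 \<union> I2)"
    using x x' by (auto simp: xe xe' ext_set_def)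
  note f = ext_facts[OF b(1) Z(1)] and f' = ext_facts[OF b(2) Z(3)]
  have dis': "I2 \<inter> I1 = {}" using dis by auto
  have XX: "Y + Z = Y' + Z'" and BB: "ext_form b Y Z + S = ext_form b' Y' Z' + S'" using eq by (simp_all add: xe xe' ext_map_def)
  have "(Y + Z) * idm I1 = Y" "(Y' + Z') * idm I1 = Y'"
    using mult_disjoint[OF Z(1) idm_Mats dis'] mult_idm[OF f(2) fin(1)] mult_disjoint[OF Z(3) idm_Mats dis'] mult_idm[OF f'(2) fin(1)]
    by (simp_all add: distrib_right)
  then have YY: "Y = Y'" using XX by simp
  then have ZZ: "Z = Z'" using XX by simp
  have e: "tr (Y + Z) * b = tr (Y + Z) * b'"
    using ext_form_cols[OF b(1) Z(1,2)] ext_form_cols[OF b(2) Z(3,4)] BB XX by simp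
  obtain T where T: "T \<in> Mats (I1 \<union> I2) I1" "(Y + Z) * T = idm I1" using Z(5) by (rule EpiE)
  have tT: "tr T * tr (Y + Z) = idm I1" using arg_cong[OF T(2), of tr] by simp
  have "tr T * (tr (Y + Z) * b) = tr T * (tr (Y + Z) * b')" by (simp only: e)
  then have "idm I1 * b = idm I1 * b'" unfolding mult_eq_assoc[OF tT] .
  then have "b = b'" using idm_mult[OF GLs_Mats[OF f(1)] fin(1)] idm_mult[OF GLs_Mats[OF f'(1)] fin(1)] by simp
  then show "x = x'" using BB YY ZZ by (simp add: xe xe')
qed

text \<open>The form on the image is \<open>b(w, w') = B(T w, w')\<close> with a right inverse
  \<open>T\<close> of \<open>X\<close>. This is independent of \<open>T\<close>, because the kernel
  of a skew map is orthogonal to its image.\<close>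

lemma ext_map_onto:
  assumes BX: "(B, X) \<in> Prt 0 ep (I1 \<union> I2) \<mu>" and X: "X \<in> Mats I1 (I1 \<union> I2)"
  shows "(B, X) \<in> ext_map ` Sigma (Prt 0 (- ep) I1 (shift \<mu>)) ext_set"
proof -
  let ?I = "I1 \<union> I2"
  have I: "finite ?I" using fin by simp
  have B: "B \<in> GLs ?I" "tr B = ep \<cdot> B" and skew: "tr X * B + B * X = 0" and ty: "has_type ?I \<mu> X"
    using BX by (auto simp: Prt_def Prs_def SN_def)
  have "card (kpow ?I X (Suc 0)) = CARD('a) ^ kdim \<mu> (Suc 0)" using ty unfolding has_type_def by blast
  then have k: "card (kerf ?I X) = CARD('a) ^ card I2" using kdim_1[OF \<mu>] c by (simp add: kerf_kpow)
  have E: "X \<in> Epi I1 ?I"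
    using k fin dis by (intro Epi_of_kernel X) (simp_all add: card_Un_disjoint power_add)
  obtain T where T: "T \<in> Mats ?I I1" "X * T = idm I1" using E by (rule EpiE)
  have tT: "tr T * tr X = idm I1" using T(2) by (simp flip: tr_mult)
  define Y Z where "Y = X * idm I1" and "Z = X * idm I2"
  have Y: "Y \<in> Mats I1 I1" and Z: "Z \<in> Mats I1 I2" unfolding Y_def Z_def using mult_idm_Mats[OF X] fin by blast+
  have XYZ: "Y + Z = X" unfolding Y_def Z_def using Mats_split_cols[OF X fin dis] by simp
  define b where "b = tr T * B * idm I1"
  have bm: "b \<in> Mats I1 I1" unfolding b_def using Mats_mult[OF Mats_mult[of "tr T" I1 ?I, OF _ GLs_Mats[OF B(1)]] idm_Mats] T(1) by simp
  have BX': "B * X = - (tr X * B)" using skew by (simp add: eq_neg_iff_add_eq_0 add.commute)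
  have Bi: "B * idm I1 = - (tr X * B * T)" using BX' by (simp add: T(2)[symmetric] mult.assoc[symmetric])
  \<comment> \<open>The identity \<open>b(X u, w) = B(u, w)\<close>: \<open>idm I1\<close> is
    written as \<open>X * T\<close>, and skewness moves \<open>X\<close> to the other
    argument.\<close>
  have Xb: "tr X * b = B * idm I1"
  proof -
    have XTX: "tr X * (tr T * tr X) = tr X" unfolding tT using mult_idm[of "tr X" ?I I1 I1] X fin by simp
    have "tr X * b = - (tr X * (tr T * tr X) * (B * T))" unfolding b_def mult.assoc Bi by simp
    then show ?thesis unfolding XTX Bi by (simp add: mult.assoc)
  qed
  \<comment> \<open>Moving \<open>X\<close> across \<open>B\<close> costs one sign, so the induced
    form has the opposite symmetry.\<close>
  have tb: "tr b = - (ep \<cdot> b)"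
  proof -
    have "b = - (tr T * tr X * (B * T))" unfolding b_def mult.assoc Bi by simp
    then have "b = - (idm I1 * (B * T))" unfolding tT .
    moreover have "tr b = ep \<cdot> (idm I1 * (B * T))" unfolding b_def by (simp add: B(2) mult.assoc)
    ultimately show ?thesis by simp
  qed
  have bG: "b \<in> GLs I1"
  proof (rule GLsI_left[OF fin(1) bm])
    show "idm I1 * (finv ?I B * tr X) \<in> Mats I1 I1"
      using idm_mult_Mats[OF Mats_mult[OF finv_props(1)[OF B(1)], of "tr X" ?I I1] fin(1)] X by simp
    have "finv ?I B * (B * idm I1) = idm I1"
      by (rule finv_cancel(2)[OF B(1) I, of _ I1]) (rule Mats_idm, auto)
    then show "idm I1 * (finv ?I B * tr X) * b = idm I1" using fin by (simp add: mult.assoc Xb idm_mult_idm)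
  qed
  have bX: "b * X = - (idm I1 * B)"
  proof -
    have "tr b * X = ep \<cdot> (idm I1 * B)" using arg_cong[OF Xb, of tr] B(2) by simp
    then have "ep \<cdot> (tr b * X) = ep \<cdot> (ep \<cdot> (idm I1 * B))" by simp
    then have "- (b * X) = idm I1 * B" unfolding tb using ep by simp
    then show ?thesis using minus_equation_iff[of "b * X" "idm I1 * B"] by simp
  qed
  have bY: "b * Y = - (idm I1 * B * idm I1)" and bZ: "b * Z = - (idm I1 * B * idm I2)"
    unfolding Y_def Z_def using bX by (simp_all add: mult.assoc[symmetric])
  have "tr Y * b = idm I1 * B * idm I1" unfolding Y_def by (simp add: mult.assoc Xb)
  then have "tr Y * b + b * Y = 0" unfolding bY by simp
  then have bPrs: "(b, Y) \<in> Prs 0 (- ep) I1" using bG tb Y by (simp add: Prs_def SN_def)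
  have "has_type I1 (shift \<mu>) Y" using has_type_Epi[OF fin dis E \<mu> c] ty by (simp add: Y_def)
  then have bPrt: "(b, Y) \<in> Prt 0 (- ep) I1 (shift \<mu>)" using bPrs by (simp add: Prt_def)
  define S where "S = idm I2 * B * idm I2"
  have S: "S \<in> Sym ep I2"
    unfolding S_def using Mats_mult[OF idm_mult_Mats[OF GLs_Mats[OF B(1)] fin(2)] idm_Mats] B(2) by (intro SymI) (simp_all add: mult.assoc)
  have "B \<in> Sym ep ?I" using B by (simp add: Sym_def GLs_Mats)
  from Sym_split[OF fin dis ep this] have BB: "ext_form b Y Z + S = B"
    unfolding ext_form_def bY bZ S_def by simp
  have "(Z, S) \<in> ext_set (b, Y)" using Z S E B(1) by (simp add: ext_set_def XYZ BB)
  then have "((b, Y), (Z, S)) \<in> Sigma (Prt 0 (- ep) I1 (shift \<mu>)) ext_set" using bPrt by blast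
  moreover have "(B, X) = ext_map ((b, Y), (Z, S))" by (simp add: ext_map_def BB XYZ)
  ultimately show ?thesis by (rule rev_image_eqI)
qed

lemma bij_betw_ext_map:
  "bij_betw ext_map (Sigma (Prt 0 (- ep) I1 (shift \<mu>)) ext_set) {(B, X) \<in> Prt 0 ep (I1 \<union> I2) \<mu>. X \<in> Mats I1 (I1 \<union> I2)}"
  unfolding bij_betw_def
proof (intro conjI inj_on_ext_map subset_antisym subsetI)
  fix y assume "y \<in> ext_map ` Sigma (Prt 0 (- ep) I1 (shift \<mu>)) ext_set"
  then obtain x where x: "x \<in> Sigma (Prt 0 (- ep) I1 (shift \<mu>)) ext_set" "y = ext_map x" by blast
  obtain b Y Z S where xe: "x = ((b, Y), (Z, S))" by (metis surj_pair)
  then have "(b, Y) \<in> Prt 0 (- ep) I1 (shift \<mu>)" "(Z, S) \<in> ext_set (b, Y)" "y = ext_map ((b, Y), (Z, S))"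
    using x by auto
  then show "y \<in> {(B, X) \<in> Prt 0 ep (I1 \<union> I2) \<mu>. X \<in> Mats I1 (I1 \<union> I2)}" using ext_map_in by simp
next
  fix y assume "y \<in> {(B, X) \<in> Prt 0 ep (I1 \<union> I2) \<mu>. X \<in> Mats I1 (I1 \<union> I2)}"
  then show "y \<in> ext_map ` Sigma (Prt 0 (- ep) I1 (shift \<mu>)) ext_set" using ext_map_onto by (cases y) simp
qed

end

definition gl :: "real => nat => nat => real" where
  "gl q m n = (\<Prod>i<m. q ^ n - q ^ i)"

text \<open>\<open>Z\<close> is counted by \<open>card_Epi_completions\<close>, and for each
  \<open>Z\<close> the block \<open>S\<close> by \<open>completion\<close>. The given block row
  there is \<open>- (b * (Y + Z))\<close>, and its part on \<open>I1\<close> has the same kernel as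
  \<open>Y\<close>.\<close>

lemma card_ext_set:
  fixes ep :: "'a::{field,finite}"
  defines "q \<equiv> real CARD('a)"
  assumes two: "(2 :: 'a) ~= 0" and eps: "ep = 1 \<or> ep = -1"
    and fin: "finite I1" "finite I2" and dis: "I1 \<inter> I2 = {}"
    and \<mu>: "0 \<notin># \<mu>" and c1: "card I2 = size \<mu>" and x: "(b, Y) \<in> Prt 0 (- ep) I1 (shift \<mu>)"
  shows "real (card (ext_set I1 I2 ep (b, Y))) * q ^ sexp ep (card I2 - size (shift \<mu>)) =
    q ^ ((card I1 - size (shift \<mu>)) * card I2) * gl q (size (shift \<mu>)) (card I2) * (q ^ sexp ep (card I2) * snf ep (card I2 - size (shift \<mu>)))"
proof -
  have ep: "ep * ep = 1" using eps by auto
  have xs: "(b, Y) \<in> Prs 0 (- ep) I1" and ty: "has_type I1 (shift \<mu>) Y" using x by (auto simp: Prt_def)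
  have bG: "b \<in> GLs I1" and Ym: "Y \<in> Mats I1 I1" using xs by (auto simp: Prs_def SN_def)
  have "card (kpow I1 Y (Suc 0)) = CARD('a) ^ kdim (shift \<mu>) (Suc 0)" using ty unfolding has_type_def by blast
  then have k: "card (kerf I1 Y) = CARD('a) ^ size (shift \<mu>)" using kdim_1[of "shift \<mu>"] by (simp add: kerf_kpow)
  have kA: "card (kerf I1 (- (b * Y))) = CARD('a) ^ size (shift \<mu>)"
  proof -
    have "kerf I1 (- (b * Y)) = kerf I1 (b * Y)" by (simp add: kerf_def)
    then show ?thesis using k kerf_GLs_mult[OF bG fin(1) Ym] by simp
  qed
  let ?ZZ = "{Z \<in> Mats I1 I2. Y + Z \<in> Epi I1 (I1 \<union> I2)}"
  let ?SS = "\<lambda>Z. {S \<in> Sym ep I2. ext_form ep b Y Z + S \<in> GLs (I1 \<union> I2)}"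
  have cS: "real (card (?SS Z)) * q ^ sexp ep (card I2 - size (shift \<mu>)) = q ^ sexp ep (card I2) * snf ep (card I2 - size (shift \<mu>))"
    if Z: "Z \<in> ?ZZ" for Z
  proof -
    have Zm: "Z \<in> Mats I1 I2" and ZE: "Y + Z \<in> Epi I1 (I1 \<union> I2)" using Z by blast+
    note f = ext_facts[OF fin dis ep \<mu> c1 xs Zm]
    obtain T where T: "T \<in> Mats (I1 \<union> I2) I1" "(Y + Z) * T = idm I1" using ZE by (rule EpiE)
    have "- (b * Y) + - (b * Z) \<in> Epi I1 (I1 \<union> I2)"
    proof (rule EpiI)
      have e: "- (b * Y) + - (b * Z) = - (b * (Y + Z))" by (simp add: distrib_left)
      show "- (b * Y) + - (b * Z) \<in> Mats I1 (I1 \<union> I2)"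
        unfolding e Mats_uminus by (rule Mats_mult[OF GLs_Mats[OF bG] f(8)])
      show "- (T * finv I1 b) \<in> Mats (I1 \<union> I2) I1" using Mats_mult[OF T(1) finv_props(1)[OF bG]] by simp
      have "b * (Y + Z) * (T * finv I1 b) = b * ((Y + Z) * T * finv I1 b)" by (simp only: mult.assoc)
      also have "... = idm I1"
        unfolding T(2) using idm_mult[OF finv_props(1)[OF bG] fin(1)] finv_props(2)[OF bG] by simp
      finally show "(- (b * Y) + - (b * Z)) * - (T * finv I1 b) = idm I1" unfolding e by simp
    qed
    from completion[OF fin dis ep f(5,6) this kA]
    obtain I3 where I3: "I3 \<subseteq> I2" "card I3 + size (shift \<mu>) = card I2"
      "card (?SS Z) * card (Sym ep I3) = card (Sym ep I2) * card (SN ep I3)"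
      unfolding ext_form_def[OF fin dis ep \<mu> c1, symmetric] by blast
    have fin3: "finite I3" using I3(1) fin(2) finite_subset by blast
    have "real (card (?SS Z)) * real (card (Sym ep I3)) = real (card (Sym ep I2)) * real (card (SN ep I3))"
      using arg_cong[OF I3(3), of real] by simp
    moreover have "card I3 = card I2 - size (shift \<mu>)" using I3(2) by simp
    ultimately show ?thesis
      unfolding real_card_SN[OF two eps fin3] card_Sym[OF two eps fin3] card_Sym[OF two eps fin(2)] q_def by simp
  qed
  have "ext_set I1 I2 ep (b, Y) = Sigma ?ZZ ?SS" by (simp add: ext_set_def[OF fin dis ep \<mu> c1])
  then have "real (card (ext_set I1 I2 ep (b, Y))) = (\<Sum>Z\<in>?ZZ. real (card (?SS Z)))"
    using fin by (simp add: card_SigmaI)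
  then have "real (card (ext_set I1 I2 ep (b, Y))) * q ^ sexp ep (card I2 - size (shift \<mu>)) =
      (\<Sum>Z\<in>?ZZ. q ^ sexp ep (card I2) * snf ep (card I2 - size (shift \<mu>)))"
    using cS by (simp add: sum_distrib_right)
  also have "... = real (card ?ZZ) * (q ^ sexp ep (card I2) * snf ep (card I2 - size (shift \<mu>)))" by simp
  finally show ?thesis using card_Epi_completions[OF fin dis Ym k] by (simp add: q_def gl_def)
qed

text \<open>\<open>\<Phi>\<close> describes a normal form and \<open>\<Omega>\<close> the pairs that
  can be brought to it. Each such pair has \<open>K\<close> base changes that do so, and each base
  change reaches every normal form once. Hence the weight of the family is the number of normal
  forms divided by \<open>K\<close>.\<close>

lemma card_conj_classes:
  fixes ep th :: "'a::{field,finite}"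
  assumes I: "finite I"
    and \<Phi>: "\<And>P B T. P \<in> GLs I ==> T \<in> Mats I I ==> \<Phi> (finv I P * T * P) \<longleftrightarrow> \<Psi> P T"
    and K: "\<And>B T. (B, T) \<in> Prs th ep I ==> \<Omega> T ==> card {P \<in> GLs I. \<Psi> P T} = K"
    and N: "\<And>P T. P \<in> GLs I ==> T \<in> Mats I I ==> \<Psi> P T ==> \<Omega> T"
  shows "card {(B, T) \<in> Prs th ep I. \<Omega> T} * K = card (GLs I :: 'a fmat set) * card {(B, T) \<in> Prs th ep I. \<Phi> T}"
proof (rule double_count[where R = "\<lambda>x P. \<Psi> P (snd x)"])
  show "finite {(B, T) \<in> Prs th ep I. \<Omega> T}" by (rule finite_subset[of _ "Prs th ep I"]) (use I in auto)
  show "finite (GLs I :: 'a fmat set)" using I by simp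
  show "card {g \<in> GLs I. \<Psi> g (snd x)} = K" if "x \<in> {(B, T) \<in> Prs th ep I. \<Omega> T}" for x
    using that K[of "fst x" "snd x"] by (cases x) simp
  show "card {x \<in> {(B, T) \<in> Prs th ep I. \<Omega> T}. \<Psi> P (snd x)} = card {(B, T) \<in> Prs th ep I. \<Phi> T}" if P: "P \<in> GLs I" for P
  proof -
    have m: "T \<in> Mats I I" if "(B, T) \<in> Prs th ep I" for B T using that by (simp add: Prs_def)
    have "{x \<in> {(B, T) \<in> Prs th ep I. \<Omega> T}. \<Psi> P (snd x)} = {x \<in> Prs th ep I. \<Phi> (snd (cong_pair I P x))}"
    proof (rule Set.set_eqI)
      fix x :: "'a fmat \<times> 'a fmat"
      obtain B T where x: "x = (B, T)" by (metis surj_pair)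
      show "x \<in> {x \<in> {(B, T) \<in> Prs th ep I. \<Omega> T}. \<Psi> P (snd x)} \<longleftrightarrow> x \<in> {x \<in> Prs th ep I. \<Phi> (snd (cong_pair I P x))}"
        using \<Phi>[OF P m, of B T] N[OF P m, of B T] by (auto simp: x cong_pair_def)
    qed
    moreover have "{(B, T) \<in> Prs th ep I. \<Phi> T} = {x \<in> Prs th ep I. \<Phi> (snd x)}" by auto
    ultimately show ?thesis
      using bij_betw_same_card[OF bij_betw_cong_pair[OF I P, of th ep "\<lambda>x. \<Phi> (snd x)"]] by simp
  qed
qed

text \<open>The normal forms are the pairs in which \<open>X\<close> maps onto the coordinates
  \<open>I1\<close>; they are the extensions of pairs on \<open>I1\<close>, and
  \<open>card_adapted\<close> gives the number of base changes. The powers of \<open>q\<close> that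
  depend on \<open>card I1\<close> cancel, so the factors involve only the first two columns, of
  lengths \<open>size \<mu>\<close> and \<open>size (shift \<mu>)\<close>.\<close>

theorem column_recursion:
  fixes ep :: "'a::{field,finite}"
  defines "q \<equiv> real CARD('a)"
  assumes two: "(2 :: 'a) ~= 0" and eps: "ep = 1 \<or> ep = -1"
    and fin: "finite I1" "finite I2" and dis: "I1 \<inter> I2 = {}"
    and \<mu>: "0 \<notin># \<mu>" and c1: "card I2 = size \<mu>" and r: "card I1 = sum_mset (shift \<mu>)"
  defines "a \<equiv> \<lambda>ep I \<mu>. real (card (Prt 0 (ep :: 'a) I \<mu>)) / real (card (GLs I :: 'a fmat set))"
  shows "a ep (I1 \<union> I2) \<mu> * (q ^ sexp ep (size \<mu> - size (shift \<mu>)) * q ^ (size \<mu> * size (shift \<mu>)) * gl q (size \<mu>) (size \<mu>)) =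
    a (- ep) I1 (shift \<mu>) * (gl q (size (shift \<mu>)) (size \<mu>) * q ^ sexp ep (size \<mu>) * snf ep (size \<mu> - size (shift \<mu>)))"
proof -
  let ?I = "I1 \<union> I2"
  have I: "finite ?I" using fin by simp
  have ep: "ep * ep = 1" using eps by auto
  have q1: "q > 1" unfolding q_def using one_less_card_field[where 'a = 'a] by simp
  have le: "size (shift \<mu>) \<le> size \<mu>"
    using size_mset_mono[OF multiset_filter_subset[of "\<lambda>j. 1 < j" \<mu>]] by (simp add: shift_def)
  have le2: "size (shift \<mu>) \<le> card I1" unfolding r by (rule size_le_sum_mset) simp
  let ?N = "{(B, X) \<in> Prt 0 ep ?I \<mu>. X \<in> Mats I1 ?I}"
  let ?K = "card (GLs I1 :: 'a fmat set) * card (GLs I2 :: 'a fmat set) * CARD('a) ^ (card I1 * card I2)"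
  have "card {(B, X) \<in> Prs 0 ep ?I. has_type ?I \<mu> X} * ?K =
      card (GLs ?I :: 'a fmat set) * card {(B, X) \<in> Prs 0 ep ?I. has_type ?I \<mu> X & X \<in> Mats I1 ?I}"
  proof (rule card_conj_classes[OF I, where \<Psi> = "\<lambda>P X. has_type ?I \<mu> X & finv ?I P * X \<in> Mats I1 ?I"])
    fix P X :: "'a fmat" assume P: "P \<in> GLs ?I" and X: "X \<in> Mats ?I ?I"
    have PX: "finv ?I P * X \<in> Mats ?I ?I" using finv_props(1)[OF P] X by (rule Mats_mult)
    have "finv ?I P * X * P \<in> Mats I1 ?I \<longleftrightarrow> finv ?I P * X \<in> Mats I1 ?I"
    proof
      assume "finv ?I P * X * P \<in> Mats I1 ?I"
      then have "finv ?I P * X * P * finv ?I P \<in> Mats I1 ?I" using finv_props(1)[OF P] by (rule Mats_mult)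
      then show "finv ?I P * X \<in> Mats I1 ?I" unfolding finv_cancel_right(1)[OF P I PX] .
    next
      assume "finv ?I P * X \<in> Mats I1 ?I"
      then show "finv ?I P * X * P \<in> Mats I1 ?I" using GLs_Mats[OF P] by (rule Mats_mult)
    qed
    then show "(has_type ?I \<mu> (finv ?I P * X * P) & finv ?I P * X * P \<in> Mats I1 ?I) =
        (has_type ?I \<mu> X & finv ?I P * X \<in> Mats I1 ?I)"
      using has_type_conj[OF I P X] by simp
  next
    fix B X :: "'a fmat" assume "(B, X) \<in> Prs 0 ep ?I" and ty: "has_type ?I \<mu> X"
    then have X: "X \<in> Mats ?I ?I" by (simp add: Prs_def)
    have "card (kpow ?I X (Suc 0)) = CARD('a) ^ kdim \<mu> (Suc 0)" using ty unfolding has_type_def by blast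
    then have k: "card (kerf ?I X) = CARD('a) ^ card I2" using kdim_1[OF \<mu>] c1 by (simp add: kerf_kpow)
    show "card {P \<in> GLs ?I. has_type ?I \<mu> X & finv ?I P * X \<in> Mats I1 ?I} = ?K"
      using card_adapted[OF fin dis X k] ty by simp
  qed simp
  moreover have "{(B, X) \<in> Prs 0 ep ?I. has_type ?I \<mu> X} = Prt 0 ep ?I \<mu>" by (simp add: Prt_def)
  moreover have "{(B, X) \<in> Prs 0 ep ?I. has_type ?I \<mu> X & X \<in> Mats I1 ?I} = ?N" by (auto simp: Prt_def)
  ultimately have 1: "card (Prt 0 ep ?I \<mu>) * ?K = card (GLs ?I :: 'a fmat set) * card ?N" by simp
  let ?E = "ext_set I1 I2 ep"
  define C where "C = q ^ ((card I1 - size (shift \<mu>)) * card I2) * gl q (size (shift \<mu>)) (card I2) *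
    (q ^ sexp ep (card I2) * snf ep (card I2 - size (shift \<mu>)))"
  have "card ?N = card (Sigma (Prt 0 (- ep) I1 (shift \<mu>)) ?E)"
    by (rule bij_betw_same_card[OF bij_betw_ext_map[OF fin dis ep \<mu> c1], symmetric])
  also have "... = (\<Sum>x\<in>Prt 0 (- ep) I1 (shift \<mu>). card (?E x))"
  proof (rule card_SigmaI)
    show "finite (Prt 0 (- ep) I1 (shift \<mu>))" using fin by simp
    show "\<forall>x\<in>Prt 0 (- ep) I1 (shift \<mu>). finite (?E x)"
    proof
      fix x :: "'a fmat \<times> 'a fmat"
      obtain b Y where x: "x = (b, Y)" by (metis surj_pair)
      have "?E x \<subseteq> Mats I1 I2 \<times> Sym ep I2" unfolding ext_set_def[OF fin dis ep \<mu> c1] x by auto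
      then show "finite (?E x)" by (rule finite_subset) (use fin in simp)
    qed
  qed
  finally have "real (card ?N) * q ^ sexp ep (card I2 - size (shift \<mu>)) =
      (\<Sum>x\<in>Prt 0 (- ep) I1 (shift \<mu>). real (card (?E x)) * q ^ sexp ep (card I2 - size (shift \<mu>)))"
    by (simp add: sum_distrib_right)
  also have "... = (\<Sum>x\<in>Prt 0 (- ep) I1 (shift \<mu>). C)"
  proof (rule sum.cong[OF refl])
    fix x :: "'a fmat \<times> 'a fmat" assume "x \<in> Prt 0 (- ep) I1 (shift \<mu>)"
    moreover obtain b Y where x: "x = (b, Y)" by (metis surj_pair)
    ultimately show "real (card (?E x)) * q ^ sexp ep (card I2 - size (shift \<mu>)) = C"
      using card_ext_set[OF two eps fin dis \<mu> c1, of b Y] unfolding C_def q_def by simp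
  qed
  finally have 2: "real (card ?N) * q ^ sexp ep (card I2 - size (shift \<mu>)) = real (card (Prt 0 (- ep) I1 (shift \<mu>))) * C" by simp
  have g2: "real (card (GLs I2 :: 'a fmat set)) = gl q (size \<mu>) (size \<mu>)"
    using real_card_GLs[OF fin(2), where 'a = 'a] c1 by (simp add: gl_def q_def)
  let ?g = "real (card (GLs ?I :: 'a fmat set))" and ?g1 = "real (card (GLs I1 :: 'a fmat set))"
  have g: "?g > 0" "?g1 > 0" using card_GLs_pos[OF I, where 'a = 'a] card_GLs_pos[OF fin(1), where 'a = 'a] by simp_all
  let ?A = "real (card (Prt 0 ep ?I \<mu>))" and ?A1 = "real (card (Prt 0 (- ep) I1 (shift \<mu>)))"
  let ?s = "q ^ sexp ep (size \<mu> - size (shift \<mu>))"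
  let ?r = "card I1" and ?c1 = "size \<mu>" and ?c2 = "size (shift \<mu>)"
  have "?A * (?g1 * gl q ?c1 ?c1 * q ^ (?r * ?c1)) = ?g * real (card ?N)"
    using arg_cong[OF 1, of real] by (simp add: g2 c1 q_def)
  then have "?A * (?g1 * gl q ?c1 ?c1 * q ^ (?r * ?c1)) * ?s = ?g * (?A1 * C)"
    using 2 c1 by (simp add: mult.assoc)
  moreover have "q ^ (?r * ?c1) = q ^ ((?r - ?c2) * ?c1) * q ^ (?c1 * ?c2)"
    using le2 by (simp add: power_add[symmetric] algebra_simps)
  moreover have "C = q ^ ((?r - ?c2) * ?c1) * (gl q ?c2 ?c1 * q ^ sexp ep ?c1 * snf ep (?c1 - ?c2))"
    unfolding C_def c1 by (simp add: mult.assoc)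
  ultimately have "q ^ ((?r - ?c2) * ?c1) * (?A * ?g1 * (?s * q ^ (?c1 * ?c2) * gl q ?c1 ?c1)) =
      q ^ ((?r - ?c2) * ?c1) * (?g * ?A1 * (gl q ?c2 ?c1 * q ^ sexp ep ?c1 * snf ep (?c1 - ?c2)))"
    by (simp add: mult_ac)
  then have "?A * ?g1 * (?s * q ^ (?c1 * ?c2) * gl q ?c1 ?c1) = ?g * ?A1 * (gl q ?c2 ?c1 * q ^ sexp ep ?c1 * snf ep (?c1 - ?c2))"
    using q1 by simp
  then show ?thesis unfolding a_def using g by (simp add: field_simps)
qed

section \<open>The weight of a type in closed form\<close>

definition pev :: "real => nat => real" where
  "pev q k = (\<Prod>i=1..k. 1 - 1 / q ^ (2 * i))"

lemma pev_0 [simp]: "pev q 0 = 1" by (simp add: pev_def)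
lemma pev_Suc: "pev q (Suc k) = pev q k * (1 - 1 / q ^ (2 * Suc k))" by (simp add: pev_def)
lemma pev_pos: "q > 1 ==> pev q k > 0"
  unfolding pev_def by (rule prod_pos) (simp add: one_less_power)
lemma podd_pos: "q > 1 ==> podd q k > 0"
  unfolding podd_def by (rule prod_pos) (simp add: one_less_power del: power_Suc)

lemma prod_odd_even: "(\<Prod>j=1..m. 1 - 1 / q ^ j) = podd q (Suc m div 2) * pev q (m div 2)"
proof (induction m)
  case (Suc m)
  show ?case
  proof (cases "even m")
    case True
    then obtain k where "m = 2 * k" by blast
    then show ?thesis using Suc by (simp add: podd_Suc)
  next
    case False
    then obtain k where "m = 2 * k + 1" using oddE by blast
    then show ?thesis using Suc by (simp add: pev_Suc)
  qed
qed simp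

text \<open>In the application \<open>n\<close> and \<open>k\<close> are the lengths of the first
  two columns, so \<open>n - k\<close> is the multiplicity of the part 1.\<close>

lemma gl_split:
  assumes q: "q > 1" and le: "k \<le> n"
  shows "gl q n n = gl q k n * q ^ (n * (n - k)) * (\<Prod>j=1..n - k. 1 - 1 / q ^ j)"
proof -
  have "gl q n n = gl q k n * (\<Prod>i\<in>{k..<n}. q ^ n - q ^ i)"
    unfolding gl_def using le prod.atLeastLessThan_concat[of 0 k n "\<lambda>i. q ^ n - q ^ i"] by (simp add: lessThan_atLeast0)
  also have "(\<Prod>i\<in>{k..<n}. q ^ n - q ^ i) = (\<Prod>j\<in>{1..n - k}. q ^ n * (1 - 1 / q ^ j))"
  proof (rule prod.reindex_bij_witness[of _ "\<lambda>j. n - j" "\<lambda>i. n - i"])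
    fix i assume i: "i \<in> {k..<n}"
    then have "q ^ n = q ^ i * q ^ (n - i)" by (simp add: power_add[symmetric])
    then show "q ^ n * (1 - 1 / q ^ (n - i)) = q ^ n - q ^ i" using q by (simp add: right_diff_distrib)
  qed (use le in auto)
  also have "... = q ^ (n * (n - k)) * (\<Prod>j=1..n - k. 1 - 1 / q ^ j)"
    by (simp add: prod.distrib power_mult)
  finally show ?thesis by simp
qed

lemma count_shift: "count (shift \<mu>) i = (if i = 0 then 0 else count \<mu> (Suc i))"
proof (induction \<mu>)
  case (add x \<mu>)
  then show ?case by (cases "1 < x") (auto simp: shift_def)
qed (simp add: shift_def)

lemma size_shift: "0 \<notin># \<mu> ==> size \<mu> = count \<mu> 1 + size (shift \<mu>)"
proof (induction \<mu>)
  case (add x \<mu>)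
  have p: "0 \<notin># \<mu>" "x ~= 0" using add.prems by simp_all
  note IH = add.IH[OF p(1)]
  consider "x = 1" | "1 < x" using p(2) by linarith
  then show ?case by cases (use IH in \<open>simp_all add: shift_def\<close>)
qed (simp add: shift_def)

text \<open>The multiplicity of \<open>i + 1\<close> becomes that of \<open>i\<close>, and the
  multiplicity of 1 splits off as a factor. The condition on \<open>f 0\<close> absorbs parts that
  do not occur.\<close>

lemma prod_shift:
  fixes f :: "nat => real"
  assumes f0: "f 0 = 1" and \<mu>: "0 \<notin># \<mu>"
  shows "(\<Prod>i\<in>set_mset \<mu>. f (count \<mu> i)) = f (count \<mu> 1) * (\<Prod>i\<in>set_mset (shift \<mu>). f (count (shift \<mu>) i))"
proof -
  let ?T = "Suc ` set_mset (shift \<mu>)"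
  have n1: "1 \<notin> ?T" using shift_partition[of \<mu>] by auto
  have sub: "set_mset \<mu> \<subseteq> insert 1 ?T"
  proof
    fix i assume i: "i \<in># \<mu>"
    show "i \<in> insert 1 ?T"
    proof (cases "i = 1")
      case False
      then have i1: "1 < i" using i \<mu> by (cases i) auto
      have "count (shift \<mu>) (i - 1) > 0" using i1 i by (simp add: count_shift)
      then have "i - 1 \<in># shift \<mu>" by simp
      then show ?thesis using i1 by (intro insertI2 image_eqI[of _ _ "i - 1"]) simp_all
    qed simp
  qed
  have "(\<Prod>i\<in>set_mset \<mu>. f (count \<mu> i)) = (\<Prod>i\<in>insert 1 ?T. f (count \<mu> i))"
  proof (rule prod.mono_neutral_left[OF _ sub])
    show "\<forall>i\<in>insert 1 ?T - set_mset \<mu>. f (count \<mu> i) = 1" using f0 by (auto simp: not_in_iff)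
  qed simp
  also have "... = f (count \<mu> 1) * (\<Prod>i\<in>?T. f (count \<mu> i))" using n1 by simp
  also have "(\<Prod>i\<in>?T. f (count \<mu> i)) = (\<Prod>i\<in>set_mset (shift \<mu>). f (count \<mu> (Suc i)))"
    by (subst prod.reindex) simp_all
  also have "... = (\<Prod>i\<in>set_mset (shift \<mu>). f (count (shift \<mu>) i))"
  proof (rule prod.cong[OF refl])
    fix i assume "i \<in># shift \<mu>"
    then have "i ~= 0" using shift_partition[of \<mu>] by (cases i) simp_all
    then show "f (count \<mu> (Suc i)) = f (count (shift \<mu>) i)" by (simp add: count_shift)
  qed
  finally show ?thesis .
qed

lemma conj_part_Suc: "conj_part \<mu> (Suc (Suc i)) = conj_part (shift \<mu>) (Suc i)"
proof (induction \<mu>)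
  case (add x \<mu>)
  then show ?case by (cases "1 < x") (auto simp: conj_part_def shift_def)
qed (simp add: conj_part_def shift_def)

lemma conj_part_1: "0 \<notin># \<mu> ==> conj_part \<mu> (Suc 0) = size \<mu>"
proof -
  assume "0 \<notin># \<mu>"
  then have "filter_mset (\<lambda>j. Suc 0 \<le> j) \<mu> = \<mu>" by (intro filter_mset_eq_conv[THEN iffD2]) (auto simp: Suc_le_eq intro: gr0I)
  then show ?thesis by (simp add: conj_part_def)
qed

lemma conj_part_zero: "sum_mset \<mu> < i ==> conj_part \<mu> i = 0"
proof -
  assume i: "sum_mset \<mu> < i"
  have "filter_mset (\<lambda>j. i \<le> j) \<mu> = {#}"
  proof (rule ccontr)
    assume "filter_mset (\<lambda>j. i \<le> j) \<mu> ~= {#}"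
    then obtain j where "j \<in># filter_mset (\<lambda>j. i \<le> j) \<mu>" by (rule multiset_nonemptyE)
    then have j: "j \<in># \<mu>" "i \<le> j" by simp_all
    from multi_member_split[OF j(1)] obtain \<nu> where "\<mu> = add_mset j \<nu>" by blast
    then show False using i j(2) by simp
  qed
  then show ?thesis by (simp add: conj_part_def)
qed

lemma n_stat_upto: "sum_mset \<mu> \<le> N ==> n_stat \<mu> = (\<Sum>i = 1..N. conj_part \<mu> i choose 2)"
  unfolding n_stat_def by (rule sum.mono_neutral_left) (auto simp: conj_part_zero)

lemma n_stat_shift:
  assumes \<mu>: "0 \<notin># \<mu>" shows "n_stat \<mu> = (size \<mu> choose 2) + n_stat (shift \<mu>)"
proof -
  let ?N = "sum_mset \<mu>"
  have "n_stat \<mu> = (\<Sum>i = 1..Suc ?N. conj_part \<mu> i choose 2)" by (rule n_stat_upto) simp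
  also have "... = (conj_part \<mu> (Suc 0) choose 2) + (\<Sum>i = Suc 1..Suc ?N. conj_part \<mu> i choose 2)"
    by (subst sum.atLeast_Suc_atMost) simp_all
  also have "(\<Sum>i = Suc 1..Suc ?N. conj_part \<mu> i choose 2) = (\<Sum>i = 1..?N. conj_part \<mu> (Suc i) choose 2)"
    by (rule sum.shift_bounds_cl_Suc_ivl)
  also have "... = (\<Sum>i = 1..?N. conj_part (shift \<mu>) i choose 2)"
  proof (rule sum.cong[OF refl])
    fix i assume "i \<in> {1..?N}"
    then obtain k where "i = Suc k" by (cases i) simp_all
    then show "conj_part \<mu> (Suc i) choose 2 = conj_part (shift \<mu>) i choose 2" by (simp add: conj_part_Suc)
  qed
  also have "... = n_stat (shift \<mu>)" by (rule n_stat_upto[symmetric]) (simp add: sum_mset_shift[OF \<mu>])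
  finally show ?thesis using conj_part_1[OF \<mu>] by simp
qed

text \<open>Of \<open>j\<close> and \<open>j - 1\<close> exactly one is odd; a part 1 counts in the
  first summand and disappears from the second.\<close>

lemma odd_parts_shift: "0 \<notin># \<mu> ==> odd_parts \<mu> + odd_parts (shift \<mu>) = size \<mu>"
proof (induction \<mu>)
  case (add x \<mu>)
  have p: "0 \<notin># \<mu>" "x ~= 0" using add.prems by simp_all
  note IH = add.IH[OF p(1)]
  consider "x = 1" | "1 < x" using p(2) by linarith
  then show ?case by cases (use IH in \<open>auto simp: odd_parts_def shift_def\<close>)
qed (simp add: odd_parts_def shift_def)

text \<open>The classical condition on Jordan types: even parts have even multiplicity in the
  orthogonal case, odd parts in the symplectic case.\<close>

definition paired :: "'a::field => nat multiset => bool" where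
  "paired ep \<mu> \<longleftrightarrow> (\<forall>i. even i = (ep = 1) --> even (count \<mu> i))"

lemma all_nat_Suc: "(\<forall>i :: nat. P i) \<longleftrightarrow> P 0 & (\<forall>i. P (Suc i))"
  by (rule iffI, blast, rule allI, rename_tac i, case_tac i) blast+

lemma paired_shift:
  fixes ep :: "'a::field"
  assumes two: "(2 :: 'a) ~= 0" and eps: "ep = 1 \<or> ep = -1" and \<mu>: "0 \<notin># \<mu>"
  shows "paired ep \<mu> \<longleftrightarrow> (ep = 1 \<or> even (count \<mu> 1)) & paired (- ep) (shift \<mu>)"
proof -
  have ne: "(1 :: 'a) ~= - 1" using two by (metis add.right_inverse one_add_one)
  then have fl: "(- ep = 1) = (\<not> ep = 1)" using eps by auto
  have c0: "count \<mu> 0 = 0" using \<mu> by (simp add: not_in_iff)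
  have cs: "count (shift \<mu>) 0 = 0" "count (shift \<mu>) (Suc i) = count \<mu> (Suc (Suc i))" for i by (simp_all add: count_shift)
  have A: "paired ep \<mu> \<longleftrightarrow> (even (0::nat) = (ep = 1) --> even (count \<mu> 0)) & (\<forall>i. even (Suc i) = (ep = 1) --> even (count \<mu> (Suc i)))"
    unfolding paired_def by (rule all_nat_Suc)
  have B: "(\<forall>i. even (Suc i) = (ep = 1) --> even (count \<mu> (Suc i))) \<longleftrightarrow>
      (even (Suc 0) = (ep = 1) --> even (count \<mu> (Suc 0))) & (\<forall>i. even (Suc (Suc i)) = (ep = 1) --> even (count \<mu> (Suc (Suc i))))"
    by (rule all_nat_Suc)
  have C: "paired (- ep) (shift \<mu>) \<longleftrightarrow> (even (0::nat) = (- ep = 1) --> even (count (shift \<mu>) 0)) &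
      (\<forall>i. even (Suc i) = (- ep = 1) --> even (count (shift \<mu>) (Suc i)))"
    unfolding paired_def by (rule all_nat_Suc)
  show ?thesis unfolding A B C fl c0 cs by (cases "ep = 1") simp_all
qed

text \<open>For \<open>ep = 1\<close> this is \<open>1 / Aut_O q \<mu>\<close> on the support of \<open>P_O q\<close>. The alternating case \<open>ep = -1\<close>
  is needed because each step of the recursion changes the sign.\<close>

definition wgt :: "'a::{field,finite} => nat multiset => real" where
  "wgt ep \<mu> = (if paired ep \<mu> then
     real CARD('a) powr (- (real (n_stat \<mu>) + real (sum_mset \<mu>) / 2 - (if ep = 1 then 1 else -1) * real (odd_parts \<mu>) / 2))
     / (\<Prod>i\<in>set_mset \<mu>. pev (real CARD('a)) (count \<mu> i div 2)) else 0)"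

lemma real_choose_2: "real (n choose 2) = real n * (real n - 1) / 2"
  by (induction n) (simp_all add: numeral_2_eq_2 field_simps)

text \<open>By \<open>odd_parts_shift\<close> the term with \<open>odd_parts\<close> returns with
  the opposite sign, in agreement with the change from \<open>ep\<close> to \<open>- ep\<close>. The
  exponent that is left is \<open>sexp ep c - c * c\<close> with
  \<open>c = size \<mu>\<close>.\<close>

lemma wgt_shift:
  fixes ep :: "'a::{field,finite}"
  defines "q \<equiv> real CARD('a)"
  assumes two: "(2 :: 'a) ~= 0" and eps: "ep = 1 \<or> ep = -1" and \<mu>: "0 \<notin># \<mu>"
  shows "wgt ep \<mu> = wgt (- ep) (shift \<mu>) *
    (if ep = 1 \<or> even (count \<mu> 1) then q ^ sexp ep (size \<mu>) / q ^ (size \<mu> * size \<mu>) / pev q (count \<mu> 1 div 2) else 0)"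
proof -
  have q1: "q > 1" unfolding q_def using one_less_card_field[where 'a = 'a] by simp
  have ne: "(1 :: 'a) ~= - 1" using two by (metis add.right_inverse one_add_one)
  then have fl: "(- ep = 1) = (\<not> ep = 1)" using eps by auto
  let ?e = "if ep = 1 then 1 else - 1 :: real" and ?c = "real (size \<mu>)"
  have o: "real (odd_parts \<mu>) = ?c - real (odd_parts (shift \<mu>))" using odd_parts_shift[OF \<mu>] by linarith
  have s: "real (sum_mset \<mu>) = ?c + real (sum_mset (shift \<mu>))" using sum_mset_shift[OF \<mu>] by linarith
  have n: "real (n_stat \<mu>) = ?c * (?c - 1) / 2 + real (n_stat (shift \<mu>))" using n_stat_shift[OF \<mu>] real_choose_2 by simp
  have sx: "real (sexp ep (size \<mu>)) = ?c * (?c + ?e) / 2"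
    unfolding sexp_def using real_choose_2[of "size \<mu>"] real_choose_2[of "Suc (size \<mu>)"] by (auto simp: algebra_simps)
  have "- (real (n_stat \<mu>) + real (sum_mset \<mu>) / 2 - ?e * real (odd_parts \<mu>) / 2) =
      - (real (n_stat (shift \<mu>)) + real (sum_mset (shift \<mu>)) / 2 - (if - ep = 1 then 1 else -1) * real (odd_parts (shift \<mu>)) / 2)
      + (real (sexp ep (size \<mu>)) - real (size \<mu> * size \<mu>))"
    unfolding o s n sx fl by (auto simp: field_simps)
  moreover have "q powr (real (sexp ep (size \<mu>)) - real (size \<mu> * size \<mu>)) = q ^ sexp ep (size \<mu>) / q ^ (size \<mu> * size \<mu>)"
    using q1 by (simp add: powr_diff powr_realpow del: of_nat_mult)
  ultimately have pw: "q powr (- (real (n_stat \<mu>) + real (sum_mset \<mu>) / 2 - ?e * real (odd_parts \<mu>) / 2)) =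
      q powr (- (real (n_stat (shift \<mu>)) + real (sum_mset (shift \<mu>)) / 2 - (if - ep = 1 then 1 else -1) * real (odd_parts (shift \<mu>)) / 2))
      * (q ^ sexp ep (size \<mu>) / q ^ (size \<mu> * size \<mu>))"
    by (simp only: powr_add)
  have pr: "(\<Prod>i\<in>set_mset \<mu>. pev q (count \<mu> i div 2)) = pev q (count \<mu> 1 div 2) * (\<Prod>i\<in>set_mset (shift \<mu>). pev q (count (shift \<mu>) i div 2))"
    by (rule prod_shift[of "\<lambda>n. pev q (n div 2)", OF _ \<mu>]) simp
  show ?thesis
    unfolding wgt_def q_def[symmetric] pw pr paired_shift[OF two eps \<mu>] by simp
qed

text \<open>Induction along \<open>shift\<close>: the weight satisfies
  \<open>column_recursion\<close> and the formula satisfies \<open>wgt_shift\<close>. The two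
  factors agree by \<open>gl_split\<close> and \<open>prod_odd_even\<close>.\<close>

theorem card_nilpotent_pairs:
  fixes ep :: "'a::{field,finite}"
  assumes two: "(2 :: 'a) ~= 0" and eps: "ep = 1 \<or> ep = -1" and \<mu>: "0 \<notin># \<mu>" and I: "finite I" "card I = sum_mset \<mu>"
  shows "real (card (Prt 0 ep I \<mu>)) = real (card (GLs I :: 'a fmat set)) * wgt ep \<mu>"
  using eps \<mu> I
proof (induction "sum_mset \<mu>" arbitrary: ep \<mu> I rule: less_induct)
  case less
  note eps = less.prems(1) and \<mu> = less.prems(2) and I = less.prems(3,4)
  define q where "q = real CARD('a)"
  have q1: "q > 1" unfolding q_def using one_less_card_field[where 'a = 'a] by simp
  show ?case
  proof (cases "\<mu> = {#}")
    case True
    have e: "idm {} = (0 :: 'a fmat)" by (rule fmat_eqI) (simp add: ent_idm)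
    have M0: "Mats {} J = {0 :: 'a fmat}" for J by (auto simp: Mats_def intro: fmat_eqI)
    have G: "GLs {} = {0 :: 'a fmat}" using M0[of "{}"] e by (auto simp: GLs_def)
    have I0: "I = {}" using True I by simp
    have kp: "kpow {} 0 i = {0 :: 'a fmat}" for i unfolding kpow_def M0 by auto
    have "has_type {} {#} (0 :: 'a fmat)"
      by (simp add: has_type_def kp kdim_def)
    then have "x \<in> Prt 0 ep {} {#} \<longleftrightarrow> x = (0, 0 :: 'a fmat)" for x
      unfolding Prt_def Prs_def SN_def G M0 by (cases x) auto
    then have P1: "Prt 0 ep {} {#} = {(0, 0 :: 'a fmat)}" by blast
    have ns: "n_stat {#} = 0" "odd_parts {#} = 0" by (simp_all add: n_stat_def odd_parts_def)
    have "wgt ep {#} = 1" unfolding wgt_def paired_def ns using one_less_card_field[where 'a = 'a] by simp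
    then show ?thesis unfolding I0 True P1 G by simp
  next
    case False
    let ?c1 = "size \<mu>" and ?c2 = "size (shift \<mu>)"
    have c1: "?c1 > 0" using False by (simp add: nonempty_has_size)
    have sm: "sum_mset \<mu> = ?c1 + sum_mset (shift \<mu>)" by (rule sum_mset_shift[OF \<mu>])
    have "sum_mset (shift \<mu>) \<le> card I" using I(2) sm by linarith
    then obtain I1 where I1: "I1 \<subseteq> I" "card I1 = sum_mset (shift \<mu>)"
      by (rule obtain_subset_with_card_n)
    define I2 where "I2 = I - I1"
    have fin: "finite I1" "finite I2" using I1 I finite_subset by (auto simp: I2_def)
    have dis: "I1 \<inter> I2 = {}" and II: "I = I1 \<union> I2" using I1 by (auto simp: I2_def)
    have cI2: "card I2 = ?c1" using I I1 sm fin by (simp add: I2_def card_Diff_subset)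
    have eps': "- ep = 1 \<or> - ep = -1" using eps by auto
    have IH: "real (card (Prt 0 (- ep) I1 (shift \<mu>))) = real (card (GLs I1 :: 'a fmat set)) * wgt (- ep) (shift \<mu>)"
      by (rule less.hyps[OF _ eps' _ fin(1) I1(2)]) (use sm c1 in simp_all)
    define m where "m = count \<mu> 1"
    have cm: "?c1 = m + ?c2" unfolding m_def by (rule size_shift[OF \<mu>])
    have g1: "real (card (GLs I1 :: 'a fmat set)) > 0" using card_GLs_pos[OF fin(1), where 'a = 'a] by simp
    have g: "real (card (GLs I :: 'a fmat set)) > 0" using card_GLs_pos[OF I(1), where 'a = 'a] by simp
    define a where "a = real (card (Prt 0 ep I \<mu>)) / real (card (GLs I :: 'a fmat set))"
    define X where "X = q ^ sexp ep m * q ^ (?c1 * ?c2) * gl q ?c1 ?c1"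
    have gl_pos: "gl q k ?c1 > 0" if "k \<le> ?c1" for k
      unfolding gl_def by (rule prod_pos) (use that q1 in \<open>simp add: power_strict_increasing\<close>)
    have X: "X > 0" unfolding X_def using gl_pos[of ?c1] q1 by simp
    have rec: "a * X = wgt (- ep) (shift \<mu>) * (gl q ?c2 ?c1 * q ^ sexp ep ?c1 * snf ep m)"
      using column_recursion[OF two eps fin dis \<mu> cI2 I1(2)] IH g1 unfolding II[symmetric] a_def X_def q_def cm by simp
    have "wgt ep \<mu> * X = wgt (- ep) (shift \<mu>) * (gl q ?c2 ?c1 * q ^ sexp ep ?c1 * snf ep m)"
    proof (cases "ep = 1 \<or> even m")
      case True
      have sn: "snf ep m = q ^ sexp ep m * podd q (Suc m div 2)" unfolding snf_def q_def using True by auto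
      have "gl q ?c1 ?c1 = gl q ?c2 ?c1 * q ^ (?c1 * m) * (podd q (Suc m div 2) * pev q (m div 2))"
        using gl_split[OF q1, of ?c2 ?c1] cm prod_odd_even[of q m] by simp
      moreover have "q ^ (?c1 * ?c1) = q ^ (?c1 * ?c2) * q ^ (?c1 * m)"
        unfolding power_add[symmetric] by (subst (2) cm) (simp add: algebra_simps)
      ultimately have "q ^ sexp ep ?c1 / q ^ (?c1 * ?c1) / pev q (m div 2) * X = gl q ?c2 ?c1 * q ^ sexp ep ?c1 * snf ep m"
        unfolding X_def sn using q1 pev_pos[OF q1, of "m div 2"] by (simp add: field_simps)
      moreover have "wgt ep \<mu> = wgt (- ep) (shift \<mu>) * (q ^ sexp ep ?c1 / q ^ (?c1 * ?c1) / pev q (m div 2))"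
        using wgt_shift[OF two eps \<mu>] True unfolding q_def m_def by simp
      ultimately show ?thesis by (simp only: mult.assoc)
    next
      \<comment> \<open>Alternating forms and an odd multiplicity of the part 1: both sides vanish,
        since no alternating form of odd size is nondegenerate.\<close>
      case False
      then show ?thesis using wgt_shift[OF two eps \<mu>] unfolding m_def by (simp add: snf_def)
    qed
    then have "a * X = wgt ep \<mu> * X" using rec by simp
    then have "a = wgt ep \<mu>" using X by simp
    then show ?thesis unfolding a_def using g by (simp add: field_simps)
  qed
qed

section \<open>Fitting decomposition\<close>

text \<open>For \<open>card I1 = sum_mset \<mu>\<close> the block \<open>N\<close> is nilpotent, and
  these are the maps in Fitting normal form.\<close>

definition block_set :: "nat set => nat set => nat multiset => 'a::{field,finite} fmat set" where
  "block_set I1 I2 \<mu> = {T. \<exists>N V. T = N + V & has_type I1 \<mu> N & V \<in> GLs I2}"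

lemma kdim_eventually: "sum_mset \<mu> \<le> i ==> kdim \<mu> i = sum_mset \<mu>"
proof (induction \<mu>)
  case (add x \<mu>)
  then show ?case by (simp add: kdim_def)
qed (simp add: kdim_def)

lemma funpow_mult_right: "((*) N ^^ i) (X * Y) = ((*) N ^^ i) X * (Y :: 'a::comm_ring_1 fmat)"
  by (induction i) (simp_all add: mult.assoc)

lemma funpow_mult_idm:
  assumes "finite I" "N \<in> Mats I I"
  shows "((*) N ^^ i) (idm I) * N = ((*) N ^^ Suc i) (idm I)"
proof -
  have "((*) N ^^ i) (idm I) * N = ((*) N ^^ i) (idm I * N)" by (simp add: funpow_mult_right)
  also have "idm I * N = N * idm I" using idm_mult[OF assms(2,1)] mult_idm[OF assms(2,1)] by simp
  also have "((*) N ^^ i) (N * idm I) = ((*) N ^^ Suc i) (idm I)" by (simp only: funpow_Suc_right o_def)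
  finally show ?thesis .
qed

text \<open>At the exponent \<open>sum_mset \<mu>\<close> the kernel has the size of the whole
  space.\<close>

lemma has_type_nilpotent:
  fixes N :: "'a::{field,finite} fmat"
  assumes I: "finite I" "card I = sum_mset \<mu>" and N: "has_type I \<mu> N"
  shows "((*) N ^^ sum_mset \<mu>) (idm I) = 0"
proof -
  have Nm: "N \<in> Mats I I" using N by (simp add: has_type_def)
  have "card (kpow I N (sum_mset \<mu>)) = card (Mats I {0} :: 'a fmat set)"
    using N I by (simp add: has_type_def kdim_eventually card_Mats)
  moreover have "kpow I N (sum_mset \<mu>) \<subseteq> Mats I {0}" by (auto simp: kpow_def)
  ultimately have eq: "kpow I N (sum_mset \<mu>) = Mats I {0}"
    using card_subset_eq[of "Mats I {0} :: 'a fmat set"] I(1) by simp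
  let ?X = "((*) N ^^ sum_mset \<mu>) (idm I)"
  have Xm: "?X \<in> Mats I I" by (rule funpow_mult_Mats[OF Nm idm_Mats])
  show ?thesis
  proof (rule fmat_eqI)
    fix i j
    show "ent ?X i j = ent 0 i j"
    proof (cases "j \<in> I")
      case True
      have e: "eunit j 0 1 \<in> (Mats I {0} :: 'a fmat set)" by (rule eunit_Mats[OF True]) simp
      have "?X * eunit j 0 1 = ((*) N ^^ sum_mset \<mu>) (eunit j 0 1)"
        unfolding funpow_mult_right[symmetric] using idm_mult[OF e I(1)] by simp
      also have "... = 0"
      proof -
        have "eunit j 0 1 \<in> kpow I N (sum_mset \<mu>)" unfolding eq by (rule e)
        then show ?thesis by (simp add: kpow_def)
      qed
      finally have "ent (?X * eunit j 0 1) i 0 = 0" by simp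
      then show ?thesis by (simp add: ent_mult_eunit)
    next
      case False
      then show ?thesis using MatsD[OF Xm, of i j] by simp
    qed
  qed
qed

text \<open>Substituting the equation into itself writes \<open>A\<close> as the \<open>i\<close>-th
  power of \<open>N\<close> applied to some \<open>A * X\<close>, for every positive
  \<open>i\<close>.\<close>

lemma nilpotent_left_zero:
  assumes I: "finite I" and N: "N \<in> Mats I I" "((*) N ^^ k) (idm I) = 0" and A: "A \<in> Mats I J"
    and eq: "A = N * (A * C)"
  shows "A = 0"
proof -
  have "\<exists>X. A = ((*) N ^^ i) (A * X) \<or> i = 0" for i
  proof (induction i)
    case (Suc i)
    show ?case
    proof (cases i)
      case 0
      then show ?thesis using eq by auto
    next
      case (Suc j)
      then obtain X where X: "A = ((*) N ^^ i) (A * X)" using Suc.IH by auto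
      have "A = N * (((*) N ^^ i) (A * X) * C)" using eq X by simp
      also have "... = ((*) N ^^ Suc i) (A * (X * C))" by (simp add: funpow_mult_right mult.assoc)
      finally show ?thesis by blast
    qed
  qed simp
  from this[of "Suc k"] obtain X where X: "A = ((*) N ^^ Suc k) (A * X)" by auto
  have AX: "A * X \<in> Mats I UNIV" by (rule Mats_mono[OF Mats_mult[OF A, of X UNIV UNIV]]) (auto simp: Mats_def)
  have "((*) N ^^ k) (A * X) = ((*) N ^^ k) (idm I * (A * X))" using idm_mult[OF AX I] by simp
  also have "... = 0" unfolding funpow_mult_right N(2) by simp
  finally show ?thesis using X by simp
qed

lemma nilpotent_right_zero:
  assumes I: "finite I" and N: "N \<in> Mats I I" "((*) N ^^ k) (idm I) = 0" and A: "A \<in> Mats J I"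
    and eq: "A = C * A * N"
  shows "A = 0"
proof -
  have "\<exists>X. A = X * ((*) N ^^ i) (idm I)" for i
  proof (induction i)
    case 0
    show ?case using mult_idm[OF A I] by (intro exI[of _ A]) simp
  next
    case (Suc i)
    then obtain X where X: "A = X * ((*) N ^^ i) (idm I)" by blast
    have "A = C * (X * ((*) N ^^ i) (idm I)) * N" using eq X by simp
    also have "... = C * X * (((*) N ^^ i) (idm I) * N)" by (simp only: mult.assoc)
    finally show ?case unfolding funpow_mult_idm[OF I N(1)] by blast
  qed
  from this[of k] show ?thesis unfolding N(2) by auto
qed

text \<open>The invertible block contributes nothing to the kernels of powers, so the type is that
  of the block \<open>N\<close>.\<close>

lemma kpow_block:
  fixes N V :: "'a::{field,finite} fmat"
  assumes fin: "finite I1" "finite I2" and dis: "I1 \<inter> I2 = {}" and N: "N \<in> Mats I1 I1" and V: "V \<in> GLs I2"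
  shows "kpow (I1 \<union> I2) (N + V) i = kpow I1 N i"
proof -
  have dis': "I2 \<inter> I1 = {}" using dis by auto
  note Vm = GLs_Mats[OF V]
  have it: "((*) (N + V) ^^ i) (v + w) = ((*) N ^^ i) v + ((*) V ^^ i) w"
    if "v \<in> Mats I1 {0}" "w \<in> Mats I2 {0}" for v w i
  proof (induction i)
    case (Suc i)
    have "((*) N ^^ i) v \<in> Mats I1 {0}" "((*) V ^^ i) w \<in> Mats I2 {0}"
      by (rule funpow_mult_Mats[OF N that(1)], rule funpow_mult_Mats[OF Vm that(2)])
    then have "N * (((*) V ^^ i) w) = 0" "V * (((*) N ^^ i) v) = 0"
      using mult_disjoint[OF N _ dis] mult_disjoint[OF Vm _ dis'] by blast+
    then show ?case using Suc by (simp add: distrib_left distrib_right)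
  qed simp
  have Vinj: "w = 0" if "w \<in> Mats I2 {0}" "((*) V ^^ i) w = 0" for w i
    using that
  proof (induction i)
    case (Suc i)
    have "((*) V ^^ i) w \<in> Mats I2 {0}" by (rule funpow_mult_Mats[OF Vm Suc.prems(1)])
    then have "((*) V ^^ i) w = 0" using GLs_cancel[OF V fin(2)] Suc.prems(2) by simp
    then show ?case by (rule Suc.IH[OF Suc.prems(1)])
  qed simp
  show ?thesis
  proof (rule Set.set_eqI)
    fix v :: "'a fmat"
    show "v \<in> kpow (I1 \<union> I2) (N + V) i \<longleftrightarrow> v \<in> kpow I1 N i"
    proof
      assume "v \<in> kpow (I1 \<union> I2) (N + V) i"
      then have v: "v \<in> Mats (I1 \<union> I2) {0}" "((*) (N + V) ^^ i) v = 0" by (simp_all add: kpow_def)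
      define v1 v2 where "v1 = idm I1 * v" and "v2 = idm I2 * v"
      have vv: "v = v1 + v2" unfolding v1_def v2_def by (rule Mats_split_rows[OF v(1) fin dis])
      have m: "v1 \<in> Mats I1 {0}" "v2 \<in> Mats I2 {0}" unfolding v1_def v2_def by (rule idm_mult_Mats[OF v(1)] fin)+
      have s: "((*) N ^^ i) v1 + ((*) V ^^ i) v2 = 0" using v(2) it[OF m] vv by simp
      have k: "((*) N ^^ i) v1 \<in> Mats I1 {0}" "((*) V ^^ i) v2 \<in> Mats I2 {0}"
        by (rule funpow_mult_Mats[OF N m(1)], rule funpow_mult_Mats[OF Vm m(2)])
      have "idm I2 * (((*) N ^^ i) v1 + ((*) V ^^ i) v2) = ((*) V ^^ i) v2"
        using mult_disjoint[OF idm_Mats k(1) dis'] idm_mult[OF k(2) fin(2)] by (simp add: distrib_left)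
      then have V0: "((*) V ^^ i) v2 = 0" unfolding s by simp
      then have "v2 = 0" by (rule Vinj[OF m(2)])
      then show "v \<in> kpow I1 N i" using s V0 m(1) vv by (simp add: kpow_def)
    next
      assume "v \<in> kpow I1 N i"
      then have v: "v \<in> Mats I1 {0}" "((*) N ^^ i) v = 0" by (simp_all add: kpow_def)
      have "((*) (N + V) ^^ i) v = 0" using it[OF v(1) Mats_zero, of i] v(2) by simp
      moreover have "v \<in> Mats (I1 \<union> I2) {0}" by (rule Mats_mono[OF v(1)]) auto
      ultimately show "v \<in> kpow (I1 \<union> I2) (N + V) i" by (simp add: kpow_def)
    qed
  qed
qed

lemma block_Mats:
  assumes "N \<in> Mats I1 I1" "V \<in> Mats I2 I2" shows "N + V \<in> Mats (I1 \<union> I2) (I1 \<union> I2)"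
  by (rule Mats_add[OF Mats_mono[OF assms(1)] Mats_mono[OF assms(2)]]) auto

lemma has_type_block:
  fixes N V :: "'a::{field,finite} fmat"
  assumes "finite I1" "finite I2" "I1 \<inter> I2 = {}" "N \<in> Mats I1 I1" "V \<in> GLs I2"
  shows "has_type (I1 \<union> I2) \<mu> (N + V) \<longleftrightarrow> has_type I1 \<mu> N"
  using kpow_block[OF assms] block_Mats[OF assms(4) GLs_Mats[OF assms(5)]] assms(4) by (simp add: has_type_def)

text \<open>Kernel and image of a high power of \<open>T\<close> are complementary. The image is
  moved to \<open>I2\<close>, then a unipotent base change moves the kernel to \<open>I1\<close>.
  Since \<open>T\<close> commutes with its power, it respects both.\<close>

lemma Fitting_exists:
  fixes T :: "'a::{field,finite} fmat"
  assumes fin: "finite I1" "finite I2" and dis: "I1 \<inter> I2 = {}" and T: "has_type (I1 \<union> I2) \<mu> T" and c: "card I1 = sum_mset \<mu>"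
  obtains P where "P \<in> GLs (I1 \<union> I2)" "finv (I1 \<union> I2) P * T * P \<in> block_set I1 I2 \<mu>"
proof -
  let ?I = "I1 \<union> I2"
  have I: "finite ?I" using fin by simp
  have dis': "I2 \<inter> I1 = {}" using dis by auto
  have Tm: "T \<in> Mats ?I ?I" using T by (simp add: has_type_def)
  \<comment> \<open>The successor keeps \<open>k\<close> positive, so that the \<open>k\<close>-th
    power kills the kernel of \<open>T\<close> also when \<open>\<mu>\<close> is empty.\<close>
  define k where "k = Suc (sum_mset \<mu>)"
  define Tk where "Tk = ((*) T ^^ k) (idm ?I)"
  have Tkm: "Tk \<in> Mats ?I ?I" unfolding Tk_def by (rule funpow_mult_Mats[OF Tm idm_Mats])
  have Tkv: "Tk * v = ((*) T ^^ k) v" if "v \<in> Mats ?I L" for v L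
    unfolding Tk_def funpow_mult_right[symmetric] using idm_mult[OF that I] by simp
  have ck: "card (kpow ?I T k) = CARD('a) ^ card I1" "card (kpow ?I T (k + k)) = CARD('a) ^ card I1"
    using T c by (simp_all add: has_type_def kdim_eventually k_def)
  have kk: "kerf ?I Tk = kpow ?I T k" unfolding kerf_def kpow_def using Tkv by auto
  obtain P J R where P: "P \<in> GLs ?I" and J: "J \<subseteq> ?I" and R: "R \<in> Epi J ?I" and TPR: "Tk = P * R"
    using row_compress[OF I I Tkm] .
  have finJ: "finite J" using J I finite_subset by blast
  have "kerf ?I Tk = kerf ?I R" unfolding TPR by (rule kerf_GLs_mult[OF P I Mats_mono[OF Epi_Mats[OF R] J subset_refl]])
  then have "CARD('a) ^ (card I1 + card J) = CARD('a) ^ card ?I"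
    using card_kerf_Epi[OF R finJ I] kk ck(1) by (simp add: power_add)
  then have "card I1 + card J = card ?I" using one_less_card_field[where 'a = 'a] by simp
  then have "card I2 = card J" using fin dis by (simp add: card_Un_disjoint)
  then obtain P0 R0 where P0: "P0 \<in> GLs ?I" and R0: "R0 \<in> Epi I2 ?I" and TPR0: "Tk = P0 * R0"
    using Epi_reindex[OF I P J R, of I2] TPR by auto
  define M where "M = R0 * P0"
  define T1 where "T1 = finv ?I P0 * T * P0"
  note p = finv_props[OF P0] GLs_Mats[OF P0]
  have R0m: "R0 \<in> Mats ?I ?I" by (rule Mats_mono[OF Epi_Mats[OF R0]]) auto
  have Mm: "M \<in> Mats I2 ?I" unfolding M_def by (rule Mats_mult[OF Epi_Mats[OF R0] p(4)])
  have T1m: "T1 \<in> Mats ?I ?I" unfolding T1_def by (rule Mats_mult[OF Mats_mult[OF p(1) Tm] p(4)])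
  have T1k: "((*) T1 ^^ k) v = M * v" if "v \<in> Mats ?I L" for v L
  proof -
    have "((*) T1 ^^ k) v = finv ?I P0 * (Tk * (P0 * v))"
      unfolding T1_def funpow_conj[OF I P0 Tm that] Tkv[OF Mats_mult[OF p(4) that]] ..
    also have "... = finv ?I P0 * (P0 * (R0 * (P0 * v)))" unfolding TPR0 by (simp only: mult.assoc)
    also have "... = M * v" unfolding finv_cancel(2)[OF P0 I Mats_mult[OF R0m Mats_mult[OF p(4) that]]] M_def by (simp only: mult.assoc)
    finally show ?thesis .
  qed
  \<comment> \<open>The kernels are stationary from \<open>k\<close> on. This is what makes the
    block \<open>Y\<close> of the \<open>k\<close>-th power invertible.\<close>
  have kT1: "kpow ?I T1 (k + k) = kpow ?I T1 k"
  proof (rule card_subset_eq[symmetric])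
    show "finite (kpow ?I T1 (k + k))" by (rule finite_subset[of _ "Mats ?I {0}"]) (use I in \<open>auto simp: kpow_def\<close>)
    show "kpow ?I T1 k \<subseteq> kpow ?I T1 (k + k)" by (auto simp: kpow_def funpow_add)
    show "card (kpow ?I T1 k) = card (kpow ?I T1 (k + k))"
      unfolding T1_def card_kpow_conj[OF I P0 Tm] ck ..
  qed
  obtain S0 where S0: "S0 \<in> Mats ?I I2" "R0 * S0 = idm I2" using R0 by (rule EpiE)
  define S where "S = finv ?I P0 * S0"
  have S: "S \<in> Mats ?I I2" unfolding S_def by (rule Mats_mult[OF p(1) S0(1)])
  have MS: "M * S = idm I2"
    unfolding M_def S_def using finv_cancel(1)[OF P0 I S0(1)] S0(2) by (simp add: mult.assoc)
  define Y Z where "Y = M * idm I2" and "Z = M * idm I1"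
  have Ym: "Y \<in> Mats I2 I2" and Zm: "Z \<in> Mats I2 I1" unfolding Y_def Z_def by (rule mult_idm_Mats[OF Mm] fin)+
  have MYZ: "M = Z + Y" unfolding Y_def Z_def by (rule Mats_split_cols[OF Mm fin dis])
  have YG: "Y \<in> GLs I2"
  proof (rule GLsI_inj[OF fin(2) Ym])
    fix y assume y: "y \<in> Mats I2 {0}" "Y * y = 0"
    have yI: "y \<in> Mats ?I {0}" by (rule Mats_mono[OF y(1)]) auto
    have My: "M * y = 0" using y idm_mult[OF y(1) fin(2)] unfolding Y_def by (simp add: mult.assoc)
    define v where "v = S * y"
    have v: "v \<in> Mats ?I {0}" unfolding v_def by (rule Mats_mult[OF S y(1)])
    have Mv: "M * v = y" unfolding v_def mult_eq_assoc[OF MS] by (rule idm_mult[OF y(1) fin(2)]) simp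
    have "((*) T1 ^^ (k + k)) v = 0" unfolding funpow_add o_def T1k[OF v] Mv T1k[OF yI] My ..
    then have "v \<in> kpow ?I T1 k" unfolding kT1[symmetric] using v by (simp add: kpow_def)
    then have "M * v = 0" using T1k[OF v] by (simp add: kpow_def)
    then show "y = 0" using Mv by simp
  qed
  note y = finv_props[OF YG]
  \<comment> \<open>Conjugation by \<open>idm ?I - A\<close> clears the block \<open>Z\<close> of
    the \<open>k\<close>-th power and leaves \<open>Y\<close> alone.\<close>
  define A where "A = finv I2 Y * Z"
  have Am: "A \<in> Mats I2 I1" unfolding A_def by (rule Mats_mult[OF y(1) Zm])
  have AI: "idm ?I * A = A" "A * idm ?I = A" by (rule idm_mult[OF Am I] mult_idm[OF Am I], simp)+
  have AA: "A * A = 0" by (rule mult_disjoint[OF Am Am dis])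
  define u where "u = idm ?I - A"
  have Amm: "A \<in> Mats ?I ?I" by (rule Mats_mono[OF Am]) auto
  have um: "u \<in> Mats ?I ?I" "idm ?I + A \<in> Mats ?I ?I" unfolding u_def by (rule Mats_diff Mats_add, rule idm_Mats, rule Amm)+
  have u1: "u * (idm ?I + A) = idm ?I" "(idm ?I + A) * u = idm ?I"
    unfolding u_def using I by (simp_all add: left_diff_distrib right_diff_distrib distrib_left distrib_right AI AA idm_mult_idm)
  have uG: "u \<in> GLs ?I" by (rule GLsI[OF um u1])
  have fu: "finv ?I u = idm ?I + A" by (rule finv_unique[OF uG I um(2) u1(1), symmetric])
  define T2 where "T2 = finv ?I u * T1 * u"
  have T2m: "T2 \<in> Mats ?I ?I" unfolding T2_def by (rule Mats_mult[OF Mats_mult[OF finv_props(1)[OF uG] T1m] um(1)])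
  have YA: "Y * A = Z" unfolding A_def by (rule finv_cancel(1)[OF YG fin(2) Zm])
  have "Z * A = 0" "A * M = 0" by (rule mult_disjoint[OF Zm Am dis] mult_disjoint[OF Am Mm dis])+
  then have conjM: "(idm ?I + A) * (M * u) = Y"
  proof -
    have "M * idm ?I = M" by (rule mult_idm[OF Mm I]) simp
    then have Mu: "M * u = Y" unfolding u_def right_diff_distrib using \<open>Z * A = 0\<close> YA by (simp add: MYZ distrib_right)
    have "A * Y = 0" by (rule mult_disjoint[OF Am Ym dis])
    moreover have "idm ?I * Y = Y" by (rule idm_mult[OF Ym I]) simp
    ultimately show ?thesis unfolding Mu by (simp add: distrib_right)
  qed
  have T2k: "((*) T2 ^^ k) v = Y * v" if "v \<in> Mats ?I L" for v L
  proof -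
    have "((*) T2 ^^ k) v = finv ?I u * ((*) T1 ^^ k) (u * v)" unfolding T2_def by (rule funpow_conj[OF I uG T1m that])
    also have "... = (idm ?I + A) * (M * (u * v))" unfolding T1k[OF Mats_mult[OF um(1) that]] fu ..
    also have "... = (idm ?I + A) * (M * u) * v" by (simp only: mult.assoc)
    finally show ?thesis unfolding conjM .
  qed
  \<comment> \<open>\<open>Y\<close> is the \<open>k\<close>-th power of \<open>T2\<close>.
    Commuting with \<open>Y\<close>, which is invertible on \<open>I2\<close> and zero on
    \<open>I1\<close>, forces the off-diagonal blocks of \<open>T2\<close> to vanish.\<close>
  have comm: "T2 * Y = Y * T2"
  proof -
    have YI: "Y * idm ?I = Y" by (rule mult_idm[OF Ym I]) simp
    have "T2 * Y = T2 * ((*) T2 ^^ k) (idm ?I)" unfolding T2k[OF idm_Mats] YI ..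
    also have "... = ((*) T2 ^^ Suc k) (idm ?I)" by simp
    also have "... = ((*) T2 ^^ k) (T2 * idm ?I)" by (simp only: funpow_Suc_right o_def)
    also have "... = Y * T2" unfolding mult_idm[OF T2m I subset_refl] by (rule T2k[OF T2m])
    finally show ?thesis .
  qed
  define N V where "N = idm I1 * T2 * idm I1" and "V = idm I2 * T2 * idm I2"
  have Nm: "N \<in> Mats I1 I1" and Vm: "V \<in> Mats I2 I2" unfolding N_def V_def by (rule Mats_mult[OF Mats_mult[OF idm_Mats T2m] idm_Mats])+
  have b12: "idm I1 * T2 * idm I2 = 0"
  proof -
    have "idm I1 * Y = 0" by (rule mult_disjoint[OF idm_Mats Ym dis])
    then have "idm I1 * (T2 * Y) = 0" unfolding comm by (simp add: mult.assoc[symmetric])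
    then have "idm I1 * (T2 * (Y * finv I2 Y)) = 0" by (simp add: mult.assoc[symmetric])
    then show ?thesis unfolding y(2) by (simp add: mult.assoc)
  qed
  have b21: "idm I2 * T2 * idm I1 = 0"
  proof -
    have "Y * idm I1 = 0" by (rule mult_disjoint[OF Ym idm_Mats dis'])
    then have "Y * (T2 * idm I1) = 0" unfolding mult.assoc[symmetric] comm[symmetric] unfolding mult.assoc by simp
    then have "finv I2 Y * (Y * (T2 * idm I1)) = 0" by simp
    then show ?thesis unfolding mult_eq_assoc[OF y(3)] by (simp add: mult.assoc)
  qed
  have NV: "T2 = N + V"
  proof -
    have "T2 = idm ?I * T2 * idm ?I" using idm_mult[OF T2m I subset_refl] mult_idm[OF T2m I subset_refl] by simp
    also have "... = N + V + (idm I1 * T2 * idm I2) + (idm I2 * T2 * idm I1)"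
      unfolding idm_Un[OF fin dis] N_def V_def by (simp add: distrib_left distrib_right)
    finally show ?thesis unfolding b12 b21 by simp
  qed
  have VG: "V \<in> GLs I2"
  proof (rule GLsI_inj[OF fin(2) Vm])
    fix w assume w: "w \<in> Mats I2 {0}" "V * w = 0"
    have wI: "w \<in> Mats ?I {0}" by (rule Mats_mono[OF w(1)]) auto
    have "N * w = 0" by (rule mult_disjoint[OF Nm w(1) dis])
    then have "T2 * w = 0" unfolding NV using w(2) by (simp add: distrib_right)
    then have "((*) T2 ^^ k) w = 0" unfolding k_def funpow_Suc_right o_def by simp
    then have "Y * w = 0" unfolding T2k[OF wI] .
    then show "w = 0" by (rule GLs_cancel[OF YG fin(2) w(1)])
  qed
  have "has_type ?I \<mu> T2" unfolding T2_def has_type_conj[OF I uG T1m] unfolding T1_def has_type_conj[OF I P0 Tm] by (rule T)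
  then have "has_type I1 \<mu> N" unfolding NV has_type_block[OF fin dis Nm VG] .
  then have B: "T2 \<in> block_set I1 I2 \<mu>" using NV VG by (auto simp: block_set_def)
  have Q: "P0 * u \<in> GLs ?I" by (rule GLs_mult[OF I P0 uG])
  have "finv ?I (P0 * u) = finv ?I u * finv ?I P0"
  proof (rule finv_unique[OF Q I _, symmetric])
    show "finv ?I u * finv ?I P0 \<in> Mats ?I ?I" by (rule Mats_mult[OF finv_props(1)[OF uG] p(1)])
    have "P0 * u * (finv ?I u * finv ?I P0) = P0 * (u * (finv ?I u * finv ?I P0))" by (simp only: mult.assoc)
    then show "P0 * u * (finv ?I u * finv ?I P0) = idm ?I" unfolding finv_cancel(1)[OF uG I p(1)] p(2) .
  qed
  then have "finv ?I (P0 * u) * T * (P0 * u) = T2" unfolding T2_def T1_def by (simp only: mult.assoc)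
  then show ?thesis using that[OF Q] B by simp
qed

text \<open>The off-diagonal blocks of a conjugator intertwine the nilpotent block of one normal
  form with the invertible block of the other. Such intertwiners are zero.\<close>

lemma block_commutant:
  fixes g :: "'a::{field,finite} fmat"
  assumes fin: "finite I1" "finite I2" and dis: "I1 \<inter> I2 = {}" and c: "card I1 = sum_mset \<mu>"
    and T: "T \<in> block_set I1 I2 \<mu>" and g: "g \<in> GLs (I1 \<union> I2)" and gT: "finv (I1 \<union> I2) g * T * g \<in> block_set I1 I2 \<mu>"
  shows "idm I1 * g * idm I2 = 0 & idm I2 * g * idm I1 = 0"
proof -
  let ?I = "I1 \<union> I2"
  have I: "finite ?I" using fin by simp
  have dis': "I2 \<inter> I1 = {}" using dis by auto
  obtain N V where T': "T = N + V" and N: "has_type I1 \<mu> N" and V: "V \<in> GLs I2" using T by (auto simp: block_set_def)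
  obtain N' V' where gT': "finv ?I g * T * g = N' + V'" and N': "has_type I1 \<mu> N'" and V': "V' \<in> GLs I2" using gT by (auto simp: block_set_def)
  have m: "N \<in> Mats I1 I1" "N' \<in> Mats I1 I1" using N N' by (simp_all add: has_type_def)
  note Vm = GLs_Mats[OF V] GLs_Mats[OF V'] and gm = GLs_Mats[OF g]
  have Tm: "T * g \<in> Mats ?I ?I" unfolding T' by (rule Mats_mult[OF block_Mats[OF m(1) Vm(1)] gm])
  have g1: "g * (N' + V') = T * g" unfolding gT'[symmetric] mult.assoc by (rule finv_cancel(1)[OF g I Tm])
  have eq: "(N + V) * g = g * (N' + V')" unfolding g1 unfolding T' ..
  let ?a = "idm I1 * g * idm I2" and ?b = "idm I2 * g * idm I1"
  have am: "?a \<in> Mats I1 I2" "?b \<in> Mats I2 I1" by (rule Mats_mult[OF Mats_mult[OF idm_Mats gm] idm_Mats])+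
  have z: "idm I1 * V = 0" "idm I2 * N = 0" "N' * idm I2 = 0" "V' * idm I1 = 0"
    by (rule mult_disjoint[OF idm_Mats Vm(1) dis] mult_disjoint[OF idm_Mats m(1) dis'] mult_disjoint[OF m(2) idm_Mats dis] mult_disjoint[OF Vm(2) idm_Mats dis'])+
  have i: "idm I1 * N = N" "N * idm I1 = N" "idm I2 * V = V" "V * idm I2 = V" "N' * idm I1 = N'" "idm I1 * N' = N'" "V' * idm I2 = V'" "idm I2 * V' = V'"
    using idm_mult[OF m(1) fin(1)] mult_idm[OF m(1) fin(1)] idm_mult[OF m(2) fin(1)] mult_idm[OF m(2) fin(1)]
      idm_mult[OF Vm(1) fin(2)] mult_idm[OF Vm(1) fin(2)] idm_mult[OF Vm(2) fin(2)] mult_idm[OF Vm(2) fin(2)] by simp_all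
  have "idm I1 * ((N + V) * g) * idm I2 = N * ?a"
    by (simp add: distrib_left distrib_right mult.assoc z[THEN mult_eq_assoc] i[THEN mult_eq_assoc])
  moreover have "idm I1 * (g * (N' + V')) * idm I2 = ?a * V'"
    by (simp add: distrib_left distrib_right mult.assoc z i i[THEN mult_eq_assoc])
  ultimately have e1: "N * ?a = ?a * V'" unfolding eq by simp
  have a1: "?a * V' * finv I2 V' = ?a" by (rule finv_cancel_right(1)[OF V' fin(2) am(1)])
  have a2: "N * (?a * finv I2 V') = N * ?a * finv I2 V'" by (rule mult.assoc[symmetric])
  have "?a = N * (?a * finv I2 V')" unfolding a2 e1 a1 ..
  then have a0: "?a = 0" by (rule nilpotent_left_zero[OF fin(1) m(1) has_type_nilpotent[OF fin(1) c N] am(1)])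
  have "idm I2 * ((N + V) * g) * idm I1 = V * ?b"
    by (simp add: distrib_left distrib_right mult.assoc z[THEN mult_eq_assoc] i[THEN mult_eq_assoc])
  moreover have "idm I2 * (g * (N' + V')) * idm I1 = ?b * N'"
    by (simp add: distrib_left distrib_right mult.assoc z i i[THEN mult_eq_assoc])
  ultimately have e2: "V * ?b = ?b * N'" unfolding eq by simp
  have b1: "finv I2 V * (V * ?b) = ?b" by (rule finv_cancel(2)[OF V fin(2) am(2)])
  have b2: "finv I2 V * ?b * N' = finv I2 V * (?b * N')" by (rule mult.assoc)
  have "?b = finv I2 V * ?b * N'" unfolding b2 e2[symmetric] b1 ..
  then have "?b = 0" by (rule nilpotent_right_zero[OF fin(1) m(2) has_type_nilpotent[OF fin(1) c N'] am(2)])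
  with a0 show ?thesis by simp
qed

lemma block_setE:
  assumes "T \<in> block_set I1 I2 \<mu>"
  obtains N V where "T = N + V" "has_type I1 \<mu> N" "V \<in> GLs I2"
  using assms unfolding block_set_def by blast

lemma quotient_of_counts:
  fixes a g g1 g2 p r :: nat
  assumes "a * (g1 * g2) = g * (p * r)" "g > 0" "g1 > 0" "g2 > 0"
  shows "real a / real g = real p / real g1 * (real r / real g2)"
proof -
  have "real a * (real g1 * real g2) = real g * (real p * real r)"
    using arg_cong[OF assms(1), of real] by (simp only: of_nat_mult)
  then have e: "real a * (real g1 * real g2) = real p * real r * real g" by (simp only: mult_ac)
  have "real g ~= 0" "real g1 * real g2 ~= 0" using assms(2-4) by simp_all
  then have "real a / real g = (real p * real r) / (real g1 * real g2)" using e by (rule frac_eq_eq[THEN iffD2])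
  then show ?thesis by (simp only: times_divide_times_eq)
qed

lemma block_mult:
  assumes "A \<in> Mats I1 J1" "A' \<in> Mats J1 K1" "B \<in> Mats I2 J2" "B' \<in> Mats J2 K2" "J1 \<inter> J2 = {}"
  shows "(A + B) * (A' + B') = A * A' + B * (B' :: 'a::comm_ring_1 fmat)"
proof -
  have "J2 \<inter> J1 = {}" using assms(5) by blast
  then have "A * B' = 0" "B * A' = 0" using mult_disjoint[OF assms(1,4,5)] mult_disjoint[OF assms(3,2)] by simp_all
  then show ?thesis by (simp add: distrib_left distrib_right)
qed

lemma block_components:
  assumes fin: "finite I1" "finite I2" and dis: "I1 \<inter> I2 = {}" and A: "A \<in> Mats I1 I1" and B: "B \<in> Mats I2 I2" and C: "C \<in> Mats I1 I2"
  shows "idm I1 * (A + B + C) * idm I1 = A" "idm I2 * (A + B + C) * idm I2 = B" "idm I1 * (A + B + C) * idm I2 = C"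
proof -
  have dis': "I2 \<inter> I1 = {}" using dis by auto
  show "idm I1 * (A + B + C) * idm I1 = A" "idm I2 * (A + B + C) * idm I2 = B" "idm I1 * (A + B + C) * idm I2 = C"
    using mult_disjoint[OF idm_Mats A dis'] mult_disjoint[OF idm_Mats C dis'] mult_disjoint[OF idm_Mats B dis]
      mult_disjoint[OF A idm_Mats dis] mult_disjoint[OF B idm_Mats dis'] mult_disjoint[OF C idm_Mats dis']
      idm_mult[OF A fin(1)] mult_idm[OF A fin(1)] idm_mult[OF B fin(2)] mult_idm[OF B fin(2)]
      idm_mult[OF C fin(1)] mult_idm[OF C fin(2)]
    by (simp_all add: distrib_left distrib_right mult.assoc)
qed

lemma block_eqD:
  fixes A B :: "'a::comm_ring_1 fmat"
  assumes fin: "finite I1" "finite I2" and dis: "I1 \<inter> I2 = {}"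
    and m: "A \<in> Mats I1 I1" "B \<in> Mats I2 I2" "A' \<in> Mats I1 I1" "B' \<in> Mats I2 I2" and eq: "A + B = A' + B'"
  shows "A = A' & B = B'"
  using block_components(1,2)[OF fin dis m(1,2) Mats_zero] block_components(1,2)[OF fin dis m(3,4) Mats_zero] eq by simp

lemma block_GLs:
  fixes A B :: "'a::{comm_ring_1,finite} fmat"
  assumes fin: "finite I1" "finite I2" and dis: "I1 \<inter> I2 = {}"
  shows "A \<in> Mats I1 I1 ==> B \<in> Mats I2 I2 ==> A + B \<in> GLs (I1 \<union> I2) \<longleftrightarrow> A \<in> GLs I1 & B \<in> GLs I2"
    and "A \<in> GLs I1 ==> B \<in> GLs I2 ==> finv (I1 \<union> I2) (A + B) = finv I1 A + finv I2 B"
proof -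
  show "A \<in> Mats I1 I1 ==> B \<in> Mats I2 I2 ==> A + B \<in> GLs (I1 \<union> I2) \<longleftrightarrow> A \<in> GLs I1 & B \<in> GLs I2"
    using GLs_block_iff[OF fin dis _ _ Mats_zero, of A B] by simp
  assume A: "A \<in> GLs I1" and B: "B \<in> GLs I2"
  note b = GLs_add_block[OF fin dis A B Mats_zero]
  have "finv I1 A + finv I2 B = finv (I1 \<union> I2) (A + B)"
    by (rule finv_unique) (use b fin in simp_all)
  then show "finv (I1 \<union> I2) (A + B) = finv I1 A + finv I2 B" by (rule sym)
qed

text \<open>By \<open>block_commutant\<close> the conjugators are block diagonal, and every
  invertible block diagonal matrix qualifies.\<close>

lemma block_normalizer:
  fixes T :: "'a::{field,finite} fmat"
  assumes fin: "finite I1" "finite I2" and dis: "I1 \<inter> I2 = {}" and c: "card I1 = sum_mset \<mu>" and T: "T \<in> block_set I1 I2 \<mu>"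
  shows "card {g \<in> GLs (I1 \<union> I2). finv (I1 \<union> I2) g * T * g \<in> block_set I1 I2 \<mu>} =
    card (GLs I1 :: 'a fmat set) * card (GLs I2 :: 'a fmat set)"
proof -
  let ?I = "I1 \<union> I2" and ?f = "\<lambda>(A, B). A + B :: 'a fmat"
  obtain N V where T': "T = N + V" and N: "has_type I1 \<mu> N" and V: "V \<in> GLs I2" using T by (rule block_setE)
  have Nm: "N \<in> Mats I1 I1" using N by (simp add: has_type_def)
  have "{g \<in> GLs ?I. finv ?I g * T * g \<in> block_set I1 I2 \<mu>} = ?f ` (GLs I1 \<times> GLs I2)"
  proof (rule Set.set_eqI, rule iffI)
    fix g assume "g \<in> {g \<in> GLs ?I. finv ?I g * T * g \<in> block_set I1 I2 \<mu>}"
    then have g: "g \<in> GLs ?I" and gT: "finv ?I g * T * g \<in> block_set I1 I2 \<mu>" by blast+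
    note z = block_commutant[OF fin dis c T g gT]
    obtain A B C where *: "A \<in> GLs I1" "B \<in> GLs I2" "C \<in> Mats I1 I2" "g = A + B + C"
      using GLs_blocksE[OF fin dis g conjunct2[OF z]] .
    have "C = 0" using block_components(3)[OF fin dis GLs_Mats[OF *(1)] GLs_Mats[OF *(2)] *(3)] conjunct1[OF z] *(4) by simp
    then have "g = ?f (A, B)" using *(4) by simp
    then show "g \<in> ?f ` (GLs I1 \<times> GLs I2)" using *(1,2) by (intro image_eqI[of _ _ "(A, B)"]) simp_all
  next
    fix g assume "g \<in> ?f ` (GLs I1 \<times> GLs I2)"
    then obtain A B where g: "g = A + B" and A: "A \<in> GLs I1" and B: "B \<in> GLs I2" by auto
    have gG: "g \<in> GLs ?I" unfolding g using block_GLs(1)[OF fin dis GLs_Mats[OF A] GLs_Mats[OF B]] A B by simp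
    note m = GLs_Mats[OF A] GLs_Mats[OF B] GLs_Mats[OF finv_GLs[OF A]] GLs_Mats[OF finv_GLs[OF B]] GLs_Mats[OF V]
    have "finv ?I g * T * g = finv I1 A * N * A + finv I2 B * V * B"
      unfolding g T' block_GLs(2)[OF fin dis A B] block_mult[OF m(3) Nm m(4) m(5) dis]
      by (rule block_mult[OF Mats_mult[OF m(3) Nm] m(1) Mats_mult[OF m(4,5)] m(2) dis])
    moreover have "has_type I1 \<mu> (finv I1 A * N * A)" using has_type_conj[OF fin(1) A Nm] N by simp
    moreover have "finv I2 B * V * B \<in> GLs I2" by (rule GLs_mult[OF fin(2) GLs_mult[OF fin(2) finv_GLs[OF B] V] B])
    ultimately show "g \<in> {g \<in> GLs ?I. finv ?I g * T * g \<in> block_set I1 I2 \<mu>}" using gG by (auto simp: block_set_def)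
  qed
  moreover have "inj_on ?f (GLs I1 \<times> GLs I2)"
  proof (rule inj_onI)
    fix x y :: "'a fmat \<times> 'a fmat" assume x: "x \<in> GLs I1 \<times> GLs I2" and y: "y \<in> GLs I1 \<times> GLs I2" and e: "?f x = ?f y"
    obtain A B A' B' where *: "x = (A, B)" "y = (A', B')" by (metis surj_pair)
    have "A = A' & B = B'" by (rule block_eqD[OF fin dis]) (use x y e * in \<open>simp_all add: GLs_Mats\<close>)
    then show "x = y" using * by simp
  qed
  ultimately show ?thesis by (simp add: card_image card_cartesian_product)
qed

text \<open>Translation by one conjugator from \<open>Fitting_exists\<close> reduces the count to a
  map already in normal form.\<close>

lemma card_block_conjugators:
  fixes T :: "'a::{field,finite} fmat"
  assumes fin: "finite I1" "finite I2" and dis: "I1 \<inter> I2 = {}" and c: "card I1 = sum_mset \<mu>" and T: "has_type (I1 \<union> I2) \<mu> T"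
  shows "card {g \<in> GLs (I1 \<union> I2). finv (I1 \<union> I2) g * T * g \<in> block_set I1 I2 \<mu>} =
    card (GLs I1 :: 'a fmat set) * card (GLs I2 :: 'a fmat set)"
proof -
  let ?I = "I1 \<union> I2" and ?S = "block_set I1 I2 \<mu>"
  have I: "finite ?I" using fin by simp
  have Tm: "T \<in> Mats ?I ?I" using T by (simp add: has_type_def)
  obtain P where P: "P \<in> GLs ?I" and PT: "finv ?I P * T * P \<in> ?S" using Fitting_exists[OF fin dis T c] .
  let ?T = "finv ?I P * T * P"
  have fm: "finv ?I (P * g) = finv ?I g * finv ?I P" if g: "g \<in> GLs ?I" for g
  proof (rule finv_unique[symmetric])
    show "P * g \<in> GLs ?I" by (rule GLs_mult[OF I P g])
    show "finv ?I g * finv ?I P \<in> Mats ?I ?I" by (rule Mats_mult[OF finv_props(1)[OF g] finv_props(1)[OF P]])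
    have "P * g * (finv ?I g * finv ?I P) = P * (g * (finv ?I g * finv ?I P))" by (rule mult.assoc)
    also have "... = P * finv ?I P" unfolding finv_cancel(1)[OF g I finv_props(1)[OF P]] ..
    finally show "P * g * (finv ?I g * finv ?I P) = idm ?I" unfolding finv_props(2)[OF P] .
  qed (rule I)
  have e: "finv ?I (P * g) * T * (P * g) = finv ?I g * ?T * g" if g: "g \<in> GLs ?I" for g
    unfolding fm[OF g] by (simp only: mult.assoc)
  have "bij_betw ((*) P) {g \<in> GLs ?I. finv ?I g * ?T * g \<in> ?S} {g \<in> GLs ?I. finv ?I g * T * g \<in> ?S}"
  proof (rule bij_betwI[where g = "(*) (finv ?I P)"])
    show "(*) P \<in> {g \<in> GLs ?I. finv ?I g * ?T * g \<in> ?S} \<rightarrow> {g \<in> GLs ?I. finv ?I g * T * g \<in> ?S}"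
      using e GLs_mult[OF I P] by simp
    show "(*) (finv ?I P) \<in> {g \<in> GLs ?I. finv ?I g * T * g \<in> ?S} \<rightarrow> {g \<in> GLs ?I. finv ?I g * ?T * g \<in> ?S}"
    proof
      fix g assume g: "g \<in> {g \<in> GLs ?I. finv ?I g * T * g \<in> ?S}"
      then have gG: "g \<in> GLs ?I" by blast
      have 1: "finv ?I P * g \<in> GLs ?I" by (rule GLs_mult[OF I finv_GLs[OF P] gG])
      show "finv ?I P * g \<in> {g \<in> GLs ?I. finv ?I g * ?T * g \<in> ?S}"
        using e[OF 1] g 1 unfolding finv_cancel(1)[OF P I GLs_Mats[OF gG]] by simp
    qed
    show "finv ?I P * (P * g) = g" if "g \<in> {g \<in> GLs ?I. finv ?I g * ?T * g \<in> ?S}" for g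
      using finv_cancel(2)[OF P I GLs_Mats] that by blast
    show "P * (finv ?I P * g) = g" if "g \<in> {g \<in> GLs ?I. finv ?I g * T * g \<in> ?S}" for g
      using finv_cancel(1)[OF P I GLs_Mats] that by blast
  qed
  then show ?thesis using block_normalizer[OF fin dis c PT] by (simp add: bij_betw_same_card)
qed

section \<open>Orthogonality of the Fitting components\<close>

definition Pri :: "'a::comm_ring_1 => 'a => nat set => ('a fmat \<times> 'a fmat) set" where
  "Pri th ep I = {(B, V) \<in> Prs th ep I. V \<in> GLs I}"

definition defect :: "'a::comm_ring_1 => 'a fmat => 'a fmat => 'a fmat" where
  "defect th B T = tr T * B + B * T + th \<cdot> (tr T * B * T)"

lemma Prs_defect: "Prs th ep I = {(B, T). B \<in> SN ep I & T \<in> Mats I I & defect th B T = 0}"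
  by (simp add: Prs_def defect_def)

lemma defect_Mats: "B \<in> Mats I I ==> T \<in> Mats I I ==> defect th B T \<in> Mats I I"
proof -
  assume B: "B \<in> Mats I I" and T: "T \<in> Mats I I"
  then have "tr T \<in> Mats I I" by simp
  then show "defect th B T \<in> Mats I I" unfolding defect_def
    using Mats_add[OF Mats_add[OF Mats_mult[OF _ B] Mats_mult[OF B T]] Mats_smult[OF Mats_mult[OF Mats_mult[OF _ B] T]]] by blast
qed

lemma defect_block:
  fixes B1 :: "'a::comm_ring_1 fmat"
  assumes "I1 \<inter> I2 = {}" and m: "B1 \<in> Mats I1 I1" "B2 \<in> Mats I2 I2" "N \<in> Mats I1 I1" "V \<in> Mats I2 I2"
  shows "defect th (B1 + B2) (N + V) = defect th B1 N + defect th B2 V"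
proof -
  have t: "tr N \<in> Mats I1 I1" "tr V \<in> Mats I2 I2" using m by simp_all
  have 1: "(tr N + tr V) * (B1 + B2) = tr N * B1 + tr V * B2" by (rule block_mult[OF t(1) m(1) t(2) m(2) assms(1)])
  have 2: "(B1 + B2) * (N + V) = B1 * N + B2 * V" by (rule block_mult[OF m(1) m(3) m(2) m(4) assms(1)])
  have 3: "(tr N * B1 + tr V * B2) * (N + V) = tr N * B1 * N + tr V * B2 * V"
    by (rule block_mult[OF Mats_mult[OF t(1) m(1)] m(3) Mats_mult[OF t(2) m(2)] m(4) assms(1)])
  show ?thesis unfolding defect_def tr_add 1 2 3 by (simp add: algebra_simps)
qed

text \<open>Solving for \<open>A * V\<close> and cancelling \<open>V\<close> gives
  \<open>A = tr N * (A * C)\<close>. Its transpose has the shape to which the nilpotency of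
  \<open>N\<close> applies.\<close>

lemma nilpotent_Sylvester:
  fixes A :: "'a::{field,finite} fmat"
  assumes fin: "finite I1" "finite I2" and c: "card I1 = sum_mset \<mu>"
    and N: "has_type I1 \<mu> N" and V: "V \<in> GLs I2" and A: "A \<in> Mats I1 I2"
    and eq: "tr N * A + A * V + th \<cdot> (tr N * A * V) = 0"
  shows "A = 0"
proof -
  have Nm: "N \<in> Mats I1 I1" using N by (simp add: has_type_def)
  have ab: "y = - x + - z" if "x + y + z = 0" for x y z :: "'a fmat"
  proof -
    have "y = - x + - z + (x + y + z)" by (simp add: algebra_simps)
    then show ?thesis unfolding that by simp
  qed
  let ?U = "- idm I2 + - (th \<cdot> V)"
  let ?C = "?U * finv I2 V"
  have "A * ?U = - A + - (th \<cdot> (A * V))"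
    unfolding distrib_left mult_minus_right smult_mult_right mult_idm[OF A fin(2) subset_refl] ..
  then have U: "tr N * (A * ?U) = - (tr N * A) + - (th \<cdot> (tr N * A * V))"
    by (simp only: distrib_left mult_minus_right smult_mult_right mult.assoc)
  have AV: "A * V = tr N * (A * ?U)" unfolding U by (rule ab[OF eq])
  have "A = A * V * finv I2 V" by (rule finv_cancel_right(1)[OF V fin(2) A, symmetric])
  also have "... = tr N * (A * ?C)" unfolding AV by (simp only: mult.assoc)
  finally have "tr A = tr (tr N * (A * ?C))" by (rule arg_cong)
  also have "... = tr ?C * tr A * N" by (simp only: tr_mult tr_tr)
  finally have e: "tr A = tr ?C * tr A * N" .
  have "tr A \<in> Mats I2 I1" using A by simp
  then have "tr A = 0" by (rule nilpotent_right_zero[OF fin(1) Nm has_type_nilpotent[OF fin(1) c N] _ e])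
  then show ?thesis by (metis tr_tr tr_zero)
qed

text \<open>The two Fitting components are orthogonal under \<open>B\<close>: the off-diagonal block
  of the equation for the pair is the equation of \<open>nilpotent_Sylvester\<close>.\<close>

lemma off_diagonal_zero:
  fixes B :: "'a::{field,finite} fmat"
  assumes fin: "finite I1" "finite I2" and dis: "I1 \<inter> I2 = {}" and c: "card I1 = sum_mset \<mu>"
    and N: "has_type I1 \<mu> N" and V: "V \<in> GLs I2" and B: "B \<in> Mats (I1 \<union> I2) (I1 \<union> I2)" and d: "defect th B (N + V) = 0"
  shows "idm I1 * B * idm I2 = 0"
proof -
  let ?B = "idm I1 * B * idm I2"
  have dis': "I2 \<inter> I1 = {}" using dis by auto
  have Nm: "N \<in> Mats I1 I1" using N by (simp add: has_type_def)
  have tNm: "tr N \<in> Mats I1 I1" and tVm: "tr V \<in> Mats I2 I2" using Nm GLs_Mats[OF V] by simp_all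
  note Vm = GLs_Mats[OF V]
  have Bm: "?B \<in> Mats I1 I2" by (rule Mats_mult[OF Mats_mult[OF idm_Mats B] idm_Mats])
  have z: "N * idm I2 = 0" "idm I1 * tr V = 0"
    by (rule mult_disjoint[OF Nm idm_Mats dis] mult_disjoint[OF idm_Mats tVm dis])+
  have i: "idm I1 * tr N = tr N" "tr N * idm I1 = tr N" "V * idm I2 = V" "idm I2 * V = V" "idm I2 * idm I2 = idm I2"
    using idm_mult[OF tNm fin(1)] mult_idm[OF tNm fin(1)] idm_mult[OF Vm fin(2)] mult_idm[OF Vm fin(2)] idm_mult_idm[OF fin(2) fin(2)] by simp_all
  have 1: "idm I1 * (tr (N + V) * B) * idm I2 = tr N * ?B"
    by (simp add: distrib_left distrib_right mult.assoc z[THEN mult_eq_assoc] i[THEN mult_eq_assoc])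
  have 2: "idm I1 * (B * (N + V)) * idm I2 = ?B * V"
    by (simp add: distrib_left distrib_right mult.assoc z i)
  have 3: "idm I1 * (tr (N + V) * B * (N + V)) * idm I2 = tr N * ?B * V"
    by (simp add: distrib_left distrib_right mult.assoc z i z[THEN mult_eq_assoc] i[THEN mult_eq_assoc])
  have "idm I1 * defect th B (N + V) * idm I2 =
      idm I1 * (tr (N + V) * B) * idm I2 + idm I1 * (B * (N + V)) * idm I2 + th \<cdot> (idm I1 * (tr (N + V) * B * (N + V)) * idm I2)"
    unfolding defect_def by (simp only: distrib_left distrib_right smult_mult_left smult_mult_right)
  then have "tr N * ?B + ?B * V + th \<cdot> (tr N * ?B * V) = 0" unfolding d 1 2 3 by simp
  then show ?thesis by (rule nilpotent_Sylvester[OF fin c N V Bm])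
qed

lemma card_block_pairs:
  fixes ep th :: "'a::{field,finite}"
  assumes fin: "finite I1" "finite I2" and dis: "I1 \<inter> I2 = {}" and c: "card I1 = sum_mset \<mu>"
  shows "card {(B, T) \<in> Prs th ep (I1 \<union> I2). T \<in> block_set I1 I2 \<mu>} = card (Prt th ep I1 \<mu>) * card (Pri th ep I2)"
proof -
  let ?I = "I1 \<union> I2" and ?f = "\<lambda>((B1, N), (B2, V)). (B1 + B2, N + V :: 'a fmat)"
  let ?L = "{(B, T) \<in> Prs th ep ?I. T \<in> block_set I1 I2 \<mu>}"
  have dz: "defect th (B1 + B2) (N + V) = 0 \<longleftrightarrow> defect th B1 N = 0 & defect th B2 V = 0"
    if m: "B1 \<in> Mats I1 I1" "B2 \<in> Mats I2 I2" "N \<in> Mats I1 I1" "V \<in> Mats I2 I2" for B1 B2 N V :: "'a fmat"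
    unfolding defect_block[OF dis m]
    using block_eqD[OF fin dis defect_Mats[OF m(1,3)] defect_Mats[OF m(2,4)] Mats_zero Mats_zero] by fastforce
  have sn: "B1 + B2 \<in> SN ep ?I \<longleftrightarrow> B1 \<in> SN ep I1 & B2 \<in> SN ep I2"
    if m: "B1 \<in> Mats I1 I1" "B2 \<in> Mats I2 I2" for B1 B2 :: "'a fmat"
  proof -
    have "tr (B1 + B2) = ep \<cdot> (B1 + B2) \<longleftrightarrow> tr B1 = ep \<cdot> B1 & tr B2 = ep \<cdot> B2"
      using block_eqD[OF fin dis, of "tr B1" "tr B2" "ep \<cdot> B1" "ep \<cdot> B2"] m Mats_smult[OF m(1)] Mats_smult[OF m(2)] by auto
    then show ?thesis unfolding SN_def using block_GLs(1)[OF fin dis m] by auto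
  qed
  have "?L = ?f ` (Prt th ep I1 \<mu> \<times> Pri th ep I2)"
  proof (rule Set.set_eqI, rule iffI)
    fix x assume "x \<in> ?f ` (Prt th ep I1 \<mu> \<times> Pri th ep I2)"
    then obtain B1 N B2 V where x: "x = (B1 + B2, N + V)" and 1: "(B1, N) \<in> Prt th ep I1 \<mu>" and 2: "(B2, V) \<in> Pri th ep I2" by auto
    have p: "B1 \<in> SN ep I1" "N \<in> Mats I1 I1" "defect th B1 N = 0" "has_type I1 \<mu> N"
      "B2 \<in> SN ep I2" "V \<in> Mats I2 I2" "defect th B2 V = 0" "V \<in> GLs I2"
      using 1 2 by (simp_all add: Prt_def Pri_def Prs_defect)
    note m = SN_Mats[OF p(1)] SN_Mats[OF p(5)]
    have "N + V \<in> block_set I1 I2 \<mu>" using p(4,8) by (auto simp: block_set_def)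
    then show "x \<in> ?L" unfolding x Prs_defect using sn[OF m] dz[OF m p(2,6)] p block_Mats[OF p(2,6)] by simp
  next
    fix x assume "x \<in> ?L"
    then obtain B T where x: "x = (B, T)" and BT: "B \<in> SN ep ?I" "defect th B T = 0" and T: "T \<in> block_set I1 I2 \<mu>" by (auto simp: Prs_defect)
    obtain N V where T': "T = N + V" and N: "has_type I1 \<mu> N" and V: "V \<in> GLs I2" using T by (rule block_setE)
    have Nm: "N \<in> Mats I1 I1" using N by (simp add: has_type_def)
    have I: "finite ?I" using fin by simp
    note Bm = SN_Mats[OF BT(1)]
    have z1: "idm I1 * B * idm I2 = 0" by (rule off_diagonal_zero[OF fin dis c N V Bm]) (use BT(2) T' in simp)
    have "tr (idm I2 * B * idm I1) = ep \<cdot> (idm I1 * B * idm I2)" using SND(2)[OF BT(1)] by (simp add: mult.assoc)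
    then have z2: "idm I2 * B * idm I1 = 0" using z1 by (metis smult_zero_right tr_tr tr_zero)
    let ?B1 = "idm I1 * B * idm I1" and ?B2 = "idm I2 * B * idm I2"
    have m: "?B1 \<in> Mats I1 I1" "?B2 \<in> Mats I2 I2" by (rule Mats_mult[OF Mats_mult[OF idm_Mats Bm] idm_Mats])+
    have "B = idm ?I * B * idm ?I" using idm_mult[OF Bm I] mult_idm[OF Bm I] by simp
    also have "... = ?B1 + ?B2" using z1 z2 fin dis by (simp add: idm_Un distrib_left distrib_right)
    finally have B: "B = ?B1 + ?B2" .
    have s: "?B1 \<in> SN ep I1 & ?B2 \<in> SN ep I2" using sn[OF m] BT(1) B by simp
    have "defect th (?B1 + ?B2) (N + V) = 0" using BT(2) unfolding T' B[symmetric] .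
    then have dd: "defect th ?B1 N = 0 & defect th ?B2 V = 0" using dz[OF m Nm GLs_Mats[OF V]] by blast
    have "(?B1, N) \<in> Prt th ep I1 \<mu>" "(?B2, V) \<in> Pri th ep I2"
      using s dd N V Nm GLs_Mats[OF V] by (simp_all add: Prt_def Pri_def Prs_defect)
    moreover have "x = ?f ((?B1, N), (?B2, V))" using x T' B by simp
    ultimately show "x \<in> ?f ` (Prt th ep I1 \<mu> \<times> Pri th ep I2)" by (intro image_eqI[where x = "((?B1, N), (?B2, V))"]) simp_all
  qed
  moreover have "inj_on ?f (Prt th ep I1 \<mu> \<times> Pri th ep I2)"
  proof (rule inj_onI)
    fix x y :: "('a fmat \<times> 'a fmat) \<times> ('a fmat \<times> 'a fmat)"
    assume x: "x \<in> Prt th ep I1 \<mu> \<times> Pri th ep I2" and y: "y \<in> Prt th ep I1 \<mu> \<times> Pri th ep I2" and e: "?f x = ?f y"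
    obtain B1 N B2 V where x': "x = ((B1, N), (B2, V))" by (metis surj_pair)
    obtain B1' N' B2' V' where y': "y = ((B1', N'), (B2', V'))" by (metis surj_pair)
    have m: "B1 \<in> Mats I1 I1" "N \<in> Mats I1 I1" "B2 \<in> Mats I2 I2" "V \<in> Mats I2 I2"
      "B1' \<in> Mats I1 I1" "N' \<in> Mats I1 I1" "B2' \<in> Mats I2 I2" "V' \<in> Mats I2 I2"
      using x y unfolding x' y' by (simp_all add: Prt_def Pri_def Prs_def SN_def GLs_Mats)
    have "B1 = B1' & B2 = B2'" by (rule block_eqD[OF fin dis m(1,3,5,7)]) (use e x' y' in simp)
    moreover have "N = N' & V = V'" by (rule block_eqD[OF fin dis m(2,4,6,8)]) (use e x' y' in simp)
    ultimately show "x = y" using x' y' by simp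
  qed
  ultimately show ?thesis by (simp add: card_image card_cartesian_product)
qed

text \<open>Multiplicativity of weights: \<open>card_conj_classes\<close> is applied to Fitting
  normal forms, whose pairs split by \<open>card_block_pairs\<close>.\<close>

lemma Fitting_count:
  fixes ep th :: "'a::{field,finite}"
  assumes fin: "finite I1" "finite I2" and dis: "I1 \<inter> I2 = {}" and c: "card I1 = sum_mset \<mu>"
  shows "real (card (Prt th ep (I1 \<union> I2) \<mu>)) / real (card (GLs (I1 \<union> I2) :: 'a fmat set)) =
    real (card (Prt th ep I1 \<mu>)) / real (card (GLs I1 :: 'a fmat set)) * (real (card (Pri th ep I2)) / real (card (GLs I2 :: 'a fmat set)))"
proof -
  let ?I = "I1 \<union> I2"
  have I: "finite ?I" using fin by simp
  have "card {(B, T) \<in> Prs th ep ?I. has_type ?I \<mu> T} * (card (GLs I1 :: 'a fmat set) * card (GLs I2 :: 'a fmat set)) =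
      card (GLs ?I :: 'a fmat set) * card {(B, T) \<in> Prs th ep ?I. T \<in> block_set I1 I2 \<mu>}"
  proof (rule card_conj_classes[OF I, where \<Psi> = "\<lambda>P T. finv ?I P * T * P \<in> block_set I1 I2 \<mu>"])
    show "card {P \<in> GLs ?I. finv ?I P * T * P \<in> block_set I1 I2 \<mu>} = card (GLs I1 :: 'a fmat set) * card (GLs I2 :: 'a fmat set)"
      if "has_type ?I \<mu> T" for T :: "'a fmat" by (rule card_block_conjugators[OF fin dis c that])
    show "has_type ?I \<mu> T" if P: "P \<in> GLs ?I" and T: "T \<in> Mats ?I ?I" and b: "finv ?I P * T * P \<in> block_set I1 I2 \<mu>" for P T :: "'a fmat"
    proof -
      obtain N V where nv: "finv ?I P * T * P = N + V" and N: "has_type I1 \<mu> N" and V: "V \<in> GLs I2"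
        using b by (rule block_setE)
      have Nm: "N \<in> Mats I1 I1" using N unfolding has_type_def by (rule conjunct1)
      have "has_type ?I \<mu> (finv ?I P * T * P)" unfolding nv by (rule has_type_block[OF fin dis Nm V, THEN iffD2, OF N])
      then show "has_type ?I \<mu> T" by (rule has_type_conj[OF I P T, THEN iffD1])
    qed
  qed simp
  then have "card (Prt th ep ?I \<mu>) * (card (GLs I1 :: 'a fmat set) * card (GLs I2 :: 'a fmat set)) =
      card (GLs ?I :: 'a fmat set) * (card (Prt th ep I1 \<mu>) * card (Pri th ep I2))"
    unfolding card_block_pairs[OF fin dis c] Prt_def[of _ _ ?I] .
  then show ?thesis
    by (rule quotient_of_counts) (simp_all only: card_GLs_pos fin I)
qed

section \<open>The Cayley transform\<close>

text \<open>Since \<open>U\<close> commutes with \<open>X\<close>, the \<open>i\<close>-th power of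
  \<open>X * U\<close> is an invertible matrix times the \<open>i\<close>-th power of
  \<open>X\<close>.\<close>

lemma kpow_mult_unit:
  fixes X :: "'a::{comm_ring_1,finite} fmat"
  assumes I: "finite I" and X: "X \<in> Mats I I" and U: "U \<in> GLs I" and com: "X * U = U * X"
  shows "kpow I (X * U) i = kpow I X i"
proof -
  have "\<exists>W\<in>GLs I. X * W = W * X & (\<forall>v\<in>Mats I {0}. ((*) (X * U) ^^ i) v = W * ((*) X ^^ i) v)"
  proof (induction i)
    case 0
    show ?case
    proof (rule bexI[OF _ idm_GLs[OF I]], intro conjI ballI)
      show "X * idm I = idm I * X" unfolding mult_idm[OF X I subset_refl] idm_mult[OF X I subset_refl] ..
      show "((*) (X * U) ^^ 0) v = idm I * ((*) X ^^ 0) v" if "v \<in> Mats I {0}" for v :: "'a fmat"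
        unfolding funpow_0 idm_mult[OF that I subset_refl] ..
    qed
  next
    case (Suc i)
    then obtain W where W: "W \<in> GLs I" "X * W = W * X" "\<And>v. v \<in> Mats I {0} ==> ((*) (X * U) ^^ i) v = W * ((*) X ^^ i) v" by blast
    have 1: "X * (U * W) = U * W * X" by (metis com W(2) mult.assoc)
    show ?case
    proof (rule bexI[OF _ GLs_mult[OF I U W(1)]], intro conjI ballI)
      show "X * (U * W) = U * W * X" by (rule 1)
      fix v :: "'a fmat" assume v: "v \<in> Mats I {0}"
      have "((*) (X * U) ^^ Suc i) v = X * (U * W) * ((*) X ^^ i) v" using W(3)[OF v] by (simp add: mult.assoc)
      also have "... = U * W * ((*) X ^^ Suc i) v" unfolding 1 by (simp add: mult.assoc)
      finally show "((*) (X * U) ^^ Suc i) v = U * W * ((*) X ^^ Suc i) v" .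
    qed
  qed
  then obtain W where W: "W \<in> GLs I" "\<And>v. v \<in> Mats I {0} ==> ((*) (X * U) ^^ i) v = W * ((*) X ^^ i) v" by blast
  have "W * ((*) X ^^ i) v = 0 \<longleftrightarrow> ((*) X ^^ i) v = 0" if "v \<in> Mats I {0}" for v
    using GLs_cancel[OF W(1) I funpow_mult_Mats[OF X that]] by auto
  then show ?thesis unfolding kpow_def using W(2) by auto
qed

lemma nilpotent_unit:
  fixes X :: "'a::{field,finite} fmat"
  assumes I: "finite I" and X: "X \<in> Mats I I" "((*) X ^^ k) (idm I) = 0" and c: "c ~= 0"
  shows "c \<cdot> idm I + d \<cdot> X \<in> GLs I"
proof (rule GLsI_inj[OF I])
  show "c \<cdot> idm I + d \<cdot> X \<in> Mats I I" by (rule Mats_add[OF Mats_smult[OF idm_Mats] Mats_smult[OF X(1)]])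
  fix v :: "'a fmat" assume v: "v \<in> Mats I {0}" and e: "(c \<cdot> idm I + d \<cdot> X) * v = 0"
  have "c \<cdot> v = - (d \<cdot> (X * v))" using e idm_mult[OF v I] by (simp add: distrib_right eq_neg_iff_add_eq_0)
  then have "(1 / c) \<cdot> (c \<cdot> v) = (1 / c) \<cdot> (- (d \<cdot> (X * v)))" by (rule arg_cong)
  then have 1: "v = - ((d / c) \<cdot> (X * v))" using c by simp
  \<comment> \<open>The scalar is written as a multiple of \<open>idm {0}\<close> on the right, so
    that the equation takes the shape required by \<open>nilpotent_left_zero\<close>.\<close>
  have "v * idm {0} = v" using mult_idm[OF v] by simp
  then have "X * (v * (- (d / c) \<cdot> idm {0})) = - ((d / c) \<cdot> (X * v))" by simp
  then have "v = X * (v * (- (d / c) \<cdot> idm {0}))" using 1 by simp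
  then show "v = 0" by (rule nilpotent_left_zero[OF I X v])
qed

text \<open>The assumption \<open>TD\<close> says \<open>T = 2 X / (1 - X)\<close>, that is
  \<open>1 + T = (1 + X) / (1 - X)\<close>. Multiplying the isometry equation by
  \<open>1 - X\<close> on the right and by its transpose on the left clears the
  denominators.\<close>

lemma defect_Cayley:
  fixes B :: "'a::{field,finite} fmat"
  assumes I: "finite I" and two: "(2 :: 'a) ~= 0" and B: "B \<in> Mats I I" and X: "X \<in> Mats I I" and T: "T \<in> Mats I I"
    and D: "idm I - X \<in> GLs I" and TD: "T * (idm I - X) = 2 \<cdot> X"
  shows "defect 1 B T = 0 \<longleftrightarrow> defect 0 B X = 0"
proof -
  let ?D = "idm I - X"
  have tX: "tr X \<in> Mats I I" using X by simp
  have i: "idm I * B = B" "B * idm I = B" "tr X * idm I = tr X" "idm I * X = X"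
    using idm_mult[OF B I] mult_idm[OF B I] mult_idm[OF tX I] idm_mult[OF X I] by simp_all
  have DT: "tr ?D * tr T = 2 \<cdot> tr X" using arg_cong[OF TD, of tr] by simp
  have "tr ?D * defect 1 B T * ?D = tr ?D * tr T * B * ?D + tr ?D * B * (T * ?D) + tr ?D * tr T * B * (T * ?D)"
    unfolding defect_def by (simp only: smult_one distrib_left distrib_right mult.assoc)
  also have "... = 2 \<cdot> (tr X * B * ?D) + 2 \<cdot> (tr ?D * B * X) + 4 \<cdot> (tr X * B * X)"
    unfolding TD DT by simp
  also have "tr X * B * ?D = tr X * B - tr X * B * X" by (simp add: right_diff_distrib mult.assoc i)
  also have "tr ?D * B * X = B * X - tr X * B * X" by (simp add: left_diff_distrib mult.assoc i i[THEN mult_eq_assoc])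
  also have "2 \<cdot> (tr X * B - tr X * B * X) + 2 \<cdot> (B * X - tr X * B * X) + 4 \<cdot> (tr X * B * X) = 2 \<cdot> defect 0 B X"
    unfolding defect_def by (rule fmat_eqI) (simp add: algebra_simps)
  finally have e: "tr ?D * defect 1 B T * ?D = 2 \<cdot> defect 0 B X" .
  show ?thesis
  proof
    assume "defect 1 B T = 0"
    then have "2 \<cdot> defect 0 B X = 0" using e by simp
    then have "(1 / 2) \<cdot> (2 \<cdot> defect 0 B X) = 0" by simp
    then show "defect 0 B X = 0" using two by simp
  next
    assume "defect 0 B X = 0"
    then have 0: "tr ?D * defect 1 B T * ?D = 0" using e by simp
    have m: "defect 1 B T \<in> Mats I I" by (rule defect_Mats[OF B T])
    have tD: "tr ?D \<in> GLs I" using D by (simp only: GLs_tr)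
    have "tr ?D * defect 1 B T = tr ?D * defect 1 B T * ?D * finv I ?D"
      by (rule finv_cancel_right(1)[OF D I Mats_mult[OF GLs_Mats[OF tD] m], symmetric])
    then have "tr ?D * defect 1 B T = 0" unfolding 0 by simp
    then show "defect 1 B T = 0" by (rule GLs_cancel[OF tD I m])
  qed
qed

lemma card_image_eqI: "f ` A = B ==> inj_on f A ==> card B = card A"
  by (auto simp: card_image)

text \<open>\<open>T\<close> and \<open>X\<close> differ by an invertible factor that commutes with
  them, so they have the same type. Nilpotency makes \<open>1 - X\<close> and \<open>2 + T\<close>
  invertible, which the transform and its inverse require.\<close>

lemma Cayley_count:
  fixes ep :: "'a::{field,finite}"
  assumes I: "finite I" and two: "(2 :: 'a) ~= 0" and c: "card I = sum_mset \<mu>"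
  shows "card (Prt 1 ep I \<mu>) = card (Prt 0 ep I \<mu>)"
proof -
  let ?D = "\<lambda>X. idm I - X :: 'a fmat" and ?E = "\<lambda>T. 2 \<cdot> idm I + T :: 'a fmat"
  let ?f = "\<lambda>(B, X). (B, X * (2 \<cdot> finv I (?D X)))"
  have D: "?D X \<in> GLs I" and E: "?E X \<in> GLs I" if "has_type I \<mu> X" for X
  proof -
    have X: "X \<in> Mats I I" using that by (simp add: has_type_def)
    note n = nilpotent_unit[OF I X has_type_nilpotent[OF I c that]]
    show "?D X \<in> GLs I" using n[of 1 "-1"] by (simp add: minus_smult)
    show "?E X \<in> GLs I" using n[of 2 1] two by simp
  qed
  have DU: "2 \<cdot> finv I P \<in> GLs I" if "P \<in> GLs I" for P :: "'a fmat"
    using GLs_smult finv_GLs[OF that] two by blast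
  have com: "X * finv I P = finv I P * X" if P: "P \<in> GLs I" and X: "X \<in> Mats I I" and e: "X * P = P * X" for X P :: "'a fmat"
  proof -
    have "X * finv I P = finv I P * (P * (X * finv I P))"
      by (rule finv_cancel(2)[OF P I Mats_mult[OF X finv_props(1)[OF P]], symmetric])
    also have "P * (X * finv I P) = X * P * finv I P" unfolding e by (rule mult.assoc[symmetric])
    also have "... = X" by (rule finv_cancel_right(1)[OF P I X])
    finally show ?thesis .
  qed
  have ht: "has_type I \<mu> (X * (2 \<cdot> finv I P)) \<longleftrightarrow> has_type I \<mu> X"
    if P: "P \<in> GLs I" and X: "X \<in> Mats I I" and e: "X * P = P * X" for X P :: "'a fmat"
  proof -
    have k: "X * (2 \<cdot> finv I P) = (2 \<cdot> finv I P) * X" using com[OF P X e] by simp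
    show ?thesis unfolding has_type_def kpow_mult_unit[OF I X DU[OF P] k]
      using X Mats_mult[OF X GLs_Mats[OF DU[OF P]]] by blast
  qed
  have XD: "X * ?D X = ?D X * X" and XE: "X * ?E X = ?E X * X" if "X \<in> Mats I I" for X
    using idm_mult[OF that I] mult_idm[OF that I] by (simp_all add: left_diff_distrib right_diff_distrib distrib_left distrib_right)
  have TD: "X * (2 \<cdot> finv I (?D X)) * ?D X = 2 \<cdot> X" if "X \<in> Mats I I" "?D X \<in> GLs I" for X
    using finv_cancel_right(2)[OF that(2) I that(1)] by simp
  \<comment> \<open>The inverse transform \<open>X = T / (2 + T)\<close>, written without
    division.\<close>
  have key: "?E T * X = T" if T: "T \<in> Mats I I" and X: "X \<in> Mats I I" and e: "T * ?D X = 2 \<cdot> X" for T X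
  proof -
    have 1: "T - T * X = 2 \<cdot> X" using e unfolding right_diff_distrib mult_idm[OF T I subset_refl] .
    have "?E T * X = 2 \<cdot> X + T * X" using idm_mult[OF X I] by (simp add: distrib_right)
    also have "... = T" unfolding 1[symmetric] by simp
    finally show ?thesis .
  qed
  have mem: "(B, Y) \<in> Prt th ep I \<mu> \<longleftrightarrow> B \<in> SN ep I & defect th B Y = 0 & has_type I \<mu> Y" if "Y \<in> Mats I I" for B Y :: "'a fmat" and th
    using that by (simp add: Prt_def Prs_defect conj_assoc)
  have ef: "?f (B, X) \<in> Prt 1 ep I \<mu> \<longleftrightarrow> (B, X) \<in> Prt 0 ep I \<mu>" if h: "has_type I \<mu> X" for B X
  proof -
    have X: "X \<in> Mats I I" using h by (simp add: has_type_def)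
    have T: "X * (2 \<cdot> finv I (?D X)) \<in> Mats I I" by (rule Mats_mult[OF X GLs_Mats[OF DU[OF D[OF h]]]])
    have d: "defect 1 B (X * (2 \<cdot> finv I (?D X))) = 0 \<longleftrightarrow> defect 0 B X = 0" if "B \<in> SN ep I"
      by (rule defect_Cayley[OF I two SN_Mats[OF that] X T D[OF h] TD[OF X D[OF h]]])
    have "has_type I \<mu> (X * (2 \<cdot> finv I (?D X)))" using ht[OF D[OF h] X XD[OF X]] h by (rule iffD2)
    then show ?thesis unfolding prod.case mem[OF T] mem[OF X] using d h by iprover
  qed
  have "?f ` Prt 0 ep I \<mu> = Prt 1 ep I \<mu>"
  proof
    show "?f ` Prt 0 ep I \<mu> \<subseteq> Prt 1 ep I \<mu>"
    proof (rule image_subsetI)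
      fix x assume x: "x \<in> Prt 0 ep I \<mu>"
      obtain B X where xx: "x = (B, X)" by (metis surj_pair)
      then have "has_type I \<mu> X" using x by (simp add: Prt_def)
      then show "?f x \<in> Prt 1 ep I \<mu>" using ef[of X B] x xx by simp
    qed
    show "Prt 1 ep I \<mu> \<subseteq> ?f ` Prt 0 ep I \<mu>"
    proof
      fix y assume y: "y \<in> Prt 1 ep I \<mu>"
      obtain B T where yy: "y = (B, T)" by (metis surj_pair)
      have h: "has_type I \<mu> T" using y yy by (simp add: Prt_def)
      then have T: "T \<in> Mats I I" by (simp add: has_type_def)
      let ?X = "T * finv I (?E T)"
      note E' = E[OF h]
      have X: "?X \<in> Mats I I" by (rule Mats_mult[OF T finv_props(1)[OF E']])
      have hX: "has_type I \<mu> ?X"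
      proof -
        have k: "T * finv I (?E T) = finv I (?E T) * T" by (rule com[OF E' T XE[OF T]])
        show ?thesis using h unfolding has_type_def kpow_mult_unit[OF I T finv_GLs[OF E'] k] using X by blast
      qed
      have "?D ?X = ?E T * finv I (?E T) - T * finv I (?E T)" unfolding finv_props(2)[OF E'] ..
      also have "... = 2 \<cdot> finv I (?E T)" using idm_mult[OF finv_props(1)[OF E'] I] by (simp add: distrib_right)
      finally have d: "?D ?X = 2 \<cdot> finv I (?E T)" .
      have "(1/2) \<cdot> ?E T = finv I (?D ?X)"
      proof (rule finv_unique[OF D[OF hX] I])
        show "(1/2) \<cdot> ?E T \<in> Mats I I" by (rule Mats_smult[OF GLs_Mats[OF E']])
        have "?D ?X * ((1/2) \<cdot> ?E T) = ((1/2) * 2) \<cdot> (finv I (?E T) * ?E T)" unfolding d by (simp only: smult_mult_left smult_mult_right smult_smult)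
        then show "?D ?X * ((1/2) \<cdot> ?E T) = idm I" unfolding finv_props(3)[OF E'] using two by simp
      qed
      then have "?X * (2 \<cdot> finv I (?D ?X)) = ?X * (2 \<cdot> ((1/2) \<cdot> ?E T))" by (simp only:)
      also have "2 \<cdot> ((1/2) \<cdot> ?E T) = ?E T" unfolding smult_smult using two by simp
      also have "?X * ?E T = T" by (rule finv_cancel_right(2)[OF E' I T])
      finally have f: "?f (B, ?X) = y" unfolding yy by simp
      then have "(B, ?X) \<in> Prt 0 ep I \<mu>" using ef[OF hX, of B] y by simp
      then show "y \<in> ?f ` Prt 0 ep I \<mu>" using f[symmetric] by (rule rev_image_eqI)
    qed
  qed
  moreover have "inj_on ?f (Prt 0 ep I \<mu>)"
  proof (rule inj_onI)
    fix x y assume x: "x \<in> Prt 0 ep I \<mu>" and y: "y \<in> Prt 0 ep I \<mu>" and e: "?f x = ?f y"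
    obtain B X C Y where xx: "x = (B, X)" and yy: "y = (C, Y)" by (metis surj_pair)
    have h: "has_type I \<mu> X" "has_type I \<mu> Y" using x y xx yy by (simp_all add: Prt_def)
    then have m: "X \<in> Mats I I" "Y \<in> Mats I I" by (simp_all add: has_type_def)
    let ?T = "X * (2 \<cdot> finv I (?D X))"
    have TY: "?T = Y * (2 \<cdot> finv I (?D Y))" and BC: "B = C" using e xx yy by simp_all
    have T: "?T \<in> Mats I I" by (rule Mats_mult[OF m(1) GLs_Mats[OF DU[OF D[OF h(1)]]]])
    have hT: "has_type I \<mu> ?T" using ht[OF D[OF h(1)] m(1) XD[OF m(1)]] h(1) by blast
    have a: "?T * ?D X = 2 \<cdot> X" "?T * ?D Y = 2 \<cdot> Y" by (rule TD[OF m(1) D[OF h(1)]], unfold TY, rule TD[OF m(2) D[OF h(2)]])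
    have "?E ?T * X = ?T" "?E ?T * Y = ?T" by (rule key[OF T m(1) a(1)], rule key[OF T m(2) a(2)])
    then have "?E ?T * (X - Y) = 0" by (simp add: right_diff_distrib)
    then have "X - Y = 0" by (rule GLs_cancel[OF E[OF hT] I Mats_diff[OF m]])
    then show "x = y" using xx yy BC by simp
  qed
  ultimately show ?thesis by (rule card_image_eqI)
qed

text \<open>\<open>X\<close> is skew for \<open>B\<close> iff \<open>B * X\<close> lies in
  \<open>Sym (- ep)\<close>. As \<open>B\<close> is invertible, \<open>B * X\<close> determines
  \<open>X\<close> and is invertible together with it.\<close>

lemma card_skew_pairs:
  fixes ep :: "'a::{field,finite}"
  assumes I: "finite I" and eps: "ep = 1 \<or> ep = -1"
  shows "card (Prs 0 ep I) = card (SN ep I) * card (Sym (- ep) I)"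
    and "card (Pri 0 ep I) = card (SN ep I) * card (SN (- ep) I)"
proof -
  let ?f = "\<lambda>(B, T). (B, B * T :: 'a fmat)" and ?g = "\<lambda>(B, S). (B, finv I B * S :: 'a fmat)"
  have ee: "ep * ep = 1" using eps by auto
  have s: "defect 0 B T = 0 \<longleftrightarrow> tr (B * T) = - ep \<cdot> (B * T)" if "tr B = ep \<cdot> B" for B T :: "'a fmat"
  proof -
    have "tr (B * T) = ep \<cdot> (tr T * B)" using that by simp
    moreover have "ep \<cdot> (tr T * B) = - ep \<cdot> (B * T) \<longleftrightarrow> ep \<cdot> (ep \<cdot> (tr T * B)) = ep \<cdot> (- ep \<cdot> (B * T))"
      by (metis ee smult_one smult_smult)
    moreover have "ep \<cdot> (ep \<cdot> (tr T * B)) = ep \<cdot> (- ep \<cdot> (B * T)) \<longleftrightarrow> tr T * B = - (B * T)" using ee by simp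
    ultimately show ?thesis by (simp add: defect_def add_eq_0_iff2)
  qed
  have c1: "bij_betw ?f (Prs 0 ep I) (SN ep I \<times> Sym (- ep) I)"
  proof (rule bij_betwI[where g = ?g])
    show "?f \<in> Prs 0 ep I \<rightarrow> SN ep I \<times> Sym (- ep) I"
    proof
      fix x assume x: "x \<in> Prs 0 ep I"
      obtain B T where xx: "x = (B, T)" by (metis surj_pair)
      then have p: "B \<in> SN ep I" "T \<in> Mats I I" "defect 0 B T = 0" using x by (simp_all add: Prs_defect)
      show "?f x \<in> SN ep I \<times> Sym (- ep) I" unfolding xx
        using p s[OF SND(2)[OF p(1)], of T] SymI[OF Mats_mult[OF SN_Mats[OF p(1)] p(2)]] by simp
    qed
    show "?g \<in> SN ep I \<times> Sym (- ep) I \<rightarrow> Prs 0 ep I"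
    proof
      fix x assume x: "x \<in> SN ep I \<times> Sym (- ep) I"
      obtain B S where xx: "x = (B, S)" by (metis surj_pair)
      then have p0: "B \<in> SN ep I" "S \<in> Sym (- ep) I" using x by simp_all
      note p = p0(1) SymD[OF p0(2)]
      note B = SND(1)[OF p(1)]
      have "B * (finv I B * S) = S" by (rule finv_cancel(1)[OF B I p(2)])
      then have "defect 0 B (finv I B * S) = 0" using s[OF SND(2)[OF p(1)], of "finv I B * S"] p(3) by simp
      then show "?g x \<in> Prs 0 ep I" unfolding xx Prs_defect using p(1) Mats_mult[OF finv_props(1)[OF B] p(2)] by simp
    qed
    show "?g (?f x) = x" if "x \<in> Prs 0 ep I" for x
      proof -
      obtain B T where xx: "x = (B, T)" by (metis surj_pair)
      then have p0: "B \<in> SN ep I" "T \<in> Mats I I" using that by (simp_all add: Prs_def)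
      show ?thesis unfolding xx prod.case finv_cancel(2)[OF SND(1)[OF p0(1)] I p0(2)] ..
    qed
    show "?f (?g x) = x" if "x \<in> SN ep I \<times> Sym (- ep) I" for x
      proof -
      obtain B S where xx: "x = (B, S)" by (metis surj_pair)
      then have p0: "B \<in> SN ep I" "S \<in> Sym (- ep) I" using that by simp_all
      show ?thesis unfolding xx prod.case finv_cancel(1)[OF SND(1)[OF p0(1)] I SymD(1)[OF p0(2)]] ..
    qed
  qed
  then show "card (Prs 0 ep I) = card (SN ep I) * card (Sym (- ep) I)" by (simp add: bij_betw_same_card card_cartesian_product)
  have e: "?f x \<in> SN ep I \<times> SN (- ep) I \<longleftrightarrow> x \<in> Pri 0 ep I" if x: "x \<in> Prs 0 ep I" for x
  proof -
    obtain B T where xx: "x = (B, T)" by (metis surj_pair)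
    then have p: "B \<in> SN ep I" "T \<in> Mats I I" using x by (simp_all add: Prs_defect)
    have "?f x \<in> SN ep I \<times> Sym (- ep) I" using c1 x unfolding bij_betw_def by blast
    then show ?thesis using x GLs_mult_iff(1)[OF I SND(1)[OF p(1)] p(2)] unfolding xx SN_Sym Pri_def by auto
  qed
  have "bij_betw ?f (Pri 0 ep I) (SN ep I \<times> SN (- ep) I)"
  proof (rule bij_betw_subset[OF c1])
    show "Pri 0 ep I \<subseteq> Prs 0 ep I" by (auto simp: Pri_def)
    show "?f ` Pri 0 ep I = SN ep I \<times> SN (- ep) I"
    proof
      show "?f ` Pri 0 ep I \<subseteq> SN ep I \<times> SN (- ep) I" using e by (auto simp: Pri_def)
      show "SN ep I \<times> SN (- ep) I \<subseteq> ?f ` Pri 0 ep I"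
      proof
        fix y assume y: "y \<in> SN ep I \<times> SN (- ep) I"
        then have "y \<in> SN ep I \<times> Sym (- ep) I" by (auto simp: SN_Sym)
        then obtain x where x: "x \<in> Prs 0 ep I" "y = ?f x" using c1 unfolding bij_betw_def by blast
        have "?f x \<in> SN ep I \<times> SN (- ep) I" using y unfolding x(2) .
        then show "y \<in> ?f ` Pri 0 ep I" unfolding x(2) by (rule imageI[OF iffD1[OF e[OF x(1)]]])
      qed
    qed
  qed
  then show "card (Pri 0 ep I) = card (SN ep I) * card (SN (- ep) I)" by (simp add: bij_betw_same_card card_cartesian_product)
qed

section \<open>The type of a primary component\<close>

text \<open>The counterpart of \<open>poly_act\<close> for finitely supported matrices.\<close>

definition act :: "'a::field fmat => 'a poly => 'a fmat => 'a fmat" where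
  "act G p v = (\<Sum>i\<le>degree p. coeff p i \<cdot> ((*) G ^^ i) v)"

lemma act_alt: "degree p \<le> N ==> act G p v = (\<Sum>i\<le>N. coeff p i \<cdot> ((*) G ^^ i) v)"
  unfolding act_def by (rule sum.mono_neutral_left) (auto simp: coeff_eq_0)

lemma act_0 [simp]: "act G 0 v = 0" by (simp add: act_def)

lemma act_pCons [simp]: "act G (pCons a p) v = a \<cdot> v + G * act G p v"
proof -
  have "act G (pCons a p) v = (\<Sum>i\<le>Suc (degree p). coeff (pCons a p) i \<cdot> ((*) G ^^ i) v)"
    by (rule act_alt[OF degree_pCons_le])
  also have "... = a \<cdot> v + (\<Sum>i\<le>degree p. coeff p i \<cdot> (G * ((*) G ^^ i) v))"
    by (simp add: sum.atMost_Suc_shift del: sum.atMost_Suc)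
  also have "(\<Sum>i\<le>degree p. coeff p i \<cdot> (G * ((*) G ^^ i) v)) = G * act G p v"
    by (simp add: act_def sum_distrib_left)
  finally show ?thesis .
qed

lemma act_1 [simp]: "act G 1 v = v" by (simp add: one_pCons)

lemma act_add: "act G (p + q) v = act G p v + act G q v"
proof -
  let ?N = "max (degree p) (degree q)"
  have "degree p \<le> ?N" "degree q \<le> ?N" "degree (p + q) \<le> ?N" by (simp_all add: degree_add_le)
  then show ?thesis by (simp add: act_alt[of _ ?N] add_smult sum.distrib)
qed

lemma act_smult: "act G (Polynomial.smult c p) v = c \<cdot> act G p v" by (induction p) simp_all

lemma act_mult: "act G (p * q) v = act G p (act G q v)"
  by (induction p) (simp_all add: act_add act_smult)

lemma act_vec_0 [simp]: "act G p 0 = 0" by (induction p) simp_all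

lemma act_vec_add: "act G p (v + w) = act G p v + act G p w"
  by (induction p) (simp_all add: distrib_left ac_simps)

declare act_pCons [simp del]

lemma act_mod:
  assumes "act G \<psi> u = 0" shows "act G (p mod \<psi>) u = act G p u"
proof -
  have "act G p u = act G (p div \<psi> * \<psi> + p mod \<psi>) u" by simp
  also have "... = act G (p mod \<psi>) u" unfolding act_add act_mult assms by simp
  finally show ?thesis ..
qed

abbreviation "zm1 \<equiv> [:-1, 1:] :: 'a::field poly"

lemma reduced_iff: "p mod zm1 ^ d = p \<longleftrightarrow> p = 0 \<or> degree p < d"
proof -
  have d: "degree (zm1 ^ d :: 'a poly) = d" by (simp add: degree_power_eq)
  show ?thesis
  proof
    assume "p mod zm1 ^ d = p"
    then show "p = 0 \<or> degree p < d" using degree_mod_less[of "zm1 ^ d" p] d by (metis power_not_zero pCons_eq_0_iff zero_neq_one)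
  next
    assume "p = 0 \<or> degree p < d"
    then show "p mod zm1 ^ d = p" using d by (auto simp: mod_poly_less)
  qed
qed

lemma cyclic_sum_Nil [simp]: "cyclic_sum \<phi> [] = {[]}" by (auto simp: cyclic_sum_def)

lemma cyclic_sum_Cons: "ps \<in> cyclic_sum \<phi> (d # ds) \<longleftrightarrow> (\<exists>p ps'. ps = p # ps' & p mod \<phi> ^ d = p & ps' \<in> cyclic_sum \<phi> ds)"
  by (auto simp: cyclic_sum_def list_all2_Cons2)

text \<open>The map from \<open>cyclic_sum\<close> that sends the unit of each summand to its
  generator \<open>u\<close>. The number \<open>d\<close> records the exponent of the summand and is
  read off by \<open>map snd\<close>.\<close>

fun hm :: "'a::field fmat => ('a fmat \<times> nat) list => 'a poly list => 'a fmat" where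
  "hm G ((u, d) # us) (p # ps) = act G p u + hm G us ps"
| "hm G _ _ = 0"

lemma hm_add:
  "ps \<in> cyclic_sum \<phi> (map snd us) ==> qs \<in> cyclic_sum \<phi> (map snd us) ==>
    hm G us (cyclic_sum_add ps qs) = hm G us ps + hm G us qs & cyclic_sum_add ps qs \<in> cyclic_sum \<phi> (map snd us)"
proof (induction us arbitrary: ps qs)
  case (Cons x us)
  obtain u d where x: "x = (u, d)" by (metis surj_pair)
  obtain p ps' q qs' where *: "ps = p # ps'" "p mod \<phi> ^ d = p" "ps' \<in> cyclic_sum \<phi> (map snd us)"
    "qs = q # qs'" "q mod \<phi> ^ d = q" "qs' \<in> cyclic_sum \<phi> (map snd us)"
    using Cons.prems x by (auto simp: cyclic_sum_Cons)
  have "(p + q) mod \<phi> ^ d = p + q" using *(2,5) by (simp add: poly_mod_add_left)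
  then show ?case using Cons.IH[OF *(3,6)] * x by (simp add: cyclic_sum_add_def cyclic_sum_Cons act_add algebra_simps)
qed (simp add: cyclic_sum_add_def)

lemma hm_act:
  "ps \<in> cyclic_sum \<phi> (map snd us) ==> (\<And>u d. (u, d) \<in> set us ==> act G (\<phi> ^ d) u = 0) ==>
    hm G us (cyclic_sum_act \<phi> (map snd us) r ps) = act G r (hm G us ps) & cyclic_sum_act \<phi> (map snd us) r ps \<in> cyclic_sum \<phi> (map snd us)"
proof (induction us arbitrary: ps)
  case (Cons x us)
  obtain u d where x: "x = (u, d)" by (metis surj_pair)
  obtain p ps' where *: "ps = p # ps'" "p mod \<phi> ^ d = p" "ps' \<in> cyclic_sum \<phi> (map snd us)"
    using Cons.prems x by (auto simp: cyclic_sum_Cons)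
  have IH: "hm G us (cyclic_sum_act \<phi> (map snd us) r ps') = act G r (hm G us ps') & cyclic_sum_act \<phi> (map snd us) r ps' \<in> cyclic_sum \<phi> (map snd us)"
    by (rule Cons.IH[OF *(3)]) (use Cons.prems(2) in simp)
  have "act G ((r * p) mod \<phi> ^ d) u = act G r (act G p u)"
    unfolding act_mult[symmetric] by (rule act_mod) (use Cons.prems(2) x in simp)
  then show ?case using IH * x by (simp add: cyclic_sum_act_def cyclic_sum_Cons act_vec_add)
qed (simp add: cyclic_sum_act_def)

section \<open>Decomposition into cyclic modules\<close>

definition subm :: "'a::field fmat => 'a fmat set => bool" where
  "subm G M \<longleftrightarrow> 0 \<in> M & (\<forall>v\<in>M. \<forall>w\<in>M. v + w \<in> M) & (\<forall>r. \<forall>v\<in>M. act G r v \<in> M)"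

lemma subm_minus: "subm G M ==> v \<in> M ==> w \<in> M ==> v - w \<in> M"
proof -
  assume M: "subm G M" and v: "v \<in> M" and w: "w \<in> M"
  have "act G [:-1:] w \<in> M" using M w unfolding subm_def by blast
  then have "v + act G [:-1:] w \<in> M" using M v unfolding subm_def by blast
  then show ?thesis by (simp add: act_pCons)
qed

lemma hm_mem: "subm G M ==> fst ` set us \<subseteq> M ==> hm G us ps \<in> M"
  by (induction G us ps rule: hm.induct) (auto simp: subm_def)

definition span :: "'a::field fmat => ('a fmat \<times> nat) list => 'a fmat set" where
  "span G us = hm G us ` cyclic_sum zm1 (map snd us)"

text \<open>A family of generators in \<open>M\<close> on which \<open>hm\<close> is well defined
  and injective. Positive exponents exclude zero summands.\<close>

definition good :: "'a::field fmat => 'a fmat set => ('a fmat \<times> nat) list => bool" where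
  "good G M us \<longleftrightarrow> (\<forall>(u, d)\<in>set us. u \<in> M & d > 0 & act G (zm1 ^ d) u = 0) &
     (\<forall>ps\<in>cyclic_sum zm1 (map snd us). hm G us ps = 0 --> set ps \<subseteq> {0})"

lemma goodD: "good G M us ==> (u, d) \<in> set us ==> u \<in> M & d > 0 & act G (zm1 ^ d) u = 0"
  unfolding good_def by blast

lemma good_fst: "good G M us ==> fst ` set us \<subseteq> M"
  using goodD by fastforce

lemma span_add: "v \<in> span G us ==> w \<in> span G us ==> v + w \<in> span G us"
proof -
  assume "v \<in> span G us" "w \<in> span G us"
  then obtain ps qs where *: "ps \<in> cyclic_sum zm1 (map snd us)" "v = hm G us ps" "qs \<in> cyclic_sum zm1 (map snd us)" "w = hm G us qs"
    unfolding span_def by blast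
  show ?thesis unfolding *(2,4) using hm_add[OF *(1,3), of G] unfolding span_def by (metis image_eqI)
qed

lemma span_act: "good G M us ==> v \<in> span G us ==> act G r v \<in> span G us"
proof -
  assume g: "good G M us" and "v \<in> span G us"
  then obtain ps where *: "ps \<in> cyclic_sum zm1 (map snd us)" "v = hm G us ps" unfolding span_def by blast
  have "\<And>u d. (u, d) \<in> set us ==> act G (zm1 ^ d) u = 0" using g unfolding good_def by blast
  then show ?thesis unfolding *(2) using hm_act[OF *(1), of G r] unfolding span_def by (metis image_eqI)
qed

lemma zero_cyclic: "replicate (length ds) 0 \<in> cyclic_sum \<phi> ds" "hm G us (replicate (length us) 0) = 0"
  by (induction ds) (simp_all add: cyclic_sum_Cons, induction us, auto)

text \<open>A vector killed by \<open>z - 1\<close> spans a module of dimension at most one, which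
  is contained in the present span or meets it trivially.\<close>

lemma good_Cons:
  assumes g: "good G M us" and x: "x \<in> M" "act G zm1 x = 0"
  shows "\<exists>us'. good G M us' & span G us \<subseteq> span G us' & x \<in> span G us'"
proof (cases "x \<in> span G us")
  case False
  let ?us = "(x, 1) # us"
  have "set ps \<subseteq> {0}" if ps: "ps \<in> cyclic_sum zm1 (map snd ?us)" and z: "hm G ?us ps = 0" for ps
  proof -
    obtain p ps' where *: "ps = p # ps'" "p mod zm1 ^ 1 = p" "ps' \<in> cyclic_sum zm1 (map snd us)" using ps by (auto simp: cyclic_sum_Cons)
    have "p = 0 \<or> degree p < 1" using *(2) reduced_iff[of p 1] by simp
    then obtain c where c: "p = [:c:]" by (metis degree_eq_zeroE degree_0 less_one)
    have e: "c \<cdot> x + hm G us ps' = 0" using z *(1) c by (simp add: act_pCons)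
    have "c = 0"
    proof (rule ccontr)
      assume "c ~= 0"
      have "hm G us ps' \<in> span G us" using *(3) by (simp add: span_def)
      then have "act G [:- 1 / c:] (hm G us ps') \<in> span G us" by (rule span_act[OF g])
      moreover have "hm G us ps' = - (c \<cdot> x)" using e by (simp add: add_eq_0_iff)
      ultimately show False using False \<open>c ~= 0\<close> by (simp add: act_pCons)
    qed
    then have "hm G us ps' = 0" using e by simp
    then show ?thesis using g *(1,3) c \<open>c = 0\<close> by (auto simp: good_def)
  qed
  then have "good G M ?us" using g x by (auto simp: good_def)
  moreover have "span G us \<subseteq> span G ?us"
  proof
    fix v assume "v \<in> span G us"
    then obtain ps where *: "ps \<in> cyclic_sum zm1 (map snd us)" "v = hm G us ps" unfolding span_def by blast
    then show "v \<in> span G ?us" unfolding span_def by (intro image_eqI[of _ _ "0 # ps"]) (simp_all add: cyclic_sum_Cons)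
  qed
  moreover have "x \<in> span G ?us"
    unfolding span_def using zero_cyclic(1)[of "map snd us"] zero_cyclic(2)[of G us] reduced_iff[of "1 :: 'a poly" 1]
    by (intro image_eqI[of _ _ "1 # replicate (length us) 0"]) (simp_all add: cyclic_sum_Cons)
  ultimately show ?thesis by blast
qed (use g in blast)

lemma good_extend:
  assumes "finite S" "good G M us" "S \<subseteq> M" "\<And>x. x \<in> S ==> act G zm1 x = 0"
  shows "\<exists>us'. good G M us' & span G us \<subseteq> span G us' & S \<subseteq> span G us'"
  using assms
proof (induction S rule: finite_induct)
  case (insert x S)
  then obtain us' where 1: "good G M us'" "span G us \<subseteq> span G us'" "S \<subseteq> span G us'" by auto
  obtain us'' where 2: "good G M us''" "span G us' \<subseteq> span G us''" "x \<in> span G us''" using good_Cons[OF 1(1), of x] insert.prems by auto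
  have "span G us \<subseteq> span G us''" "insert x S \<subseteq> span G us''" using 1(2,3) 2(2,3) by blast+
  then show ?case using 2(1) by blast
qed blast

abbreviation "lifted f us == map (\<lambda>(v, e). (f v, Suc e)) us"

lemma hm_lift:
  assumes "\<forall>x\<in>set us. act G zm1 (f (fst x)) = fst x"
  shows "act G zm1 (hm G (lifted f us) ps) = hm G us ps"
  using assms
proof (induction us arbitrary: ps)
  case (Cons x us)
  obtain v e where x: "x = (v, e)" by (metis surj_pair)
  show ?case
  proof (cases ps)
    case (Cons p ps')
    have "act G zm1 (act G p (f v)) = act G p (act G zm1 (f v))" unfolding act_mult[symmetric] by (simp only: mult.commute)
    also have "... = act G p v" using Cons.prems x by simp
    finally have a: "act G zm1 (act G p (f v)) = act G p v" .
    have IH: "act G zm1 (hm G (lifted f us) ps') = hm G us ps'"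
      by (rule Cons.IH) (use Cons.prems in simp)
    show ?thesis unfolding Cons x by (simp only: list.map prod.case hm.simps act_vec_add a IH)
  qed simp
qed simp

text \<open>Multiplied by \<open>z - 1\<close>, a relation between lifted generators becomes one
  between the old generators, so every coefficient is divisible by a positive power of
  \<open>z - 1\<close>. Dividing the coefficients by \<open>z - 1\<close> again gives a relation
  between the old generators, and therefore all of them vanish.\<close>

lemma lift_injective:
  assumes lift: "\<forall>x\<in>set us. act G zm1 (f (fst x)) = fst x" and g: "good G M us"
    and ps: "ps \<in> cyclic_sum zm1 (map snd (lifted f us))" and z: "hm G (lifted f us) ps = 0"
  shows "set ps \<subseteq> {0}"
proof -
  let ?L = "lifted f us"
  have tor: "\<And>v e. (v, e) \<in> set us ==> act G (zm1 ^ e) v = 0 & e > 0" using g unfolding good_def by blast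
  have inj: "\<And>ps. ps \<in> cyclic_sum zm1 (map snd us) ==> hm G us ps = 0 ==> set ps \<subseteq> {0}" using g unfolding good_def by blast
  have red: "hm G us (map2 (\<lambda>p d. p mod zm1 ^ d) ps (map snd us)) = hm G us ps & map2 (\<lambda>p d. p mod zm1 ^ d) ps (map snd us) \<in> cyclic_sum zm1 (map snd us) & length ps = length us"
    if "ps \<in> cyclic_sum zm1 (map snd (lifted f us))" "\<And>v e. (v, e) \<in> set us ==> act G (zm1 ^ e) v = 0" for us ps
    using that
  proof (induction us arbitrary: ps)
    case (Cons x us)
    obtain v e where x: "x = (v, e)" by (metis surj_pair)
    obtain p ps' where *: "ps = p # ps'" "ps' \<in> cyclic_sum zm1 (map snd (lifted f us))"
      using Cons.prems(1) x by (auto simp: cyclic_sum_Cons)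
    have IH: "hm G us (map2 (\<lambda>p d. p mod zm1 ^ d) ps' (map snd us)) = hm G us ps' & map2 (\<lambda>p d. p mod zm1 ^ d) ps' (map snd us) \<in> cyclic_sum zm1 (map snd us) & length ps' = length us"
      by (rule Cons.IH[OF *(2)]) (use Cons.prems(2) in simp)
    have "act G (p mod zm1 ^ e) v = act G p v" by (rule act_mod) (use Cons.prems(2) x in simp)
    then show ?case using IH by (simp add: * x cyclic_sum_Cons)
  qed simp
  have z': "hm G us ps = 0" using hm_lift[OF lift, of ps] z by simp
  note r = red[OF ps conjunct1[OF tor]]
  have r0: "set (map2 (\<lambda>p d. p mod zm1 ^ d) ps (map snd us)) \<subseteq> {0}" by (rule inj) (use r z' in auto)
  have div: "hm G us (map (\<lambda>p. p div zm1) ps) = hm G (lifted f us) ps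
      & map (\<lambda>p. p div zm1) ps \<in> cyclic_sum zm1 (map snd us) & (\<forall>p\<in>set ps. p = zm1 * (p div zm1))"
    if "ps \<in> cyclic_sum zm1 (map snd (lifted f us))" "set (map2 (\<lambda>p d. p mod zm1 ^ d) ps (map snd us)) \<subseteq> {0}"
      "\<forall>x\<in>set us. act G zm1 (f (fst x)) = fst x & snd x > 0" for us ps
    using that
  proof (induction us arbitrary: ps)
    case (Cons x us)
    obtain v e where x: "x = (v, e)" by (metis surj_pair)
    obtain p ps' where *: "ps = p # ps'" "p mod zm1 ^ Suc e = p" "ps' \<in> cyclic_sum zm1 (map snd (lifted f us))"
      using Cons.prems(1) x by (auto simp: cyclic_sum_Cons)
    have IH: "hm G us (map (\<lambda>p. p div zm1) ps') = hm G (lifted f us) ps'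
      & map (\<lambda>p. p div zm1) ps' \<in> cyclic_sum zm1 (map snd us) & (\<forall>p\<in>set ps'. p = zm1 * (p div zm1))"
      by (rule Cons.IH[OF *(3)]) (use Cons.prems *(1) x in simp_all)
    have ve: "act G zm1 (f v) = v" "e > 0" using Cons.prems(3) x by simp_all
    have "zm1 ^ e dvd p" using Cons.prems(2) * x by (simp add: mod_eq_0_iff_dvd)
    moreover have "zm1 dvd zm1 ^ e" using ve(2) by (simp add: dvd_power)
    ultimately have "zm1 dvd p" by (rule dvd_trans[rotated])
    then have p: "p = zm1 * (p div zm1)" by (rule dvd_mult_div_cancel[symmetric])
    have "zm1 * ((p div zm1) mod zm1 ^ e) = (zm1 * (p div zm1)) mod (zm1 * zm1 ^ e)" by (rule mod_mult_mult1[symmetric])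
    also have "... = zm1 * (p div zm1)" using *(2) p by simp
    finally have "(p div zm1) mod zm1 ^ e = p div zm1" by (rule mult_left_cancel[THEN iffD1, rotated]) simp
    moreover have "act G (p div zm1) v = act G p (f v)"
    proof -
      have "act G (p div zm1) v = act G (p div zm1 * zm1) (f v)" unfolding act_mult ve(1) ..
      also have "p div zm1 * zm1 = p" using p by (simp only: mult.commute)
      finally show ?thesis .
    qed
    ultimately show ?case using IH p by (simp add: *(1) x cyclic_sum_Cons)
  qed simp
  have d: "hm G us (map (\<lambda>p. p div zm1) ps) = 0 & map (\<lambda>p. p div zm1) ps \<in> cyclic_sum zm1 (map snd us) & (\<forall>p\<in>set ps. p = zm1 * (p div zm1))"
    using div[OF ps r0] lift tor z by force
  have "set (map (\<lambda>p. p div zm1) ps) \<subseteq> {0}" by (rule inj) (use d in auto)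
  then have q: "p div zm1 = 0" if "p \<in> set ps" for p using that by auto
  show ?thesis
  proof
    fix p assume p: "p \<in> set ps"
    then have "p = zm1 * (p div zm1)" using d by blast
    then show "p \<in> {0}" unfolding q[OF p] by simp
  qed
qed

text \<open>Induction on the exponent. A decomposition of the multiples of \<open>z - 1\<close> in
  \<open>M\<close> is lifted along multiplication by \<open>z - 1\<close>, which lengthens every
  summand by one, and is then completed by vectors killed by \<open>z - 1\<close>.\<close>

lemma structure_theorem:
  fixes G :: "'a::field fmat"
  assumes "subm G M" "finite M" "\<And>m. m \<in> M ==> act G (zm1 ^ k) m = 0"
  shows "\<exists>us. good G M us & M = span G us"
proof -
  have sub: "span G us \<subseteq> M" if "good G M us" "subm G M" for M us
    using hm_mem[OF that(2) good_fst[OF that(1)]] by (auto simp: span_def)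
  have "\<exists>us. good G M us & M \<subseteq> span G us"
    using assms
  proof (induction k arbitrary: M)
    case 0
    then have "M \<subseteq> span G []" by (auto simp: span_def)
    moreover have "good G M []" by (simp add: good_def)
    ultimately show ?case by blast
  next
    case (Suc k)
    let ?M = "act G zm1 ` M"
    have s: "subm G ?M"
      unfolding subm_def
    proof (intro conjI ballI allI)
      show "0 \<in> ?M" using Suc.prems(1) by (intro image_eqI[of _ _ 0]) (simp_all add: subm_def)
    next
      fix v w assume "v \<in> ?M" "w \<in> ?M"
      then obtain a b where "a \<in> M" "b \<in> M" "v + w = act G zm1 (a + b)" by (auto simp: act_vec_add simp del: act_pCons)
      moreover have "a + b \<in> M" using \<open>a \<in> M\<close> \<open>b \<in> M\<close> Suc.prems(1) by (simp add: subm_def)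
      ultimately show "v + w \<in> ?M" by blast
    next
      fix r v assume "v \<in> ?M"
      then obtain a where a: "a \<in> M" "v = act G zm1 a" by blast
      have "act G r v = act G zm1 (act G r a)" unfolding a(2) act_mult[symmetric] by (simp only: mult.commute)
      moreover have "act G r a \<in> M" using a(1) Suc.prems(1) by (simp add: subm_def)
      ultimately show "act G r v \<in> ?M" by blast
    qed
    have "\<exists>us. good G ?M us & ?M \<subseteq> span G us"
    proof (rule Suc.IH[OF s])
      show "finite ?M" using Suc.prems(2) by simp
      fix m assume "m \<in> ?M"
      then obtain a where a: "a \<in> M" "m = act G zm1 a" by blast
      have "act G (zm1 ^ k) m = act G (zm1 ^ Suc k) a" unfolding a(2) act_mult[symmetric] by (simp only: power_Suc2)
      then show "act G (zm1 ^ k) m = 0" using Suc.prems(3)[OF a(1)] by simp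
    qed
    then obtain us where us: "good G ?M us" "?M \<subseteq> span G us" by blast
    define f where "f v = (SOME u. u \<in> M & act G zm1 u = v)" for v
    have f: "f v \<in> M & act G zm1 (f v) = v" if "v \<in> ?M" for v
      unfolding f_def by (rule someI_ex) (use that in blast)
    have lift: "\<forall>x\<in>set us. act G zm1 (f (fst x)) = fst x"
    proof
      fix x assume "x \<in> set us"
      then have "fst x \<in> ?M" using good_fst[OF us(1)] by blast
      then show "act G zm1 (f (fst x)) = fst x" using f by blast
    qed
    let ?L = "lifted f us"
    have gL: "good G M ?L"
      unfolding good_def
    proof (intro conjI ballI impI)
      fix x assume "x \<in> set ?L"
      then obtain v e where ve: "(v, e) \<in> set us" "x = (f v, Suc e)" by auto
      have v: "v \<in> ?M" "act G (zm1 ^ e) v = 0" using goodD[OF us(1) ve(1)] by blast+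
      have "act G (zm1 ^ Suc e) (f v) = act G (zm1 ^ e) (act G zm1 (f v))" unfolding act_mult[symmetric] by (simp only: power_Suc2)
      then have "act G (zm1 ^ Suc e) (f v) = 0" using f[OF v(1)] v(2) by simp
      then show "case x of (u, d) => u \<in> M & d > 0 & act G (zm1 ^ d) u = 0" unfolding ve(2) using f[OF v(1)] by simp
    next
      fix ps assume "ps \<in> cyclic_sum zm1 (map snd ?L)" "hm G ?L ps = 0"
      then show "set ps \<subseteq> {0}" by (rule lift_injective[OF lift us(1)])
    qed
    \<comment> \<open>An element of \<open>M\<close> minus a combination of lifted generators with
      the same multiple by \<open>z - 1\<close> lies in \<open>?K\<close>. Hence it suffices to
      adjoin \<open>?K\<close>.\<close>
    let ?K = "{x \<in> M. act G zm1 x = 0}"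
    have Kf: "finite ?K" using Suc.prems(2) by simp
    have "\<exists>us'. good G M us' & span G ?L \<subseteq> span G us' & ?K \<subseteq> span G us'"
      by (rule good_extend[OF Kf gL]) blast+
    then obtain us' where us': "good G M us'" "span G ?L \<subseteq> span G us'" "?K \<subseteq> span G us'" by (elim exE conjE)
    have "m \<in> span G us'" if m: "m \<in> M" for m
    proof -
      have "act G zm1 m \<in> span G us" using us(2) m by blast
      then obtain ps where ps: "ps \<in> cyclic_sum zm1 (map snd us)" "act G zm1 m = hm G us ps" unfolding span_def by blast
      have up: "ps \<in> cyclic_sum zm1 (map snd (lifted f us))" if "ps \<in> cyclic_sum zm1 (map snd us)" for us ps
        using that by (induction us arbitrary: ps) (auto simp: cyclic_sum_Cons reduced_iff simp del: power_Suc)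
      let ?s = "hm G ?L ps"
      have s1: "?s \<in> span G ?L" unfolding span_def using up[OF ps(1)] by blast
      have s2: "?s \<in> M" using sub[OF gL Suc.prems(1)] s1 by blast
      have "act G zm1 (m - ?s) = act G zm1 m - act G zm1 ?s" by (simp add: act_pCons right_diff_distrib)
      also have "... = 0" unfolding hm_lift[OF lift] ps(2) by simp
      finally have "m - ?s \<in> ?K" using subm_minus[OF Suc.prems(1) m s2] by simp
      then have "m - ?s \<in> span G us'" "?s \<in> span G us'" using us'(2,3) s1 by blast+
      from span_add[OF this] show ?thesis by simp
    qed
    then show ?case using us'(1) by blast
  qed
  then show ?thesis using sub assms(1) by blast
qed

lemma cyclic_sum_diff_zero:
  assumes "ps \<in> cyclic_sum \<phi> (map snd us)" "qs \<in> cyclic_sum \<phi> (map snd us)" "set (cyclic_sum_add ps (map uminus qs)) \<subseteq> {0}"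
  shows "ps = qs"
  using assms
proof (induction us arbitrary: ps qs)
  case (Cons x us)
  obtain p ps' q qs' where *: "ps = p # ps'" "ps' \<in> cyclic_sum \<phi> (map snd us)" "qs = q # qs'" "qs' \<in> cyclic_sum \<phi> (map snd us)"
    using Cons.prems(1,2) by (auto simp: cyclic_sum_Cons)
  have "set (cyclic_sum_add ps' (map uminus qs')) \<subseteq> {0}" "p - q = 0" using Cons.prems(3) * by (simp_all add: cyclic_sum_add_def)
  then show ?case using Cons.IH[OF *(2,4)] * by simp
qed simp

lemma cyclic_sum_uminus: "qs \<in> cyclic_sum \<phi> (map snd us) ==> map uminus qs \<in> cyclic_sum \<phi> (map snd us) & hm G us (map uminus qs) = - hm G us qs"
proof (induction us arbitrary: qs)
  case (Cons x us)
  obtain u d where x: "x = (u, d)" by (metis surj_pair)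
  obtain q qs' where *: "qs = q # qs'" "q mod \<phi> ^ d = q" "qs' \<in> cyclic_sum \<phi> (map snd us)"
    using Cons.prems x by (auto simp: cyclic_sum_Cons)
  have "act G (- q) u = - act G q u" using act_smult[of G "-1" q u] by simp
  moreover have "(- q) mod \<phi> ^ d = - q" using *(2) by (simp add: poly_mod_minus_left)
  ultimately show ?case using Cons.IH[OF *(3)] x by (simp add: * cyclic_sum_Cons)
qed simp

lemma good_inj_on: assumes g: "good G M us" shows "inj_on (hm G us) (cyclic_sum zm1 (map snd us))"
proof (rule inj_onI)
  fix ps qs assume p: "ps \<in> cyclic_sum zm1 (map snd us)" and q: "qs \<in> cyclic_sum zm1 (map snd us)" and e: "hm G us ps = hm G us qs"
  note u = cyclic_sum_uminus[OF q, of G]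
  note a = hm_add[OF p conjunct1[OF u], of G]
  have "hm G us (cyclic_sum_add ps (map uminus qs)) = 0" using a u e by simp
  then have "set (cyclic_sum_add ps (map uminus qs)) \<subseteq> {0}" using a g unfolding good_def by blast
  then show "ps = qs" by (rule cyclic_sum_diff_zero[OF p q])
qed

section \<open>Translation to vectors and matrices of a fixed size\<close>

definition vof :: "nat => 'a::field fmat => 'a vec" where "vof n w = vec n (\<lambda>i. ent w i 0)"
definition cof :: "nat => 'a::field vec => 'a fmat" where "cof n v = (\<Sum>i<n. eunit i 0 (vec_index v i))"
definition fof :: "nat => 'a::field mat => 'a fmat" where "fof n g = (\<Sum>i<n. \<Sum>j<n. eunit i j (index_mat g (i, j)))"
definition mof :: "nat => 'a::field fmat => 'a mat" where "mof n A = mat n n (\<lambda>(i, j). ent A i j)"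

lemma ent_cof: "ent (cof n v) a b = (if a < n & b = 0 then vec_index v a else 0)"
  by (auto simp: cof_def ent_sum ent_eunit)

lemma ent_fof: "ent (fof n g) a b = (if a < n & b < n then index_mat g (a, b) else 0)"
proof -
  have "(\<Sum>j<n. if a = i & b = j then index_mat g (i, j) else 0) = (if a = i then (if b < n then index_mat g (a, b) else 0) else 0)" for i
    by (cases "a = i") simp_all
  then show ?thesis unfolding fof_def ent_sum ent_eunit by simp
qed

lemma fof_Mats: "fof n g \<in> Mats {..<n} {..<n}" by (rule MatsI) (auto simp: ent_fof split: if_splits)
lemma cof_Mats: "cof n v \<in> Mats {..<n} {0}" by (rule MatsI) (auto simp: ent_cof split: if_splits)
lemma vof_carrier [simp]: "vof n w \<in> carrier_vec n" by (simp add: vof_def)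
lemma mof_carrier [simp]: "mof n A \<in> carrier_mat n n" by (simp add: mof_def)

lemma vof_cof: "v \<in> carrier_vec n ==> vof n (cof n v) = v"
  by (rule eq_vecI) (auto simp: vof_def ent_cof)
lemma cof_vof: "w \<in> Mats {..<n} {0} ==> cof n (vof n w) = w"
proof (rule fmat_eqI)
  fix i j assume "w \<in> Mats {..<n} {0}"
  then show "ent (cof n (vof n w)) i j = ent w i j" using MatsD[of w "{..<n}" "{0}" i j] by (simp add: ent_cof vof_def)
qed
lemma mof_fof: "g \<in> carrier_mat n n ==> mof n (fof n g) = g"
  by (rule eq_matI) (auto simp: mof_def ent_fof)
lemma fof_mof: "A \<in> Mats {..<n} {..<n} ==> fof n (mof n A) = A"
proof (rule fmat_eqI)
  fix i j assume "A \<in> Mats {..<n} {..<n}"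
  then show "ent (fof n (mof n A)) i j = ent A i j" using MatsD[of A "{..<n}" "{..<n}" i j] by (simp add: ent_fof mof_def)
qed

lemma bij_betw_vof: "bij_betw (vof n) (Mats {..<n} {0}) (carrier_vec n)"
  by (rule bij_betwI[where g = "cof n"]) (auto simp: vof_cof cof_vof cof_Mats)

lemma vof_add: "vof n (v + w) = vof n v + vof n w"
  by (rule eq_vecI) (auto simp: vof_def)

lemma vof_0: "vof n 0 = 0\<^sub>v n" by (rule eq_vecI) (auto simp: vof_def)

lemma vof_inj: "v \<in> Mats {..<n} {0} ==> w \<in> Mats {..<n} {0} ==> vof n v = vof n w \<longleftrightarrow> v = w"
  using cof_vof by metis

lemma mult_vof:
  assumes g: "g \<in> carrier_mat n n" and w: "w \<in> Mats {..<n} {0}"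
  shows "g *\<^sub>v vof n w = vof n (fof n g * w)"
proof (rule eq_vecI)
  fix i assume "i < dim_vec (vof n (fof n g * w))"
  then have i: "i < n" by (simp add: vof_def)
  have "ent (fof n g * w) i 0 = (\<Sum>k<n. ent (fof n g) i k * ent w k 0)"
    by (rule ent_mult) (simp_all add: ent_fof)
  then show "vec_index (g *\<^sub>v vof n w) i = vec_index (vof n (fof n g * w)) i"
    using i g by (simp add: vof_def scalar_prod_def ent_fof atLeast0LessThan)
qed (use g in \<open>simp add: vof_def\<close>)

lemma pow_vof:
  assumes g: "g \<in> carrier_mat n n" and w: "w \<in> Mats {..<n} {0}"
  shows "(g ^\<^sub>m i) *\<^sub>v vof n w = vof n (((*) (fof n g) ^^ i) w)"
  using w
proof (induction i arbitrary: w)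
  case 0
  then show ?case using g by simp
next
  case (Suc i)
  have "g ^\<^sub>m i \<in> carrier_mat n n" using g by simp
  then have "(g ^\<^sub>m Suc i) *\<^sub>v vof n w = (g ^\<^sub>m i) *\<^sub>v (g *\<^sub>v vof n w)" using g assoc_mult_mat_vec[of "g ^\<^sub>m i" n n g n "vof n w"] by simp
  also have "... = vof n (((*) (fof n g) ^^ i) (fof n g * w))"
    unfolding mult_vof[OF g Suc.prems] by (rule Suc.IH[OF Mats_mult[OF fof_Mats Suc.prems]])
  finally show ?case unfolding funpow_Suc_right o_def .
qed

lemma poly_act_vof:
  assumes g: "g \<in> carrier_mat n n" and w: "w \<in> Mats {..<n} {0}"
  shows "poly_act g r (vof n w) = vof n (act (fof n g) r w)"
proof (rule eq_vecI)
  fix j assume "j < dim_vec (vof n (act (fof n g) r w))"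
  then have j: "j < n" by (simp add: vof_def)
  then show "vec_index (poly_act g r (vof n w)) j = vec_index (vof n (act (fof n g) r w)) j"
    using g by (simp add: poly_act_def pow_vof[OF g w]) (simp add: vof_def act_def ent_sum)
qed (use g in \<open>simp add: poly_act_def vof_def\<close>)

lemma act_Mats: "G \<in> Mats I I ==> w \<in> Mats I J ==> act G r w \<in> Mats I J"
  unfolding act_def by (intro Mats_sum Mats_smult funpow_mult_Mats)

definition nilpart :: "nat => 'a::field mat => 'a fmat set" where
  "nilpart n g = {w \<in> Mats {..<n} {0}. \<exists>k. act (fof n g) (zm1 ^ k) w = 0}"

lemma primary_component_vof:
  assumes g: "g \<in> carrier_mat n n"
  shows "primary_component zm1 g = vof n ` nilpart n g"
proof (rule Set.set_eqI, rule iffI)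
  fix v assume "v \<in> primary_component zm1 g"
  then obtain k where v: "v \<in> carrier_vec n" and k: "poly_act g (zm1 ^ k) v = 0\<^sub>v n" using g by (auto simp: primary_component_def)
  let ?w = "cof n v"
  have w: "?w \<in> Mats {..<n} {0}" by (rule cof_Mats)
  have "vof n (act (fof n g) (zm1 ^ k) ?w) = vof n 0" using k poly_act_vof[OF g w, of "zm1 ^ k"] unfolding vof_cof[OF v] vof_0 by simp
  then have "act (fof n g) (zm1 ^ k) ?w = 0" using vof_inj[OF act_Mats[OF fof_Mats w] Mats_zero] by blast
  then have "?w \<in> nilpart n g" using w by (auto simp: nilpart_def)
  then show "v \<in> vof n ` nilpart n g" using vof_cof[OF v] by force
next
  fix v assume "v \<in> vof n ` nilpart n g"
  then obtain w k where w: "w \<in> Mats {..<n} {0}" and k: "act (fof n g) (zm1 ^ k) w = 0" and v: "v = vof n w" by (auto simp: nilpart_def)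
  have "poly_act g (zm1 ^ k) v = 0\<^sub>v n" unfolding v poly_act_vof[OF g w] k vof_0 ..
  then show "v \<in> primary_component zm1 g" using g v by (auto simp: primary_component_def)
qed

lemma primary_iso_exists:
  fixes g :: "'a::{field,finite} mat"
  assumes g: "g \<in> carrier_mat n n"
  shows "\<exists>ds h. 0 \<notin> set ds & primary_iso zm1 g ds h"
proof -
  let ?G = "fof n g" and ?M = "nilpart n g"
  have fin: "finite ?M" by (rule finite_subset[of _ "Mats {..<n} {0}"]) (auto simp: nilpart_def)
  have mono: "act ?G (zm1 ^ (k + l)) w = 0" if "act ?G (zm1 ^ k) w = 0" for k l w
    using that by (simp add: power_add mult.commute[of "zm1 ^ k"] act_mult)
  have sm: "subm ?G ?M"
    unfolding subm_def
  proof (intro conjI ballI allI)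
    show "0 \<in> ?M" by (auto simp: nilpart_def)
  next
    fix v w assume "v \<in> ?M" "w \<in> ?M"
    then obtain k l where *: "v \<in> Mats {..<n} {0}" "w \<in> Mats {..<n} {0}" "act ?G (zm1 ^ k) v = 0" "act ?G (zm1 ^ l) w = 0" by (auto simp: nilpart_def)
    have "act ?G (zm1 ^ (k + l)) (v + w) = 0"
      unfolding act_vec_add using mono[OF *(3), of l] mono[OF *(4), of k] by (simp add: add.commute)
    then show "v + w \<in> ?M" using Mats_add[OF *(1,2)] by (auto simp: nilpart_def)
  next
    fix r v assume "v \<in> ?M"
    then obtain k where *: "v \<in> Mats {..<n} {0}" "act ?G (zm1 ^ k) v = 0" by (auto simp: nilpart_def)
    have "act ?G (zm1 ^ k) (act ?G r v) = act ?G r (act ?G (zm1 ^ k) v)" unfolding act_mult[symmetric] by (simp only: mult.commute)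
    then have "act ?G (zm1 ^ k) (act ?G r v) = 0" unfolding *(2) by simp
    then show "act ?G r v \<in> ?M" using act_Mats[OF fof_Mats *(1)] by (auto simp: nilpart_def)
  qed
  \<comment> \<open>One exponent that works for all of the finitely many elements.\<close>
  define K where "K = (\<Sum>w\<in>?M. SOME k. act ?G (zm1 ^ k) w = 0)"
  have K: "act ?G (zm1 ^ K) w = 0" if w: "w \<in> ?M" for w
  proof -
    let ?k = "SOME k. act ?G (zm1 ^ k) w = 0"
    have "\<exists>k. act ?G (zm1 ^ k) w = 0" using w by (auto simp: nilpart_def)
    then have 1: "act ?G (zm1 ^ ?k) w = 0" by (rule someI_ex)
    have "?k \<le> K" unfolding K_def by (rule member_le_sum[OF w _ fin]) simp
    then obtain l where "K = ?k + l" using le_Suc_ex by blast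
    then show ?thesis using mono[OF 1, of l] by simp
  qed
  obtain us where us: "good ?G ?M us" "?M = span ?G us" using structure_theorem[OF sm fin K] by blast
  let ?ds = "map snd us" and ?h = "\<lambda>ps. vof n (hm ?G us ps)"
  have hM: "hm ?G us ps \<in> Mats {..<n} {0}" if "ps \<in> cyclic_sum zm1 ?ds" for ps
    using us(2) that by (auto simp: span_def nilpart_def)
  have "bij_betw ?h (cyclic_sum zm1 ?ds) (primary_component zm1 g)"
    unfolding bij_betw_def
  proof
    show "inj_on ?h (cyclic_sum zm1 ?ds)"
    proof (rule inj_onI)
      fix ps qs assume p: "ps \<in> cyclic_sum zm1 ?ds" and q: "qs \<in> cyclic_sum zm1 ?ds" and e: "?h ps = ?h qs"
      have "hm ?G us ps = hm ?G us qs" using vof_inj[OF hM[OF p] hM[OF q]] e by blast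
      then show "ps = qs" by (rule inj_onD[OF good_inj_on[OF us(1)] _ p q])
    qed
    show "?h ` cyclic_sum zm1 ?ds = primary_component zm1 g"
      unfolding primary_component_vof[OF g] us(2) span_def image_image ..
  qed
  moreover have "?h (cyclic_sum_add ps qs) = ?h ps + ?h qs" if "ps \<in> cyclic_sum zm1 ?ds" "qs \<in> cyclic_sum zm1 ?ds" for ps qs
    using hm_add[OF that, of ?G] by (simp add: vof_add)
  moreover have "?h (cyclic_sum_act zm1 ?ds r ps) = poly_act g r (?h ps)" if p: "ps \<in> cyclic_sum zm1 ?ds" for ps r
  proof -
    have "\<And>u d. (u, d) \<in> set us ==> act ?G (zm1 ^ d) u = 0" using goodD[OF us(1)] by blast
    from conjunct1[OF hm_act[OF p this, of r]] show ?thesis unfolding poly_act_vof[OF g hM[OF p]] by simp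
  qed
  ultimately have "primary_iso zm1 g ?ds ?h" unfolding primary_iso_def by blast
  moreover have "0 \<notin> set ?ds" using goodD[OF us(1)] by fastforce
  ultimately show ?thesis by blast
qed

section \<open>Kernel sizes in a sum of cyclic modules\<close>

lemma card_reduced: "card {p :: 'a::{field,finite} poly. p mod zm1 ^ d = p} = CARD('a) ^ d"
proof (induction d)
  case (Suc d)
  have "bij_betw (\<lambda>(a, p). pCons a p) (UNIV \<times> {p :: 'a poly. p mod zm1 ^ d = p}) {p. p mod zm1 ^ Suc d = p}"
    unfolding bij_betw_def
  proof
    show "inj_on (\<lambda>(a, p). pCons a p) (UNIV \<times> {p :: 'a poly. p mod zm1 ^ d = p})" by (auto simp: inj_on_def)
    have e: "pCons a r mod zm1 ^ Suc d = pCons a r \<longleftrightarrow> r mod zm1 ^ d = r" for a and r :: "'a poly"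
      unfolding reduced_iff by (auto simp: degree_pCons_eq_if)
    show "(\<lambda>(a, p). pCons a p) ` (UNIV \<times> {p :: 'a poly. p mod zm1 ^ d = p}) = {p. p mod zm1 ^ Suc d = p}"
    proof (rule Set.set_eqI, rule iffI)
      fix p :: "'a poly" assume "p \<in> (\<lambda>(a, p). pCons a p) ` (UNIV \<times> {p. p mod zm1 ^ d = p})"
      then obtain a r where "p = pCons a r" "r mod zm1 ^ d = r" by auto
      then show "p \<in> {p. p mod zm1 ^ Suc d = p}" using e[of a r] by blast
    next
      fix p :: "'a poly" assume p: "p \<in> {p. p mod zm1 ^ Suc d = p}"
      obtain a r where ar: "p = pCons a r" by (cases p)
      have "r mod zm1 ^ d = r" using p e[of a r] unfolding ar by blast
      then show "p \<in> (\<lambda>(a, p). pCons a p) ` (UNIV \<times> {p. p mod zm1 ^ d = p})" unfolding ar by (intro image_eqI[of _ _ "(a, r)"]) simp_all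
    qed
  qed
  then have "card {p :: 'a poly. p mod zm1 ^ Suc d = p} = card ((UNIV :: 'a set) \<times> {p :: 'a poly. p mod zm1 ^ d = p})" by (rule bij_betw_same_card[symmetric])
  then show ?case using Suc by (simp add: card_cartesian_product)
qed simp

text \<open>In the quotient by \<open>(z - 1)^d\<close> the elements killed by
  \<open>(z - 1)^i\<close> are the multiples of \<open>(z - 1)^(d - min d i)\<close>.\<close>

lemma card_reduced_killed:
  "card {p :: 'a::{field,finite} poly. p mod zm1 ^ d = p & (zm1 ^ i * p) mod zm1 ^ d = 0} = CARD('a) ^ min d i"
proof -
  let ?m = "min d i" and ?z = "zm1 :: 'a poly"
  have zn: "?z ^ k ~= 0" for k by simp
  have "bij_betw (\<lambda>c. ?z ^ (d - ?m) * c) {c. c mod ?z ^ ?m = c} {p. p mod ?z ^ d = p & (?z ^ i * p) mod ?z ^ d = 0}"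
    unfolding bij_betw_def
  proof
    show "inj_on (\<lambda>c. ?z ^ (d - ?m) * c) {c. c mod ?z ^ ?m = c}" using zn[of "d - ?m"] by (intro inj_onI) simp
    have dd: "?z ^ d = ?z ^ (d - ?m) * ?z ^ ?m" by (simp add: power_add[symmetric])
    have red: "(?z ^ (d - ?m) * c) mod ?z ^ d = ?z ^ (d - ?m) * c \<longleftrightarrow> c mod ?z ^ ?m = c" for c
      unfolding dd mod_mult_mult1 using zn[of "d - ?m"] by simp
    have dv: "?z ^ d dvd ?z ^ i * p \<longleftrightarrow> ?z ^ (d - ?m) dvd p" for p
    proof (cases "i \<le> d")
      case True
      have "?z ^ d = ?z ^ i * ?z ^ (d - i)" using True by (simp add: power_add[symmetric])
      then show ?thesis using True zn[of i] by (simp add: min_def dvd_times_left_cancel_iff)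
    next
      case False
      then have "?z ^ d dvd ?z ^ i" by (intro le_imp_power_dvd) simp
      then show ?thesis using False by (simp add: min_def dvd_mult2)
    qed
    show "(\<lambda>c. ?z ^ (d - ?m) * c) ` {c. c mod ?z ^ ?m = c} = {p. p mod ?z ^ d = p & (?z ^ i * p) mod ?z ^ d = 0}"
      unfolding mod_eq_0_iff_dvd dv using red by (auto simp: image_iff elim!: dvdE)
  qed
  then show ?thesis using card_reduced[of ?m, where 'a = 'a] by (simp add: bij_betw_same_card[symmetric])
qed

lemma card_cyclic_sum_killed:
  "card {ps \<in> cyclic_sum (zm1 :: 'a::{field,finite} poly) ds. cyclic_sum_act zm1 ds (zm1 ^ i) ps = replicate (length ds) 0} =
    CARD('a) ^ kdim (mset ds) i"
proof (induction ds)
  case Nil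
  have "{ps. ps = [] & cyclic_sum_act (zm1 :: 'a poly) [] (zm1 ^ i) ps = []} = {[]}" by (auto simp: cyclic_sum_act_def)
  then show ?case by (simp add: kdim_def)
next
  case (Cons d ds)
  let ?A = "{p :: 'a poly. p mod zm1 ^ d = p & (zm1 ^ i * p) mod zm1 ^ d = 0}"
  let ?B = "{ps \<in> cyclic_sum (zm1 :: 'a poly) ds. cyclic_sum_act zm1 ds (zm1 ^ i) ps = replicate (length ds) 0}"
  have "{ps \<in> cyclic_sum (zm1 :: 'a poly) (d # ds). cyclic_sum_act zm1 (d # ds) (zm1 ^ i) ps = replicate (length (d # ds)) 0}
      = (\<lambda>(p, ps). p # ps) ` (?A \<times> ?B)"
    by (auto simp: cyclic_sum_Cons cyclic_sum_act_def)
  moreover have "inj_on (\<lambda>(p, ps). p # ps) (?A \<times> ?B)" by (auto simp: inj_on_def)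
  ultimately show ?case using Cons by (simp add: card_image card_cartesian_product card_reduced_killed kdim_def power_add)
qed

lemma act_zm1_pow:
  assumes G: "G \<in> Mats I I" and I: "finite I" and w: "w \<in> Mats I {0}"
  shows "act G (zm1 ^ i) w = ((*) (G - idm I) ^^ i) w"
proof (induction i)
  case (Suc i)
  let ?X = "G - idm I"
  have m: "((*) ?X ^^ i) w \<in> Mats I {0}" by (rule funpow_mult_Mats[OF Mats_diff[OF G idm_Mats] w])
  have "act G (zm1 ^ Suc i) w = act G zm1 (((*) ?X ^^ i) w)" unfolding power_Suc act_mult Suc ..
  also have "... = ?X * ((*) ?X ^^ i) w" using idm_mult[OF m I subset_refl] by (simp add: act_pCons left_diff_distrib)
  finally show ?case by simp
qed simp

text \<open>An isomorphism matches the elements killed by \<open>(z - 1)^i\<close> on both sides. In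
  the whole space all such vectors belong to the primary component, so their number is the size of
  \<open>kpow\<close>.\<close>

lemma primary_iso_has_type:
  fixes g :: "'a::{field,finite} mat"
  assumes g: "g \<in> carrier_mat n n" and iso: "primary_iso zm1 g ds h"
  shows "has_type {..<n} (mset ds) (fof n g - idm {..<n})"
proof -
  let ?X = "fof n g - idm {..<n}" and ?cs = "cyclic_sum (zm1 :: 'a poly) ds" and ?z = "replicate (length ds) (0 :: 'a poly)"
  have bij: "bij_betw h ?cs (vof n ` nilpart n g)" using iso unfolding primary_iso_def primary_component_vof[OF g] by blast
  have hadd: "h (cyclic_sum_add ps qs) = h ps + h qs" if "ps \<in> ?cs" "qs \<in> ?cs" for ps qs using iso that unfolding primary_iso_def by blast
  have hact: "h (cyclic_sum_act zm1 ds r ps) = poly_act g r (h ps)" if "ps \<in> ?cs" for r ps using iso that unfolding primary_iso_def by blast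
  have hc: "h ps \<in> carrier_vec n" if "ps \<in> ?cs" for ps
  proof -
    have "h ps \<in> vof n ` nilpart n g" using bij that unfolding bij_betw_def by blast
    then show ?thesis by auto
  qed
  have z: "?z \<in> ?cs" by (rule zero_cyclic(1))
  \<comment> \<open>That \<open>h\<close> sends zero to zero is not part of
    \<open>primary_iso\<close> and is derived from additivity.\<close>
  have "cyclic_sum_add ?z ?z = ?z" by (simp add: cyclic_sum_add_def zip_replicate)
  then have "h ?z = h ?z + h ?z" using hadd[OF z z] by simp
  moreover have "h ?z + 0\<^sub>v n = h ?z" using hc[OF z] by simp
  ultimately have h0: "h ?z = 0\<^sub>v n"
    using hc[OF z] by (intro eq_vecI) (auto, metis add_cancel_right_right carrier_vecD index_add_vec(1))
  have cl: "cyclic_sum_act zm1 ds r ps \<in> ?cs" if "ps \<in> ?cs" for r ps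
    using that by (auto simp: cyclic_sum_def cyclic_sum_act_def list_all2_conv_all_nth)
  have "card (kpow {..<n} ?X i) = CARD('a) ^ kdim (mset ds) i" for i
  proof -
    have k: "kpow {..<n} ?X i = {w \<in> Mats {..<n} {0}. act (fof n g) (zm1 ^ i) w = 0}"
    proof -
      have "act (fof n g) (zm1 ^ i) w = ((*) ?X ^^ i) w" if "w \<in> Mats {..<n} {0}" for w
        by (rule act_zm1_pow[OF fof_Mats finite_lessThan that])
      then show ?thesis unfolding kpow_def by auto
    qed
    have "bij_betw h {ps \<in> ?cs. cyclic_sum_act zm1 ds (zm1 ^ i) ps = ?z} (vof n ` kpow {..<n} ?X i)"
    proof (rule bij_betw_subset[OF bij])
      show "{ps \<in> ?cs. cyclic_sum_act zm1 ds (zm1 ^ i) ps = ?z} \<subseteq> ?cs" by blast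
      show "h ` {ps \<in> ?cs. cyclic_sum_act zm1 ds (zm1 ^ i) ps = ?z} = vof n ` kpow {..<n} ?X i"
      proof (rule Set.set_eqI, rule iffI)
        fix v assume "v \<in> h ` {ps \<in> ?cs. cyclic_sum_act zm1 ds (zm1 ^ i) ps = ?z}"
        then obtain ps where ps: "ps \<in> ?cs" "cyclic_sum_act zm1 ds (zm1 ^ i) ps = ?z" "v = h ps" by blast
        have v0: "poly_act g (zm1 ^ i) v = 0\<^sub>v n" using hact[OF ps(1), of "zm1 ^ i"] ps(2,3) h0 by simp
        have v: "v \<in> carrier_vec n" using hc ps by simp
        have w: "cof n v \<in> Mats {..<n} {0}" by (rule cof_Mats)
        have "vof n (act (fof n g) (zm1 ^ i) (cof n v)) = vof n 0"
          using v0 unfolding poly_act_vof[OF g w, unfolded vof_cof[OF v]] vof_0 .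
        then have "act (fof n g) (zm1 ^ i) (cof n v) = 0" using vof_inj[OF act_Mats[OF fof_Mats w] Mats_zero] by blast
        then have "cof n v \<in> kpow {..<n} ?X i" using w k by blast
        then show "v \<in> vof n ` kpow {..<n} ?X i" by (rule rev_image_eqI) (rule vof_cof[OF v, symmetric])
      next
        fix v assume "v \<in> vof n ` kpow {..<n} ?X i"
        then obtain w where w: "w \<in> Mats {..<n} {0}" "act (fof n g) (zm1 ^ i) w = 0" "v = vof n w" using k by blast
        then have "w \<in> nilpart n g" by (auto simp: nilpart_def)
        then obtain ps where ps: "ps \<in> ?cs" "v = h ps" using bij w(3) unfolding bij_betw_def by blast
        have "h (cyclic_sum_act zm1 ds (zm1 ^ i) ps) = h ?z"
          unfolding hact[OF ps(1)] ps(2)[symmetric] w(3) poly_act_vof[OF g w(1)] w(2) vof_0 h0 ..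
        then have "cyclic_sum_act zm1 ds (zm1 ^ i) ps = ?z"
          using bij cl[OF ps(1)] z unfolding bij_betw_def inj_on_def by blast
        then show "v \<in> h ` {ps \<in> ?cs. cyclic_sum_act zm1 ds (zm1 ^ i) ps = ?z}" using ps by blast
      qed
    qed
    then have "card (vof n ` kpow {..<n} ?X i) = CARD('a) ^ kdim (mset ds) i"
      using card_cyclic_sum_killed[of ds i, where 'a = 'a] by (simp add: bij_betw_same_card[symmetric])
    moreover have "inj_on (vof n) (kpow {..<n} ?X i)"
      by (rule inj_on_subset[OF bij_betw_imp_inj_on[OF bij_betw_vof]]) (auto simp: kpow_def)
    ultimately show ?thesis by (simp add: card_image)
  qed
  then show ?thesis unfolding has_type_def using Mats_diff[OF fof_Mats idm_Mats] by blast
qed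

lemma kdim_step: "kdim \<mu> (Suc i) = kdim \<mu> i + size {#j \<in># \<mu>. i < j#}"
  by (induction \<mu>) (auto simp: kdim_def min_def)

lemma count_step: "size {#j \<in># \<mu>. i < j#} = count \<mu> (Suc i) + size {#j \<in># \<mu>. Suc i < j#}"
  by (induction \<mu>) auto

text \<open>The first differences of \<open>kdim\<close> are the conjugate partition, and the
  differences of these are the multiplicities.\<close>

lemma kdim_inject:
  assumes "kdim \<mu> = kdim \<nu>" "0 \<notin># \<mu>" "0 \<notin># \<nu>" shows "\<mu> = \<nu>"
proof (rule multiset_eqI)
  fix x
  have s: "size {#j \<in># \<mu>. i < j#} = size {#j \<in># \<nu>. i < j#}" for i
    using kdim_step[of \<mu> i] kdim_step[of \<nu> i] assms(1) by simp
  show "count \<mu> x = count \<nu> x"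
  proof (cases x)
    case 0
    then show ?thesis using assms(2,3) by (simp add: not_in_iff)
  next
    case (Suc i)
    then show ?thesis using count_step[of i \<mu>] count_step[of i \<nu>] s[of i] s[of "Suc i"] by simp
  qed
qed

lemma has_type_unique:
  fixes X :: "'a::{field,finite} fmat"
  assumes "has_type I \<mu> X" "has_type I \<nu> X" "0 \<notin># \<mu>" "0 \<notin># \<nu>" shows "\<mu> = \<nu>"
proof (rule kdim_inject[OF _ assms(3,4)], rule ext)
  fix i
  have "CARD('a) ^ kdim \<mu> i = CARD('a) ^ kdim \<nu> i" using assms(1,2) unfolding has_type_def by metis
  then show "kdim \<mu> i = kdim \<nu> i" using one_less_card_field[where 'a = 'a] by (simp add: power_inject_exp)
qed

text \<open>Existence of a decomposition and uniqueness of the type justify the definite description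
  and replace it by a statement about kernels.\<close>

lemma primary_partition_iff:
  fixes g :: "'a::{field,finite} mat"
  assumes g: "g \<in> carrier_mat n n"
  shows "primary_partition zm1 g = \<mu> \<longleftrightarrow> 0 \<notin># \<mu> & has_type {..<n} \<mu> (fof n g - idm {..<n})"
proof -
  obtain ds h where ds: "0 \<notin> set ds" and iso: "primary_iso zm1 g ds h" using primary_iso_exists[OF g] by blast
  note t = primary_iso_has_type[OF g]
  have p: "primary_partition zm1 g = mset ds"
    unfolding primary_partition_def
  proof (rule the_equality)
    show "is_partition (mset ds) & (\<exists>ds' h. mset ds' = mset ds & primary_iso zm1 g ds' h)" using ds iso by (auto simp: is_partition_def)
    fix \<nu> assume "is_partition \<nu> & (\<exists>ds h. mset ds = \<nu> & primary_iso zm1 g ds h)"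
    then obtain ds' h' where n: "0 \<notin># \<nu>" "mset ds' = \<nu>" "primary_iso zm1 g ds' h'" by (auto simp: is_partition_def)
    show "\<nu> = mset ds" by (rule has_type_unique[OF _ t[OF iso] n(1)]) (use t[OF n(3)] n(2) ds in simp_all)
  qed
  show ?thesis
  proof
    assume "primary_partition zm1 g = \<mu>"
    then show "0 \<notin># \<mu> & has_type {..<n} \<mu> (fof n g - idm {..<n})" using p ds t[OF iso] by auto
  next
    assume a: "0 \<notin># \<mu> & has_type {..<n} \<mu> (fof n g - idm {..<n})"
    have "\<mu> = mset ds" by (rule has_type_unique[OF conjunct2[OF a] t[OF iso] conjunct1[OF a]]) (use ds in simp)
    then show "primary_partition zm1 g = \<mu>" using p by simp
  qed
qed

section \<open>Congruence classes of symmetric matrices\<close>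

definition congr :: "nat set => 'a::comm_ring_1 fmat => 'a fmat => bool" where
  "congr I B C \<longleftrightarrow> (\<exists>P\<in>GLs I. C = tr P * B * P)"

lemma congrI: "P \<in> GLs I ==> tr P * B * P = C ==> congr I B C" by (auto simp: congr_def)

lemma congr_trans:
  fixes B :: "'a::{comm_ring_1,finite} fmat"
  assumes I: "finite I" and "congr I B C" "congr I C D" shows "congr I B D"
proof -
  obtain P where P: "P \<in> GLs I" "C = tr P * B * P" using assms(2) unfolding congr_def by blast
  obtain R where R: "R \<in> GLs I" "D = tr R * C * R" using assms(3) unfolding congr_def by blast
  have "tr (P * R) * B * (P * R) = D" unfolding P(2) R(2) tr_mult mult.assoc ..
  then show ?thesis by (rule congrI[OF GLs_mult[OF I P(1) R(1)]])
qed

lemma congr_sym: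
  fixes B :: "'a::{comm_ring_1,finite} fmat"
  assumes I: "finite I" and B: "B \<in> Mats I I" and "congr I B C" shows "congr I C B"
proof -
  obtain P where P: "P \<in> GLs I" "C = tr P * B * P" using assms(3) unfolding congr_def by blast
  let ?R = "finv I P"
  have "tr ?R * C * ?R = tr ?R * (tr P * (B * (P * ?R)))" unfolding P(2) mult.assoc ..
  also have "B * (P * ?R) = B" unfolding finv_props(2)[OF P(1)] by (rule mult_idm[OF B I subset_refl])
  also have "tr ?R * (tr P * B) = idm I * B" by (rule mult_eq_assoc[OF tr_finv(2)[OF P(1)]])
  also have "... = B" by (rule idm_mult[OF B I subset_refl])
  finally show ?thesis by (rule congrI[OF finv_GLs[OF P(1)]])
qed

lemma congr_refl: "finite I ==> B \<in> Mats I I ==> congr I B B"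
  by (rule congrI[OF idm_GLs]) (simp_all add: idm_mult[OF _ _ subset_refl] mult_idm[OF _ _ subset_refl])

lemma congr_SN:
  fixes B :: "'a::{comm_ring_1,finite} fmat"
  shows "finite I ==> B \<in> SN ep I ==> congr I B C ==> C \<in> SN ep I"
  using SN_congruence unfolding congr_def by blast

lemma congr_block:
  fixes B1 :: "'a::{comm_ring_1,finite} fmat"
  assumes fin: "finite I1" "finite I2" and dis: "I1 \<inter> I2 = {}" and m: "B1 \<in> Mats I1 I1" "B2 \<in> Mats I2 I2"
    and c: "congr I1 B1 C1" "congr I2 B2 C2"
  shows "congr (I1 \<union> I2) (B1 + B2) (C1 + C2)"
proof -
  obtain P where P: "P \<in> GLs I1" "C1 = tr P * B1 * P" using c(1) unfolding congr_def by blast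
  obtain R where R: "R \<in> GLs I2" "C2 = tr R * B2 * R" using c(2) unfolding congr_def by blast
  note g = GLs_Mats[OF P(1)] GLs_Mats[OF R(1)]
  have t: "tr P \<in> Mats I1 I1" "tr R \<in> Mats I2 I2" using g by simp_all
  have G: "P + R \<in> GLs (I1 \<union> I2)" using block_GLs(1)[OF fin dis g] P(1) R(1) by blast
  have "tr (P + R) * (B1 + B2) * (P + R) = (tr P * B1 + tr R * B2) * (P + R)"
    unfolding tr_add block_mult[OF t(1) m(1) t(2) m(2) dis] ..
  also have "... = C1 + C2"
    unfolding P(2) R(2) by (rule block_mult[OF Mats_mult[OF t(1) m(1)] g(1) Mats_mult[OF t(2) m(2)] g(2) dis])
  finally show ?thesis by (rule congrI[OF G])
qed

lemma congr_cofactor_GLs: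
  fixes B :: "'a::{comm_ring_1,finite} fmat"
  assumes I: "finite I" and P: "P \<in> Mats I I" and B: "B \<in> Mats I I" and E: "tr P * B * P \<in> GLs I"
  shows "P \<in> GLs I"
proof (rule GLsI_left[OF I P])
  have t: "tr P \<in> Mats I I" using P by simp
  show "finv I (tr P * B * P) * (tr P * B) \<in> Mats I I" by (rule Mats_mult[OF finv_props(1)[OF E] Mats_mult[OF t B]])
  show "finv I (tr P * B * P) * (tr P * B) * P = idm I"
    using finv_props(3)[OF E] by (simp only: mult.assoc)
qed

lemma eunit_mult: "eunit i j c * eunit k l d = (if j = k then eunit i l (c * d) else 0)"
  by (rule fmat_eqI) (auto simp: ent_mult_eunit ent_eunit)

lemma tr_eunit: "tr (eunit i j c) = eunit j i c" by (rule fmat_eqI) (auto simp: ent_eunit)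

lemma idm_singleton: "c \<cdot> idm {s} = eunit s s c" by (rule fmat_eqI) (auto simp: ent_eunit ent_idm)

lemma Mats_singleton: "A \<in> Mats {k} {k} ==> A = ent A k k \<cdot> idm {k}"
proof (rule fmat_eqI)
  fix i j assume "A \<in> Mats {k} {k}"
  then show "ent A i j = ent (ent A k k \<cdot> idm {k}) i j" using MatsD[of A "{k}" "{k}" i j] by (auto simp: ent_idm)
qed

lemma idm_empty: "idm {} = 0" by (rule fmat_eqI) (simp add: ent_idm)

text \<open>If the diagonal vanishes but the entry at \<open>(i, j)\<close> does not, adding the
  basis vector \<open>j\<close> to the basis vector \<open>i\<close> creates the diagonal entry
  \<open>2 * ent B i j\<close>.\<close>

lemma pivot_exists:
  fixes B :: "'a::{field,finite} fmat"
  assumes two: "(2 :: 'a) ~= 0" and I: "finite I" "I ~= {}" and B: "B \<in> SN 1 I"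
  shows "\<exists>C k. congr I B C & k \<in> I & ent C k k ~= 0"
proof (cases "\<exists>k\<in>I. ent B k k ~= 0")
  case True
  then show ?thesis using congr_refl[OF I(1) SN_Mats[OF B]] by blast
next
  case False
  have Bm: "B \<in> Mats I I" by (rule SN_Mats[OF B])
  have sym: "ent B j i = ent B i j" for i j using arg_cong[OF SND(2)[OF B], of "\<lambda>M. ent M i j"] by simp
  have "B ~= 0"
  proof
    assume "B = 0"
    then have "idm I = (0 :: 'a fmat)" using finv_props(2)[OF SND(1)[OF B]] by simp
    moreover obtain i where "i \<in> I" using I(2) by blast
    ultimately have "ent (idm I) i i = (0 :: 'a)" by simp
    then show False using \<open>i \<in> I\<close> I(1) by (simp add: ent_idm)
  qed
  then obtain i j where e: "ent B i j ~= 0" by (metis fmat_eqI ent_zero)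
  then have ij: "i \<in> I" "j \<in> I" using MatsD[OF Bm] by blast+
  then have ne: "i ~= j" using e False by blast
  let ?N = "eunit j i 1 :: 'a fmat"
  have N: "?N \<in> Mats I I" by (rule eunit_Mats[OF ij(2,1)])
  have NN: "?N * ?N = 0" using ne by (simp add: eunit_mult)
  have i1: "idm I * ?N = ?N" "?N * idm I = ?N" "idm I * idm I = (idm I :: 'a fmat)"
    using idm_mult[OF N I(1)] mult_idm[OF N I(1)] idm_mult_idm[OF I(1) I(1)] by simp_all
  have P: "idm I + ?N \<in> GLs I"
    by (rule GLsI_right[OF I(1) Mats_add[OF idm_Mats N] Mats_diff[OF idm_Mats N]])
      (simp add: distrib_left distrib_right right_diff_distrib i1 NN)
  let ?C = "tr (idm I + ?N) * B * (idm I + ?N)"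
  have t: "tr ?N = eunit i j 1" by (rule tr_eunit)
  have tN: "eunit i j 1 \<in> Mats I I" by (rule eunit_Mats[OF ij])
  have b: "idm I * B = B" "B * idm I = B" "eunit i j 1 * B * idm I = eunit i j 1 * B"
    using idm_mult[OF Bm I(1)] mult_idm[OF Bm I(1)] mult_idm[OF Mats_mult[OF tN Bm] I(1)] by simp_all
  have C: "?C = B + B * ?N + eunit i j 1 * B + eunit i j 1 * B * ?N"
    by (simp add: t distrib_left distrib_right b add.assoc)
  have r: "ent (eunit i j 1 * B) i x = ent B j x" for x
  proof -
    have "ent (eunit i j 1 * B) i x = ent (tr (eunit i j 1 * B)) x i" by (simp only: ent_tr)
    also have "... = ent (tr B * eunit j i 1) x i" by (simp only: tr_mult tr_eunit)
    also have "... = ent B j x" by (simp add: ent_mult_eunit)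
    finally show ?thesis .
  qed
  have "ent ?C i i = ent B i i + ent B i j + ent B j i + ent B j j" unfolding C by (simp add: ent_mult_eunit r)
  also have "... = 2 * ent B i j" using False ij sym[of i j] by simp
  finally have "ent ?C i i ~= 0" using e two by simp
  moreover have "congr I B ?C" by (rule congrI[OF P refl])
  ultimately show ?thesis using ij(1) by blast
qed

text \<open>The orthogonal complement of a vector of nonzero norm; \<open>N\<close> is the
  Gram-Schmidt correction.\<close>

lemma split_pivot:
  fixes B :: "'a::{field,finite} fmat"
  assumes J: "finite J" "k \<notin> J" and B: "B \<in> SN 1 ({k} \<union> J)" and a: "ent B k k ~= 0"
  shows "\<exists>D\<in>SN 1 J. congr ({k} \<union> J) B (ent B k k \<cdot> idm {k} + D)"
proof -
  let ?I = "{k} \<union> J" and ?a = "ent B k k"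
  have dis: "{k} \<inter> J = {}" "J \<inter> {k} = {}" using J by auto
  have I: "finite ?I" using J by simp
  have BS: "B \<in> Sym 1 ?I" using B by (simp add: SN_Sym)
  have one: "(1 :: 'a) * 1 = 1" by simp
  obtain A C D where m: "A \<in> Sym 1 {k}" "C \<in> Mats {k} J" "D \<in> Sym 1 J" "B = A + C + 1 \<cdot> tr C + D"
    by (rule Sym_UnE[OF BS finite.insertI[OF finite.emptyI] J(1) dis(1) one])
  note Am = SymD(1)[OF m(1)] and Dm = SymD(1)[OF m(3)]
  have tC: "tr C \<in> Mats J {k}" using m(2) by simp
  have "ent C k k = 0" "ent (tr C) k k = 0" "ent D k k = 0" using MatsD[OF m(2)] MatsD[OF Dm] J(2) by simp_all
  then have "?a = ent A k k" using m(4) by simp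
  then have A: "A = ?a \<cdot> idm {k}" using Mats_singleton[OF Am] by simp
  let ?b = "- (1 / ?a)"
  define N where "N = ?b \<cdot> C"
  have N: "N \<in> Mats {k} J" unfolding N_def by (rule Mats_smult[OF m(2)])
  have tN: "tr N \<in> Mats J {k}" using N by simp
  have AN: "A * N = - C" unfolding A N_def using idm_mult[OF m(2), of "{k}"] a by simp
  have NA: "tr N * A = - tr C" unfolding A N_def using mult_idm[OF tC, of "{k}"] a by simp
  have P: "idm {k} + idm J + N \<in> GLs ?I"
    by (rule GLs_add_block(1)[OF finite.insertI[OF finite.emptyI] J(1) dis(1) idm_GLs idm_GLs N]) (simp_all add: J)
  let ?P = "idm {k} + idm J + N"
  have z: "A * idm J = 0" "C * idm {k} = 0" "C * N = 0" "tr C * idm J = 0" "D * idm {k} = 0" "D * N = 0"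
    by (rule mult_disjoint[OF Am idm_Mats dis(1)] mult_disjoint[OF m(2) idm_Mats dis(2)] mult_disjoint[OF m(2) N dis(2)]
      mult_disjoint[OF tC idm_Mats dis(1)] mult_disjoint[OF Dm idm_Mats dis(2)] mult_disjoint[OF Dm N dis(2)])+
  have i: "A * idm {k} = A" "C * idm J = C" "tr C * idm {k} = tr C" "D * idm J = D"
    using mult_idm[OF Am, of "{k}"] mult_idm[OF m(2) J(1)] mult_idm[OF tC, of "{k}"] mult_idm[OF Dm J(1)] by simp_all
  let ?D = "D + tr C * N"
  have D'm: "?D \<in> Mats J J" by (rule Mats_add[OF Dm Mats_mult[OF tC N]])
  have BP: "B * ?P = A + tr C + ?D"
    unfolding m(4) smult_one distrib_left distrib_right z i AN by simp
  have z': "idm J * A = 0" "idm {k} * tr C = 0" "tr N * tr C = 0" "idm {k} * ?D = 0" "tr N * ?D = 0"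
    by (rule mult_disjoint[OF idm_Mats Am dis(2)] mult_disjoint[OF idm_Mats tC dis(1)] mult_disjoint[OF tN tC dis(1)]
      mult_disjoint[OF idm_Mats D'm dis(1)] mult_disjoint[OF tN D'm dis(1)])+
  have i': "idm {k} * A = A" "idm J * tr C = tr C" "idm J * ?D = ?D"
    using idm_mult[OF Am, of "{k}"] idm_mult[OF tC J(1)] idm_mult[OF D'm J(1)] by simp_all
  have tP: "tr ?P = idm {k} + idm J + tr N" by simp
  have e: "x * (A + tr C + ?D) = x * A + x * tr C + x * ?D" for x by (simp only: distrib_left)
  have "tr ?P * B * ?P = tr ?P * (B * ?P)" by (rule mult.assoc)
  also have "... = idm {k} * (A + tr C + ?D) + idm J * (A + tr C + ?D) + tr N * (A + tr C + ?D)"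
    unfolding BP tP by (simp only: distrib_right)
  also have "... = A + ?D" unfolding e z' i' NA by simp
  finally have eq: "tr ?P * B * ?P = A + ?D" .
  have c: "congr ?I B (A + ?D)" by (rule congrI[OF P eq])
  then have S: "A + ?D \<in> SN 1 ?I" by (rule congr_SN[OF I B])
  have "?D \<in> GLs J" using block_GLs(1)[OF finite.insertI[OF finite.emptyI] J(1) dis(1) Am D'm] SND(1)[OF S] by blast
  moreover have "tr ?D = 1 \<cdot> ?D"
  proof -
    have tD: "tr ?D \<in> Mats J J" unfolding Mats_tr by (rule D'm)
    have "A + tr ?D = A + ?D" using SND(2)[OF S] SymD(2)[OF m(1)] by simp
    then show ?thesis by simp
  qed
  ultimately have "?D \<in> SN 1 J" by (simp add: SN_def)
  then show ?thesis using c A by auto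
qed

lemma card_squares:
  assumes two: "(2 :: 'a::{field,finite}) ~= 0"
  shows "card ((\<lambda>c :: 'a. c\<^sup>2) ` (UNIV - {0})) * 2 = CARD('a) - 1"
proof -
  have "card ((\<lambda>c :: 'a. c\<^sup>2) ` (UNIV - {0})) * 2 = card (UNIV - {0 :: 'a}) * 1"
  proof (rule double_count[where R = "\<lambda>s c. c\<^sup>2 = s"])
    fix s :: 'a assume "s \<in> (\<lambda>c. c\<^sup>2) ` (UNIV - {0})"
    then obtain c where c: "s = c\<^sup>2" "c ~= 0" by blast
    have "{g \<in> UNIV - {0}. g\<^sup>2 = s} = {c, - c}" using c by (auto simp: power2_eq_iff)
    moreover have "c ~= - c"
    proof
      assume "c = - c"
      then have "2 * c = 0" by (metis add.right_inverse mult_2)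
      then show False using two c(2) by simp
    qed
    ultimately show "card {g \<in> UNIV - {0}. g\<^sup>2 = s} = 2" by simp
  next
    fix g :: 'a assume g: "g \<in> UNIV - {0}"
    have "{x \<in> (\<lambda>c. c\<^sup>2) ` (UNIV - {0}). g\<^sup>2 = x} = {g\<^sup>2}" using g by auto
    then show "card {x \<in> (\<lambda>c. c\<^sup>2) ` (UNIV - {0}). g\<^sup>2 = x} = 1" by simp
  qed simp_all
  then show ?thesis by (simp add: card_Diff_singleton)
qed

text \<open>At most two classes modulo squares: the nonzero squares are half of the nonzero
  elements, so their multiples by a nonsquare fill the other half.\<close>

lemma square_classes:
  assumes two: "(2 :: 'a::{field,finite}) ~= 0"
  shows "\<exists>e :: 'a. e ~= 0 & (\<forall>d. d ~= 0 --> (\<exists>c. c ~= 0 & (d = c\<^sup>2 \<or> d = e * c\<^sup>2)))"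
proof -
  let ?S = "(\<lambda>c :: 'a. c\<^sup>2) ` (UNIV - {0})"
  show ?thesis
  proof (cases "\<exists>e. e ~= 0 & e \<notin> ?S")
    case True
    then obtain e where e: "e ~= 0" "e \<notin> ?S" by blast
    have dis: "?S \<inter> (*) e ` ?S = {}"
    proof (rule ccontr)
      assume "\<not> ?thesis"
      then obtain c b where cb: "c ~= 0" "b ~= 0" "c\<^sup>2 = e * b\<^sup>2" by auto
      then have "e = (c / b)\<^sup>2" by (simp add: power_divide)
      then show False using e(2) cb by auto
    qed
    have "card ((*) e ` ?S) = card ?S" by (rule card_image) (use e in \<open>simp add: inj_on_def\<close>)
    then have "card (?S \<union> (*) e ` ?S) = card (UNIV - {0 :: 'a})"
      using card_squares[OF two] dis by (simp add: card_Un_disjoint card_Diff_singleton)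
    moreover have "?S \<union> (*) e ` ?S \<subseteq> UNIV - {0}" using e(1) by auto
    ultimately have "?S \<union> (*) e ` ?S = UNIV - {0}" by (intro card_subset_eq) simp_all
    then have "\<exists>c. c ~= 0 & (d = c\<^sup>2 \<or> d = e * c\<^sup>2)" if "d ~= 0" for d
    proof -
      have "d \<in> ?S \<union> (*) e ` ?S" using that \<open>?S \<union> (*) e ` ?S = UNIV - {0}\<close> by blast
      then show ?thesis by auto
    qed
    then show ?thesis using e(1) by blast
  next
    case False
    then have "\<exists>c. c ~= 0 & d = c\<^sup>2" if "d ~= 0" for d :: 'a
    proof -
      have "d \<in> ?S" using False that by blast
      then show ?thesis by auto
    qed
    then show ?thesis by (intro exI[of _ 1]) auto
  qed
qed

text \<open>Pigeonhole: the values of \<open>a * x^2\<close> and those of \<open>1 - d * y^2\<close>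
  each make up more than half of the field.\<close>

lemma represent_one:
  fixes a d :: "'a::{field,finite}"
  assumes two: "(2 :: 'a) ~= 0" and "a ~= 0" "d ~= 0"
  shows "\<exists>x y. a * x\<^sup>2 + d * y\<^sup>2 = 1"
proof -
  let ?R = "range (\<lambda>c :: 'a. c\<^sup>2)"
  have "?R = insert 0 ((\<lambda>c :: 'a. c\<^sup>2) ` (UNIV - {0}))" by (auto simp: image_iff)
  then have r: "card ?R * 2 = CARD('a) + 1"
    using card_squares[OF two] one_less_card_field[where 'a = 'a] by (subst \<open>?R = _\<close>) (subst card_insert_disjoint, auto)
  have 1: "card ((*) a ` ?R) = card ?R" by (rule card_image) (use assms in \<open>simp add: inj_on_def\<close>)
  have 2: "card ((\<lambda>s. 1 - d * s) ` ?R) = card ?R" by (rule card_image) (use assms in \<open>simp add: inj_on_def\<close>)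
  have "(*) a ` ?R \<inter> (\<lambda>s. 1 - d * s) ` ?R ~= {}"
  proof
    assume "(*) a ` ?R \<inter> (\<lambda>s. 1 - d * s) ` ?R = {}"
    then have "card ((*) a ` ?R \<union> (\<lambda>s. 1 - d * s) ` ?R) = card ?R * 2" using 1 2 by (simp add: card_Un_disjoint)
    moreover have "card ((*) a ` ?R \<union> (\<lambda>s. 1 - d * s) ` ?R) \<le> CARD('a)" by (rule card_mono) simp_all
    ultimately show False using r by simp
  qed
  then obtain x y where "a * x\<^sup>2 = 1 - d * y\<^sup>2" by auto
  then have "a * x\<^sup>2 + d * y\<^sup>2 = 1" by simp
  then show ?thesis by blast
qed

text \<open>The form represents 1 by some \<open>(x, y)\<close>, the first column of
  \<open>?P\<close>. The second column is orthogonal to it and has norm \<open>a * d\<close>, so the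
  discriminant moves into one entry.\<close>

lemma congr_binary:
  fixes a d :: "'a::{field,finite}"
  assumes two: "(2 :: 'a) ~= 0" and ad: "a ~= 0" "d ~= 0" and st: "s ~= t"
  shows "congr ({s} \<union> {t}) (a \<cdot> idm {s} + d \<cdot> idm {t}) (idm {s} + (a * d) \<cdot> idm {t})"
proof -
  obtain x y where xy: "a * x\<^sup>2 + d * y\<^sup>2 = 1" using represent_one[OF two ad] by blast
  let ?P = "eunit s s x + eunit s t (- d * y) + eunit t s y + eunit t t (a * x)"
  let ?I = "{s} \<union> {t}" and ?B = "a \<cdot> idm {s} + d \<cdot> idm {t}"
  have P: "?P \<in> Mats ?I ?I" by (intro Mats_add eunit_Mats) simp_all
  have m: "c \<cdot> idm {s} \<in> Mats {s} {s}" "c \<cdot> idm {t} \<in> Mats {t} {t}" for c :: 'a by (rule Mats_smult[OF idm_Mats])+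
  have B: "?B \<in> Mats ?I ?I" by (rule block_Mats[OF m])
  have e1: "a * x * x + d * y * y = 1" using xy by (simp add: power2_eq_square mult.assoc)
  have e2: "a * d * (a * x * x + d * y * y) = a * d" unfolding e1 by simp
  have "tr ?P * ?B * ?P = eunit s s (a * x * x + d * y * y) + eunit t t (a * d * (a * x * x + d * y * y))"
    unfolding idm_singleton
    by (rule fmat_eqI) (use st in \<open>simp add: tr_eunit eunit_mult distrib_left distrib_right ent_eunit algebra_simps\<close>)
  also have "... = 1 \<cdot> idm {s} + (a * d) \<cdot> idm {t}" unfolding e2 unfolding e1 idm_singleton ..
  finally have eq: "tr ?P * ?B * ?P = idm {s} + (a * d) \<cdot> idm {t}" by simp
  have "idm {s} + (a * d) \<cdot> idm {t} \<in> GLs ?I"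
    using block_GLs(1)[OF _ _ _ idm_Mats m(2)[of "a * d"], of "{s}"] idm_GLs[of "{s}"] GLs_smult[OF idm_GLs[of "{t}"], of "a * d"] ad st by simp
  then have "?P \<in> GLs ?I" using congr_cofactor_GLs[OF _ P B] eq by simp
  then show ?thesis by (rule congrI[OF _ eq])
qed

text \<open>A normal form whose only free entry is the discriminant \<open>d\<close>, placed at
  \<open>k\<close>.\<close>

definition dg :: "nat set => nat => 'a::comm_ring_1 => 'a fmat" where
  "dg I k d = d \<cdot> idm {k} + idm (I - {k})"

lemma dg_Mats: "k \<in> I ==> dg I k d \<in> Mats I I"
  unfolding dg_def by (intro Mats_add Mats_smult Mats_idm) auto

lemma dg_SN:
  fixes d :: "'a::{field,finite}"
  assumes "finite I" "k \<in> I" "d ~= 0" shows "dg I k d \<in> SN 1 I"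
proof -
  have u: "{k} \<union> (I - {k}) = I" using assms by blast
  have "d \<cdot> idm {k} \<in> GLs {k}" by (rule GLs_smult[OF idm_GLs]) (use assms in simp_all)
  moreover have "idm (I - {k}) \<in> GLs (I - {k})" by (rule idm_GLs) (use assms in simp)
  ultimately have "dg I k d \<in> GLs ({k} \<union> (I - {k}))" unfolding dg_def
    using block_GLs(1)[of "{k}" "I - {k}" "d \<cdot> idm {k}" "idm (I - {k})"] assms(1) GLs_Mats by auto
  then show ?thesis unfolding u by (simp add: SN_def dg_def)
qed

text \<open>A pivot is split off, the complement is brought to the form \<open>dg\<close> by
  induction, and \<open>congr_binary\<close> merges the two free entries.\<close>

lemma congr_dg:
  fixes B :: "'a::{field,finite} fmat"
  assumes two: "(2 :: 'a) ~= 0"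
  shows "finite I ==> k \<in> I ==> B \<in> SN 1 I ==> \<exists>d. d ~= 0 & congr I B (dg I k d)"
proof (induction "card I" arbitrary: I k B rule: less_induct)
  case less
  note I = less.prems(1) and k = less.prems(2)
  obtain C j where C: "congr I B C" "j \<in> I" "ent C j j ~= 0" using pivot_exists[OF two I _ less.prems(3)] k by blast
  let ?J = "I - {j}" and ?a = "ent C j j"
  have u: "{j} \<union> ?J = I" using C(2) by blast
  have CS: "C \<in> SN 1 ({j} \<union> ?J)" unfolding u by (rule congr_SN[OF I less.prems(3) C(1)])
  obtain D where D: "D \<in> SN 1 ?J" "congr ({j} \<union> ?J) C (?a \<cdot> idm {j} + D)"
    using split_pivot[OF _ _ CS C(3)] I by blast
  have 1: "congr I B (?a \<cdot> idm {j} + D)" by (rule congr_trans[OF I C(1) D(2)[unfolded u]])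
  have am: "?a \<cdot> idm {j} \<in> Mats {j} {j}" by (rule Mats_smult[OF idm_Mats])
  note Dm = SN_Mats[OF D(1)]
  have fJ: "finite ?J" using I by simp
  show ?case
  proof (cases "?J = {}")
    case True
    have "D = 0" using Dm MatsD[OF Dm] True by (intro fmat_eqI) auto
    have jk: "j = k" using True k C(2) by blast
    have Ik: "I - {k} = {}" using True jk by simp
    have "congr I B (dg I k ?a)" using 1 unfolding \<open>D = 0\<close> dg_def Ik idm_empty jk .
    then show ?thesis using C(3) by blast
  next
    case False
    \<comment> \<open>The free entry of the complement is placed at \<open>k\<close>, unless the
      pivot already sits there; then any other index serves.\<close>
    define l where "l = (if j = k then SOME l. l \<in> ?J else k)"
    have l: "l \<in> ?J" unfolding l_def using False k some_in_eq[of ?J] by auto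
    have "card ?J < card I" using I C(2) by (intro psubset_card_mono) auto
    from less.hyps[OF this fJ l D(1)] obtain d where d: "d ~= 0" "congr ?J D (dg ?J l d)" by blast
    have 2: "congr I (?a \<cdot> idm {j} + D) (?a \<cdot> idm {j} + dg ?J l d)"
      using congr_block[OF _ fJ _ am Dm congr_refl[OF _ am] d(2)] unfolding u by simp
    let ?L = "?J - {l}"
    have lj: "l ~= j" "j ~= l" and u2: "({j} \<union> {l}) \<union> ?L = I" "({l} \<union> {j}) \<union> ?L = I" using l C(2) by auto
    have m: "c \<cdot> idm {j} + b \<cdot> idm {l} \<in> Mats ({j} \<union> {l}) ({j} \<union> {l})" for b c :: 'a
      by (rule block_Mats) (rule Mats_smult[OF idm_Mats])+
    have iL: "congr ?L (idm ?L) (idm ?L :: 'a fmat)" by (rule congr_refl) (use fJ in simp_all)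
    have fL: "finite ?L" "({j} \<union> {l}) \<inter> ?L = {}" using fJ by auto
    have e1: "?a \<cdot> idm {j} + dg ?J l d = (?a \<cdot> idm {j} + d \<cdot> idm {l}) + idm ?L" by (simp add: dg_def add.assoc)
    have c: "congr ({j} \<union> {l}) (?a \<cdot> idm {j} + d \<cdot> idm {l}) E ==> congr I (?a \<cdot> idm {j} + dg ?J l d) (E + idm ?L)" for E
      unfolding e1 using congr_block[OF _ fL(1,2) m idm_Mats _ iL, of ?a d E] unfolding u2 by simp
    have id: "idm (insert x ?L) = idm {x} + (idm ?L :: 'a fmat)" if "x \<notin> ?L" for x
      using idm_Un[of "{x}" ?L] fL(1) that by simp
    have lnL: "l \<notin> ?L" "j \<notin> ?L" by auto
    have "\<exists>b. b ~= 0 & congr I (?a \<cdot> idm {j} + dg ?J l d) (dg I k b)"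
    proof (cases "j = k")
      case True
      have s: "I - {k} = insert l ?L" using l True by auto
      have "congr ({l} \<union> {j}) (d \<cdot> idm {l} + ?a \<cdot> idm {j}) (idm {l} + (d * ?a) \<cdot> idm {j})"
        by (rule congr_binary[OF two d(1) C(3) lj(1)])
      then have "congr ({j} \<union> {l}) (?a \<cdot> idm {j} + d \<cdot> idm {l}) (idm {l} + (d * ?a) \<cdot> idm {j})"
        by (simp only: Un_commute add.commute)
      from c[OF this] have "congr I (?a \<cdot> idm {j} + dg ?J l d) (dg I k (d * ?a))"
        unfolding dg_def[of I] s id[OF lnL(1)] using True by (simp add: ac_simps)
      then show ?thesis using d(1) C(3) by (intro exI[of _ "d * ?a"]) simp
    next
      case False
      then have lk: "l = k" by (simp add: l_def)
      have s: "I - {k} = insert j ?L" using C(2) False lk by auto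
      have "congr ({j} \<union> {l}) (?a \<cdot> idm {j} + d \<cdot> idm {l}) (idm {j} + (?a * d) \<cdot> idm {l})"
        by (rule congr_binary[OF two C(3) d(1) lj(2)])
      from c[OF this] have "congr I (?a \<cdot> idm {j} + dg ?J l d) (dg I k (?a * d))"
        unfolding dg_def[of I] s id[OF lnL(2)] using lk by (simp add: ac_simps)
      then show ?thesis using d(1) C(3) by (intro exI[of _ "?a * d"]) simp
    qed
    then obtain b where b: "b ~= 0" "congr I (?a \<cdot> idm {j} + dg ?J l d) (dg I k b)" by blast
    have "congr I B (dg I k b)" by (rule congr_trans[OF I congr_trans[OF I 1 2] b(2)])
    then show ?thesis using b(1) by blast
  qed
qed

lemma congr_dg_square:
  fixes d c :: "'a::{field,finite}"
  assumes I: "finite I" "k \<in> I" and c: "c ~= 0"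
  shows "congr I (dg I k d) (dg I k (d * c\<^sup>2))"
proof -
  have u: "{k} \<union> (I - {k}) = I" using I by blast
  have 1: "congr {k} (d \<cdot> idm {k}) ((d * c\<^sup>2) \<cdot> idm {k})"
    by (rule congrI[of "c \<cdot> idm {k}"])
      (use c in \<open>simp_all add: GLs_smult idm_GLs idm_mult_idm power2_eq_square ac_simps\<close>)
  have 2: "congr (I - {k}) (idm (I - {k})) (idm (I - {k}) :: 'a fmat)" by (rule congr_refl) (use I in simp_all)
  have "congr ({k} \<union> (I - {k})) (dg I k d) (dg I k (d * c\<^sup>2))"
    unfolding dg_def by (rule congr_block[OF _ _ _ Mats_smult[OF idm_Mats] idm_Mats 1 2]) (use I in auto)
  then show ?thesis unfolding u .
qed

text \<open>The same \<open>e\<close> serves for all index sets. This uniformity allows classes to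
  be compared across dimensions.\<close>

lemma two_classes:
  assumes two: "(2 :: 'a::{field,finite}) ~= 0"
  shows "\<exists>e :: 'a. e ~= 0 & (\<forall>I k B. finite I --> k \<in> I --> B \<in> SN 1 I --> congr I (dg I k 1) B \<or> congr I (dg I k e) B)"
proof -
  obtain e :: 'a where e: "e ~= 0" "\<And>d. d ~= 0 ==> \<exists>c. c ~= 0 & (d = c\<^sup>2 \<or> d = e * c\<^sup>2)" using square_classes[OF two] by blast
  have "congr I (dg I k 1) B \<or> congr I (dg I k e) B" if I: "finite I" "k \<in> I" and B: "B \<in> SN 1 I" for I k and B :: "'a fmat"
  proof -
    obtain d where d: "d ~= 0" "congr I B (dg I k d)" using congr_dg[OF two I B] by blast
    have s: "congr I (dg I k d) B" by (rule congr_sym[OF I(1) SN_Mats[OF B] d(2)])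
    obtain c where c: "c ~= 0" "d = c\<^sup>2 \<or> d = e * c\<^sup>2" using e(2)[OF d(1)] by blast
    have "congr I (dg I k b) (dg I k (b * c\<^sup>2))" for b by (rule congr_dg_square[OF I c(1)])
    then have "congr I (dg I k 1) (dg I k d) \<or> congr I (dg I k e) (dg I k d)" using c(2) by (metis mult_1)
    then show ?thesis using congr_trans[OF I(1) _ s] by blast
  qed
  then show ?thesis using e(1) by blast
qed

text \<open>An orthonormal complement is added to both forms. Read backwards: if the two
  representatives differ in the large dimension, they differ in every smaller positive one.\<close>

lemma classes_descend:
  fixes e :: "'a::{field,finite}"
  assumes "finite I" "J \<subseteq> I" "k \<in> J" "congr J (dg J k 1) (dg J k e)"
  shows "congr I (dg I k 1) (dg I k e)"
proof -
  let ?L = "I - J"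
  have u: "J \<union> ?L = I" using assms by blast
  have d: "dg I k x = dg J k x + idm ?L" for x :: 'a
  proof -
    have "I - {k} = (J - {k}) \<union> ?L" using assms by blast
    then have "idm (I - {k}) = idm (J - {k}) + (idm ?L :: 'a fmat)"
      using idm_Un[of "J - {k}" ?L] assms finite_subset[OF assms(2,1)] by auto
    then show ?thesis by (simp add: dg_def add.assoc)
  qed
  have "congr (J \<union> ?L) (dg J k 1 + idm ?L) (dg J k e + idm ?L)"
    by (rule congr_block[OF _ _ _ dg_Mats idm_Mats assms(4) congr_refl])
      (use assms finite_subset[OF assms(2,1)] in auto)
  then show ?thesis unfolding u d .
qed

section \<open>Orbits of forms and their isometries\<close>

definition isos :: "nat set => 'a::comm_ring_1 fmat => 'a fmat set" where
  "isos I B = {T \<in> Mats I I. defect 1 B T = 0}"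

lemma defect_isometry:
  assumes I: "finite I" and B: "B \<in> Mats I I" and T: "T \<in> Mats I I"
  shows "defect 1 B T = tr (idm I + T) * B * (idm I + T) - (B :: 'a::comm_ring_1 fmat)"
proof -
  have "tr T \<in> Mats I I" using T by simp
  then show ?thesis using idm_mult[OF B I] mult_idm[OF B I] mult_idm[OF Mats_mult[OF _ B] I]
    by (simp add: defect_def distrib_left distrib_right algebra_simps)
qed

text \<open>The base changes that carry \<open>B\<close> to a given \<open>C\<close> form a coset of
  the isometry group, whose elements are written \<open>1 + T\<close>.\<close>

lemma orbit_stabilizer:
  fixes B :: "'a::{comm_ring_1,finite} fmat"
  assumes I: "finite I" and B: "B \<in> SN 1 I"
  shows "card {C. congr I B C} * card (isos I B) = card (GLs I :: 'a fmat set)"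
proof -
  note Bm = SN_Mats[OF B]
  have fin: "finite {C. congr I B C}" by (rule finite_subset[of _ "(\<lambda>P. tr P * B * P) ` GLs I"]) (auto simp: congr_def I)
  have "card {C. congr I B C} * card (isos I B) = card (GLs I :: 'a fmat set) * 1"
  proof (rule double_count[OF fin finite_GLs[OF I], where R = "\<lambda>C P. tr P * B * P = C"])
    fix C assume "C \<in> {C. congr I B C}"
    then obtain P where P: "P \<in> GLs I" "C = tr P * B * P" by (auto simp: congr_def)
    have "bij_betw (\<lambda>T. (idm I + T) * P) (isos I B) {R \<in> GLs I. tr R * B * R = C}"
    proof (rule bij_betwI[where g = "\<lambda>R. R * finv I P - idm I"])
      show "(\<lambda>T. (idm I + T) * P) \<in> isos I B \<rightarrow> {R \<in> GLs I. tr R * B * R = C}"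
      proof
        fix T assume "T \<in> isos I B"
        then have T: "T \<in> Mats I I" "defect 1 B T = 0" by (simp_all add: isos_def)
        then have e: "tr (idm I + T) * B * (idm I + T) = B" using defect_isometry[OF I Bm T(1)] by simp
        have "idm I + T \<in> GLs I"
          by (rule congr_cofactor_GLs[OF I Mats_add[OF idm_Mats T(1)] Bm]) (unfold e, rule SND(1)[OF B])
        then have G: "(idm I + T) * P \<in> GLs I" by (rule GLs_mult[OF I _ P(1)])
        have "tr ((idm I + T) * P) * B * ((idm I + T) * P) = tr P * (tr (idm I + T) * B * (idm I + T)) * P"
          by (simp only: tr_mult mult.assoc)
        then show "(idm I + T) * P \<in> {R \<in> GLs I. tr R * B * R = C}" using G unfolding e P(2) by simp
      qed
      show "(\<lambda>R. R * finv I P - idm I) \<in> {R \<in> GLs I. tr R * B * R = C} \<rightarrow> isos I B"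
      proof
        fix R assume "R \<in> {R \<in> GLs I. tr R * B * R = C}"
        then have R: "R \<in> GLs I" "tr R * B * R = C" by simp_all
        have m: "R * finv I P \<in> Mats I I" by (rule Mats_mult[OF GLs_Mats[OF R(1)] finv_props(1)[OF P(1)]])
        have e: "idm I + (R * finv I P - idm I) = R * finv I P" by simp
        have "tr (R * finv I P) * B * (R * finv I P) = tr (finv I P) * (tr R * B * R) * finv I P" by (simp only: tr_mult mult.assoc)
        also have "... = tr (finv I P) * (tr P * (B * (P * finv I P)))" unfolding R(2) P(2) by (simp only: mult.assoc)
        also have "B * (P * finv I P) = B" unfolding finv_props(2)[OF P(1)] by (rule mult_idm[OF Bm I subset_refl])
        also have "tr (finv I P) * (tr P * B) = idm I * B" by (rule mult_eq_assoc[OF tr_finv(2)[OF P(1)]])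
        also have "... = B" by (rule idm_mult[OF Bm I subset_refl])
        finally have "defect 1 B (R * finv I P - idm I) = 0"
          unfolding defect_isometry[OF I Bm Mats_diff[OF m idm_Mats]] e by simp
        then show "R * finv I P - idm I \<in> isos I B" using Mats_diff[OF m idm_Mats] by (simp add: isos_def)
      qed
      show "(idm I + T) * P * finv I P - idm I = T" if "T \<in> isos I B" for T
      proof -
        have "T \<in> Mats I I" using that by (simp add: isos_def)
        then have "idm I + T \<in> Mats I I" by (rule Mats_add[OF idm_Mats])
        then show ?thesis using finv_cancel_right(1)[OF P(1) I] by simp
      qed
      show "(idm I + (R * finv I P - idm I)) * P = R" if "R \<in> {R \<in> GLs I. tr R * B * R = C}" for R
      proof -
        have "R * finv I P * P = R" by (rule finv_cancel_right(2)[OF P(1) I GLs_Mats]) (use that in simp)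
        then show ?thesis by simp
      qed
    qed
    then show "card {R \<in> GLs I. tr R * B * R = C} = card (isos I B)" by (simp add: bij_betw_same_card)
  next
    fix P :: "'a fmat" assume P: "P \<in> GLs I"
    have "{C \<in> {C. congr I B C}. tr P * B * P = C} = {tr P * B * P}" using congrI[OF P refl, of B] by blast
    then show "card {C \<in> {C. congr I B C}. tr P * B * P = C} = 1" by simp
  qed
  then show ?thesis by simp
qed

lemma Prs_isos: "Prs 1 ep I = (SIGMA B:SN ep I. isos I B)"
  by (auto simp: Prs_defect isos_def)

lemma card_isos_congr:
  fixes B :: "'a::{field,finite} fmat"
  assumes I: "finite I" and B: "B \<in> SN 1 I" and c: "congr I B C"
    and inv: "\<And>P T. P \<in> GLs I ==> T \<in> Mats I I ==> \<Phi> (finv I P * T * P) \<longleftrightarrow> \<Phi> T"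
  shows "card {T \<in> isos I C. \<Phi> T} = card {T \<in> isos I B. \<Phi> T}"
proof -
  \<comment> \<open>One inequality suffices, because congruence is symmetric.\<close>
  have le: "card {T \<in> isos I B. \<Phi> T} \<le> card {T \<in> isos I C. \<Phi> T}" if B: "B \<in> SN 1 I" and c: "congr I B C" for B C :: "'a fmat"
  proof -
    obtain P where P: "P \<in> GLs I" "C = tr P * B * P" using c by (auto simp: congr_def)
    show ?thesis
    proof (rule card_inj_on_le[where f = "\<lambda>T. finv I P * T * P"])
      show "inj_on (\<lambda>T. finv I P * T * P) {T \<in> isos I B. \<Phi> T}"
      proof (rule inj_onI)
        fix S T assume S: "S \<in> {T \<in> isos I B. \<Phi> T}" and T: "T \<in> {T \<in> isos I B. \<Phi> T}" and e: "finv I P * S * P = finv I P * T * P"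
        have m: "S \<in> Mats I I" "T \<in> Mats I I" using S T by (simp_all add: isos_def)
        show "S = T" using conj_inverse(1)[OF I P(1) m(1)] conj_inverse(1)[OF I P(1) m(2)] unfolding e by (rule trans[OF sym])
      qed
      show "(\<lambda>T. finv I P * T * P) ` {T \<in> isos I B. \<Phi> T} \<subseteq> {T \<in> isos I C. \<Phi> T}"
      proof (rule image_subsetI)
        fix T assume T: "T \<in> {T \<in> isos I B. \<Phi> T}"
        then have Tm: "T \<in> Mats I I" and p: "(B, T) \<in> Prs 1 1 I" "\<Phi> T" using B by (simp_all add: Prs_isos isos_def)
        have "cong_pair I P (B, T) \<in> Prs 1 1 I" by (rule cong_pair_Prs[OF I P(1) p(1)])
        then have "finv I P * T * P \<in> isos I C" unfolding Prs_isos P(2) by (simp add: cong_pair_def)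
        then show "finv I P * T * P \<in> {T \<in> isos I C. \<Phi> T}" using inv[OF P(1) Tm] p(2) by simp
      qed
      show "finite {T \<in> isos I C. \<Phi> T}" by (rule finite_subset[of _ "Mats I I"]) (auto simp: isos_def I)
    qed
  qed
  show ?thesis using le[OF B c] le[OF congr_SN[OF I B c] congr_sym[OF I SN_Mats[OF B] c]] by simp
qed

text \<open>By \<open>orbit_stabilizer\<close> the size of an orbit divided by the order of
  \<open>GL\<close> is the inverse of the order of the isometry group. So each orbit contributes a
  probability, and the weight is twice their average.\<close>

lemma two_orbit_count:
  fixes B1 B2 :: "'a::{field,finite} fmat"
  assumes I: "finite I" and B: "B1 \<in> SN 1 I" "B2 \<in> SN 1 I" and n: "\<not> congr I B1 B2"
    and all: "\<And>C. C \<in> SN 1 I ==> congr I B1 C \<or> congr I B2 C"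
    and inv: "\<And>P T. P \<in> GLs I ==> T \<in> Mats I I ==> \<Phi> (finv I P * T * P) \<longleftrightarrow> \<Phi> T"
  shows "real (card {(C, T) \<in> Prs 1 1 I. \<Phi> T}) / real (card (GLs I :: 'a fmat set)) =
    real (card {T \<in> isos I B1. \<Phi> T}) / real (card (isos I B1)) + real (card {T \<in> isos I B2. \<Phi> T}) / real (card (isos I B2))"
proof -
  let ?O = "\<lambda>B. {C. congr I B C}" and ?f = "\<lambda>C. {T \<in> isos I C. \<Phi> T}"
  have sub: "?O B \<subseteq> SN 1 I" if "B \<in> SN 1 I" for B :: "'a fmat" using congr_SN[OF I that] by blast
  have fin: "finite (?O B)" if "B \<in> SN 1 I" for B :: "'a fmat" by (rule finite_subset[OF sub[OF that]]) (simp add: I)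
  have U: "SN 1 I = ?O B1 \<union> ?O B2" using all sub[OF B(1)] sub[OF B(2)] by blast
  have D: "?O B1 \<inter> ?O B2 = {}"
  proof (rule ccontr)
    assume "\<not> ?thesis"
    then obtain C where C: "congr I B1 C" "congr I B2 C" by blast
    have "congr I C B2" by (rule congr_sym[OF I SN_Mats[OF B(2)] C(2)])
    then show False using n congr_trans[OF I C(1)] by blast
  qed
  have ff: "finite (?f C)" for C by (rule finite_subset[of _ "Mats I I"]) (auto simp: isos_def I)
  have "{(C, T) \<in> Prs 1 1 I. \<Phi> T} = (SIGMA C:SN 1 I. ?f C)" unfolding Prs_isos by blast
  then have "card {(C, T) \<in> Prs 1 1 I. \<Phi> T} = (\<Sum>C\<in>SN 1 I. card (?f C))" using ff I by simp
  also have "... = (\<Sum>C\<in>?O B1. card (?f C)) + (\<Sum>C\<in>?O B2. card (?f C))"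
    unfolding U by (rule sum.union_disjoint[OF fin[OF B(1)] fin[OF B(2)] D])
  also have "(\<Sum>C\<in>?O B1. card (?f C)) = card (?O B1) * card (?f B1)" using card_isos_congr[OF I B(1) _ inv] by simp
  also have "(\<Sum>C\<in>?O B2. card (?f C)) = card (?O B2) * card (?f B2)" using card_isos_congr[OF I B(2) _ inv] by simp
  finally have e: "real (card {(C, T) \<in> Prs 1 1 I. \<Phi> T}) = real (card (?O B1)) * real (card (?f B1)) + real (card (?O B2)) * real (card (?f B2))" by simp
  have q: "real (card (?O B)) * x / real (card (GLs I :: 'a fmat set)) = x / real (card (isos I B))" if "B \<in> SN 1 I" for B :: "'a fmat" and x
  proof -
    have os: "real (card (?O B)) * real (card (isos I B)) = real (card (GLs I :: 'a fmat set))"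
      using orbit_stabilizer[OF I that] by (metis of_nat_mult)
    moreover have "real (card (GLs I :: 'a fmat set)) > 0" using card_GLs_pos[OF I, where 'a = 'a] by simp
    ultimately have "real (card (?O B)) ~= 0" by (metis mult_zero_left order_less_irrefl)
    then show ?thesis unfolding os[symmetric] by simp
  qed
  show ?thesis unfolding e add_divide_distrib q[OF B(1)] q[OF B(2)] ..
qed

section \<open>Quadratic forms\<close>

lemma vof_smult: "vof n (c \<cdot> w) = c \<cdot>\<^sub>v vof n w"
  by (rule eq_vecI) (auto simp: vof_def)

lemma linear_expansion:
  fixes F :: "'a::field fmat => 'a"
  assumes add: "\<And>u v. u \<in> Mats {..<n} {0} ==> v \<in> Mats {..<n} {0} ==> F (u + v) = F u + F v"
    and sm: "\<And>c u. u \<in> Mats {..<n} {0} ==> F (c \<cdot> u) = c * F u" and u: "u \<in> Mats {..<n} {0}"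
  shows "F u = (\<Sum>i<n. ent u i 0 * F (eunit i 0 1))"
proof -
  have e: "eunit i 0 1 \<in> Mats {..<n} {0}" if "i < n" for i by (rule eunit_Mats) (use that in simp_all)
  have s: "m \<le> n ==> F (\<Sum>i<m. ent u i 0 \<cdot> eunit i 0 1) = (\<Sum>i<m. ent u i 0 * F (eunit i 0 1))" for m
  proof (induction m)
    case 0
    show ?case using sm[OF Mats_zero, of 0] by simp
  next
    case (Suc m)
    have "(\<Sum>i<m. ent u i 0 \<cdot> eunit i 0 1) \<in> Mats {..<n} {0}"
      by (rule Mats_sum, rule Mats_smult, rule e) (use Suc.prems in simp)
    then show ?case using Suc add[OF _ Mats_smult[OF e], of _ m] sm[OF e, of m] by simp
  qed
  have "u = (\<Sum>i<n. ent u i 0 \<cdot> eunit i 0 1)"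
  proof (rule fmat_eqI)
    fix a b :: nat
    have "(\<Sum>i<n. ent u i 0 * (if a = i & b = 0 then 1 else 0)) = (\<Sum>i<n. if a = i then (if b = 0 then ent u a 0 else 0) else 0)"
      by (rule sum.cong) auto
    then show "ent u a b = ent (\<Sum>i<n. ent u i 0 \<cdot> eunit i 0 1) a b"
      using MatsD[OF u, of a b] by (auto simp: ent_sum ent_eunit)
  qed
  then show ?thesis using s[of n] by simp
qed

text \<open>The Gram matrix of the polar form itself and not of its half; hence the factor 2 in
  \<open>quadratic_gram\<close>.\<close>

definition gram :: "nat => ('a::field vec => 'a) => 'a fmat" where
  "gram n Q = fof n (mat n n (\<lambda>(i, j). polar Q (vof n (eunit i 0 1)) (vof n (eunit j 0 1))))"

lemma ent_gram: "ent (gram n Q) i j = (if i < n & j < n then polar Q (vof n (eunit i 0 1)) (vof n (eunit j 0 1)) else 0)"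
  by (simp add: gram_def ent_fof)

lemma gram_Mats: "gram n Q \<in> Mats {..<n} {..<n}" by (simp add: gram_def fof_Mats)

lemma polar_sym: "u \<in> carrier_vec n ==> v \<in> carrier_vec n ==> polar Q u v = polar Q v u"
  by (simp add: polar_def comm_add_vec[of u n v] algebra_simps)

lemma polar_gram:
  assumes Q: "quadratic_form n Q" and u: "u \<in> Mats {..<n} {0}" and w: "w \<in> Mats {..<n} {0}"
  shows "polar Q (vof n u) (vof n w) = ent (tr u * gram n Q * w) 0 0"
proof -
  have a: "polar Q (x + y) z = polar Q x z + polar Q y z" if "x \<in> carrier_vec n" "y \<in> carrier_vec n" "z \<in> carrier_vec n" for x y z
    using Q that unfolding quadratic_form_def by blast
  have m: "polar Q (c \<cdot>\<^sub>v x) z = c * polar Q x z" if "x \<in> carrier_vec n" "z \<in> carrier_vec n" for c x z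
    using Q that unfolding quadratic_form_def by blast
  have l: "polar Q (vof n u) z = (\<Sum>i<n. ent u i 0 * polar Q (vof n (eunit i 0 1)) z)" if "u \<in> Mats {..<n} {0}" "z \<in> carrier_vec n" for u z
    by (rule linear_expansion[where F = "\<lambda>u. polar Q (vof n u) z"]) (simp_all add: vof_add vof_smult a m that)
  have "polar Q (vof n u) (vof n w) = (\<Sum>j<n. ent w j 0 * polar Q (vof n (eunit j 0 1)) (vof n u))"
    using l[OF w vof_carrier[of n u]] polar_sym[of "vof n u" n "vof n w" Q] by simp
  also have "... = (\<Sum>j<n. (\<Sum>i<n. ent u i 0 * ent (gram n Q) i j) * ent w j 0)"
  proof (rule sum.cong[OF refl])
    fix j assume j: "j \<in> {..<n}"
    have "polar Q (vof n (eunit j 0 1)) (vof n u) = polar Q (vof n u) (vof n (eunit j 0 1))" by (rule polar_sym[OF vof_carrier vof_carrier])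
    also have "... = (\<Sum>i<n. ent u i 0 * ent (gram n Q) i j)" using l[OF u vof_carrier] j by (simp add: ent_gram)
    finally show "ent w j 0 * polar Q (vof n (eunit j 0 1)) (vof n u) = (\<Sum>i<n. ent u i 0 * ent (gram n Q) i j) * ent w j 0" by simp
  qed
  also have "... = (\<Sum>j<n. ent (tr u * gram n Q) 0 j * ent w j 0)"
  proof (rule sum.cong[OF refl])
    fix j
    have "ent (tr u * gram n Q) 0 j = (\<Sum>i<n. ent (tr u) 0 i * ent (gram n Q) i j)"
      by (rule ent_mult) (use MatsD[OF u] in auto)
    then show "(\<Sum>i<n. ent u i 0 * ent (gram n Q) i j) * ent w j 0 = ent (tr u * gram n Q) 0 j * ent w j 0" by simp
  qed
  also have "... = ent (tr u * gram n Q * w) 0 0"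
    by (rule ent_mult[symmetric]) (use MatsD[OF w] in auto)
  finally show ?thesis .
qed

lemma quadratic_gram:
  assumes two: "(2 :: 'a::field) ~= 0" and Q: "quadratic_form n (Q :: 'a vec => 'a)" and u: "u \<in> Mats {..<n} {0}"
  shows "2 * Q (vof n u) = ent (tr u * gram n Q * u) 0 0"
proof -
  have "vof n u + vof n u = 2 \<cdot>\<^sub>v vof n u" by (rule eq_vecI) (simp_all add: vof_def)
  then have "Q (vof n u + vof n u) = 2\<^sup>2 * Q (vof n u)" using Q unfolding quadratic_form_def by simp
  then have "polar Q (vof n u) (vof n u) = 2 * Q (vof n u)" by (simp add: polar_def)
  then show ?thesis using polar_gram[OF Q u u] by simp
qed

lemma ent_sandwich: "ent (tr (eunit a 0 1) * M * eunit b 0 1) 0 0 = ent M a (b :: nat)"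
proof -
  have "ent (tr (eunit a 0 1) * M * eunit b 0 1) 0 0 = ent (tr (eunit a 0 1) * M) 0 b" by (simp add: ent_mult_eunit)
  also have "... = ent (tr (tr (eunit a 0 1) * M)) b 0" by (simp only: ent_tr)
  also have "... = ent (tr M * eunit a 0 1) b 0" by (simp only: tr_mult tr_tr)
  also have "... = ent M a b" by (simp add: ent_mult_eunit)
  finally show ?thesis .
qed

text \<open>An isometry preserves the polar form, which is compared on basis vectors. Conversely,
  the Gram matrix gives \<open>2 * Q\<close>, and 2 can be cancelled.\<close>

lemma isometry_iff:
  assumes two: "(2 :: 'a::field) ~= 0" and Q: "quadratic_form n (Q :: 'a vec => 'a)" and Q': "quadratic_form n Q'"
    and g: "g \<in> carrier_mat n n"
  shows "(\<forall>v\<in>carrier_vec n. Q' (g *\<^sub>v v) = Q v) \<longleftrightarrow> tr (fof n g) * gram n Q' * fof n g = gram n Q"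
proof
  let ?G = "fof n g" and ?V = "Mats {..<n} {0} :: 'a fmat set"
  have Gm: "?G * u \<in> ?V" if "u \<in> ?V" for u by (rule Mats_mult[OF fof_Mats that])
  have sw: "tr (?G * u) * gram n Q' * (?G * w) = tr u * (tr ?G * gram n Q' * ?G) * w" for u w by (simp only: tr_mult mult.assoc)
  {
    assume iso: "\<forall>v\<in>carrier_vec n. Q' (g *\<^sub>v v) = Q v"
    have p: "polar Q' (g *\<^sub>v v) (g *\<^sub>v w) = polar Q v w" if "v \<in> carrier_vec n" "w \<in> carrier_vec n" for v w
      unfolding polar_def using iso that mult_add_distrib_mat_vec[OF g that] add_carrier_vec[OF that] by metis
    show "tr ?G * gram n Q' * ?G = gram n Q"
    proof (rule fmat_eqI)
      fix a b
      show "ent (tr ?G * gram n Q' * ?G) a b = ent (gram n Q) a b"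
      proof (cases "a < n & b < n")
        case True
        let ?a = "eunit a 0 1 :: 'a fmat" and ?b = "eunit b 0 1 :: 'a fmat"
        have m: "?a \<in> ?V" "?b \<in> ?V" using True by (simp_all add: eunit_Mats)
        have "ent (gram n Q) a b = polar Q (vof n ?a) (vof n ?b)" using True by (simp add: ent_gram)
        also have "... = polar Q' (vof n (?G * ?a)) (vof n (?G * ?b))" using p[of "vof n ?a" "vof n ?b"] by (simp add: mult_vof[OF g m(1)] mult_vof[OF g m(2)])
        also have "... = ent (tr ?a * (tr ?G * gram n Q' * ?G) * ?b) 0 0" unfolding polar_gram[OF Q' Gm[OF m(1)] Gm[OF m(2)]] sw ..
        also have "... = ent (tr ?G * gram n Q' * ?G) a b" by (rule ent_sandwich)
        finally show ?thesis ..
      next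
        case False
        have "tr ?G \<in> Mats {..<n} {..<n}" unfolding Mats_tr by (rule fof_Mats)
        from Mats_mult[OF Mats_mult[OF this gram_Mats] fof_Mats]
        have "tr ?G * gram n Q' * ?G \<in> Mats {..<n} {..<n}" .
        from MatsD[OF this, of a b] MatsD[OF gram_Mats, of a n b Q] show ?thesis using False by auto
      qed
    qed
  }
  {
    assume e: "tr ?G * gram n Q' * ?G = gram n Q"
    show "\<forall>v\<in>carrier_vec n. Q' (g *\<^sub>v v) = Q v"
    proof
      fix v :: "'a vec" assume v: "v \<in> carrier_vec n"
      let ?u = "cof n v"
      have u: "?u \<in> ?V" by (rule cof_Mats)
      have "2 * Q' (g *\<^sub>v vof n ?u) = 2 * Q (vof n ?u)"
        unfolding mult_vof[OF g u] quadratic_gram[OF two Q' Gm[OF u]] quadratic_gram[OF two Q u] sw e ..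
      then show "Q' (g *\<^sub>v v) = Q v" using two unfolding vof_cof[OF v] by simp
    qed
  }
qed

lemma fof_mult:
  assumes "g \<in> carrier_mat n n" "h \<in> carrier_mat n n"
  shows "fof n (g * h) = fof n g * fof n h"
proof (rule fmat_eqI)
  fix a b
  have "ent (fof n g * fof n h) a b = (\<Sum>k<n. ent (fof n g) a k * ent (fof n h) k b)"
    by (rule ent_mult) (auto simp: ent_fof)
  then show "ent (fof n (g * h)) a b = ent (fof n g * fof n h) a b"
    using assms by (auto simp: ent_fof scalar_prod_def atLeast0LessThan)
qed

lemma fof_one: "fof n (1\<^sub>m n) = idm {..<n}" by (rule fmat_eqI) (auto simp: ent_fof ent_idm)

lemma fof_inj: "g \<in> carrier_mat n n ==> h \<in> carrier_mat n n ==> fof n g = fof n h \<longleftrightarrow> g = h"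
  using mof_fof by metis

lemma GL_iff: "g \<in> GL n \<longleftrightarrow> g \<in> carrier_mat n n & fof n g \<in> GLs {..<n}"
proof
  assume "g \<in> GL n"
  then obtain h where g: "g \<in> carrier_mat n n" and h: "g * h = 1\<^sub>m n" "h * g = 1\<^sub>m (dim_row h)"
    unfolding GL_def invertible_mat_def inverts_mat_def by auto
  have "dim_col (g * h) = n" "dim_col (h * g) = dim_row h" unfolding h by simp_all
  then have hc: "h \<in> carrier_mat n n" using g by (intro carrier_matI) simp_all
  have "fof n g * fof n h = idm {..<n}" "fof n h * fof n g = idm {..<n}"
    using h hc unfolding fof_mult[OF g hc, symmetric] fof_mult[OF hc g, symmetric] fof_one[symmetric] by simp_all
  then show "g \<in> carrier_mat n n & fof n g \<in> GLs {..<n}" using g GLsI[OF fof_Mats fof_Mats] by blast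
next
  assume a: "g \<in> carrier_mat n n & fof n g \<in> GLs {..<n}"
  let ?h = "mof n (finv {..<n} (fof n g))"
  have G: "fof n g \<in> GLs {..<n}" and g: "g \<in> carrier_mat n n" using a by blast+
  have h: "fof n ?h = finv {..<n} (fof n g)" by (rule fof_mof[OF finv_props(1)[OF G]])
  have "fof n (g * ?h) = fof n (1\<^sub>m n)" unfolding fof_mult[OF g mof_carrier] h fof_one by (rule finv_props(2)[OF G])
  then have 1: "g * ?h = 1\<^sub>m n" using fof_inj[OF mult_carrier_mat[OF g mof_carrier] one_carrier_mat] by blast
  have "fof n (?h * g) = fof n (1\<^sub>m n)" unfolding fof_mult[OF mof_carrier g] h fof_one by (rule finv_props(3)[OF G])
  then have 2: "?h * g = 1\<^sub>m n" using fof_inj[OF mult_carrier_mat[OF mof_carrier g] one_carrier_mat] by blast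
  have "dim_row g = n" "dim_col g = n" "dim_row ?h = n" using g by (simp_all add: mof_def)
  then have "invertible_mat g" unfolding invertible_mat_def inverts_mat_def using 1 2 by auto
  then show "g \<in> GL n" using g by (simp add: GL_def)
qed

lemma gram_SN:
  fixes Q :: "'a::{field,finite} vec => 'a"
  assumes Q: "quadratic_form n Q" and nd: "nondegenerate n Q"
  shows "gram n Q \<in> SN 1 {..<n}"
proof -
  have "tr (gram n Q) = gram n Q"
    by (rule fmat_eqI) (auto simp: ent_gram intro: polar_sym[of _ n])
  moreover have "gram n Q \<in> GLs {..<n}"
  proof (rule GLsI_inj[OF finite_lessThan gram_Mats])
    fix w :: "'a fmat" assume w: "w \<in> Mats {..<n} {0}" and z: "gram n Q * w = 0"
    have "polar Q (vof n w) v = 0" if v: "v \<in> carrier_vec n" for v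
    proof -
      have c: "cof n v \<in> Mats {..<n} {0}" by (rule cof_Mats)
      have "polar Q (vof n w) v = polar Q v (vof n w)" by (rule polar_sym[OF vof_carrier v])
      also have "... = ent (tr (cof n v) * gram n Q * w) 0 0" using polar_gram[OF Q c w] unfolding vof_cof[OF v] .
      also have "... = 0" unfolding mult.assoc z by simp
      finally show ?thesis .
    qed
    then have "vof n w = vof n 0" using nd vof_carrier[of n w] unfolding nondegenerate_def vof_0 by blast
    then show "w = 0" using vof_inj[OF w Mats_zero] by blast
  qed
  ultimately show ?thesis by (simp add: SN_def)
qed

lemma orthogonal_group_iff:
  fixes Q :: "'a::{field,finite} vec => 'a"
  assumes two: "(2 :: 'a) ~= 0" and Q: "quadratic_form n Q" and nd: "nondegenerate n Q"
  shows "g \<in> orthogonal_group n Q \<longleftrightarrow> g \<in> carrier_mat n n & fof n g - idm {..<n} \<in> isos {..<n} (gram n Q)"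
proof -
  note B = gram_SN[OF Q nd]
  have "fof n g - idm {..<n} \<in> isos {..<n} (gram n Q) \<longleftrightarrow> tr (fof n g) * gram n Q * fof n g = gram n Q"
  proof -
    have "idm {..<n} + (fof n g - idm {..<n}) = fof n g" by simp
    then show ?thesis
      unfolding isos_def using defect_isometry[OF finite_lessThan gram_Mats Mats_diff[OF fof_Mats idm_Mats], of n Q g]
        Mats_diff[OF fof_Mats[of n g] idm_Mats] by simp
  qed
  moreover have "fof n g \<in> GLs {..<n}" if "tr (fof n g) * gram n Q * fof n g = gram n Q"
    by (rule congr_cofactor_GLs[OF finite_lessThan fof_Mats gram_Mats[of n Q]]) (unfold that, rule SND(1)[OF B])
  ultimately show ?thesis unfolding orthogonal_group_def GL_iff using isometry_iff[OF two Q Q, of g] by blast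
qed

lemma card_orthogonal:
  fixes Q :: "'a::{field,finite} vec => 'a"
  assumes two: "(2 :: 'a) ~= 0" and Q: "quadratic_form n Q" and nd: "nondegenerate n Q"
  shows "card {g \<in> orthogonal_group n Q. \<Phi> (fof n g - idm {..<n})} = card {T \<in> isos {..<n} (gram n Q). \<Phi> T}"
proof (rule bij_betw_same_card[where f = "\<lambda>g. fof n g - idm {..<n}"], rule bij_betwI[where g = "\<lambda>T. mof n (T + idm {..<n})"])
  note iff = orthogonal_group_iff[OF two Q nd]
  show "(\<lambda>g. fof n g - idm {..<n}) \<in> {g \<in> orthogonal_group n Q. \<Phi> (fof n g - idm {..<n})} \<rightarrow> {T \<in> isos {..<n} (gram n Q). \<Phi> T}"
    using iff by blast
  have m: "fof n (mof n (T + idm {..<n})) - idm {..<n} = T" if "T \<in> isos {..<n} (gram n Q)" for T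
  proof -
    have "T \<in> Mats {..<n} {..<n}" using that by (simp add: isos_def)
    then have "fof n (mof n (T + idm {..<n})) = T + idm {..<n}" by (intro fof_mof Mats_add idm_Mats)
    then show ?thesis by simp
  qed
  show "(\<lambda>T. mof n (T + idm {..<n})) \<in> {T \<in> isos {..<n} (gram n Q). \<Phi> T} \<rightarrow> {g \<in> orthogonal_group n Q. \<Phi> (fof n g - idm {..<n})}"
    using m iff by simp
  show "mof n (fof n g - idm {..<n} + idm {..<n}) = g" if "g \<in> {g \<in> orthogonal_group n Q. \<Phi> (fof n g - idm {..<n})}" for g
  proof -
    have "fof n g - idm {..<n} + idm {..<n} = fof n g" by simp
    moreover have "g \<in> carrier_mat n n" using that iff by blast
    ultimately show ?thesis by (simp only: mof_fof)
  qed
  show "fof n (mof n (T + idm {..<n})) - idm {..<n} = T" if "T \<in> {T \<in> isos {..<n} (gram n Q). \<Phi> T}" for T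
    using m that by blast
qed

text \<open>Read backwards, the two given forms have Gram matrices in different congruence
  classes.\<close>

lemma isometric_congr:
  fixes Q :: "'a::{field,finite} vec => 'a"
  assumes two: "(2 :: 'a) ~= 0" and Q: "quadratic_form n Q" and Q': "quadratic_form n Q'"
    and c: "congr {..<n} (gram n Q') (gram n Q)"
  shows "isometric n Q Q'"
proof -
  obtain P where P: "P \<in> GLs {..<n}" "gram n Q = tr P * gram n Q' * P" using c by (auto simp: congr_def)
  let ?g = "mof n P"
  have f: "fof n ?g = P" by (rule fof_mof[OF GLs_Mats[OF P(1)]])
  have "?g \<in> GL n" unfolding GL_iff f using P(1) by simp
  moreover have "\<forall>v\<in>carrier_vec n. Q' (?g *\<^sub>v v) = Q v"
    unfolding isometry_iff[OF two Q Q' mof_carrier] f using P(2) by simp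
  ultimately show ?thesis unfolding isometric_def by blast
qed

lemma pmf_Lambda:
  fixes Qp Qm :: "'a::{field,finite} vec => 'a"
  assumes two: "(2 :: 'a) ~= 0" and Qp: "quadratic_form n Qp" "nondegenerate n Qp" and Qm: "quadratic_form n Qm" "nondegenerate n Qm"
  shows "pmf (Lambda_O n Qp Qm) \<mu> = (if 0 \<in># \<mu> then 0 else
    1/2 * (real (card {T \<in> isos {..<n} (gram n Qp). has_type {..<n} \<mu> T}) / real (card (isos {..<n} (gram n Qp))) +
           real (card {T \<in> isos {..<n} (gram n Qm). has_type {..<n} \<mu> T}) / real (card (isos {..<n} (gram n Qm)))))"
proof -
  let ?p = "primary_partition zm1 :: 'a mat => nat multiset"
  have one: "pmf (map_pmf ?p (pmf_of_set (orthogonal_group n Q))) \<mu> = (if 0 \<in># \<mu> then 0 else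
      real (card {T \<in> isos {..<n} (gram n Q). has_type {..<n} \<mu> T}) / real (card (isos {..<n} (gram n Q))))"
    if Q: "quadratic_form n Q" "nondegenerate n Q" for Q :: "'a vec => 'a"
  proof -
    let ?O = "orthogonal_group n Q"
    note iff = orthogonal_group_iff[OF two Q]
    have fin: "finite ?O"
      by (rule inj_on_finite[of "fof n" _ "Mats {..<n} {..<n}"]) (auto simp: inj_on_def fof_Mats iff fof_inj)
    have "1\<^sub>m n \<in> ?O" unfolding iff fof_one by (simp add: isos_def defect_def)
    then have ne: "?O ~= {}" by blast
    have c: "card ?O = card (isos {..<n} (gram n Q))" using card_orthogonal[OF two Q, of "\<lambda>_. True"] by simp
    have "card (?O \<inter> ?p -` {\<mu>}) = (if 0 \<in># \<mu> then 0 else card {T \<in> isos {..<n} (gram n Q). has_type {..<n} \<mu> T})"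
    proof -
      have "?O \<inter> ?p -` {\<mu>} = {g \<in> ?O. 0 \<notin># \<mu> & has_type {..<n} \<mu> (fof n g - idm {..<n})}"
        using primary_partition_iff[where 'a = 'a] iff by auto
      then show ?thesis using card_orthogonal[OF two Q, of "has_type {..<n} \<mu>"] by simp
    qed
    moreover have "pmf (map_pmf ?p (pmf_of_set ?O)) \<mu> = real (card (?O \<inter> ?p -` {\<mu>})) / real (card ?O)"
      unfolding pmf_map by (rule measure_pmf_of_set[OF ne fin])
    ultimately show ?thesis unfolding c by simp
  qed
  have "pmf (Lambda_O n Qp Qm) \<mu> = 1/2 * pmf (map_pmf ?p (pmf_of_set (orthogonal_group n Qp))) \<mu> + 1/2 * pmf (map_pmf ?p (pmf_of_set (orthogonal_group n Qm))) \<mu>"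
    unfolding Lambda_O_def random_orthogonal_def map_bind_pmf pmf_bind by (simp add: integral_bernoulli_pmf)
  then show ?thesis unfolding one[OF Qp] one[OF Qm] by (simp add: distrib_left)
qed

section \<open>Series estimates\<close>

context
  fixes q :: real
  assumes q3: "q \<ge> 3"
begin

lemma q_pos: "q > 0" "q > 1" "q ~= 0" using q3 by simp_all

lemma inv_q2: "1 / q ^ (2 * k) \<le> (1 / 9) ^ k"
proof -
  have "(9 :: real) \<le> q\<^sup>2" using power_mono[OF q3, of 2] by simp
  then have "9 ^ k \<le> (q\<^sup>2) ^ k" by (intro power_mono) simp_all
  then have "9 ^ k \<le> q ^ (2 * k)" by (simp add: power_mult)
  then show ?thesis by (simp add: power_divide frac_le)
qed

text \<open>The bound equals \<open>1 - 1/9 - ... - (1/9)^k\<close>. Keeping the remainder lets the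
  induction close; the limit 7/8 alone would not.\<close>

lemma pev_lower: "pev q k \<ge> 7 / 8 + 1 / 8 * (1 / 9) ^ k"
proof (induction k)
  case (Suc k)
  define t :: real where "t = (1 / 9) ^ k"
  have t: "0 < t" "t \<le> 1" unfolding t_def by (simp_all add: power_le_one)
  have "1 - 1 / q ^ (2 * Suc k) \<ge> 1 - t / 9" using inv_q2[of "Suc k"] by (simp add: t_def)
  then have "pev q k * (1 - 1 / q ^ (2 * Suc k)) \<ge> (7 / 8 + 1 / 8 * t) * (1 - t / 9)"
    using Suc t unfolding t_def[symmetric] by (intro mult_mono) simp_all
  moreover have "(7 / 8 + 1 / 8 * t) * (1 - t / 9) - (7 / 8 + 1 / 8 * (t / 9)) = t * (1 - t) / 72" by (simp add: field_simps)
  moreover have "t * (1 - t) / 72 \<ge> 0" using t by simp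
  ultimately show ?case unfolding pev_Suc by (simp add: t_def)
qed (simp add: pev_0)

lemma pev_78: "pev q k \<ge> 7 / 8" using pev_lower[of k] by (smt (verit) zero_le_power zero_le_divide_1_iff mult_nonneg_nonneg)
lemma pev_gt0: "pev q k > 0" using pev_78[of k] by simp
lemma pev_le1: "pev q k \<le> 1"
proof (induction k)
  case (Suc k)
  have "1 \<le> q ^ (2 * Suc k)" using q_pos by (intro one_le_power) simp
  then have "1 - 1 / q ^ (2 * Suc k) \<le> 1" "0 \<le> 1 - 1 / q ^ (2 * Suc k)" by (simp_all del: power_Suc mult_Suc_right)
  then show ?case unfolding pev_Suc using Suc pev_gt0[of k] by (simp add: mult_le_one)
qed (simp add: pev_0)

text \<open>As in \<open>pev_lower\<close>, now subtracting the terms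
  \<open>(1/3) * (1/9)^i\<close>, which leads to the limit 5/8.\<close>

lemma podd_lower: "podd q k \<ge> 5 / 8 + 3 / 8 * (1 / 9) ^ k"
proof (induction k)
  case (Suc k)
  define t :: real where "t = (1 / 9) ^ k"
  have t: "0 < t" "t \<le> 1" unfolding t_def by (simp_all add: power_le_one)
  have "1 / q ^ (2 * k + 1) = 1 / q ^ (2 * k) * (1 / q)" by simp
  also have "... \<le> t * (1 / 3)" unfolding t_def using q3 inv_q2[of k] by (intro mult_mono) (simp_all add: frac_le)
  finally have "1 - 1 / q ^ (2 * k + 1) \<ge> 1 - t / 3" by simp
  then have "podd q k * (1 - 1 / q ^ (2 * k + 1)) \<ge> (5 / 8 + 3 / 8 * t) * (1 - t / 3)"
    using Suc t unfolding t_def[symmetric] by (intro mult_mono) simp_all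
  moreover have "(5 / 8 + 3 / 8 * t) * (1 - t / 3) - (5 / 8 + 3 / 8 * (t / 9)) = t * (1 - t) / 8" by (simp add: field_simps)
  moreover have "t * (1 - t) / 8 \<ge> 0" using t by simp
  ultimately show ?case unfolding podd_Suc by (simp add: t_def)
qed simp

text \<open>Coefficients of three power series in \<open>z\<close>. Let \<open>E\<close> be the
  product of \<open>1 - z / q^(2 i + 1)\<close> over \<open>i \<ge> 0\<close>. Euler's expansions
  give \<open>ac\<close> for the inverse of \<open>E\<close> and \<open>ec\<close> for
  \<open>E\<close>. By the q-binomial theorem \<open>fc\<close> belongs to \<open>E\<close> divided
  by the product of \<open>1 - z / q^(2 i)\<close>. The sums \<open>sc\<close> are the partial sums
  of \<open>E\<close> at \<open>z = 1\<close>.\<close>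

definition ac :: "nat => real" where "ac k = 1 / (q ^ k * pev q k)"
definition ec :: "nat => real" where "ec k = (-1) ^ k / (q ^ (k * k) * pev q k)"
definition fc :: "nat => real" where "fc k = podd q k / pev q k"
definition sc :: "nat => real" where "sc k = (\<Sum>j\<le>k. ec j)"

section \<open>Convolution identities from q-difference equations\<close>

definition iq :: real where "iq = 1 / q\<^sup>2"
text \<open>The dilation that replaces \<open>z\<close> by \<open>z / q^2\<close>. Each series is
  handled through its behaviour under this dilation, which avoids infinite products of power
  series.\<close>

definition sg :: "real fps => real fps" where "sg F = Abs_fps (\<lambda>k. iq ^ k * fps_nth F k)"

lemma sg_nth: "fps_nth (sg F) k = iq ^ k * fps_nth F k" by (simp add: sg_def)

lemma sg_mult: "sg (F * G) = sg F * sg G"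
proof (rule fps_ext)
  fix n
  have "iq ^ n * (\<Sum>i=0..n. fps_nth F i * fps_nth G (n - i)) = (\<Sum>i=0..n. (iq ^ i * fps_nth F i) * (iq ^ (n - i) * fps_nth G (n - i)))"
    unfolding sum_distrib_left
  proof (rule sum.cong[OF refl])
    fix i assume "i \<in> {0..n}"
    then have "iq ^ n = iq ^ i * iq ^ (n - i)" by (simp add: power_add[symmetric])
    then show "iq ^ n * (fps_nth F i * fps_nth G (n - i)) = (iq ^ i * fps_nth F i) * (iq ^ (n - i) * fps_nth G (n - i))" by (simp only: mult_ac)
  qed
  then show "fps_nth (sg (F * G)) n = fps_nth (sg F * sg G) n" by (simp add: sg_nth fps_mult_nth)
qed

lemma Qpow: "iq ^ k = 1 / q ^ (2 * k)" by (simp add: iq_def power_divide power_mult)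

lemma Qpow_less: "iq ^ Suc k < 1" unfolding Qpow using one_less_power[OF q_pos(2), of "2 * Suc k"] by (simp del: power_Suc mult_Suc_right)

definition Lq :: "real fps" where "Lq = 1 - fps_const (1 / q) * fps_X"

lemma Lq_nth: "fps_nth (Lq * F) k = (if k = 0 then fps_nth F 0 else fps_nth F k - fps_nth F (k - 1) / q)"
  by (simp add: Lq_def left_diff_distrib mult.assoc)

lemma sg_a: "sg (Abs_fps ac) = Lq * Abs_fps ac"
proof (rule fps_ext)
  fix k
  show "fps_nth (sg (Abs_fps ac)) k = fps_nth (Lq * Abs_fps ac) k"
  proof (cases k)
    case (Suc m)
    have "pev q m > 0" "pev q (Suc m) > 0" by (rule pev_gt0)+
    then have "1 / pev q m = (1 - iq ^ Suc m) / pev q (Suc m)" unfolding Qpow pev_Suc by (simp add: field_simps)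
    moreover have "ac m / q = 1 / pev q m * (1 / q ^ Suc m)" by (simp add: ac_def)
    moreover have "(1 - iq ^ Suc m) * ac (Suc m) = (1 - iq ^ Suc m) / pev q (Suc m) * (1 / q ^ Suc m)" by (simp add: ac_def)
    ultimately have "ac m / q = (1 - iq ^ Suc m) * ac (Suc m)" by simp
    then show ?thesis using Suc by (simp add: sg_nth Lq_nth left_diff_distrib)
  qed (simp add: sg_nth Lq_def)
qed

lemma e_rec: "ec (Suc m) = iq ^ Suc m * ec (Suc m) - iq ^ m * ec m / q"
proof -
  have "pev q m > 0" "pev q (Suc m) > 0" by (rule pev_gt0)+
  then have p: "(1 - iq ^ Suc m) / pev q (Suc m) = 1 / pev q m" unfolding Qpow pev_Suc by (simp add: field_simps)
  have e: "q ^ (Suc m * Suc m) = q ^ (2 * m) * q ^ (m * m) * q"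
    unfolding power_add[symmetric] power_Suc2[symmetric] by (rule arg_cong[of _ _ "power q"]) simp
  have "(1 - iq ^ Suc m) * ec (Suc m) = (-1) ^ Suc m / q ^ (Suc m * Suc m) * ((1 - iq ^ Suc m) / pev q (Suc m))" by (simp add: ec_def)
  also have "... = - (iq ^ m * ec m / q)" unfolding p unfolding Qpow ec_def e by simp
  finally show ?thesis by (simp add: left_diff_distrib)
qed

lemma sg_e: "Abs_fps ec = Lq * sg (Abs_fps ec)"
proof (rule fps_ext)
  fix k
  show "fps_nth (Abs_fps ec) k = fps_nth (Lq * sg (Abs_fps ec)) k"
  proof (cases k)
    case (Suc m)
    then show ?thesis using e_rec[of m] by (simp add: sg_nth Lq_nth)
  qed (simp add: sg_nth Lq_def)
qed

lemma sg_f: "(1 - fps_X) * Abs_fps fc = Lq * sg (Abs_fps fc)"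
proof (rule fps_ext)
  fix k
  show "fps_nth ((1 - fps_X) * Abs_fps fc) k = fps_nth (Lq * sg (Abs_fps fc)) k"
  proof (cases k)
    case (Suc m)
    have "pev q m > 0" "pev q (Suc m) > 0" by (rule pev_gt0)+
    then have p: "(1 - iq ^ Suc m) / pev q (Suc m) = 1 / pev q m" unfolding Qpow pev_Suc by (simp add: field_simps)
    have "(1 - iq ^ Suc m) * fc (Suc m) = podd q (Suc m) * ((1 - iq ^ Suc m) / pev q (Suc m))" by (simp add: fc_def)
    also have "... = fc m - iq ^ m * fc m / q" unfolding p unfolding podd_Suc fc_def Qpow by (simp add: algebra_simps diff_divide_distrib)
    finally show ?thesis using Suc by (simp add: sg_nth Lq_nth left_diff_distrib algebra_simps)
  qed (simp add: sg_nth Lq_def)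
qed

text \<open>The product of the two series is invariant under the dilation, hence constant, because
  \<open>iq ^ k\<close> is 1 for \<open>k = 0\<close> only.\<close>

lemma conv_ae: "(\<Sum>j\<le>k. ac (k - j) * ec j) = (if k = 0 then 1 else 0)"
proof -
  define H where "H = Abs_fps ec * Abs_fps ac"
  have "sg H = H"
    unfolding H_def sg_mult sg_a by (subst (2) sg_e) (simp only: mult_ac)
  then have "iq ^ k * fps_nth H k = fps_nth H k" by (metis sg_nth)
  moreover have "iq ^ k ~= 1" if "k ~= 0" using Qpow_less[of "k - 1"] that by simp
  ultimately have "fps_nth H k = 0" if "k ~= 0" using that by simp
  moreover have "fps_nth H 0 = 1" by (simp add: H_def ec_def ac_def pev_0)
  moreover have "fps_nth H k = (\<Sum>j\<le>k. ac (k - j) * ec j)"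
    unfolding H_def fps_mult_nth atLeast0AtMost by (rule sum.cong[OF refl]) (simp add: mult.commute)
  ultimately show ?thesis by auto
qed

text \<open>The product \<open>H\<close> of the two series satisfies
  \<open>H(z / q^2) = (1 - z) H(z)\<close>, which gives a recursion for its coefficients with
  solution \<open>1 / pev q k\<close>.\<close>

lemma conv_af: "(\<Sum>j\<le>k. ac (k - j) * fc j) = 1 / pev q k"
proof -
  define H where "H = Abs_fps fc * Abs_fps ac"
  have "sg H = (1 - fps_X) * H"
  proof -
    have "(1 - fps_X) * H = ((1 - fps_X) * Abs_fps fc) * Abs_fps ac" unfolding H_def by (simp only: mult.assoc)
    also have "... = sg (Abs_fps fc) * (Lq * Abs_fps ac)" unfolding sg_f by (simp only: mult_ac)
    finally show ?thesis unfolding H_def sg_mult sg_a by (rule sym)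
  qed
  then have e: "iq ^ k * fps_nth H k = fps_nth ((1 - fps_X) * H) k" for k by (metis sg_nth)
  have H: "fps_nth H k = 1 / pev q k" for k
  proof (induction k)
    case 0
    show ?case by (simp add: H_def fc_def ac_def pev_0)
  next
    case (Suc m)
    have "iq ^ Suc m * fps_nth H (Suc m) = fps_nth H (Suc m) - fps_nth H m" using e[of "Suc m"] by (simp add: left_diff_distrib)
    then have *: "(1 - iq ^ Suc m) * fps_nth H (Suc m) = 1 / pev q m" using Suc by (simp add: left_diff_distrib)
    have "1 - iq ^ Suc m ~= 0" using Qpow_less[of m] by simp
    then have "fps_nth H (Suc m) = (1 - iq ^ Suc m) * fps_nth H (Suc m) / (1 - iq ^ Suc m)" by (rule nonzero_mult_div_cancel_left[symmetric])
    then have "fps_nth H (Suc m) = 1 / pev q m / (1 - iq ^ Suc m)" unfolding * .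
    then show ?case unfolding pev_Suc Qpow by simp
  qed
  have "fps_nth H k = (\<Sum>j\<le>k. ac (k - j) * fc j)"
    unfolding H_def fps_mult_nth atLeast0AtMost by (rule sum.cong[OF refl]) (simp add: mult.commute)
  then show ?thesis using H by simp
qed

text \<open>Convolution with a series in the square of the variable; invertible skew maps live in
  even dimensions only.\<close>

lemma even_sum:
  fixes g h :: "nat => real"
  shows "(\<Sum>m\<le>n. g m * (if even (n - m) then h ((n - m) div 2) else 0)) = (\<Sum>j\<le>n div 2. g (n - 2 * j) * h j)"
proof -
  have "(\<Sum>m\<le>n. g m * (if even (n - m) then h ((n - m) div 2) else 0)) =
      (\<Sum>m\<in>{m. m \<le> n & even (n - m)}. g m * h ((n - m) div 2))"
    by (rule sum.mono_neutral_cong_right) auto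
  also have "... = (\<Sum>j\<le>n div 2. g (n - 2 * j) * h j)"
    by (rule sum.reindex_bij_witness[of _ "\<lambda>j. n - 2 * j" "\<lambda>m. (n - m) div 2"]) (auto elim!: evenE)
  finally show ?thesis .
qed

text \<open>A convolution with nonzero constant term can be undone, and the value at
  \<open>n\<close> depends on the data up to \<open>n\<close> only.\<close>

lemma conv_unique:
  fixes f :: "nat => real"
  assumes "f 0 ~= 0" and "\<And>k. k \<le> n ==> (\<Sum>m\<le>k. a m * f (k - m)) = (\<Sum>m\<le>k. b m * f (k - m))"
  shows "a n = b n"
  using assms(2)
proof (induction n rule: less_induct)
  case (less n)
  have "a m = b m" if "m < n" for m using less.IH[OF that] less.prems that by simp
  then have "(\<Sum>m<n. a m * f (n - m)) = (\<Sum>m<n. b m * f (n - m))" by (intro sum.cong) auto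
  then show ?case using less.prems[of n] assms(1) by (simp add: lessThan_Suc_atMost[symmetric])
qed

text \<open>\<open>nilc m\<close> will be the total weight of all types of size \<open>m\<close>,
  and \<open>dc k\<close> the number \<open>d(k)\<close>.\<close>

definition nilc :: "nat => real" where "nilc m = ac (m div 2)"
definition dc :: "nat => real" where "dc n = sc (n div 2)"

lemma ac_shift: "j \<le> n div 2 ==> nilc (n - 2 * j) = ac (n div 2 - j)"
proof -
  assume "j \<le> n div 2"
  then have "(n - 2 * j) div 2 = n div 2 - j" by linarith
  then show ?thesis by (simp add: nilc_def)
qed

text \<open>The assumption is the Fitting convolution for skew pairs, with invertible part
  \<open>fc\<close> and total \<open>1 / pev\<close>.\<close>

lemma nilc_unique:
  assumes "\<And>n. (\<Sum>m\<le>n. nil m * (if even (n - m) then fc ((n - m) div 2) else 0)) = 1 / pev q (n div 2)"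
  shows "nil n = nilc n"
proof (rule conv_unique[where f = "\<lambda>k. if even k then fc (k div 2) else 0"])
  show "(if even 0 then fc (0 div 2) else 0) ~= 0" by (simp add: fc_def pev_0)
  fix n
  have "(\<Sum>m\<le>n. nilc m * (if even (n - m) then fc ((n - m) div 2) else 0)) = (\<Sum>j\<le>n div 2. ac (n div 2 - j) * fc j)"
    unfolding even_sum by (rule sum.cong[OF refl]) (simp add: ac_shift)
  then show "(\<Sum>m\<le>n. nil m * (if even (n - m) then fc ((n - m) div 2) else 0)) =
      (\<Sum>m\<le>n. nilc m * (if even (n - m) then fc ((n - m) div 2) else 0))"
    using assms conv_af by simp
qed

text \<open>In generating functions \<open>nilc\<close> is \<open>(1 + z) A(z^2)\<close> and
  \<open>dc\<close> is \<open>E(z^2) / (1 - z)\<close>, where \<open>A E = 1\<close>. The product is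
  \<open>(1 + z) / (1 - z)\<close>, with coefficients 1, 2, 2 and so on.\<close>

lemma dc_total: "(\<Sum>m\<le>n. nilc m * dc (n - m)) = (if n = 0 then 1 else 2)"
proof -
  have dd: "dc k = (if k = 0 then 0 else dc (k - 1)) + (if even k then ec (k div 2) else 0)" for k
  proof (cases k)
    case (Suc m)
    show ?thesis
    proof (cases "even k")
      case True
      then obtain j where "k = 2 * Suc j" using Suc by (metis evenE mult_is_0 not0_implies_Suc Zero_not_Suc)
      then show ?thesis by (simp add: dc_def sc_def)
    next
      case False
      then obtain j where "k = 2 * j + 1" using oddE by blast
      then show ?thesis by (simp add: dc_def)
    qed
  qed (simp add: dc_def sc_def)
  have ce: "(\<Sum>m\<le>n. nilc m * (if even (n - m) then ec ((n - m) div 2) else 0)) = (if n div 2 = 0 then 1 else 0)" for n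
  proof -
    have "(\<Sum>m\<le>n. nilc m * (if even (n - m) then ec ((n - m) div 2) else 0)) = (\<Sum>j\<le>n div 2. ac (n div 2 - j) * ec j)"
      unfolding even_sum by (rule sum.cong[OF refl]) (simp add: ac_shift)
    then show ?thesis by (simp add: conv_ae)
  qed
  have step: "(\<Sum>m\<le>Suc n. nilc m * dc (Suc n - m)) = (\<Sum>m\<le>n. nilc m * dc (n - m)) + (if Suc n div 2 = 0 then 1 else 0)" for n
  proof -
    have "(\<Sum>m\<le>Suc n. nilc m * dc (Suc n - m)) =
        (\<Sum>m\<le>Suc n. nilc m * (if Suc n - m = 0 then 0 else dc (Suc n - m - 1))) + (\<Sum>m\<le>Suc n. nilc m * (if even (Suc n - m) then ec ((Suc n - m) div 2) else 0))"
      unfolding sum.distrib[symmetric] distrib_left[symmetric] by (subst dd) (rule refl)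
    also have "(\<Sum>m\<le>Suc n. nilc m * (if Suc n - m = 0 then 0 else dc (Suc n - m - 1))) = (\<Sum>m\<le>n. nilc m * dc (n - m))"
      by (auto intro!: sum.cong)
    finally show ?thesis unfolding ce .
  qed
  show ?thesis
  proof (induction n)
    case 0
    show ?case by (simp add: nilc_def dc_def sc_def ac_def ec_def pev_0)
  next
    case (Suc n)
    then show ?case unfolding step by (cases n) simp_all
  qed
qed

lemma dc_unique:
  assumes "\<And>k. k \<le> n ==> (\<Sum>m\<le>k. nilc m * d (k - m)) = (if k = 0 then 1 else 2)"
  shows "d n = dc n"
proof (rule conv_unique[where f = nilc])
  show "nilc 0 ~= 0" by (simp add: nilc_def ac_def pev_0)
  fix k assume k: "k \<le> n"
  have r: "(\<Sum>m\<le>k. f m * nilc (k - m)) = (\<Sum>m\<le>k. nilc m * f (k - m))" for f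
    by (rule sum.reindex_bij_witness[of _ "\<lambda>m. k - m" "\<lambda>m. k - m"]) auto
  show "(\<Sum>m\<le>k. d m * nilc (k - m)) = (\<Sum>m\<le>k. dc m * nilc (k - m))"
    unfolding r assms[OF k] dc_total ..
qed

section \<open>Tails of the alternating series\<close>

lemma abs_ec: "\<bar>ec k\<bar> \<le> 8 / 7 * (1 / q ^ (k * k))"
proof -
  have "\<bar>ec k\<bar> = 1 / q ^ (k * k) * (1 / pev q k)" unfolding ec_def using q_pos pev_gt0[of k] by (simp add: abs_mult power_abs)
  also have "... \<le> 1 / q ^ (k * k) * (8 / 7)" using pev_78[of k] q_pos by (intro mult_left_mono) (simp_all add: field_simps)
  finally show ?thesis by simp
qed

lemma inv_pow_sq: "1 / q ^ ((k + i) * (k + i)) \<le> 1 / q ^ (k * k) * (1 / 9) ^ i" if "k \<ge> 1"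
proof -
  have "(k + i) * (k + i) = k * k + 2 * (k * i) + i * i" by (simp add: algebra_simps)
  moreover have "i \<le> k * i" using that by simp
  ultimately have "k * k + 2 * i \<le> (k + i) * (k + i)" by linarith
  then have "q ^ (k * k + 2 * i) \<le> q ^ ((k + i) * (k + i))" using q_pos by (intro power_increasing) simp_all
  then have "1 / q ^ ((k + i) * (k + i)) \<le> 1 / q ^ (k * k + 2 * i)" using q_pos by (intro divide_left_mono) simp_all
  also have "... = 1 / q ^ (k * k) * (1 / q ^ (2 * i))" by (simp add: power_add)
  also have "... \<le> 1 / q ^ (k * k) * (1 / 9) ^ i" using inv_q2[of i] q_pos by (intro mult_left_mono) simp_all
  finally show ?thesis .
qed

lemma ec_tail_bound: "\<bar>ec (i + Suc k)\<bar> \<le> 8 / 7 * (1 / q ^ (Suc k * Suc k)) * (1 / 9) ^ i"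
proof -
  have "\<bar>ec (Suc k + i)\<bar> \<le> 8 / 7 * (1 / q ^ ((Suc k + i) * (Suc k + i)))" by (rule abs_ec)
  also have "... \<le> 8 / 7 * (1 / q ^ (Suc k * Suc k) * (1 / 9) ^ i)" by (intro mult_left_mono inv_pow_sq) simp_all
  finally show ?thesis by (simp only: add.commute mult.assoc)
qed

lemma geo9: "summable (\<lambda>i. (1 / 9 :: real) ^ i)" "(\<Sum>i. (1 / 9 :: real) ^ i) = 9 / 8"
  using suminf_geometric[of "1 / 9 :: real"] summable_geometric[of "1 / 9 :: real"] by simp_all

lemma summable_ec: "summable (\<lambda>k. \<bar>ec k\<bar>)" "summable ec"
proof -
  have "summable (\<lambda>i. \<bar>ec (i + Suc 0)\<bar>)"
  proof (rule summable_comparison_test')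
    show "summable (\<lambda>i. 8 / 7 * (1 / q ^ (Suc 0 * Suc 0)) * (1 / 9) ^ i)" by (intro summable_mult geo9)
    show "norm \<bar>ec (i + Suc 0)\<bar> \<le> 8 / 7 * (1 / q ^ (Suc 0 * Suc 0)) * (1 / 9) ^ i" if "i \<ge> 0" for i
      using ec_tail_bound[of i 0] by simp
  qed
  then show "summable (\<lambda>k. \<bar>ec k\<bar>)" by (rule summable_iff_shift[THEN iffD1])
  then show "summable ec" by (rule summable_rabs_cancel)
qed

text \<open>The constant is 8/7, from the lower bound 7/8 of \<open>pev\<close>, times 9/8, the sum
  of the geometric series of ratio 1/9.\<close>

lemma tail: "\<bar>suminf ec - sc k\<bar> \<le> 9 / 7 * (1 / q ^ (Suc k * Suc k))"
proof -
  have s: "summable (\<lambda>i. \<bar>ec (i + Suc k)\<bar>)" by (rule summable_iff_shift[THEN iffD2, OF summable_ec(1)])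
  have "suminf ec - sc k = (\<Sum>i. ec (i + Suc k))"
    using suminf_minus_initial_segment[OF summable_ec(2), of "Suc k"] by (simp add: sc_def lessThan_Suc_atMost)
  then have "\<bar>suminf ec - sc k\<bar> \<le> (\<Sum>i. \<bar>ec (i + Suc k)\<bar>)" using summable_rabs[OF s] by simp
  also have "... \<le> (\<Sum>i. 8 / 7 * (1 / q ^ (Suc k * Suc k)) * (1 / 9) ^ i)"
    by (intro suminf_le s summable_mult geo9 ec_tail_bound)
  also have "... = 8 / 7 * (1 / q ^ (Suc k * Suc k)) * (9 / 8)" unfolding suminf_mult[OF geo9(1)] geo9(2) ..
  finally show ?thesis by simp
qed

lemma ac_bound: "ac k \<le> 8 / 7 * (1 / q ^ k)" "ac k \<ge> 1 / q ^ k" "ac k \<ge> 0"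
proof -
  have e: "ac k = 1 / q ^ k * (1 / pev q k)" by (simp add: ac_def)
  have "1 / pev q k \<le> 8 / 7" "1 \<le> 1 / pev q k" using pev_78[of k] pev_gt0[of k] pev_le1[of k] by (simp_all add: field_simps)
  then show "ac k \<le> 8 / 7 * (1 / q ^ k)" "ac k \<ge> 1 / q ^ k" unfolding e using q_pos
    by (metis mult.commute mult_left_mono zero_le_divide_1_iff zero_le_power less_imp_le, metis mult.right_neutral mult_left_mono zero_le_divide_1_iff zero_le_power less_imp_le)
  then show "ac k \<ge> 0" using q_pos by (smt (verit) zero_less_power zero_less_divide_1_iff)
qed

text \<open>\<open>E N\<close> is Euler's series at \<open>z = q^(-2 N)\<close>. The difference
  equation yields \<open>E 0 = podd q N * E N\<close>, and \<open>E N\<close> tends to the constant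
  term 1.\<close>

lemma podd_tendsto: "(\<lambda>N. podd q N) \<longlonglongrightarrow> suminf ec"
proof -
  define E where "E N = (\<Sum>j. iq ^ (N * j) * ec j)" for N
  have Q1: "0 \<le> iq" "iq \<le> 1" using q_pos Qpow_less[of 0] by (simp_all add: iq_def)
  have sm: "summable (\<lambda>j. iq ^ (N * j) * ec j)" for N
  proof (rule summable_comparison_test'[OF summable_ec(1)])
    show "norm (iq ^ (N * j) * ec j) \<le> \<bar>ec j\<bar>" if "j \<ge> 0" for j
      using Q1 power_le_one[OF Q1, of "N * j"] by (simp add: abs_mult mult_left_le_one_le)
  qed
  have Estep: "E N = E (Suc N) * (1 - 1 / q ^ (2 * N + 1))" for N
  proof -
    have t: "iq ^ (N * Suc j) * ec (Suc j) = iq ^ (Suc N * Suc j) * ec (Suc j) - 1 / q ^ (2 * N + 1) * (iq ^ (Suc N * j) * ec j)" for j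
    proof -
      have "iq ^ (N * Suc j) * ec (Suc j) = iq ^ (N * Suc j) * (iq ^ Suc j * ec (Suc j)) - iq ^ (N * Suc j) * (iq ^ j * ec j / q)"
        using arg_cong[OF e_rec[of j], of "\<lambda>x. iq ^ (N * Suc j) * x"] by (simp only: right_diff_distrib)
      also have "iq ^ (N * Suc j) * (iq ^ Suc j * ec (Suc j)) = iq ^ (Suc N * Suc j) * ec (Suc j)"
        by (simp only: mult.assoc[symmetric] power_add[symmetric] mult_Suc add.commute)
      also have "iq ^ (N * Suc j) * (iq ^ j * ec j / q) = 1 / q ^ (2 * N + 1) * (iq ^ (Suc N * j) * ec j)"
      proof -
        have "iq ^ (N * Suc j) * iq ^ j = iq ^ N * iq ^ (Suc N * j)"
          by (simp add: power_add[symmetric] algebra_simps)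
        moreover have "iq ^ N / q = 1 / q ^ (2 * N + 1)" unfolding Qpow by simp
        ultimately show ?thesis by (metis (no_types, lifting) mult.assoc mult.commute times_divide_eq_right)
      qed
      finally show ?thesis .
    qed
    have "E N = ec 0 + (\<Sum>j. iq ^ (N * Suc j) * ec (Suc j))"
      unfolding E_def using suminf_split_head[OF sm[of N]] by simp
    also have "(\<Sum>j. iq ^ (N * Suc j) * ec (Suc j)) = (\<Sum>j. iq ^ (Suc N * Suc j) * ec (Suc j)) - 1 / q ^ (2 * N + 1) * E (Suc N)"
      unfolding t E_def using sm[of "Suc N"] summable_Suc_iff[of "\<lambda>j. iq ^ (Suc N * j) * ec j"]
      by (subst suminf_diff[symmetric]) (auto intro: summable_mult simp only: suminf_mult)
    also have "ec 0 + ((\<Sum>j. iq ^ (Suc N * Suc j) * ec (Suc j)) - 1 / q ^ (2 * N + 1) * E (Suc N)) = E (Suc N) - 1 / q ^ (2 * N + 1) * E (Suc N)"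
      unfolding E_def using suminf_split_head[OF sm[of "Suc N"]] by simp
    finally show ?thesis by (simp add: algebra_simps)
  qed
  have E0: "E 0 = podd q N * E N" for N
  proof (induction N)
    case (Suc N)
    have "E 0 = podd q N * (E (Suc N) * (1 - 1 / q ^ (2 * N + 1)))" unfolding Estep[of N, symmetric] by (rule Suc)
    then show ?case by (simp only: podd_Suc mult_ac)
  qed simp
  have "(\<lambda>N. E N) \<longlonglongrightarrow> 1"
  proof -
    let ?C = "\<Sum>j. \<bar>ec j\<bar>"
    have bd: "\<bar>E N - 1\<bar> \<le> iq ^ N * ?C" for N
    proof -
      have s1: "summable (\<lambda>j. \<bar>iq ^ (N * Suc j) * ec (Suc j)\<bar>)"
      proof (rule summable_comparison_test'[OF summable_Suc_iff[THEN iffD2, OF summable_ec(1)]])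
        show "norm \<bar>iq ^ (N * Suc j) * ec (Suc j)\<bar> \<le> \<bar>ec (Suc j)\<bar>" if "j \<ge> 0" for j
          using Q1 power_le_one[OF Q1, of "N * Suc j"] by (simp add: abs_mult mult_left_le_one_le del: mult_Suc_right)
      qed
      have "E N - 1 = (\<Sum>j. iq ^ (N * Suc j) * ec (Suc j))"
        unfolding E_def using suminf_split_head[OF sm[of N]] by (simp add: ec_def pev_0)
      then have "\<bar>E N - 1\<bar> \<le> (\<Sum>j. \<bar>iq ^ (N * Suc j) * ec (Suc j)\<bar>)" using summable_rabs[OF s1] by simp
      also have "... \<le> (\<Sum>j. iq ^ N * \<bar>ec (Suc j)\<bar>)"
      proof (rule suminf_le[OF _ s1])
        show "\<bar>iq ^ (N * Suc j) * ec (Suc j)\<bar> \<le> iq ^ N * \<bar>ec (Suc j)\<bar>" for j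
          using Q1 power_decreasing[of N "N * Suc j" iq] by (simp add: abs_mult mult_right_mono)
        show "summable (\<lambda>j. iq ^ N * \<bar>ec (Suc j)\<bar>)" by (intro summable_mult summable_Suc_iff[THEN iffD2] summable_ec)
      qed
      also have "... = iq ^ N * (\<Sum>j. \<bar>ec (Suc j)\<bar>)" by (intro suminf_mult summable_Suc_iff[THEN iffD2] summable_ec)
      also have "... \<le> iq ^ N * ?C"
        using Q1 suminf_split_head[OF summable_ec(1)] by (intro mult_left_mono) simp_all
      finally show ?thesis .
    qed
    have "iq < 1" using Qpow_less[of 0] by simp
    then have "(\<lambda>N. iq ^ N * ?C) \<longlonglongrightarrow> 0 * ?C" using Q1 by (intro tendsto_mult LIMSEQ_power_zero tendsto_const) simp
    then have "(\<lambda>N. E N - 1) \<longlonglongrightarrow> 0" using bd by (intro Lim_null_comparison[of "\<lambda>N. E N - 1" "\<lambda>N. iq ^ N * ?C"]) simp_all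
    then show ?thesis by (simp only: LIM_zero_iff)
  qed
  then have "(\<lambda>N. E 0 / E N) \<longlonglongrightarrow> E 0 / 1" by (intro tendsto_divide tendsto_const) simp_all
  moreover have "eventually (\<lambda>N. E 0 / E N = podd q N) sequentially"
  proof -
    have "eventually (\<lambda>N. E N ~= 0) sequentially"
      using tendsto_imp_eventually_ne[OF \<open>E \<longlonglongrightarrow> 1\<close>, of 0] by simp
    then show ?thesis
    proof eventually_elim
      case (elim N)
      then show ?case using E0[of N] by simp
    qed
  qed
  ultimately have "(\<lambda>N. podd q N) \<longlonglongrightarrow> E 0" using Lim_transform_eventually by fastforce
  then show ?thesis by (simp add: E_def)
qed

lemma c_bounds: "5 / 8 \<le> suminf ec" "suminf ec \<le> 1"
proof -
  have "5 / 8 \<le> podd q N" for N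
  proof -
    have "0 \<le> (1 / 9 :: real) ^ N" by simp
    then show ?thesis using podd_lower[of N] by linarith
  qed
  then show "5 / 8 \<le> suminf ec" using podd_tendsto by (intro LIMSEQ_le_const) auto
  have "podd q N \<le> 1" for N
    unfolding podd_def using q_pos by (intro prod_le_1) (auto simp: one_le_power simp del: power_Suc)
  then show "suminf ec \<le> 1" using podd_tendsto by (intro LIMSEQ_le_const2) auto
qed

lemma c_prodinf: "(\<Prod>i. 1 - 1 / q ^ (2 * i + 1)) = suminf ec"
proof -
  have "0 \<le> iq" by (simp add: iq_def)
  then have s: "summable (\<lambda>i. 1 / q * iq ^ i)" using Qpow_less[of 0] by (intro summable_mult summable_geometric) simp
  have e: "(\<lambda>i. norm (1 - 1 / q ^ (2 * i + 1) - 1)) = (\<lambda>i. 1 / q * iq ^ i)"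
    by (rule ext) (use q_pos in \<open>simp add: Qpow abs_mult\<close>)
  have "abs_convergent_prod (\<lambda>i. 1 - 1 / q ^ (2 * i + 1))" unfolding abs_convergent_prod_conv_summable e by (rule s)
  then have "convergent_prod (\<lambda>i. 1 - 1 / q ^ (2 * i + 1))" by (rule abs_convergent_prod_imp_convergent_prod)
  then have "(\<lambda>n. \<Prod>i\<le>n. 1 - 1 / q ^ (2 * i + 1)) \<longlonglongrightarrow> (\<Prod>i. 1 - 1 / q ^ (2 * i + 1))" by (rule convergent_prod_LIMSEQ)
  moreover have "(\<lambda>n. \<Prod>i\<le>n. 1 - 1 / q ^ (2 * i + 1)) \<longlonglongrightarrow> suminf ec"
    using LIMSEQ_Suc[OF podd_tendsto] by (simp add: podd_def lessThan_Suc_atMost)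
  ultimately show ?thesis by (rule LIMSEQ_unique)
qed

text \<open>The deviation for sizes of one parity. \<open>N\<close> is the number of sizes of that
  parity up to \<open>n\<close>; beyond them the random matrix has probability zero and the whole
  value of the product remains.\<close>

definition gam :: "nat => nat => real" where
  "gam N k = (if k < N then \<bar>suminf ec - sc (N - 1 - k)\<bar> else suminf ec)"

lemma sum_split:
  fixes f :: "nat => real"
  shows "(\<Sum>k<m + n. f k) = (\<Sum>k<m. f k) + (\<Sum>i<n. f (m + i))"
  by (induction n) simp_all

text \<open>The terms with \<open>k < N\<close> sum to at most
  \<open>(8/7) * (9/7) * (9/8) = 81/49\<close>, the others to at most
  \<open>(8/7) * (3/2) = 12/7\<close>. Together this is about 3.367.\<close>

lemma gam_sum: "(\<Sum>k\<le>K. ac k * gam N k) \<le> 3.37 / q ^ N"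
proof -
  have gn: "gam N k \<ge> 0" for k unfolding gam_def using c_bounds by auto
  define h where "h k = (if k < N then 72 / 49 * (1 / 9) ^ (N - 1 - k) else 8 / 7 * (1 / 3) ^ (k - N) :: real)" for k
  have t: "ac k * gam N k \<le> h k / q ^ N" for k
  proof (cases "k < N")
    case True
    define j where "j = N - 1 - k"
    have N: "N = k + j + 1" using True by (simp add: j_def)
    have "ac k * gam N k \<le> 8 / 7 * (1 / q ^ k) * (9 / 7 * (1 / q ^ (Suc j * Suc j)))"
      using True ac_bound[of k] tail[of j] unfolding gam_def j_def[symmetric] using q_pos by (intro mult_mono) simp_all
    also have "... = 72 / 49 * (1 / (q ^ k * q ^ (Suc j * Suc j)))" by simp
    \<comment> \<open>In the exponent \<open>k + (j + 1)^2 = N + j * (j + 1)\<close>, so every term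
      contains the common factor \<open>1 / q ^ N\<close>.\<close>
    also have "q ^ k * q ^ (Suc j * Suc j) = q ^ N * q ^ (j * (j + 1))" by (simp add: N power_add[symmetric] algebra_simps)
    also have "72 / 49 * (1 / (q ^ N * q ^ (j * (j + 1)))) \<le> 72 / 49 * (1 / (q ^ N * q ^ (2 * j)))"
    proof -
      have "2 * j \<le> j * (j + 1)" by (cases j) simp_all
      then have "q ^ (2 * j) \<le> q ^ (j * (j + 1))" using q_pos by (intro power_increasing) simp_all
      then show ?thesis using q_pos by (intro mult_left_mono divide_left_mono) simp_all
    qed
    also have "... = 72 / 49 * (1 / q ^ (2 * j) * (1 / q ^ N))" by simp
    also have "... \<le> 72 / 49 * ((1 / 9) ^ j * (1 / q ^ N))"
      by (intro mult_left_mono mult_right_mono inv_q2) (use q_pos in simp_all)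
    also have "... = 72 / 49 * (1 / 9) ^ j / q ^ N" by simp
    finally show ?thesis using True by (simp add: h_def j_def)
  next
    case False
    then have N: "k = N + (k - N)" by simp
    have "(3::real) ^ (k - N) \<le> q ^ (k - N)" using q3 by (intro power_mono) simp_all
    then have "1 / q ^ (k - N) \<le> 1 / 3 ^ (k - N)" by (intro divide_left_mono) (use q_pos in simp_all)
    have "ac k * gam N k \<le> 8 / 7 * (1 / q ^ k) * 1"
      using False ac_bound[of k] c_bounds unfolding gam_def using q_pos by (intro mult_mono) simp_all
    also have "... = 8 / 7 * (1 / q ^ (k - N)) / q ^ N" by (subst N) (simp add: power_add)
    also have "... \<le> 8 / 7 * (1 / 3 ^ (k - N)) / q ^ N"
      using \<open>1 / q ^ (k - N) \<le> 1 / 3 ^ (k - N)\<close> q_pos by (intro divide_right_mono mult_left_mono) simp_all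
    finally show ?thesis using False by (simp add: h_def power_one_over)
  qed
  have hs: "(\<Sum>k\<le>K. h k) \<le> 3.37"
  proof -
    have "(\<Sum>k\<le>K. h k) \<le> (\<Sum>k<N + Suc K. h k)"
      by (rule sum_mono2) (auto simp: h_def)
    also have "... = (\<Sum>k<N. h k) + (\<Sum>i<Suc K. h (N + i))"
      by (rule sum_split)
    also have "(\<Sum>k<N. h k) + (\<Sum>i<Suc K. h (N + i)) \<le> 72 / 49 * (9 / 8) + 8 / 7 * (3 / 2)"
    proof (rule add_mono)
    have "(\<Sum>k<N. h k) = (\<Sum>j<N. 72 / 49 * (1 / 9) ^ j)"
      by (rule sum.reindex_bij_witness[of _ "\<lambda>j. N - 1 - j" "\<lambda>k. N - 1 - k"]) (auto simp: h_def)
    also have "... \<le> 72 / 49 * (9 / 8)"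
      unfolding sum_distrib_left[symmetric] geo9(2)[symmetric] by (intro mult_left_mono sum_le_suminf geo9) simp_all
    finally show "(\<Sum>k<N. h k) \<le> 72 / 49 * (9 / 8)" .
    have "(\<Sum>i<Suc K. h (N + i)) = (\<Sum>i<Suc K. 8 / 7 * (1 / 3) ^ i)" by (rule sum.cong) (auto simp: h_def)
    also have "... \<le> 8 / 7 * (3 / 2)"
    proof -
      have "(\<Sum>i<Suc K. (1 / 3 :: real) ^ i) \<le> (\<Sum>i. (1 / 3) ^ i)" by (intro sum_le_suminf summable_geometric) simp_all
      also have "... = 3 / 2" using suminf_geometric[of "1 / 3 :: real"] by simp
      finally show ?thesis unfolding sum_distrib_left[symmetric] by simp
    qed
    finally show "(\<Sum>i<Suc K. h (N + i)) \<le> 8 / 7 * (3 / 2)" .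
    qed
    finally show ?thesis by simp
  qed
  have "(\<Sum>k\<le>K. ac k * gam N k) \<le> (\<Sum>k\<le>K. h k) / q ^ N" unfolding sum_divide_distrib by (rule sum_mono) (rule t)
  also have "... \<le> 3.37 / q ^ N" using hs q_pos by (intro divide_right_mono) simp_all
  finally show ?thesis .
qed

lemma sum_even_odd:
  fixes f :: "nat => real"
  shows "(\<Sum>m<2 * Suc M. f m) = (\<Sum>k\<le>M. f (2 * k)) + (\<Sum>k\<le>M. f (2 * k + 1))"
proof (induction M)
  case (Suc M)
  have "(\<Sum>m<2 * Suc (Suc M). f m) = (\<Sum>m<2 * Suc M. f m) + f (2 * Suc M) + f (2 * Suc M + 1)" by simp
  then show ?case unfolding Suc sum.atMost_Suc by (simp only: ac_simps)
qed (simp add: numeral_2_eq_2)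

text \<open>The two point masses at a partition of size \<open>m\<close> will differ by half of its
  weight times \<open>gg n m\<close>.\<close>

definition gg :: "nat => nat => real" where
  "gg n m = \<bar>suminf ec - (if m \<le> n then dc (n - m) else 0)\<bar>"

lemma gg_gam:
  assumes "m \<le> n \<longleftrightarrow> k < N" "m \<le> n ==> (n - m) div 2 = N - 1 - k"
  shows "gg n m = gam N k"
proof (cases "m \<le> n")
  case True
  then show ?thesis using assms by (simp add: gg_def gam_def dc_def)
next
  case False
  then show ?thesis using assms(1) c_bounds by (simp add: gg_def gam_def)
qed

text \<open>Even and odd sizes are summed separately by \<open>gam_sum\<close>. For even
  \<open>n\<close> the two exponents differ by one, which gives the constant
  \<open>3.37 + 3.37 / 3 < 5.2\<close>; for odd \<open>n\<close> they agree, which gives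
  \<open>6.74 < 8\<close>. The targets 5.2 and 8 are four times 1.3 and 2.\<close>

lemma gg_upper: "(\<Sum>m\<le>M. nilc m * gg n m) \<le> (if even n then 5.2 / q ^ (n div 2) else 8 / q ^ ((n + 1) div 2))"
proof -
  have nn: "nilc m * gg n m \<ge> 0" for m unfolding nilc_def gg_def using ac_bound(3) by simp
  have "(\<Sum>m\<le>M. nilc m * gg n m) \<le> (\<Sum>m<2 * Suc M. nilc m * gg n m)"
    by (rule sum_mono2) (use nn in auto)
  also have "... = (\<Sum>k\<le>M. nilc (2 * k) * gg n (2 * k)) + (\<Sum>k\<le>M. nilc (2 * k + 1) * gg n (2 * k + 1))"
    by (rule sum_even_odd)
  also have "... = (\<Sum>k\<le>M. ac k * gam (Suc (n div 2)) k) + (\<Sum>k\<le>M. ac k * gam ((n + 1) div 2) k)"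
  proof (intro arg_cong2[where f = "(+)"] sum.cong refl)
    fix k
    have "gg n (2 * k) = gam (Suc (n div 2)) k" by (rule gg_gam) ((rule iffI)?; linarith)+
    then show "nilc (2 * k) * gg n (2 * k) = ac k * gam (Suc (n div 2)) k" by (simp add: nilc_def)
    have "gg n (2 * k + 1) = gam ((n + 1) div 2) k" by (rule gg_gam) ((rule iffI)?; linarith)+
    then show "nilc (2 * k + 1) * gg n (2 * k + 1) = ac k * gam ((n + 1) div 2) k" by (simp add: nilc_def)
  qed
  also have "... \<le> 3.37 / q ^ Suc (n div 2) + 3.37 / q ^ ((n + 1) div 2)"
    by (intro add_mono gam_sum)
  also have "... \<le> (if even n then 5.2 / q ^ (n div 2) else 8 / q ^ ((n + 1) div 2))"
  proof (cases "even n")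
    case True
    then have e: "(n + 1) div 2 = n div 2" by simp
    have "3.37 / q ^ Suc (n div 2) \<le> (3.37 / 3) / q ^ (n div 2)"
    proof -
      have "3.37 / q ^ Suc (n div 2) = 3.37 / q / q ^ (n div 2)" by simp
      also have "... \<le> (3.37 / 3) / q ^ (n div 2)" using q3 by (intro divide_right_mono divide_left_mono) simp_all
      finally show ?thesis .
    qed
    then have "3.37 / q ^ Suc (n div 2) + 3.37 / q ^ (n div 2) \<le> (3.37 / 3 + 3.37) / q ^ (n div 2)" by (simp add: add_divide_distrib)
    also have "... \<le> 5.2 / q ^ (n div 2)" using q_pos by (intro divide_right_mono) simp_all
    finally show ?thesis using True unfolding e by simp
  next
    case False
    then have e: "Suc (n div 2) = (n + 1) div 2" by presburger
    have "3.37 / q ^ ((n + 1) div 2) + 3.37 / q ^ ((n + 1) div 2) = 6.74 / q ^ ((n + 1) div 2)" by (simp add: add_divide_distrib[symmetric])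
    also have "... \<le> 8 / q ^ ((n + 1) div 2)" using q_pos by (intro divide_right_mono) simp_all
    finally show ?thesis using False unfolding e by simp
  qed
  finally show ?thesis .
qed

text \<open>Size \<open>n + 1\<close> is beyond the reach of the random matrix, so the deviation is
  the full product, at least 5/8. The target 0.4 is four times 0.1.\<close>

lemma gg_lower: "0.4 / q ^ ((n + 1) div 2) \<le> nilc (n + 1) * gg n (n + 1)"
proof -
  have g: "gg n (n + 1) = suminf ec" using c_bounds by (simp add: gg_def)
  have "0.4 / q ^ ((n + 1) div 2) \<le> (5 / 8) / q ^ ((n + 1) div 2)" using q_pos by (intro divide_right_mono) simp_all
  also have "... = 1 / q ^ ((n + 1) div 2) * (5 / 8)" by simp
  also have "... \<le> ac ((n + 1) div 2) * suminf ec"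
    by (rule mult_mono[OF ac_bound(2) c_bounds(1) ac_bound(3)]) simp
  finally show ?thesis unfolding g nilc_def .
qed

end

section \<open>The total variation distance\<close>

text \<open>If 2 were zero, the sets \<open>{x, x + 1}\<close> would partition the field into pairs
  and its order would be even.\<close>

lemma odd_card_two:
  assumes "odd CARD('a::{field,finite})" shows "(2 :: 'a) ~= 0"
proof
  assume "(2 :: 'a) = 0"
  then have two: "x + 1 + 1 = x" for x :: 'a by (metis add.assoc add.right_neutral one_add_one)
  have "card (UNIV :: 'a set) * 1 = card (range (\<lambda>x :: 'a. {x, x + 1})) * 2"
  proof (rule double_count[where R = "\<lambda>x g. x \<in> g"])
    fix x :: 'a
    have "{g \<in> range (\<lambda>x :: 'a. {x, x + 1}). x \<in> g} = {{x, x + 1}}"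
    proof -
      have "g = {x, x + 1}" if g: "g \<in> range (\<lambda>x :: 'a. {x, x + 1})" and xg: "x \<in> g" for g
      proof -
        obtain y where y: "g = {y, y + 1}" using g by blast
        then have "x = y \<or> x = y + 1" using xg by blast
        then show ?thesis unfolding y using two[of y] by auto
      qed
      then show ?thesis by blast
    qed
    then show "card {g \<in> range (\<lambda>x :: 'a. {x, x + 1}). x \<in> g} = 1" by simp
  next
    fix g :: "'a set" assume "g \<in> range (\<lambda>x. {x, x + 1})"
    then obtain y where "g = {y, y + 1}" by blast
    then have "{x \<in> UNIV. x \<in> g} = {y, y + 1}" by auto
    then have "card {x \<in> UNIV. x \<in> g} = card {y, y + 1}" by (rule arg_cong)
    then show "card {x \<in> UNIV. x \<in> g} = 2" by (rule trans) simp
  qed simp_all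
  then show False using assms by simp
qed

section \<open>Total weights of pairs\<close>

definition parts :: "nat => nat multiset set" where "parts m = {\<mu>. 0 \<notin># \<mu> & sum_mset \<mu> = m}"

lemma finite_parts: "finite (parts m)"
proof (rule finite_subset)
  show "parts m \<subseteq> mset ` {xs. set xs \<subseteq> {..m} & length xs \<le> m}"
  proof
    fix \<mu> assume "\<mu> \<in> parts m"
    then have \<mu>: "0 \<notin># \<mu>" "sum_mset \<mu> = m" by (simp_all add: parts_def)
    obtain xs where xs: "\<mu> = mset xs" by (metis ex_mset)
    have "x \<le> m" if "x \<in># \<mu>" for x using \<mu>(2) multi_member_split[OF that] by auto
    moreover have "size \<mu> \<le> m" using size_le_sum_mset[OF \<mu>(1)] \<mu>(2) by simp
    ultimately show "\<mu> \<in> mset ` {xs. set xs \<subseteq> {..m} & length xs \<le> m}" using xs by auto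
  qed
  show "finite (mset ` {xs. set xs \<subseteq> {..m} & length xs \<le> m})" by (intro finite_imageI finite_lists_length_le) simp
qed

lemma has_type_bound:
  fixes T :: "'a::{field,finite} fmat"
  assumes I: "finite I" and T: "has_type I \<mu> T" shows "sum_mset \<mu> \<le> card I"
proof -
  have "card (kpow I T (sum_mset \<mu>)) \<le> card (Mats I {0} :: 'a fmat set)"
    by (rule card_mono) (auto simp: kpow_def I)
  then have "CARD('a) ^ sum_mset \<mu> \<le> CARD('a) ^ card I"
    using T card_Mats[OF I, of "{0}", where 'a = 'a] kdim_eventually[of \<mu> "sum_mset \<mu>"] by (simp add: has_type_def)
  then show ?thesis using one_less_card_field[where 'a = 'a] by (simp add: power_increasing_iff)
qed

text \<open>The module decomposition is applied to the matrix \<open>1 + T\<close>, whether or not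
  it is invertible.\<close>

lemma has_type_exists:
  fixes T :: "'a::{field,finite} fmat"
  assumes T: "T \<in> Mats {..<n} {..<n}"
  shows "\<exists>\<mu>. 0 \<notin># \<mu> & has_type {..<n} \<mu> T"
proof -
  let ?g = "mof n (T + idm {..<n})"
  have "fof n ?g = T + idm {..<n}" by (rule fof_mof[OF Mats_add[OF T idm_Mats]])
  then have e: "fof n ?g - idm {..<n} = T" by simp
  obtain ds h where "0 \<notin> set ds" "primary_iso zm1 ?g ds h" using primary_iso_exists[OF mof_carrier] by blast
  then show ?thesis using primary_iso_has_type[OF mof_carrier, of n "T + idm {..<n}" ds h] unfolding e by (intro exI[of _ "mset ds"]) simp
qed

lemma Prs_decomposition:
  fixes th :: "'a::{field,finite}"
  shows "card (Prs th ep {..<n}) = (\<Sum>m\<le>n. \<Sum>\<mu>\<in>parts m. card (Prt th ep {..<n} \<mu>))"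
proof -
  let ?I = "{..<n}" and ?P = "\<Union>m\<in>{..n}. parts m"
  have fP: "finite ?P" by (intro finite_UN_I finite_parts) simp
  have "Prs th ep ?I = (\<Union>\<mu>\<in>?P. Prt th ep ?I \<mu>)"
  proof
    show "(\<Union>\<mu>\<in>?P. Prt th ep ?I \<mu>) \<subseteq> Prs th ep ?I" by (auto simp: Prt_def)
    show "Prs th ep ?I \<subseteq> (\<Union>\<mu>\<in>?P. Prt th ep ?I \<mu>)"
    proof
      fix x assume x: "x \<in> Prs th ep ?I"
      obtain B T where BT: "x = (B, T)" by (metis surj_pair)
      have "T \<in> Mats ?I ?I" using x BT by (simp add: Prs_def)
      then obtain \<mu> where \<mu>: "0 \<notin># \<mu>" "has_type ?I \<mu> T" using has_type_exists by blast
      have "sum_mset \<mu> \<le> n" using has_type_bound[OF finite_lessThan \<mu>(2)] by simp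
      then have "\<mu> \<in> ?P" using \<mu>(1) by (auto simp: parts_def)
      moreover have "x \<in> Prt th ep ?I \<mu>" using x BT \<mu>(2) by (simp add: Prt_def)
      ultimately show "x \<in> (\<Union>\<mu>\<in>?P. Prt th ep ?I \<mu>)" by blast
    qed
  qed
  moreover have "card (\<Union>\<mu>\<in>?P. Prt th ep ?I \<mu>) = (\<Sum>\<mu>\<in>?P. card (Prt th ep ?I \<mu>))"
  proof (rule card_UN_disjoint[OF fP])
    show "\<forall>\<mu>\<in>?P. finite (Prt th ep ?I \<mu>)" by simp
    show "\<forall>\<mu>\<in>?P. \<forall>\<nu>\<in>?P. \<mu> ~= \<nu> --> Prt th ep ?I \<mu> \<inter> Prt th ep ?I \<nu> = {}"
    proof (intro ballI impI, rule ccontr)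
      fix \<mu> \<nu> assume p: "\<mu> \<in> ?P" "\<nu> \<in> ?P" "\<mu> ~= \<nu>" and ne: "Prt th ep ?I \<mu> \<inter> Prt th ep ?I \<nu> ~= {}"
      then obtain T :: "'a fmat" where "has_type ?I \<mu> T" "has_type ?I \<nu> T" by (auto simp: Prt_def)
      from has_type_unique[OF this] show False using p by (auto simp: parts_def)
    qed
  qed
  moreover have "(\<Sum>\<mu>\<in>?P. card (Prt th ep ?I \<mu>)) = (\<Sum>m\<le>n. \<Sum>\<mu>\<in>parts m. card (Prt th ep ?I \<mu>))"
    by (rule sum.UNION_disjoint) (simp_all add: finite_parts, auto simp: parts_def)
  ultimately show ?thesis by simp
qed

text \<open>For \<open>th = 1\<close> the weight \<open>rr th k\<close> of the invertible part is
  the number \<open>d(k)\<close>. For \<open>th = 0\<close> both weights are explicit by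
  \<open>skew_totals\<close>.\<close>

definition xx :: "'a::{field,finite} => nat => real" where
  "xx th k = real (card (Prs th 1 {..<k})) / real (card (GLs {..<k} :: 'a fmat set))"

definition rr :: "'a::{field,finite} => nat => real" where
  "rr th k = real (card (Pri th 1 {..<k})) / real (card (GLs {..<k} :: 'a fmat set))"

definition nilw :: "'a::{field,finite} itself => nat => real" where
  "nilw _ m = (\<Sum>\<mu>\<in>parts m. wgt (1 :: 'a) \<mu>)"

lemma Prt_ratio:
  fixes th :: "'a::{field,finite}"
  assumes two: "(2 :: 'a) ~= 0" and th: "th = 0 \<or> th = 1" and \<mu>: "\<mu> \<in> parts m" and m: "m \<le> n"
  shows "real (card (Prt th 1 {..<n} \<mu>)) / real (card (GLs {..<n} :: 'a fmat set)) = wgt (1 :: 'a) \<mu> * rr th (n - m)"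
proof -
  \<comment> \<open>The nilpotent block takes the last \<open>m\<close> coordinates, so that the
    invertible block lives on the index set that occurs in \<open>rr\<close>.\<close>
  let ?I1 = "{n - m..<n}" and ?I2 = "{..<n - m}"
  have u: "?I1 \<union> ?I2 = {..<n}" and dis: "?I1 \<inter> ?I2 = {}" using m by auto
  have p: "0 \<notin># \<mu>" "sum_mset \<mu> = m" using \<mu> by (simp_all add: parts_def)
  have c: "card ?I1 = sum_mset \<mu>" using m p by simp
  have "card (Prt th 1 ?I1 \<mu>) = card (Prt 0 (1 :: 'a) ?I1 \<mu>)" using th Cayley_count[OF _ two c] by auto
  also have "real ... = real (card (GLs ?I1 :: 'a fmat set)) * wgt (1 :: 'a) \<mu>"
    by (rule card_nilpotent_pairs) (use two p c in simp_all)
  finally have e: "real (card (Prt th 1 ?I1 \<mu>)) = real (card (GLs ?I1 :: 'a fmat set)) * wgt (1 :: 'a) \<mu>" .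
  have "card (GLs ?I1 :: 'a fmat set) > 0" by (rule card_GLs_pos) simp
  then have "real (card (GLs ?I1 :: 'a fmat set)) ~= 0" by linarith
  then have "real (card (Prt th 1 ?I1 \<mu>)) / real (card (GLs ?I1 :: 'a fmat set)) = wgt (1 :: 'a) \<mu>"
    unfolding e by (rule nonzero_mult_div_cancel_left)
  then show ?thesis
    using Fitting_count[OF finite_atLeastLessThan finite_lessThan dis c, of th 1] unfolding u rr_def by simp
qed

lemma xx_convolution:
  fixes th :: "'a::{field,finite}"
  assumes two: "(2 :: 'a) ~= 0" and th: "th = 0 \<or> th = 1"
  shows "xx th n = (\<Sum>m\<le>n. nilw TYPE('a) m * rr th (n - m))"
proof -
  have "xx th n = (\<Sum>m\<le>n. \<Sum>\<mu>\<in>parts m. real (card (Prt th 1 {..<n} \<mu>)) / real (card (GLs {..<n} :: 'a fmat set)))"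
    unfolding xx_def Prs_decomposition by (simp add: sum_divide_distrib)
  also have "... = (\<Sum>m\<le>n. \<Sum>\<mu>\<in>parts m. wgt (1 :: 'a) \<mu> * rr th (n - m))"
    using Prt_ratio[OF two th] by (intro sum.cong refl) simp
  finally show ?thesis by (simp add: nilw_def sum_distrib_right)
qed

lemma choose_two_sum: "(Suc k choose 2) + (k choose 2) = k * k"
  by (induction k) (simp_all add: numeral_2_eq_2)

text \<open>The exponents for symmetric and alternating matrices add up to \<open>k * k\<close>, the
  exponent in the order of \<open>GL\<close>, so all powers of \<open>q\<close> cancel.\<close>

lemma skew_totals:
  assumes two: "(2 :: 'a::{field,finite}) ~= 0"
  defines "q \<equiv> real CARD('a)"
  shows "xx (0 :: 'a) k = 1 / pev q (k div 2)"
    and "rr (0 :: 'a) k = (if even k then podd q (k div 2) / pev q (k div 2) else 0)"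
proof -
  have q: "q > 1" using one_less_card_field[where 'a = 'a] by (simp add: q_def)
  have pos: "podd q j > 0" "pev q j > 0" for j using podd_pos[OF q] pev_pos[OF q] by simp_all
  have neg: "(-1 :: 'a) ~= 1"
  proof
    assume "(-1 :: 'a) = 1"
    then have "(1 :: 'a) + 1 = 0" by (metis add.right_inverse)
    then show False using two by simp
  qed
  have c2: "sexp (1 :: 'a) k + sexp (-1 :: 'a) k = k * k" using choose_two_sum neg by (simp add: sexp_def)
  have "real (card (GLs {..<k} :: 'a fmat set)) = gl q k k"
    using real_card_GLs[OF finite_lessThan, of k, where 'a = 'a] by (simp add: gl_def q_def)
  also have "... = q ^ (k * k) * (podd q (Suc k div 2) * pev q (k div 2))"
    using gl_split[OF q, of 0 k] prod_odd_even[where q = q and m = k] by (simp add: gl_def)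
  finally have G: "real (card (GLs {..<k} :: 'a fmat set)) = q ^ (k * k) * (podd q (Suc k div 2) * pev q (k div 2))" .
  have S: "real (card (SN 1 {..<k} :: 'a fmat set)) = q ^ sexp (1 :: 'a) k * podd q (Suc k div 2)"
    using real_card_SN[OF two, of 1 "{..<k}"] by (simp add: snf_def q_def)
  have S': "real (card (SN (-1) {..<k} :: 'a fmat set)) = q ^ sexp (-1 :: 'a) k * (if even k then podd q (k div 2) else 0)"
    using real_card_SN[OF two, of "-1" "{..<k}"] neg by (simp add: snf_def q_def)
  have Y: "real (card (Sym (-1) {..<k} :: 'a fmat set)) = q ^ sexp (-1 :: 'a) k"
    using card_Sym[OF two, of "-1" "{..<k}"] by (simp add: q_def)
  have "real (card (Prs 0 (1 :: 'a) {..<k})) = q ^ (k * k) * podd q (Suc k div 2)"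
    unfolding card_skew_pairs(1)[OF finite_lessThan disjI1[OF refl]] of_nat_mult S Y c2[symmetric] power_add by simp
  then show "xx (0 :: 'a) k = 1 / pev q (k div 2)"
    unfolding xx_def G using pos[of "Suc k div 2"] pos[of "k div 2"] q by simp
  have "real (card (Pri 0 (1 :: 'a) {..<k})) = q ^ (k * k) * podd q (Suc k div 2) * (if even k then podd q (k div 2) else 0)"
    unfolding card_skew_pairs(2)[OF finite_lessThan disjI1[OF refl]] of_nat_mult S S' c2[symmetric] power_add by simp
  then show "rr (0 :: 'a) k = (if even k then podd q (k div 2) / pev q (k div 2) else 0)"
    unfolding rr_def G using pos[of "Suc k div 2"] pos[of "k div 2"] q by simp
qed

text \<open>The sum of the weights over all partitions of \<open>m\<close> is found by dividing the
  skew total by its invertible part, without a direct partition identity.\<close>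

lemma nilw_eq:
  assumes two: "(2 :: 'a::{field,finite}) ~= 0" and q3: "real CARD('a) \<ge> 3"
  shows "nilw TYPE('a) m = nilc (real CARD('a)) m"
proof (rule nilc_unique[OF q3])
  fix n
  show "(\<Sum>m\<le>n. nilw TYPE('a) m * (if even (n - m) then fc (real CARD('a)) ((n - m) div 2) else 0)) = 1 / pev (real CARD('a)) (n div 2)"
    using xx_convolution[OF two, of 0 n] unfolding skew_totals[OF two] fc_def[OF q3] by simp
qed

lemma card_isos_pos:
  fixes B :: "'a::{field,finite} fmat"
  shows "finite I ==> B \<in> SN 1 I ==> card (isos I B) > 0"
  using orbit_stabilizer[of I B] card_GLs_pos[of I, where 'a = 'a] by (metis gr0I less_irrefl mult_0_right)

lemma wgt_nonneg:
  fixes ep :: "'a::{field,finite}"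
  shows "wgt ep \<mu> \<ge> 0"
proof -
  have "pev (real CARD('a)) k > 0" for k using one_less_card_field[where 'a = 'a] by (intro pev_pos) simp
  then have "(\<Prod>i\<in>set_mset \<mu>. pev (real CARD('a)) (count \<mu> i div 2)) > 0" by (intro prod_pos) simp
  then show ?thesis unfolding wgt_def by (simp only: divide_nonneg_pos powr_ge_zero split: if_splits) simp
qed

lemma P_O_wgt:
  assumes q3: "real CARD('a::{field,finite}) \<ge> 3" and \<mu>: "0 \<notin># \<mu>"
  shows "P_O CARD('a) \<mu> = 1/2 * (wgt (1 :: 'a) \<mu> * suminf (ec (real CARD('a))))"
proof -
  have p: "paired (1 :: 'a) \<mu> \<longleftrightarrow> (\<forall>i. even i --> even (count \<mu> i))" by (simp add: paired_def)
  show ?thesis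
  proof (cases "\<forall>i. even i --> even (count \<mu> i)")
    case True
    let ?x = "real (n_stat \<mu>) + real (sum_mset \<mu>) / 2 - real (odd_parts \<mu>) / 2"
    have "wgt (1 :: 'a) \<mu> = real CARD('a) powr (- ?x) / (\<Prod>i\<in>set_mset \<mu>. pev (real CARD('a)) (count \<mu> i div 2))"
      using p True by (simp add: wgt_def)
    also have "... = 1 / Aut_O CARD('a) \<mu>"
      unfolding powr_minus_divide Aut_O_def pev_def by (simp only: divide_divide_eq_left)
    finally have w: "wgt (1 :: 'a) \<mu> = 1 / Aut_O CARD('a) \<mu>" .
    then show ?thesis using True \<mu> unfolding P_O_def c_prodinf[OF q3] by (simp add: is_partition_def)
  next
    case False
    then show ?thesis using p by (auto simp: P_O_def wgt_def)
  qed
qed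

text \<open>\<open>two_classes\<close> allows at most two classes, and the given forms show that
  there are two in dimension \<open>n\<close>. \<open>classes_descend\<close> carries this down to
  every positive dimension. Each orbit contributes weight 1; dimension 0 has a single form.\<close>

lemma class_numbers:
  fixes B1 B2 :: "'a::{field,finite} fmat"
  assumes two: "(2 :: 'a) ~= 0" and n: "n \<ge> 1" and B: "B1 \<in> SN 1 {..<n}" "B2 \<in> SN 1 {..<n}" and nc: "\<not> congr {..<n} B1 B2"
  shows "\<And>C. C \<in> SN 1 {..<n} ==> congr {..<n} B1 C \<or> congr {..<n} B2 C"
    and "k \<le> n ==> xx (1 :: 'a) k = (if k = 0 then 1 else 2)"
proof -
  obtain e :: 'a where e: "e ~= 0"
    and cl: "\<And>I k B. finite I ==> k \<in> I ==> B \<in> SN 1 I ==> congr I (dg I k 1) B \<or> congr I (dg I k e) B"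
    using two_classes[OF two] by blast
  let ?I = "{..<n}" and ?D = "dg {..<n} 0 (1 :: 'a)" and ?E = "dg {..<n} 0 e"
  have I: "finite ?I" and z: "0 \<in> ?I" using n by simp_all
  have D: "?D \<in> SN 1 ?I" and E: "?E \<in> SN 1 ?I" by (rule dg_SN[OF I z one_neq_zero], rule dg_SN[OF I z e])
  note tr = congr_trans[OF I] and sy = congr_sym[OF I GLs_Mats[OF SND(1)]]
  \<comment> \<open>If the two representatives were congruent, all forms would be, contrary to
    \<open>nc\<close>.\<close>
  have nDE: "\<not> congr ?I ?D ?E"
  proof
    assume DE: "congr ?I ?D ?E"
    have "congr ?I ?D C" if "C \<in> SN 1 ?I" for C :: "'a fmat" using cl[OF I z that] tr[OF DE] by blast
    then show False using nc tr[OF sy[OF D]] B by blast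
  qed
  have same: "congr ?I X Y" if "congr ?I Z X" "congr ?I Z Y" "Z \<in> SN 1 ?I" for X Y Z :: "'a fmat" using tr[OF sy[OF that(3,1)] that(2)] .
  show "congr ?I B1 C \<or> congr ?I B2 C" if C: "C \<in> SN 1 ?I" for C
    using cl[OF I z B(1)] cl[OF I z B(2)] cl[OF I z C] same[OF _ _ D] same[OF _ _ E] nc by blast
  show "xx (1 :: 'a) k = (if k = 0 then 1 else 2)" if k: "k \<le> n"
  proof (cases "k = 0")
    case True
    have m: "M = 0" if "M \<in> Mats {} {}" for M :: "'a fmat" using MatsD[OF that] by (intro fmat_eqI) auto
    have "idm {} \<in> (GLs {} :: 'a fmat set)" by (rule idm_GLs) simp
    then have g0: "(0 :: 'a fmat) \<in> GLs {}" using m[OF GLs_Mats] by fastforce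
    then have g: "GLs {} = {0 :: 'a fmat}" using m[OF GLs_Mats] by blast
    have "Prs 1 1 {} = {(0 :: 'a fmat, 0 :: 'a fmat)}"
      unfolding Prs_def SN_def g using m by (auto simp: g)
    then show ?thesis using True g by (simp add: xx_def lessThan_0)
  next
    case False
    let ?K = "{..<k}"
    have K: "finite ?K" "0 \<in> ?K" "?K \<subseteq> ?I" using False k by auto
    have d: "dg ?K 0 (1 :: 'a) \<in> SN 1 ?K" "dg ?K 0 e \<in> SN 1 ?K" by (rule dg_SN[OF K(1,2) one_neq_zero], rule dg_SN[OF K(1,2) e])
    have "\<not> congr ?K (dg ?K 0 1) (dg ?K 0 e)" using classes_descend[OF I K(3,2)] nDE by blast
    from two_orbit_count[OF K(1) d this cl[OF K(1,2)], of "\<lambda>_. True"]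
    have "xx (1 :: 'a) k = real (card (isos ?K (dg ?K 0 (1 :: 'a)))) / real (card (isos ?K (dg ?K 0 (1 :: 'a)))) +
        real (card (isos ?K (dg ?K 0 e))) / real (card (isos ?K (dg ?K 0 e)))" by (simp add: xx_def)
    then show ?thesis using False card_isos_pos[OF K(1) d(1)] card_isos_pos[OF K(1) d(2)] by simp
  qed
qed

text \<open>The factor 1/4 combines the half in the distance with the half that \<open>P_O\<close>
  and the mixture of the two groups have in common.\<close>

lemma total_variation:
  fixes Qp Qm :: "'a::{field,finite} vec => 'a"
  assumes two: "(2 :: 'a) ~= 0" and q3: "real CARD('a) \<ge> 3" and n: "n \<ge> 1"
    and Qp: "quadratic_form n Qp" "nondegenerate n Qp" and Qm: "quadratic_form n Qm" "nondegenerate n Qm"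
    and ni: "\<not> isometric n Qp Qm"
  defines "F \<equiv> \<lambda>\<mu>. if 0 \<in># \<mu> then 0 else wgt (1 :: 'a) \<mu> * gg (real CARD('a)) n (sum_mset \<mu>)"
  shows "tv_dist (P_O CARD('a)) (pmf (Lambda_O n Qp Qm)) = 1/4 * (\<Sum>\<^sub>\<infinity>\<mu>. F \<mu>)"
proof -
  let ?I = "{..<n}" and ?q = "real CARD('a)" and ?B1 = "gram n Qm" and ?B2 = "gram n Qp"
  have B: "?B1 \<in> SN 1 ?I" "?B2 \<in> SN 1 ?I" by (rule gram_SN[OF Qm] gram_SN[OF Qp])+
  have nc: "\<not> congr ?I ?B1 ?B2" using isometric_congr[OF two Qp(1) Qm(1)] ni by blast
  note cls = class_numbers[OF two n B nc]
  \<comment> \<open>Two classes are available in dimensions up to \<open>n\<close>, so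
    \<open>rr\<close> is determined there. The point masses involve it at
    \<open>n - sum_mset \<mu>\<close> only.\<close>
  have d: "rr (1 :: 'a) k = dc ?q k" if k: "k \<le> n" for k
  proof (rule dc_unique[OF q3])
    fix j assume "j \<le> k"
    then have "xx (1 :: 'a) j = (if j = 0 then 1 else 2)" using cls(2) k by simp
    then show "(\<Sum>m\<le>j. nilc ?q m * rr (1 :: 'a) (j - m)) = (if j = 0 then 1 else 2)"
      using xx_convolution[OF two, of 1 j] nilw_eq[OF two q3] by simp
  qed
  have pm: "pmf (Lambda_O n Qp Qm) \<mu> = 1/2 * (wgt (1 :: 'a) \<mu> * (if sum_mset \<mu> \<le> n then dc ?q (n - sum_mset \<mu>) else 0))" if \<mu>: "0 \<notin># \<mu>" for \<mu>
  proof -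
    have "real (card (Prt 1 (1 :: 'a) ?I \<mu>)) / real (card (GLs ?I :: 'a fmat set)) =
        real (card {T \<in> isos ?I ?B1. has_type ?I \<mu> T}) / real (card (isos ?I ?B1)) + real (card {T \<in> isos ?I ?B2. has_type ?I \<mu> T}) / real (card (isos ?I ?B2))"
      unfolding Prt_def by (rule two_orbit_count[OF finite_lessThan B nc cls(1) has_type_conj[OF finite_lessThan]])
    then have 1: "pmf (Lambda_O n Qp Qm) \<mu> = 1/2 * (real (card (Prt 1 (1 :: 'a) ?I \<mu>)) / real (card (GLs ?I :: 'a fmat set)))"
      unfolding pmf_Lambda[OF two Qp Qm] using \<mu> by simp
    show ?thesis
    proof (cases "sum_mset \<mu> \<le> n")
      case True
      have "\<mu> \<in> parts (sum_mset \<mu>)" using \<mu> by (simp add: parts_def)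
      from Prt_ratio[OF two disjI2[OF refl] this True] show ?thesis unfolding 1 using True d by simp
    next
      case False
      then have "Prt 1 (1 :: 'a) ?I \<mu> = {}" using has_type_bound[OF finite_lessThan, of n \<mu>, where 'a = 'a] by (auto simp: Prt_def)
      then show ?thesis unfolding 1 using False by simp
    qed
  qed
  have "\<bar>P_O CARD('a) \<mu> - pmf (Lambda_O n Qp Qm) \<mu>\<bar> = 1/2 * F \<mu>" for \<mu>
  proof (cases "0 \<in># \<mu>")
    case True
    then show ?thesis using pmf_Lambda[OF two Qp Qm, of \<mu>] by (simp add: F_def P_O_def is_partition_def)
  next
    case False
    have "P_O CARD('a) \<mu> - pmf (Lambda_O n Qp Qm) \<mu> = 1/2 * (wgt (1 :: 'a) \<mu> * (suminf (ec ?q) - (if sum_mset \<mu> \<le> n then dc ?q (n - sum_mset \<mu>) else 0)))"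
      unfolding P_O_wgt[OF q3 False] pm[OF False] by (simp only: right_diff_distrib)
    then have "\<bar>P_O CARD('a) \<mu> - pmf (Lambda_O n Qp Qm) \<mu>\<bar> = \<bar>1/2 * (wgt (1 :: 'a) \<mu> * (suminf (ec ?q) - (if sum_mset \<mu> \<le> n then dc ?q (n - sum_mset \<mu>) else 0)))\<bar>"
      by (rule arg_cong)
    also have "... = 1/2 * (wgt (1 :: 'a) \<mu> * gg ?q n (sum_mset \<mu>))"
      unfolding gg_def[OF q3] abs_mult using wgt_nonneg[of "1 :: 'a" \<mu>] by (simp only: abs_of_nonneg)
    also have "... = 1/2 * F \<mu>" using False by (simp add: F_def)
    finally show ?thesis .
  qed
  then have e: "(\<lambda>\<mu>. \<bar>P_O CARD('a) \<mu> - pmf (Lambda_O n Qp Qm) \<mu>\<bar>) = (\<lambda>\<mu>. 1/2 * F \<mu>)" by (rule ext)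
  show ?thesis unfolding tv_dist_def e infsum_cmult_right' by simp
qed

text \<open>Summed over the partitions of one size, \<open>F\<close> gives \<open>nilc * gg\<close>.
  A finite set of partitions is enlarged to all partitions up to some size, which yields summability
  and the upper bound at once.\<close>

lemma mass_bounds:
  fixes n :: nat
  assumes two: "(2 :: 'a::{field,finite}) ~= 0" and q3: "real CARD('a) \<ge> 3"
  defines "F \<equiv> \<lambda>\<mu>. if 0 \<in># \<mu> then 0 else wgt (1 :: 'a) \<mu> * gg (real CARD('a)) n (sum_mset \<mu>)"
  shows "(\<Sum>\<^sub>\<infinity>\<mu>. F \<mu>) \<le> (if even n then 5.2 / real CARD('a) ^ (n div 2) else 8 / real CARD('a) ^ ((n + 1) div 2))"
    and "0.4 / real CARD('a) ^ ((n + 1) div 2) \<le> (\<Sum>\<^sub>\<infinity>\<mu>. F \<mu>)"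
proof -
  let ?q = "real CARD('a)"
  have F0: "F \<mu> \<ge> 0" for \<mu> unfolding F_def gg_def[OF q3] using wgt_nonneg[of "1 :: 'a" \<mu>] by simp
  have parts_sum: "(\<Sum>\<mu>\<in>parts m. F \<mu>) = nilc ?q m * gg ?q n m" for m
  proof -
    have "(\<Sum>\<mu>\<in>parts m. F \<mu>) = (\<Sum>\<mu>\<in>parts m. wgt (1 :: 'a) \<mu> * gg ?q n m)"
      by (rule sum.cong[OF refl]) (auto simp: parts_def F_def)
    also have "... = (\<Sum>\<mu>\<in>parts m. wgt (1 :: 'a) \<mu>) * gg ?q n m" by (rule sum_distrib_right[symmetric])
    finally show ?thesis using nilw_eq[OF two q3, of m] by (simp only: nilw_def)
  qed
  have up: "sum F S \<le> (if even n then 5.2 / ?q ^ (n div 2) else 8 / ?q ^ ((n + 1) div 2))" if S: "finite S" for S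
  proof -
    obtain M where M: "\<forall>\<mu>\<in>S. sum_mset \<mu> \<le> M" using finite_nat_set_iff_bounded_le[of "sum_mset ` S"] S by auto
    have "sum F S = sum F {\<mu> \<in> S. 0 \<notin># \<mu>}" by (rule sum.mono_neutral_right) (use S in \<open>auto simp: F_def\<close>)
    also have "... \<le> sum F (\<Union>m\<in>{..M}. parts m)"
      by (rule sum_mono2) (simp add: finite_parts, (use M in \<open>auto simp: parts_def\<close>)[1], use F0 in simp)
    also have "... = (\<Sum>m\<le>M. \<Sum>\<mu>\<in>parts m. F \<mu>)"
      by (rule sum.UNION_disjoint) (simp_all add: finite_parts, auto simp: parts_def)
    also have "... \<le> (if even n then 5.2 / ?q ^ (n div 2) else 8 / ?q ^ ((n + 1) div 2))"
      unfolding parts_sum by (rule gg_upper[OF q3])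
    finally show ?thesis .
  qed
  have sm: "F summable_on UNIV"
    by (rule nonneg_bdd_above_summable_on) (use F0 up in \<open>auto simp: bdd_above_def\<close>)
  show "(\<Sum>\<^sub>\<infinity>\<mu>. F \<mu>) \<le> (if even n then 5.2 / ?q ^ (n div 2) else 8 / ?q ^ ((n + 1) div 2))"
    by (rule infsum_le_finite_sums[OF sm]) (use up in blast)
  have "0.4 / ?q ^ ((n + 1) div 2) \<le> sum F (parts (n + 1))" unfolding parts_sum by (rule gg_lower[OF q3])
  also have "... \<le> (\<Sum>\<^sub>\<infinity>\<mu>. F \<mu>)" by (rule finite_sum_le_infsum[OF sm finite_parts]) (use F0 in auto)
  finally show "0.4 / ?q ^ ((n + 1) div 2) \<le> (\<Sum>\<^sub>\<infinity>\<mu>. F \<mu>)" .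
qed

theorem theorem5p3:
  fixes Qp Qm :: "'a::{field,finite} vec \<Rightarrow> 'a"
    and n q :: nat
  assumes "q = CARD('a)" and "odd q"
    and "quadratic_form n Qp" and "nondegenerate n Qp"
    and "quadratic_form n Qm" and "nondegenerate n Qm"
    and "\<not> isometric n Qp Qm"
  shows "(even n \<and> n \<ge> 2 \<longrightarrow>
            0.1 / real q ^ (n div 2) \<le> tv_dist (P_O q) (pmf (Lambda_O n Qp Qm)) \<and>
            tv_dist (P_O q) (pmf (Lambda_O n Qp Qm)) \<le> 1.3 / real q ^ (n div 2)) \<and>
         (odd n \<and> n \<ge> 1 \<longrightarrow>
            0.1 / real q ^ ((n + 1) div 2) \<le> tv_dist (P_O q) (pmf (Lambda_O n Qp Qm)) \<and>
            tv_dist (P_O q) (pmf (Lambda_O n Qp Qm)) \<le> 2 / real q ^ ((n + 1) div 2))"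
proof -
  have two: "(2 :: 'a) \<noteq> 0" using odd_card_two assms(1,2) by blast
  have "CARD('a) \<noteq> 2" "CARD('a) > 1" using assms(1,2) one_less_card_field[where 'a = 'a] by auto
  then have q3: "real CARD('a) \<ge> 3" by simp
  let ?tv = "tv_dist (P_O q) (pmf (Lambda_O n Qp Qm))"
  define A where "A = (\<Sum>\<^sub>\<infinity>\<mu>. if 0 \<in># \<mu> then 0 else wgt (1 :: 'a) \<mu> * gg (real CARD('a)) n (sum_mset \<mu>))"
  have tv: "?tv = 1/4 * A" if "n \<ge> 1"
    unfolding A_def assms(1) by (rule total_variation[OF two q3 that assms(3-7)])
  have b: "A \<le> (if even n then 5.2 / real q ^ (n div 2) else 8 / real q ^ ((n + 1) div 2))" "0.4 / real q ^ ((n + 1) div 2) \<le> A"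
    unfolding A_def assms(1) by (rule mass_bounds[OF two q3])+
  show ?thesis
  proof (intro conjI impI)
    assume n: "even n \<and> n \<ge> 2"
    then have e: "(n + 1) div 2 = n div 2" "?tv = 1/4 * A" using tv by simp_all
    show "0.1 / real q ^ (n div 2) \<le> ?tv" "?tv \<le> 1.3 / real q ^ (n div 2)" using b n unfolding e by simp_all
  next
    assume n: "odd n \<and> n \<ge> 1"
    show "0.1 / real q ^ ((n + 1) div 2) \<le> ?tv" "?tv \<le> 2 / real q ^ ((n + 1) div 2)" using b n tv by simp_all
  qed
qed

end
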